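(* Let $G$ be a compact connected Lie group acting in a Hamiltonian fashion on a compact symplectic manifold $(M,\omega)$ that has the strong Lefschetz property. Suppose $\alpha\in\Omega_G$ is equivariantly harmonic (that is, $d_G\alpha=0$ and $\delta\alpha=0$) and is either equivariantly exact ($\alpha=d_G\gamma$ for some $\gamma\in\Omega_G$) or coexact ($\alpha=\delta\gamma$ for some $\gamma\in\Omega_G$). Then there exists $\beta\in\Omega_G$ such that $\alpha=d_G\delta\beta$.
   Context: Setting. $(M,\omega)$ is a compact symplectic manifold of dimension $2n$; $\Omega=\Omega(M)$ is its de Rham complex of real differential forms, $H(M)$ its de Rham cohomology. $M$ has the strong Lefschetz property: for each $0\le k\le n$ the map $H^{n-k}(M)\to H^{n+k}(M)$, $c\mapsto[\omega]^k\wedge c$, is an isomorphism. $G$ is a compact connected Lie group with Lie algebra $\mathfrak{g}$, acting on $M$ in a Hamiltonian fashion, i.e. preserving $\omega$ and with a $G$-equivariant moment map $\phi\colon\mathfrak{g}\to C^\infty(M)$, $d\phi(\xi)=\iota(\xi)\omega$, where $\iota(\xi)$ denotes inner product with the vector field on $M$ induced by $\xi\in\mathfrak{g}$. Symplectic Hodge theory. The symplectic form gives isomorphisms $T_xM\to T_x^*M$, $a\mapsto a^\flat=\omega(a,\cdot)$, with inverse $\sharp$. Put $\omega(v,w)=\omega(v^\sharp,w^\sharp)$ for covectors and $\omega(v_1\wedge\cdots\wedge v_k,w_1\wedge\cdots\wedge w_k)=\det\bigl(\omega(v_i,w_j)\bigr)$. The symplectic star operator $*\colon\Omega^k(M)\to\Omega^{2n-k}(M)$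 is defined by $\alpha\wedge*\beta=\omega(\alpha,\beta)\,\omega^n/n!$ for $\alpha,\beta\in\Omega^k(M)$, and $\delta\colon\Omega^k(M)\to\Omega^{k-1}(M)$ by $\delta\alpha=(-1)^{k+1}{*}d{*}\alpha$. Cartan complex. $\Omega_G=\Omega_G(M)=(S\mathfrak{g}^*\otimes\Omega(M))^G$; its elements are viewed as $G$-equivariant polynomial maps $\mathfrak{g}\to\Omega(M)$. The bigrading is $\Omega_G^{ij}=(S^i\mathfrak{g}^*\otimes\Omega^{j-i})^G$, the total grading $\Omega_G^k=\bigoplus_{i+j=k}\Omega_G^{ij}$. The vertical differential is $d=1\otimes d$, the horizontal differential is $(\partial\alpha)(\xi)=-\iota(\xi)\alpha(\xi)$, and $d_G=d+\partial$. On $\Omega_G$ the symbol $\delta$ means $1\otimes\delta$, of bidegree $(0,-1)$. *)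

theory Defs
  imports
    "HOL-Analysis.Analysis"
    "HOL-Algebra.Group_Action"
    "Jordan_Normal_Form.Determinant"
begin

section \<open>Smooth manifolds\<close>

text \<open>
  A manifold is a Hausdorff space (the whole of a type) with an atlas of charts into a
  finite-dimensional real inner product space. The class \<open>euclidean_space\<close> is avoided
  because it excludes dimension 0, which occurs for points and for the trivial Lie group. The
  class \<open>heine_borel\<close> is satisfied by every finite-dimensional inner product space.
\<close>

primrec Ck_on :: "nat \<Rightarrow> 'a::real_normed_vector set \<Rightarrow> ('a \<Rightarrow> 'b::real_normed_vector) \<Rightarrow> bool" where
  "Ck_on 0 S f \<longleftrightarrow> continuous_on S f"
| "Ck_on (Suc k) S f \<longleftrightarrow>
     (\<forall>x\<in>S. f differentiable (at x)) \<and> (\<forall>v. Ck_on k S (\<lambda>x. frechet_derivative f (at x) v))"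

text \<open>Only used for open subsets of finite-dimensional spaces.\<close>

definition smooth_on :: "'a::real_normed_vector set \<Rightarrow> ('a \<Rightarrow> 'b::real_normed_vector) \<Rightarrow> bool" where
  "smooth_on S f \<longleftrightarrow> (\<forall>k. Ck_on k S f)"

type_synonym ('m, 'e) chart = "'m set \<times> ('m \<Rightarrow> 'e)"
type_synonym ('m, 'e) atlas = "('m, 'e) chart set"

definition chart_inv :: "('m, 'e) chart \<Rightarrow> 'e \<Rightarrow> 'm" where
  "chart_inv c = inv_into (fst c) (snd c)"

definition chart_image :: "('m, 'e) chart \<Rightarrow> 'e set" where
  "chart_image c = snd c ` fst c"

locale smooth_manifold =
  fixes A :: "('m::t2_space, 'e::{real_inner, heine_borel}) atlas"
  assumes finite_dim: "\<exists>B::'e set. finite B \<and> span B = UNIV"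
    and covering: "(\<Union>c\<in>A. fst c) = UNIV"
    and open_domain: "c \<in> A \<Longrightarrow> open (fst c)"
    and open_image: "c \<in> A \<Longrightarrow> open (chart_image c)"
    and chart_homeomorphism: "c \<in> A \<Longrightarrow> homeomorphism (fst c) (chart_image c) (snd c) (chart_inv c)"
    and smooth_transition:
      "c \<in> A \<Longrightarrow> c' \<in> A \<Longrightarrow> smooth_on (snd c ` (fst c \<inter> fst c')) (snd c' \<circ> chart_inv c)"

definition smooth_map ::
  "('m::topological_space, 'e::real_normed_vector) atlas \<Rightarrow>
   ('k::topological_space, 'f::real_normed_vector) atlas \<Rightarrow> ('m \<Rightarrow> 'k) \<Rightarrow> bool" where
  "smooth_map A B f \<longleftrightarrow> continuous_on UNIV f \<and>
     (\<forall>c\<in>A. \<forall>c'\<in>B. smooth_on (snd c ` (fst c \<inter> f -` fst c')) (snd c' \<circ> f \<circ> chart_inv c))"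

definition prod_atlas :: "('m, 'e) atlas \<Rightarrow> ('k, 'f) atlas \<Rightarrow> ('m \<times> 'k, 'e \<times> 'f) atlas" where
  "prod_atlas A B = {(fst c \<times> fst c', map_prod (snd c) (snd c')) | c c'. c \<in> A \<and> c' \<in> B}"

text \<open>
  The tangent space at \<open>p\<close> is identified with the model space \<open>'e\<close> by means of one chart
  \<open>chart_at A p\<close> around \<open>p\<close>, selected once and for all. Derivatives of maps and values of
  forms at \<open>p\<close> are always expressed with respect to this chart.
\<close>

definition chart_at :: "('m, 'e) atlas \<Rightarrow> 'm \<Rightarrow> ('m, 'e) chart" where
  "chart_at A p = (SOME c. c \<in> A \<and> p \<in> fst c)"

definition tangent_map ::
  "('m, 'e::real_normed_vector) atlas \<Rightarrow> ('k, 'f::real_normed_vector) atlas \<Rightarrow>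
   ('m \<Rightarrow> 'k) \<Rightarrow> 'm \<Rightarrow> 'e \<Rightarrow> 'f" where
  "tangent_map A B f p =
     frechet_derivative (snd (chart_at B (f p)) \<circ> f \<circ> chart_inv (chart_at A p))
       (at (snd (chart_at A p) p))"

section \<open>Exterior algebra of a vector space\<close>

text \<open>
  An element of the exterior algebra of the dual of \<open>'e\<close> is a function on lists of vectors
  whose restriction to lists of each length \<open>k\<close> is an alternating \<open>k\<close>-linear form; this
  restriction is the component of degree \<open>k\<close>. (Components of degree larger than the dimension
  vanish automatically.)
\<close>

type_synonym 'e ext = "'e list \<Rightarrow> real"

definition alt_form :: "'e::real_vector ext \<Rightarrow> bool" where
  "alt_form a \<longleftrightarrow> (\<forall>us ws. linear (\<lambda>v. a (us @ v # ws))) \<and> (\<forall>vs. \<not> distinct vs \<longrightarrow> a vs = 0)"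

definition Alt :: "nat \<Rightarrow> 'e::real_vector ext set" where
  "Alt k = {a. alt_form a \<and> (\<forall>vs. length vs \<noteq> k \<longrightarrow> a vs = 0)}"

definition ext_part :: "nat \<Rightarrow> 'e ext \<Rightarrow> 'e ext" where
  "ext_part k a = (\<lambda>vs. if length vs = k then a vs else 0)"

definition ext_one :: "'e ext" where
  "ext_one = (\<lambda>vs. if vs = [] then 1 else 0)"

text \<open>
  The sum over all \<open>(I, complement of I)\<close>-shuffles, each with its sign; no factorial
  factors, so that \<open>(a \<and> b)(v, w) = a(v) b(w) - a(w) b(v)\<close> for covectors.
\<close>

definition wedge :: "'e ext \<Rightarrow> 'e ext \<Rightarrow> 'e ext" where
  "wedge a b = (\<lambda>vs. \<Sum>I\<in>Pow {..<length vs}.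
     (-1) ^ card {(i, j). i \<in> I \<and> j \<in> {..<length vs} - I \<and> j < i} * a (nths vs I) * b (nths vs (- I)))"

definition wedge_list :: "'e ext list \<Rightarrow> 'e ext" where
  "wedge_list as = foldr wedge as ext_one"

definition wedge_power :: "'e ext \<Rightarrow> nat \<Rightarrow> 'e ext" where
  "wedge_power a k = wedge_list (replicate k a)"

section \<open>Symplectic linear algebra\<close>

text \<open>In this section \<open>w\<close> is a symplectic form on a vector space \<open>'e\<close> of dimension \<open>2 * n\<close>.\<close>

definition sharp :: "'e ext \<Rightarrow> 'e ext \<Rightarrow> 'e" where
  "sharp w v = (THE a. \<forall>b. w [a, b] = v [b])"

definition covector_pairing :: "'e ext \<Rightarrow> 'e ext \<Rightarrow> 'e ext \<Rightarrow> real" where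
  "covector_pairing w v v' = w [sharp w v, sharp w v']"

definition is_ext_pairing :: "'e::real_vector ext \<Rightarrow> nat \<Rightarrow> ('e ext \<Rightarrow> 'e ext \<Rightarrow> real) \<Rightarrow> bool" where
  "is_ext_pairing w k B \<longleftrightarrow>
     (\<forall>a\<in>Alt k. \<forall>b\<in>Alt k. \<forall>c\<in>Alt k. \<forall>r s.
        B (\<lambda>vs. r * a vs + s * b vs) c = r * B a c + s * B b c \<and>
        B c (\<lambda>vs. r * a vs + s * b vs) = r * B c a + s * B c b) \<and>
     (\<forall>as bs. set as \<subseteq> Alt 1 \<and> set bs \<subseteq> Alt 1 \<and> length as = k \<and> length bs = k \<longrightarrow>
        B (wedge_list as) (wedge_list bs) =
          Determinant.det (mat k k (\<lambda>(i, j). covector_pairing w (as ! i) (bs ! j))))"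

text \<open>The pairing is uniquely determined on \<open>Alt k\<close>; its values elsewhere are never used.\<close>

definition ext_pairing :: "'e::real_vector ext \<Rightarrow> nat \<Rightarrow> 'e ext \<Rightarrow> 'e ext \<Rightarrow> real" where
  "ext_pairing w k = (SOME B. is_ext_pairing w k B)"

definition ext_star_deg :: "nat \<Rightarrow> 'e::real_vector ext \<Rightarrow> nat \<Rightarrow> 'e ext \<Rightarrow> 'e ext" where
  "ext_star_deg n w k b = (THE c. c \<in> Alt (2 * n - k) \<and>
     (\<forall>a\<in>Alt k. wedge a c = (\<lambda>vs. ext_pairing w k a b * (wedge_power w n vs / fact n))))"

definition ext_star :: "nat \<Rightarrow> 'e::real_vector ext \<Rightarrow> 'e ext \<Rightarrow> 'e ext" where
  "ext_star n w b = (\<lambda>vs. \<Sum>k\<le>2 * n. ext_star_deg n w k (ext_part k b) vs)"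

section \<open>Differential forms\<close>

text \<open>
  \<open>\<alpha> p\<close> is the value at \<open>p\<close>, an element of the exterior algebra of the dual of the tangent
  space at \<open>p\<close> (in the chart \<open>chart_at A p\<close>). Forms need not be homogeneous.
\<close>

type_synonym ('m, 'e) form = "'m \<Rightarrow> 'e ext"

text \<open>
  The pullback of \<open>\<alpha>\<close> along the inverse of an arbitrary chart \<open>c\<close>. The derivative occurring
  here is that of the change of coordinates from \<open>c\<close> to the chart selected at the point.
\<close>

definition local_form ::
  "('m, 'e::real_normed_vector) atlas \<Rightarrow> ('m, 'e) chart \<Rightarrow> ('m, 'e) form \<Rightarrow> 'e \<Rightarrow> 'e ext" where
  "local_form A c \<alpha> x = (\<lambda>vs. \<alpha> (chart_inv c x)
     (map (frechet_derivative (snd (chart_at A (chart_inv c x)) \<circ> chart_inv c) (at x)) vs))"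

definition Omega :: "('m, 'e::real_normed_vector) atlas \<Rightarrow> ('m, 'e) form set" where
  "Omega A = {\<alpha>. (\<forall>p. alt_form (\<alpha> p)) \<and>
     (\<forall>c\<in>A. \<forall>vs. smooth_on (chart_image c) (\<lambda>x. local_form A c \<alpha> x vs))}"

definition Omega_deg :: "('m, 'e::real_normed_vector) atlas \<Rightarrow> nat \<Rightarrow> ('m, 'e) form set" where
  "Omega_deg A k = {\<alpha> \<in> Omega A. \<forall>p. \<alpha> p \<in> Alt k}"

definition zero_form :: "('m, 'e) form" where
  "zero_form = (\<lambda>p vs. 0)"

definition form_of_fun :: "('m \<Rightarrow> real) \<Rightarrow> ('m, 'e) form" where
  "form_of_fun f = (\<lambda>p vs. if vs = [] then f p else 0)"

definition form_part :: "nat \<Rightarrow> ('m, 'e) form \<Rightarrow> ('m, 'e) form" where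
  "form_part k \<alpha> = (\<lambda>p. ext_part k (\<alpha> p))"

definition form_wedge :: "('m, 'e) form \<Rightarrow> ('m, 'e) form \<Rightarrow> ('m, 'e) form" where
  "form_wedge \<alpha> \<beta> = (\<lambda>p. wedge (\<alpha> p) (\<beta> p))"

definition form_power :: "('m, 'e) form \<Rightarrow> nat \<Rightarrow> ('m, 'e) form" where
  "form_power \<alpha> k = (\<lambda>p. wedge_power (\<alpha> p) k)"

definition contract :: "('m \<Rightarrow> 'e) \<Rightarrow> ('m, 'e) form \<Rightarrow> ('m, 'e) form" where
  "contract X \<alpha> = (\<lambda>p vs. \<alpha> p (X p # vs))"

definition pullback ::
  "('m, 'e::real_normed_vector) atlas \<Rightarrow> ('k, 'f::real_normed_vector) atlas \<Rightarrow> ('m \<Rightarrow> 'k) \<Rightarrow>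
   ('k, 'f) form \<Rightarrow> ('m, 'e) form" where
  "pullback A B f \<alpha> = (\<lambda>p vs. \<alpha> (f p) (map (tangent_map A B f p) vs))"

text \<open>
  The usual formula \<open>d\<alpha>(v\<^sub>0, \<dots>, v\<^sub>k) = \<Sum>\<^sub>i (-1)\<^sup>i \<partial>\<^bsub>v\<^sub>i\<^esub> \<alpha>(v\<^sub>0, \<dots>, v\<^sub>k without v\<^sub>i)\<close> for constant
  vectors, in the coordinates given by the chart selected at \<open>p\<close>.
\<close>

definition ext_d :: "('m, 'e::real_normed_vector) atlas \<Rightarrow> ('m, 'e) form \<Rightarrow> ('m, 'e) form" where
  "ext_d A \<alpha> = (\<lambda>p vs. \<Sum>i<length vs. (-1) ^ i *
     frechet_derivative (\<lambda>x. local_form A (chart_at A p) \<alpha> x (take i vs @ drop (Suc i) vs))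
       (at (snd (chart_at A p) p)) (vs ! i))"

section \<open>De Rham cohomology and the strong Lefschetz property\<close>

definition cohomology_class ::
  "('m, 'e::real_normed_vector) atlas \<Rightarrow> ('m, 'e) form \<Rightarrow> ('m, 'e) form set" where
  "cohomology_class A \<alpha> = {\<beta> \<in> Omega A. ext_d A \<beta> = zero_form \<and>
     (\<exists>\<gamma>\<in>Omega A. \<beta> = (\<lambda>p vs. \<alpha> p vs + ext_d A \<gamma> p vs))}"

definition cohomology ::
  "('m, 'e::real_normed_vector) atlas \<Rightarrow> nat \<Rightarrow> ('m, 'e) form set set" where
  "cohomology A k = cohomology_class A ` {\<alpha> \<in> Omega_deg A k. ext_d A \<alpha> = zero_form}"

text \<open>The classes of \<open>\<omega>\<^sup>k \<and> \<alpha>\<close> all coincide when \<open>\<alpha>\<close> runs through the representatives of \<open>c\<close>.\<close>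

definition lefschetz_map ::
  "('m, 'e::real_normed_vector) atlas \<Rightarrow> ('m, 'e) form \<Rightarrow> nat \<Rightarrow>
   ('m, 'e) form set \<Rightarrow> ('m, 'e) form set" where
  "lefschetz_map A \<omega> k c = (\<Union>\<alpha>\<in>c. cohomology_class A (form_wedge (form_power \<omega> k) \<alpha>))"

text \<open>The Lefschetz maps are linear, so being an isomorphism amounts to being bijective.\<close>

definition strong_lefschetz ::
  "('m, 'e::real_normed_vector) atlas \<Rightarrow> nat \<Rightarrow> ('m, 'e) form \<Rightarrow> bool" where
  "strong_lefschetz A n \<omega> \<longleftrightarrow>
     (\<forall>k\<le>n. bij_betw (lefschetz_map A \<omega> k) (cohomology A (n - k)) (cohomology A (n + k)))"

section \<open>Symplectic manifolds and symplectic Hodge theory\<close>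

locale symplectic_manifold = smooth_manifold A
  for A :: "('m::t2_space, 'e::{real_inner, heine_borel}) atlas" +
  fixes n :: nat and \<omega> :: "('m, 'e) form"
  assumes dimension: "dim (UNIV :: 'e set) = 2 * n"
    and two_form: "\<omega> \<in> Omega_deg A 2"
    and closed: "ext_d A \<omega> = zero_form"
    and nondegenerate: "(\<forall>w. \<omega> p [v, w] = 0) \<Longrightarrow> v = 0"

definition sympl_star :: "nat \<Rightarrow> ('m, 'e::real_vector) form \<Rightarrow> ('m, 'e) form \<Rightarrow> ('m, 'e) form" where
  "sympl_star n \<omega> \<alpha> = (\<lambda>p. ext_star n (\<omega> p) (\<alpha> p))"

definition sympl_delta ::
  "('m, 'e::real_normed_vector) atlas \<Rightarrow> nat \<Rightarrow> ('m, 'e) form \<Rightarrow> ('m, 'e) form \<Rightarrow> ('m, 'e) form" where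
  "sympl_delta A n \<omega> \<alpha> = (\<lambda>p vs. \<Sum>k\<le>2 * n.
     (-1) ^ (k + 1) * sympl_star n \<omega> (ext_d A (sympl_star n \<omega> (form_part k \<alpha>))) p vs)"

section \<open>Lie groups and Hamiltonian actions\<close>

locale lie_group = group G + smooth_manifold A
  for G :: "'g::t2_space monoid" (structure) and A :: "('g, 'f::{real_inner, heine_borel}) atlas" +
  assumes carrier_UNIV: "carrier G = UNIV"
    and smooth_mult: "smooth_map (prod_atlas A A) A (\<lambda>(g, h). g \<otimes> h)"
    and smooth_inv: "smooth_map A A (\<lambda>g. inv g)"

text \<open>
  The Lie algebra is the tangent space \<open>'f\<close> at the identity. The adjoint action is the
  derivative at the identity of conjugation. The vector field induced by \<open>\<xi>\<close> has at \<open>p\<close> the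
  value \<open>d/dt (exp (t \<xi>) \<cdot> p)\<close> at \<open>t = 0\<close>, which is the derivative of the orbit map
  \<open>g \<mapsto> g \<cdot> p\<close> at the identity, applied to \<open>\<xi>\<close>.
\<close>

definition Ad :: "'g monoid \<Rightarrow> ('g, 'f::real_normed_vector) atlas \<Rightarrow> 'g \<Rightarrow> 'f \<Rightarrow> 'f" where
  "Ad G A g = tangent_map A A (\<lambda>h. g \<otimes>\<^bsub>G\<^esub> h \<otimes>\<^bsub>G\<^esub> inv\<^bsub>G\<^esub> g) \<one>\<^bsub>G\<^esub>"

definition induced_field ::
  "'g monoid \<Rightarrow> ('g, 'f::real_normed_vector) atlas \<Rightarrow> ('m, 'e::real_normed_vector) atlas \<Rightarrow>
   ('g \<Rightarrow> 'm \<Rightarrow> 'm) \<Rightarrow> 'f \<Rightarrow> 'm \<Rightarrow> 'e" where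
  "induced_field G A\<^sub>G A act \<xi> p = tangent_map A\<^sub>G A (\<lambda>g. act g p) \<one>\<^bsub>G\<^esub> \<xi>"

locale hamiltonian_action =
  Lie: lie_group G A\<^sub>G + Sympl: symplectic_manifold A n \<omega> + action: group_action G UNIV act
  for G :: "'g::t2_space monoid" (structure)
    and A\<^sub>G :: "('g, 'f::{real_inner, heine_borel}) atlas"
    and A :: "('m::t2_space, 'e::{real_inner, heine_borel}) atlas"
    and n :: nat and \<omega> :: "('m, 'e) form"
    and act :: "'g \<Rightarrow> 'm \<Rightarrow> 'm" +
  fixes \<phi> :: "'f \<Rightarrow> 'm \<Rightarrow> real"
  assumes smooth_action: "smooth_map (prod_atlas A\<^sub>G A) A (\<lambda>(g, p). act g p)"
    and preserves_symplectic_form: "pullback A A (act g) \<omega> = \<omega>"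
    and moment_smooth: "form_of_fun (\<phi> \<xi>) \<in> Omega_deg A 0"
    and moment_linear: "linear (\<lambda>\<xi>. \<phi> \<xi> p)"
    and moment_equivariant: "\<phi> (Ad G A\<^sub>G g \<xi>) (act g p) = \<phi> \<xi> p"
    and moment_map:
      "ext_d A (form_of_fun (\<phi> \<xi>)) = contract (induced_field G A\<^sub>G A act \<xi>) \<omega>"

section \<open>The Cartan complex\<close>

text \<open>
  Elements of \<open>S\<gg>\<^sup>* \<otimes> \<Omega>\<close> are finite sums of products of a polynomial on the Lie algebra and a form.
  Equivariance \<open>\<alpha> (Ad g \<xi>) = (g\<^sup>-\<^sup>1)\<^sup>* \<alpha> \<xi>\<close> is stated with the pullback moved to the other side.
\<close>

definition polynomial_form_maps ::
  "('m, 'e::real_normed_vector) atlas \<Rightarrow> ('f::real_normed_vector \<Rightarrow> ('m, 'e) form) set" where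
  "polynomial_form_maps A = {\<alpha>. \<exists>(N::nat) q \<eta>.
     (\<forall>i<N. real_polynomial_function (q i) \<and> \<eta> i \<in> Omega A) \<and>
     \<alpha> = (\<lambda>\<xi> p vs. \<Sum>i<N. q i \<xi> * \<eta> i p vs)}"

definition Omega_G ::
  "'g monoid \<Rightarrow> ('g, 'f::real_normed_vector) atlas \<Rightarrow> ('m, 'e::real_normed_vector) atlas \<Rightarrow>
   ('g \<Rightarrow> 'm \<Rightarrow> 'm) \<Rightarrow> ('f \<Rightarrow> ('m, 'e) form) set" where
  "Omega_G G A\<^sub>G A act = {\<alpha> \<in> polynomial_form_maps A.
     \<forall>g\<in>carrier G. \<forall>\<xi>. pullback A A (act g) (\<alpha> (Ad G A\<^sub>G g \<xi>)) = \<alpha> \<xi>}"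

definition cartan_zero :: "'f \<Rightarrow> ('m, 'e) form" where
  "cartan_zero = (\<lambda>\<xi>. zero_form)"

definition cartan_vert ::
  "('m, 'e::real_normed_vector) atlas \<Rightarrow> ('f \<Rightarrow> ('m, 'e) form) \<Rightarrow> 'f \<Rightarrow> ('m, 'e) form" where
  "cartan_vert A \<alpha> = (\<lambda>\<xi>. ext_d A (\<alpha> \<xi>))"

definition cartan_hor ::
  "'g monoid \<Rightarrow> ('g, 'f::real_normed_vector) atlas \<Rightarrow> ('m, 'e::real_normed_vector) atlas \<Rightarrow>
   ('g \<Rightarrow> 'm \<Rightarrow> 'm) \<Rightarrow> ('f \<Rightarrow> ('m, 'e) form) \<Rightarrow> 'f \<Rightarrow> ('m, 'e) form" where
  "cartan_hor G A\<^sub>G A act \<alpha> =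
     (\<lambda>\<xi> p vs. - contract (induced_field G A\<^sub>G A act \<xi>) (\<alpha> \<xi>) p vs)"

definition cartan_d ::
  "'g monoid \<Rightarrow> ('g, 'f::real_normed_vector) atlas \<Rightarrow> ('m, 'e::real_normed_vector) atlas \<Rightarrow>
   ('g \<Rightarrow> 'm \<Rightarrow> 'm) \<Rightarrow> ('f \<Rightarrow> ('m, 'e) form) \<Rightarrow> 'f \<Rightarrow> ('m, 'e) form" where
  "cartan_d G A\<^sub>G A act \<alpha> =
     (\<lambda>\<xi> p vs. cartan_vert A \<alpha> \<xi> p vs + cartan_hor G A\<^sub>G A act \<alpha> \<xi> p vs)"

definition cartan_delta ::
  "('m, 'e::real_normed_vector) atlas \<Rightarrow> nat \<Rightarrow> ('m, 'e) form \<Rightarrow>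
   ('f \<Rightarrow> ('m, 'e) form) \<Rightarrow> 'f \<Rightarrow> ('m, 'e) form" where
  "cartan_delta A n \<omega> \<alpha> = (\<lambda>\<xi>. sympl_delta A n \<omega> (\<alpha> \<xi>))"

end

theory Submission
  imports Defs "HOL-Library.Function_Algebras"
begin

text \<open>
  The operators \<open>L = \<omega> \<and> _\<close> and its symplectic adjoint \<open>\<Lambda>\<close> make \<open>\<Omega>(M)\<close> an sl(2)-module. The Weyl element
  \<open>W = exp L exp (- \<Lambda>) exp L\<close> agrees up to signs with the symplectic star, whence \<open>\<delta> = [\<Lambda>, d]\<close>. The
  strong Lefschetz property carries over to the complex \<open>\<Omega>\<^sub>G\<close> with the vertical differential: solve the
  equations at finitely many points of \<open>\<gg>\<close>, interpolate, and average over \<open>G\<close>. Hence every \<open>d\<close>-closed element of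
  \<open>\<Omega>\<^sub>G\<close> is \<open>d\<close>-cohomologous to a harmonic one, and harmonic elements that are \<open>d\<close>-exact or coexact are in the
  image of \<open>d\<delta>\<close>. The horizontal differential \<open>\<partial>\<close> is the commutator \<open>[\<delta>, \<phi>]\<close> with the multiplication by the
  moment map, so it maps harmonic elements to coexact ones; this allows an induction on the form degree
  that replaces \<open>d\<close> by \<open>d\<^sub>G\<close>.
\<close>

section \<open>Linear operators on function spaces\<close>

text \<open>The abstract locales are instantiated at three levels: the exterior algebra of one
  cotangent space, where \<open>W\<close> is compared with the star; the forms on M, where the
  Lefschetz property is given; and the Cartan complex, the only one on which the Hodge-theoretic
  part is run. It works because d and D = [Lam, d] form a doublet under sl(2); the missing relation
  [Lam, D] = 0 is forced by [L, d] = 0 and the bound on degrees. The obstacle in the Cartan complex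
  is that the Lefschetz property yields preimages and potentials of single forms, with no control of
  their dependence on \<xi>: interpolation makes the choices polynomial, and an invariant mean,
  built from averages over finitely many translates, makes them equivariant. That d anticommutes
  with the horizontal differential means that the Lie derivative of \<alpha>(\<xi>) along \<xi>
  vanishes; this comes from differentiating equivariance at the identity along \<xi>, where Ad
  leaves \<xi> stationary. The induction runs over the form degree, not the total degree: d raises
  it by one and the horizontal differential lowers it by one, so the leading component sees only
  d.\<close>

instantiation "fun" :: (type, real_vector) real_vector
begin
definition scaleR_fun :: "real \<Rightarrow> ('a \<Rightarrow> 'b) \<Rightarrow> 'a \<Rightarrow> 'b" where
  "scaleR_fun c f = (\<lambda>x. c *\<^sub>R f x)"
instance
  by standard (simp_all add: scaleR_fun_def fun_eq_iff scaleR_add_right scaleR_add_left)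
end

lemma scaleR_fun_apply [simp]: "(c *\<^sub>R f) x = c *\<^sub>R f x"
  by (simp add: scaleR_fun_def)

lemma sum_fun_apply [simp]: "(\<Sum>i\<in>I. f i) x = (\<Sum>i\<in>I. f i x)"
  by (induction I rule: infinite_finite_induct) auto

text \<open>Unification may eta-expand terms of function type, after which the simplifier pushes these
  rules into the expansions; they are switched off where that happens.\<close>

lemmas fun_apply = plus_fun_apply zero_fun_apply scaleR_fun_apply sum_fun_apply uminus_apply minus_apply

text \<open>Relative to a carrier set because the operators of interest are linear only there: the
  derivative of a non-differentiable coefficient is an arbitrary value, so the exterior derivative
  need not be additive outside \<open>Omega A\<close>.\<close>

definition lin_op :: "'v::real_vector set \<Rightarrow> ('v \<Rightarrow> 'v) \<Rightarrow> bool" where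
  "lin_op V f \<longleftrightarrow> (\<forall>x\<in>V. f x \<in> V) \<and> (\<forall>x\<in>V. \<forall>y\<in>V. f (x + y) = f x + f y) \<and>
     (\<forall>c. \<forall>x\<in>V. f (c *\<^sub>R x) = c *\<^sub>R f x)"

lemma lin_opI:
  assumes "\<And>x. x \<in> V \<Longrightarrow> f x \<in> V" "\<And>x y. x \<in> V \<Longrightarrow> y \<in> V \<Longrightarrow> f (x + y) = f x + f y"
    "\<And>c x. x \<in> V \<Longrightarrow> f (c *\<^sub>R x) = c *\<^sub>R f x"
  shows "lin_op V f"
  using assms by (auto simp: lin_op_def)

context
  fixes V :: "'v::real_vector set" and f :: "'v \<Rightarrow> 'v"
  assumes f: "lin_op V f"
begin

lemma lin_op_mem: "x \<in> V \<Longrightarrow> f x \<in> V"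
  and lin_op_add: "x \<in> V \<Longrightarrow> y \<in> V \<Longrightarrow> f (x + y) = f x + f y"
  and lin_op_scale: "x \<in> V \<Longrightarrow> f (c *\<^sub>R x) = c *\<^sub>R f x"
  using f by (auto simp: lin_op_def)

lemma lin_op_zero: "subspace V \<Longrightarrow> f 0 = 0"
  using lin_op_scale[of 0 0] by (simp add: subspace_0)

lemma lin_op_minus: "x \<in> V \<Longrightarrow> f (- x) = - f x"
  using lin_op_scale[of x "-1"] by simp

lemma lin_op_diff: "subspace V \<Longrightarrow> x \<in> V \<Longrightarrow> y \<in> V \<Longrightarrow> f (x - y) = f x - f y"
  using lin_op_add[of x "- y"] by (simp add: lin_op_minus subspace_neg)

lemma lin_op_sum:
  assumes "subspace V" "\<And>i. i \<in> I \<Longrightarrow> g i \<in> V"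
  shows "f (\<Sum>i\<in>I. g i) = (\<Sum>i\<in>I. f (g i))"
  using assms(2)
proof (induction I rule: infinite_finite_induct)
  case (insert i I)
  moreover from insert have "sum g I \<in> V" by (intro subspace_sum[OF assms(1)]) auto
  ultimately show ?case using lin_op_add[of "g i" "sum g I"] by auto
qed (use lin_op_zero assms(1) in auto)

lemma lin_op_pow: "lin_op V (f ^^ k)"
  by (induction k) (use f in \<open>auto simp: lin_op_def\<close>)

end

lemma lin_op_comp: "lin_op V f \<Longrightarrow> lin_op V g \<Longrightarrow> lin_op V (\<lambda>x. f (g x))"
  by (simp add: lin_op_def)

lemma lin_op_sub: "subspace V \<Longrightarrow> lin_op V f \<Longrightarrow> lin_op V g \<Longrightarrow> lin_op V (\<lambda>x. f x - g x)"
  by (auto simp: lin_op_def subspace_diff algebra_simps)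

lemma lin_op_scaleR: "subspace V \<Longrightarrow> lin_op V f \<Longrightarrow> lin_op V (\<lambda>x. c *\<^sub>R f x)"
  by (auto simp: lin_op_def subspace_scale algebra_simps)

lemma lin_op_sumf: "subspace V \<Longrightarrow> (\<And>i. i \<in> I \<Longrightarrow> lin_op V (f i)) \<Longrightarrow> lin_op V (\<lambda>x. \<Sum>i\<in>I. f i x)"
proof (induction I rule: infinite_finite_induct)
  case (insert i I)
  then have "lin_op V (\<lambda>x. \<Sum>i\<in>I. f i x)" "lin_op V (f i)" by auto
  with insert show ?case by (auto simp: lin_op_def subspace_add algebra_simps)
qed (auto simp: lin_op_def subspace_0)

text \<open>For an operator with \<open>T ^^ Suc N = 0\<close> this is the exponential of c T; a
  finite sum needs no topology on the space.\<close>

definition trunc_exp :: "nat \<Rightarrow> real \<Rightarrow> ('v::real_vector \<Rightarrow> 'v) \<Rightarrow> 'v \<Rightarrow> 'v" where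
  "trunc_exp N c T x = (\<Sum>i\<le>N. (c ^ i / fact i) *\<^sub>R (T ^^ i) x)"

lemma lin_op_trunc_exp: "subspace V \<Longrightarrow> lin_op V T \<Longrightarrow> lin_op V (trunc_exp N c T)"
  unfolding trunc_exp_def[abs_def] by (intro lin_op_sumf lin_op_scaleR lin_op_pow)

text \<open>The exponential of ad T applied to f stops after the linear term, since the commutator g
  of T and f commutes with T.\<close>

lemma trunc_exp_conjugate:
  assumes V: "subspace V" and T: "lin_op V T" and f: "lin_op V f" and g: "lin_op V g"
    and Tf: "\<And>x. x \<in> V \<Longrightarrow> T (f x) = f (T x) + g x"
    and Tg: "\<And>x. x \<in> V \<Longrightarrow> T (g x) = g (T x)"
    and N: "\<And>x. x \<in> V \<Longrightarrow> (T ^^ N) x = 0" and x: "x \<in> V"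
  shows "trunc_exp N c T (f x) = f (trunc_exp N c T x) + c *\<^sub>R g (trunc_exp N c T x)"
proof -
  note mem = lin_op_mem[OF lin_op_pow[OF T]]
  have gT: "(T ^^ i) (g x) = g ((T ^^ i) x)" if "x \<in> V" for i x
    using that by (induction i) (auto simp: Tg mem)
  have *: "(T ^^ Suc i) (f x) = f ((T ^^ Suc i) x) + real (Suc i) *\<^sub>R g ((T ^^ i) x)" for i
  proof (induction i)
    case 0
    then show ?case using x by (simp add: Tf)
  next
    case (Suc i)
    have "(T ^^ Suc (Suc i)) (f x) = T (f ((T ^^ Suc i) x)) + real (Suc i) *\<^sub>R T (g ((T ^^ i) x))"
      using Suc x mem[of x] lin_op_mem[OF f] lin_op_mem[OF g] V lin_op_scale[OF T] lin_op_add[OF T]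
      by (metis funpow.simps(2) o_apply subspace_scale)
    then show ?case using x by (simp add: Tf Tg mem lin_op_mem[OF T] algebra_simps scaleR_2)
  qed
  have "trunc_exp N c T (f x) = f x + (\<Sum>i<N. (c ^ Suc i / fact (Suc i)) *\<^sub>R (T ^^ Suc i) (f x))"
    unfolding trunc_exp_def by (subst sum.atMost_shift) simp
  also have "\<dots> = f x + (\<Sum>i<N. (c ^ Suc i / fact (Suc i)) *\<^sub>R f ((T ^^ Suc i) x)) +
      c *\<^sub>R (\<Sum>i<N. (c ^ i / fact i) *\<^sub>R g ((T ^^ i) x))"
  proof -
    have "c ^ Suc i / fact (Suc i) * real (Suc i) = c * (c ^ i / fact i)" for i
      by (simp add: divide_simps)
    then have "(c ^ Suc i / fact (Suc i)) *\<^sub>R (T ^^ Suc i) (f x) =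
      (c ^ Suc i / fact (Suc i)) *\<^sub>R f ((T ^^ Suc i) x) + c *\<^sub>R (c ^ i / fact i) *\<^sub>R g ((T ^^ i) x)" for i
      unfolding * scaleR_add_right scaleR_scaleR by simp
    then show ?thesis by (simp add: sum.distrib scaleR_sum_right del: funpow.simps)
  qed
  also have "f x + (\<Sum>i<N. (c ^ Suc i / fact (Suc i)) *\<^sub>R f ((T ^^ Suc i) x)) = f (trunc_exp N c T x)"
  proof -
    have "trunc_exp N c T x = x + (\<Sum>i<N. (c ^ Suc i / fact (Suc i)) *\<^sub>R (T ^^ Suc i) x)"
      unfolding trunc_exp_def by (subst sum.atMost_shift) simp
    also have "f \<dots> = f x + (\<Sum>i<N. f ((c ^ Suc i / fact (Suc i)) *\<^sub>R (T ^^ Suc i) x))"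
      by (subst lin_op_add[OF f]) (auto simp: x mem subspace_scale[OF V] lin_op_sum[OF f V] lin_op_mem[OF T]
        intro!: subspace_sum[OF V])
    finally show ?thesis by (simp add: lin_op_scale[OF f] x mem lin_op_mem[OF T])
  qed
  \<comment> \<open>The sum lacks the term i = N of the truncated exponential, which is zero because
    \<open>T ^^ N\<close> kills x.\<close>
  also have "(\<Sum>i<N. (c ^ i / fact i) *\<^sub>R g ((T ^^ i) x)) = g (trunc_exp N c T x)"
    unfolding trunc_exp_def
    by (cases N) (use N[OF x] in \<open>simp_all add: lin_op_sum[OF g V] lin_op_scale[OF g] x mem subspace_scale[OF V]
      lin_op_zero[OF g V] lessThan_Suc_atMost\<close>)
  finally show ?thesis .
qed

section \<open>Lefschetz modules\<close>

text \<open>A graded sl(2)-module in which the semisimple element is replaced by the projections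
  \<open>P k\<close>: the commutator of Lam and L is the weight n - k in degree k. The bound 2 n on
  the degree takes the place of finite dimension, which spaces of forms do not have.\<close>

locale lefschetz_module =
  fixes V :: "'v::real_vector set" and n :: nat and P :: "nat \<Rightarrow> 'v \<Rightarrow> 'v" and L Lam :: "'v \<Rightarrow> 'v"
  assumes V: "subspace V"
    and P: "lin_op V (P k)" and L: "lin_op V L" and Lam: "lin_op V Lam"
    and P_P: "x \<in> V \<Longrightarrow> P j (P k x) = (if j = k then P k x else 0)"
    and P_sum: "x \<in> V \<Longrightarrow> (\<Sum>k\<le>2 * n. P k x) = x"
    and P_L: "x \<in> V \<Longrightarrow> P k (L x) = (if k < 2 then 0 else L (P (k - 2) x))"
    and P_Lam: "x \<in> V \<Longrightarrow> P k (Lam x) = Lam (P (k + 2) x)"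
    and Lam_L: "x \<in> V \<Longrightarrow> P k x = x \<Longrightarrow> Lam (L x) = L (Lam x) + (real n - real k) *\<^sub>R x"
begin

section \<open>Homogeneous elements and commutation of powers of L and Lam\<close>

definition hom_part :: "nat \<Rightarrow> 'v set" where
  "hom_part k = {x \<in> V. P k x = x}"

lemmas mem [simp] = lin_op_mem[OF P] lin_op_mem[OF L] lin_op_mem[OF Lam]
  lin_op_mem[OF lin_op_pow[OF L]] lin_op_mem[OF lin_op_pow[OF Lam]]

lemma Vsub [simp]: "0 \<in> V" "x \<in> V \<Longrightarrow> c *\<^sub>R x \<in> V" "x \<in> V \<Longrightarrow> y \<in> V \<Longrightarrow> x + y \<in> V"
  "x \<in> V \<Longrightarrow> y \<in> V \<Longrightarrow> x - y \<in> V" "x \<in> V \<Longrightarrow> - x \<in> V"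
  using V by (auto simp: subspace_0 subspace_scale subspace_add subspace_diff subspace_neg)

lemma zero [simp]: "P k 0 = 0" "L 0 = 0" "Lam 0 = 0" "(L ^^ j) 0 = 0" "(Lam ^^ j) 0 = 0"
  by (auto intro!: lin_op_zero[OF _ V] lin_op_pow P L Lam)

lemma hom_partD: "x \<in> hom_part k \<Longrightarrow> x \<in> V" "x \<in> hom_part k \<Longrightarrow> P k x = x"
  by (auto simp: hom_part_def)

lemma subspace_hom_part: "subspace (hom_part k)"
  using P by (auto simp: hom_part_def subspace_def lin_op_def)

lemma P_hom [simp]: "x \<in> V \<Longrightarrow> P k x \<in> hom_part k"
  by (simp add: hom_part_def P_P)

lemma P_high: "x \<in> V \<Longrightarrow> k > 2 * n \<Longrightarrow> P k x = 0"
proof -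
  assume x: "x \<in> V" and k: "k > 2 * n"
  have "P k (\<Sum>j\<le>2 * n. P j x) = (\<Sum>j\<le>2 * n. P k (P j x))"
    by (rule lin_op_sum[OF P V]) (use x in auto)
  also have "\<dots> = 0" using k x by (intro sum.neutral) (auto simp: P_P)
  finally show ?thesis using x by (simp add: P_sum)
qed

lemma hom_high: "x \<in> hom_part k \<Longrightarrow> k > 2 * n \<Longrightarrow> x = 0"
  using P_high by (metis hom_partD)

lemma hom_L: "x \<in> hom_part k \<Longrightarrow> L x \<in> hom_part (k + 2)"
  and hom_Lam: "x \<in> hom_part (k + 2) \<Longrightarrow> Lam x \<in> hom_part k"
  by (auto simp: hom_part_def P_L P_Lam)

lemma zero_if_P: "x \<in> V \<Longrightarrow> (\<And>k. P k x = 0) \<Longrightarrow> x = 0"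
  by (metis P_sum sum.neutral)

lemma hom_eq:
  assumes "x \<in> hom_part j" "x \<in> hom_part k" "j \<noteq> k" shows "x = 0"
proof -
  have "P k (P j x) = 0" using P_P[of x k j] assms(1,3) hom_partD by auto
  then show ?thesis using assms hom_partD by metis
qed

lemma Lam_low: "x \<in> hom_part k \<Longrightarrow> k < 2 \<Longrightarrow> Lam x = 0"
proof (rule zero_if_P)
  fix j assume x: "x \<in> hom_part k" "k < 2"
  have "P (j + 2) (P k x) = 0" using x hom_partD[OF x(1)] P_P[of x "j + 2" k] by auto
  then show "P j (Lam x) = 0" using P_Lam[of x j] hom_partD[OF x(1)] by simp
qed (use hom_partD in auto)

lemma hom_pow_L: "x \<in> hom_part k \<Longrightarrow> (L ^^ j) x \<in> hom_part (k + 2 * j)"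
  by (induction j) (auto dest: hom_L simp: algebra_simps)

lemma hom_pow_Lam: "x \<in> hom_part k \<Longrightarrow> 2 * j \<le> k \<Longrightarrow> (Lam ^^ j) x \<in> hom_part (k - 2 * j)"
proof (induction j)
  case (Suc j)
  then have "(Lam ^^ j) x \<in> hom_part (k - 2 * Suc j + 2)" by (simp add: numeral_2_eq_2 Suc_diff_Suc)
  then show ?case using hom_Lam by simp
qed simp

lemma hom_pow_Lam0: "x \<in> hom_part k \<Longrightarrow> k < 2 * j \<Longrightarrow> (Lam ^^ j) x = 0"
proof (induction j)
  case (Suc j)
  show ?case
  proof (cases "k < 2 * j")
    case False
    then have "(Lam ^^ j) x \<in> hom_part (k - 2 * j)" "k - 2 * j < 2"
      using hom_pow_Lam[of x k j] Suc.prems by auto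
    then show ?thesis using Lam_low by simp
  qed (use Suc in simp)
qed simp

lemma pow_vanish:
  assumes x: "x \<in> V" shows "(L ^^ Suc n) x = 0" "(Lam ^^ Suc n) x = 0"
proof -
  have "(L ^^ Suc n) (P k x) = 0" for k
    by (rule hom_high[of _ "k + 2 * Suc n"]) (use hom_pow_L[OF P_hom[OF x], of "Suc n"] in auto)
  moreover have "(L ^^ Suc n) x = (\<Sum>k\<le>2 * n. (L ^^ Suc n) (P k x))"
    using lin_op_sum[OF lin_op_pow[OF L] V] x P_sum by (metis mem(1))
  ultimately show "(L ^^ Suc n) x = 0" by (simp del: funpow.simps)
  have "(Lam ^^ Suc n) (P k x) = 0" if "k \<le> 2 * n" for k
    by (rule hom_pow_Lam0[of _ k]) (use that x in auto)
  moreover have "(Lam ^^ Suc n) x = (\<Sum>k\<le>2 * n. (Lam ^^ Suc n) (P k x))"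
    using lin_op_sum[OF lin_op_pow[OF Lam] V] x P_sum by (metis mem(1))
  ultimately show "(Lam ^^ Suc n) x = 0" by (simp del: funpow.simps)
qed

text \<open>The coefficient is the sum of the weights n - k - 2 i for i from 0 to j, one for each
  factor L that Lam is moved past.\<close>

lemma Lam_pow_L:
  assumes x: "x \<in> hom_part k"
  shows "Lam ((L ^^ Suc j) x) = (L ^^ Suc j) (Lam x) + (real (Suc j) * (real n - real k - real j)) *\<^sub>R (L ^^ j) x"
proof (induction j)
  case 0
  then show ?case using x hom_partD Lam_L by simp
next
  case (Suc j)
  have xV: "x \<in> V" using x hom_partD by auto
  have "Lam ((L ^^ Suc (Suc j)) x) = L (Lam ((L ^^ Suc j) x)) + (real n - real (k + 2 * Suc j)) *\<^sub>R (L ^^ Suc j) x"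
    using Lam_L[OF hom_partD(1) hom_partD(2), OF hom_pow_L hom_pow_L, OF x x, of "Suc j"] by simp
  also have "L (Lam ((L ^^ Suc j) x)) =
      (L ^^ Suc (Suc j)) (Lam x) + (real (Suc j) * (real n - real k - real j)) *\<^sub>R (L ^^ Suc j) x"
    unfolding Suc using xV by (subst lin_op_add[OF L]) (auto simp: lin_op_scale[OF L])
  moreover have "real (Suc (Suc j)) * (real n - real k - real (Suc j)) =
    real (Suc j) * (real n - real k - real j) + (real n - real (k + 2 * Suc j))"
    by (simp add: algebra_simps)
  ultimately show ?case by (simp only: scaleR_left_distrib add.assoc)
qed

lemma L_pow_Lam:
  assumes x: "x \<in> V" and k: "P k x = x"
  shows "L ((Lam ^^ Suc j) x) = (Lam ^^ Suc j) (L x) - (real (Suc j) * (real n - real k + real j)) *\<^sub>R (Lam ^^ j) x"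
proof (induction j)
  case 0
  then show ?case using assms Lam_L by simp
next
  case (Suc j)
  let ?y = "(Lam ^^ Suc j) x"
  \<comment> \<open>The weight of \<open>(Lam ^^ Suc j) x\<close> is read off its degree
    \<open>k - 2 * Suc j\<close>; where this subtraction is truncated, the element is zero by
    \<open>hom_pow_Lam0\<close>.\<close>
  have L_Lam: "L (Lam y) = Lam (L y) - (real n - real k + 2 * real (Suc j)) *\<^sub>R y" if "y = ?y" for y
  proof (cases "2 * Suc j \<le> k")
    case True
    have "x \<in> hom_part k" using assms by (simp add: hom_part_def)
    from hom_pow_Lam[OF this True] have "?y \<in> hom_part (k - 2 * Suc j)" .
    then show ?thesis
      using Lam_L[of ?y "k - 2 * Suc j"] hom_partD that True by (auto simp: of_nat_diff algebra_simps)
  next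
    case False
    moreover have "x \<in> hom_part k" using assms by (simp add: hom_part_def)
    ultimately have "?y = 0" using hom_pow_Lam0[of x k "Suc j"] by simp
    then show ?thesis using that by simp
  qed
  have "L ((Lam ^^ Suc (Suc j)) x) = Lam (L ?y) - (real n - real k + 2 * real (Suc j)) *\<^sub>R ?y"
    using L_Lam[OF refl] by simp
  also have "Lam (L ?y) =
      (Lam ^^ Suc (Suc j)) (L x) - (real (Suc j) * (real n - real k + real j)) *\<^sub>R ?y"
    unfolding Suc using x by (subst lin_op_diff[OF Lam V]) (auto simp: lin_op_scale[OF Lam])
  moreover have "real (Suc (Suc j)) * (real n - real k + real (Suc j)) =
    real (Suc j) * (real n - real k + real j) + (real n - real k + 2 * real (Suc j))"
    by (simp add: algebra_simps)
  ultimately show ?case by (simp only: scaleR_left_distrib diff_diff_eq)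
qed

text \<open>On a primitive element the first term of \<open>Lam_pow_L\<close> disappears, so each
  pair of Lam and L contributes one scalar factor.\<close>

lemma Lam_pow_L_pow:
  assumes x: "x \<in> hom_part (n - k)" and k: "k \<le> n" and "Lam x = 0" and "j \<le> k"
  shows "(Lam ^^ j) ((L ^^ j) x) = (\<Prod>i<j. real (Suc i) * (real k - real i)) *\<^sub>R x"
  using \<open>j \<le> k\<close>
proof (induction j)
  case (Suc j)
  have xV: "x \<in> V" using x hom_partD by auto
  have "(Lam ^^ Suc j) ((L ^^ Suc j) x) = (Lam ^^ j) (Lam ((L ^^ Suc j) x))" by (simp only: funpow_Suc_right o_apply)
  also have "\<dots> = (real (Suc j) * (real k - real j)) *\<^sub>R (Lam ^^ j) ((L ^^ j) x)"
    unfolding Lam_pow_L[OF x] using k xV \<open>Lam x = 0\<close>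
    by (simp add: of_nat_diff lin_op_scale[OF lin_op_pow[OF Lam]] del: funpow.simps)
  finally show ?case using Suc by (simp add: mult_ac del: funpow.simps)
qed simp

lemma L_pow_Lam_pow:
  assumes x: "x \<in> hom_part (n + k)" and "L x = 0" and "j \<le> k"
  shows "(L ^^ j) ((Lam ^^ j) x) = (\<Prod>i<j. real (Suc i) * (real k - real i)) *\<^sub>R x"
  using \<open>j \<le> k\<close>
proof (induction j)
  case (Suc j)
  have xV: "x \<in> V" "P (n + k) x = x" using x hom_partD by auto
  have "(L ^^ Suc j) ((Lam ^^ Suc j) x) = (L ^^ j) (L ((Lam ^^ Suc j) x))" by (simp only: funpow_Suc_right o_apply)
  also have "\<dots> = (real (Suc j) * (real k - real j)) *\<^sub>R (L ^^ j) ((Lam ^^ j) x)"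
  proof -
    have "- (real (Suc j) * (real n - real (n + k) + real j)) = real (Suc j) * (real k - real j)"
      by (simp add: algebra_simps)
    then have "L ((Lam ^^ Suc j) x) = (real (Suc j) * (real k - real j)) *\<^sub>R (Lam ^^ j) x"
      using L_pow_Lam[OF xV, of j] \<open>L x = 0\<close> by (metis diff_0 scaleR_minus_left zero(5))
    then show ?thesis using xV by (simp add: lin_op_scale[OF lin_op_pow[OF L]] del: funpow.simps)
  qed
  finally show ?case using Suc by (simp add: mult_ac del: funpow.simps)
qed simp

text \<open>All factors are positive because i < k; this is the scalar by which one divides when
  inverting the Lefschetz powers.\<close>

lemma ladder_pos: "(\<Prod>i<k. real (Suc i) * (real k - real i)) \<noteq> 0"
  by simp

text \<open>The Lefschetz maps of a finite-dimensional representation of \<open>sl\<^sub>2\<close> are bijective; the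
  submodule \<open>U\<close> will be either the whole module or the submodule of harmonic elements.\<close>

lemma L_pow_onto:
  assumes U: "subspace U" "U \<subseteq> V" "\<And>x. x \<in> U \<Longrightarrow> L x \<in> U" "\<And>x. x \<in> U \<Longrightarrow> Lam x \<in> U"
    and x: "x \<in> U" "x \<in> hom_part (n + k)" and k: "k \<le> n"
  shows "\<exists>y\<in>U. y \<in> hom_part (n - k) \<and> x = (L ^^ k) y"
  using x k
proof (induction "n - k" arbitrary: k x rule: less_induct)
  case less
  have powU: "(L ^^ j) y \<in> U \<and> (Lam ^^ j) y \<in> U" if "y \<in> U" for j y
    using that by (induction j) (auto simp: U)
  \<comment> \<open>\<open>L x\<close> has degree n + (k + 2), where the induction hypothesis or,
    above degree 2 n, vanishing applies. Subtracting \<open>(L ^^ Suc k) y\<close> from x leaves an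
    element killed by L, on which the ladder formula inverts \<open>L ^^ k\<close>.\<close>
  have "\<exists>y\<in>U. L x = (L ^^ (k + 2)) y \<and> (L ^^ Suc k) y \<in> hom_part (n + k) \<and> L y \<in> hom_part (n - k)"
  proof (cases "k + 2 \<le> n")
    case True
    have "L x \<in> hom_part (n + (k + 2))" using hom_L[OF less.prems(2)] by (simp add: add.assoc)
    from less.hyps[OF _ U(3)[OF less.prems(1)] this True] True obtain y
      where y: "y \<in> U" "y \<in> hom_part (n - (k + 2))" "L x = (L ^^ (k + 2)) y"
      by (metis add.commute add_lessD1 diff_less_mono2 less_add_same_cancel1 less_le_trans zero_less_numeral)
    have "n - (k + 2) + 2 * Suc k = n + k" "n - (k + 2) + 2 = n - k" using True by auto
    then show ?thesis using y hom_pow_L[OF y(2), of "Suc k"] hom_L[OF y(2)] by auto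
  next
    case False
    then have "L x = 0" using hom_L[OF less.prems(2)] hom_high by (metis (full_types) add.assoc add_le_cancel_left mult_2 not_le)
    then show ?thesis using U(1) subspace_0[OF subspace_hom_part] by (intro bexI[of _ 0]) (auto simp: subspace_0)
  qed
  then obtain y where y: "y \<in> U" "L x = (L ^^ (k + 2)) y" "(L ^^ Suc k) y \<in> hom_part (n + k)" "L y \<in> hom_part (n - k)"
    by auto
  define x' where "x' = x - (L ^^ Suc k) y"
  have x': "x' \<in> U" "x' \<in> hom_part (n + k)"
    using y powU less.prems subspace_diff[OF subspace_hom_part] U(1) by (auto simp: x'_def subspace_diff simp del: funpow.simps)
  have yV: "y \<in> V" "x \<in> V" using y less.prems U by auto
  have "L x' = L x - L ((L ^^ Suc k) y)"
    unfolding x'_def by (rule lin_op_diff[OF L V]) (use yV in \<open>auto simp del: funpow.simps\<close>)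
  then have Lx': "L x' = 0" unfolding y(2) by simp
  define c where "c = (\<Prod>i<k. real (Suc i) * (real k - real i))"
  have c: "(L ^^ k) ((Lam ^^ k) x') = c *\<^sub>R x'" "c \<noteq> 0"
    using L_pow_Lam_pow[OF x'(2) Lx' order_refl] ladder_pos[of k] by (auto simp: c_def)
  define z where "z = L y + (1 / c) *\<^sub>R (Lam ^^ k) x'"
  have zU: "z \<in> U" unfolding z_def using y x' powU U by (auto intro!: subspace_add subspace_scale)
  have "(Lam ^^ k) x' \<in> hom_part (n - k)" using hom_pow_Lam[OF x'(2), of k] less.prems by simp
  then have zh: "z \<in> hom_part (n - k)"
    unfolding z_def using y subspace_hom_part by (intro subspace_add subspace_scale) auto
  have "(L ^^ k) z = (L ^^ Suc k) y + x'"
    unfolding z_def using yV x' hom_partD c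
    by (subst lin_op_add[OF lin_op_pow[OF L]]) (auto simp: lin_op_scale[OF lin_op_pow[OF L]] funpow_swap1)
  then have "(L ^^ k) z = x" by (simp add: x'_def)
  then show ?case using zU zh by auto
qed

text \<open>The two claims support each other in an induction on the degree: primitivity in degree m
  uses injectivity in degree m - 2, and injectivity in degree m uses primitivity in the same
  degree.\<close>

lemma primitive_and_L_pow_inj:
  assumes "x \<in> hom_part m" "m \<le> n"
  shows "((L ^^ Suc (n - m)) x = 0 \<longrightarrow> Lam x = 0) \<and> ((L ^^ (n - m)) x = 0 \<longrightarrow> x = 0)"
proof -
  have main: "(x \<in> hom_part m \<longrightarrow> m \<le> n \<longrightarrow> (L ^^ Suc (n - m)) x = 0 \<longrightarrow> Lam x = 0) \<and>
    (x \<in> hom_part m \<longrightarrow> m \<le> n \<longrightarrow> (L ^^ (n - m)) x = 0 \<longrightarrow> x = 0)" for x m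
  proof (induction m arbitrary: x rule: less_induct)
    case (less m)
    have 1: "Lam x = 0" if x: "x \<in> hom_part m" "m \<le> n" "(L ^^ Suc (n - m)) x = 0" for x
    proof (cases "m < 2")
      case True then show ?thesis using Lam_low x by auto
    next
      case False
      \<comment> \<open>For j = n - m the coefficient in \<open>Lam_pow_L\<close> is zero, so
        \<open>Lam x\<close> inherits the vanishing; one more factor L gives the power for which
        injectivity in degree m - 2 is available.\<close>
      have "(L ^^ Suc (n - m)) (Lam x) = 0" using Lam_pow_L[OF x(1), of "n - m"] x by (simp add: of_nat_diff)
      then have "L ((L ^^ Suc (n - m)) (Lam x)) = 0" by (simp del: funpow.simps)
      then have "(L ^^ (n - (m - 2))) (Lam x) = 0"
        using False x(2) by (simp add: Suc_diff_le numeral_2_eq_2)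
      moreover have "m - 2 + 2 = m" using False by simp
      then have "Lam x \<in> hom_part (m - 2)" using hom_Lam[of x "m - 2"] x by metis
      ultimately show ?thesis using less.IH[of "m - 2" "Lam x"] x(2) False by auto
    qed
    have 2: "x = 0" if x: "x \<in> hom_part m" "m \<le> n" "(L ^^ (n - m)) x = 0" for x
    proof -
      have "Lam x = 0" using 1[OF x(1,2)] x(3) by simp
      then show ?thesis
        using Lam_pow_L_pow[of x "n - m" "n - m"] x ladder_pos[of "n - m"] by auto
    qed
    show ?case using 1 2 by blast
  qed
  then show ?thesis using assms by blast
qed

lemmas primitive_if_L_pow_vanish = primitive_and_L_pow_inj[THEN conjunct1, rule_format]
  and L_pow_inj = primitive_and_L_pow_inj[THEN conjunct2, rule_format]

text \<open>Nothing is lost by truncating at \<open>Suc n\<close>, and \<open>pow_vanish\<close>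
  supplies the vanishing power that \<open>trunc_exp_conjugate\<close> requires with the same
  bound.\<close>

definition W :: "'v \<Rightarrow> 'v" where
  "W x = trunc_exp (Suc n) 1 L (trunc_exp (Suc n) (- 1) Lam (trunc_exp (Suc n) 1 L x))"

lemma W: "lin_op V W"
  unfolding W_def[abs_def]
  by (rule lin_op_comp[OF lin_op_trunc_exp[OF V L]
      lin_op_comp[OF lin_op_trunc_exp[OF V Lam] lin_op_trunc_exp[OF V L]]])

text \<open>Under commutators with L and Lam, f and g span the two-dimensional representation, so
  each exponential acts by a unipotent matrix. The single factors are recorded because
  \<open>trunc_exp_wedge_contr\<close> needs them before they are assembled into
  \<open>W\<close>.\<close>

lemma trunc_exp_doublet:
  assumes f: "lin_op V f" and g: "lin_op V g"
    and Lf: "\<And>x. x \<in> V \<Longrightarrow> L (f x) = f (L x)"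
    and Lamf: "\<And>x. x \<in> V \<Longrightarrow> Lam (f x) = f (Lam x) + g x"
    and Lamg: "\<And>x. x \<in> V \<Longrightarrow> Lam (g x) = g (Lam x)"
    and Lg: "\<And>x. x \<in> V \<Longrightarrow> L (g x) = g (L x) + f x"
    and x: "x \<in> V"
  shows "trunc_exp (Suc n) 1 L (f x) = f (trunc_exp (Suc n) 1 L x)"
    and "trunc_exp (Suc n) 1 L (g x) = g (trunc_exp (Suc n) 1 L x) + f (trunc_exp (Suc n) 1 L x)"
    and "trunc_exp (Suc n) (- 1) Lam (f x) = f (trunc_exp (Suc n) (- 1) Lam x) - g (trunc_exp (Suc n) (- 1) Lam x)"
    and "trunc_exp (Suc n) (- 1) Lam (g x) = g (trunc_exp (Suc n) (- 1) Lam x)"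
proof -
  have 0: "lin_op V (\<lambda>x. 0)" by (simp add: lin_op_def)
  show "trunc_exp (Suc n) 1 L (f x) = f (trunc_exp (Suc n) 1 L x)"
    using trunc_exp_conjugate[OF V L f 0, of "Suc n" x 1] x pow_vanish Lf by simp
  show "trunc_exp (Suc n) 1 L (g x) = g (trunc_exp (Suc n) 1 L x) + f (trunc_exp (Suc n) 1 L x)"
    using trunc_exp_conjugate[OF V L g f Lg Lf pow_vanish(1) x, of 1] by simp
  show "trunc_exp (Suc n) (- 1) Lam (f x) = f (trunc_exp (Suc n) (- 1) Lam x) - g (trunc_exp (Suc n) (- 1) Lam x)"
    using trunc_exp_conjugate[OF V Lam f g Lamf Lamg pow_vanish(2) x, of "-1"] by simp
  show "trunc_exp (Suc n) (- 1) Lam (g x) = g (trunc_exp (Suc n) (- 1) Lam x)"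
    using trunc_exp_conjugate[OF V Lam g 0, of "Suc n" x "-1"] x pow_vanish Lamg by simp
qed

text \<open>\<open>W\<close> represents the Weyl element of \<open>SL\<^sub>2\<close>; it interchanges the two weight vectors of every
  two-dimensional representation formed by operators.\<close>

lemma W_conjugate:
  assumes f: "lin_op V f" and g: "lin_op V g"
    and Lf: "\<And>x. x \<in> V \<Longrightarrow> L (f x) = f (L x)"
    and Lamf: "\<And>x. x \<in> V \<Longrightarrow> Lam (f x) = f (Lam x) + g x"
    and Lamg: "\<And>x. x \<in> V \<Longrightarrow> Lam (g x) = g (Lam x)"
    and Lg: "\<And>x. x \<in> V \<Longrightarrow> L (g x) = g (L x) + f x"
    and x: "x \<in> V"
  shows "W (f x) = - g (W x)" "W (g x) = f (W x)"
proof -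
  let ?E = "trunc_exp (Suc n) 1 L" and ?F = "trunc_exp (Suc n) (- 1) Lam"
  have EV: "?E x \<in> V" "?F x \<in> V" if "x \<in> V" for x
    using lin_op_mem[OF lin_op_trunc_exp[OF V]] L Lam that by auto
  note fgm = lin_op_mem[OF f] lin_op_mem[OF g]
  note ex = trunc_exp_doublet[OF f g Lf Lamf Lamg Lg]
  have add: "?E (y - z) = ?E y - ?E z" "?F (y + z) = ?F y + ?F z" if "y \<in> V" "z \<in> V" for y z
    using that lin_op_diff[OF lin_op_trunc_exp[OF V L] V] lin_op_add[OF lin_op_trunc_exp[OF V Lam]] by auto
  show "W (f x) = - g (W x)" "W (g x) = f (W x)"
    unfolding W_def using x EV fgm by (simp_all add: ex add)
qed

end

section \<open>Lefschetz complexes\<close>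

context lefschetz_module begin

lemma eq_on_hom_parts:
  assumes "lin_op V f" "lin_op V g" "\<And>m x. m \<le> 2 * n \<Longrightarrow> x \<in> hom_part m \<Longrightarrow> f x = g x" "x \<in> V"
  shows "f x = g x"
proof -
  have "f (\<Sum>k\<le>2 * n. P k x) = g (\<Sum>k\<le>2 * n. P k x)"
    using assms(3,4) by (simp add: lin_op_sum[OF assms(1) V] lin_op_sum[OF assms(2) V])
  then show ?thesis using P_sum[OF assms(4)] by simp
qed

lemma sum_hom_parts:
  assumes "lin_op V f" "subspace S" "\<And>m y. m \<le> 2 * n \<Longrightarrow> y \<in> hom_part m \<Longrightarrow> y = P m x \<Longrightarrow> f y \<in> S" "x \<in> V"
  shows "f x \<in> S"
proof -
  have "f (P k x) \<in> S" if "k \<le> 2 * n" for k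
    using assms(3)[OF that P_hom[OF assms(4)] refl] .
  then have "f (\<Sum>k\<le>2 * n. P k x) \<in> S"
    using assms(4) by (subst lin_op_sum[OF assms(1) V]) (auto intro!: subspace_sum[OF assms(2)])
  then show ?thesis using P_sum[OF assms(4)] by simp
qed

end

locale lefschetz_complex = lefschetz_module +
  fixes d
  assumes d: "lin_op V d"
    and P_d: "x \<in> V \<Longrightarrow> P k (d x) = (if k = 0 then 0 else d (P (k - 1) x))"
    and d_d: "x \<in> V \<Longrightarrow> d (d x) = 0"
    and L_d: "x \<in> V \<Longrightarrow> L (d x) = d (L x)"
begin

text \<open>On forms this becomes the symplectic codifferential by \<open>sympl_delta_eq\<close>;
  taking the commutator as the definition keeps the star operator out of the abstract
  complex.\<close>

definition D where "D x = Lam (d x) - d (Lam x)"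

lemmas d_mem [simp] = lin_op_mem[OF d]
lemmas d_zero [simp] = lin_op_zero[OF d V]

text \<open>The iterated commutators serve to show that the second one vanishes, which is what makes
  d and D a doublet.\<close>

primrec ad_Lam where
  "ad_Lam 0 = d"
| "ad_Lam (Suc k) = (\<lambda>x. Lam (ad_Lam k x) - ad_Lam k (Lam x))"

lemma ad_Lam: "lin_op V (ad_Lam k)"
proof (induction k)
  case (Suc k)
  then show ?case using lin_op_sub[OF V lin_op_comp[OF Lam Suc] lin_op_comp[OF Suc Lam]] by simp
qed (simp add: d)

lemmas ad_Lam_mem [simp] = lin_op_mem[OF ad_Lam]

lemma Lam_P_low: "x \<in> V \<Longrightarrow> k < 2 \<Longrightarrow> Lam (P k x) = 0"
  using Lam_low P_hom by blast

lemma P_ad_Lam: "x \<in> V \<Longrightarrow> P j (ad_Lam k x) = (if j + 2 * k = 0 then 0 else ad_Lam k (P (j + 2 * k - 1) x))"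
proof (induction k arbitrary: j x)
  case 0
  then show ?case by (simp add: P_d)
next
  case (Suc k)
  have "P j (ad_Lam (Suc k) x) = Lam (P (j + 2) (ad_Lam k x)) - P j (ad_Lam k (Lam x))"
    using Suc.prems by (simp add: lin_op_diff[OF P V] P_Lam)
  also have "P (j + 2) (ad_Lam k x) = ad_Lam k (P (j + 2 * k + 1) x)"
    using Suc by simp
  \<comment> \<open>For j = k = 0 both sides vanish: d has no component in degree 0, and Lam kills
    degree 1.\<close>
  also have "P j (ad_Lam k (Lam x)) = ad_Lam k (Lam (P (j + 2 * k + 1) x))"
    using Suc P_Lam[of x "j + 2 * k - 1"] Lam_P_low[of x 1] lin_op_zero[OF ad_Lam V]
    by (cases "j + 2 * k = 0") (auto simp: eval_nat_numeral)
  finally show ?case by simp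
qed

lemma hom_ad_Lam: "x \<in> hom_part m \<Longrightarrow> 2 * k \<le> m + 1 \<Longrightarrow> ad_Lam k x \<in> hom_part (m + 1 - 2 * k)"
  and hom_ad_Lam0: "x \<in> hom_part m \<Longrightarrow> m + 1 < 2 * k \<Longrightarrow> ad_Lam k x = 0"
proof -
  assume x: "x \<in> hom_part m"
  then have xV: "x \<in> V" "P m x = x" by (auto simp: hom_part_def)
  {
    assume "2 * k \<le> m + 1"
    then have "P (m + 1 - 2 * k) (ad_Lam k x) = ad_Lam k x"
      using P_ad_Lam[OF xV(1), of "m + 1 - 2 * k" k] xV by simp
    then show "ad_Lam k x \<in> hom_part (m + 1 - 2 * k)"
      using ad_Lam_mem[OF xV(1)] unfolding hom_part_def by blast
  }
  assume m: "m + 1 < 2 * k"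
  have "P j (ad_Lam k x) = 0" for j
  proof -
    have "j + 2 * k \<noteq> 0" "j + 2 * k - 1 \<noteq> m" using m by auto
    then have "P (j + 2 * k - 1) x = 0" using P_P[OF xV(1), of "j + 2 * k - 1" m] by (simp only: xV if_False)
    then show ?thesis using P_ad_Lam[OF xV(1), of j k] lin_op_zero[OF ad_Lam V] by (metis (full_types))
  qed
  then show "ad_Lam k x = 0" by (rule zero_if_P[OF ad_Lam_mem[OF xV(1)]])
qed

lemma L_Lam:
  assumes "x \<in> hom_part m" shows "L (Lam x) = Lam (L x) - (real n - real m) *\<^sub>R x"
  using Lam_L[of x m] hom_partD[OF assms] by simp

text \<open>The analogue of \<open>Lam_pow_L\<close> in the adjoint action: d commutes with L, and
  \<open>ad_Lam i\<close> changes the degree by 1 - 2 i. The coefficient is the sum of 1 - 2 i for i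
  from 0 to k.\<close>

lemma L_ad_Lam:
  assumes "x \<in> V"
  shows "L (ad_Lam (Suc k) x) = ad_Lam (Suc k) (L x) + (real (Suc k) * (1 - real k)) *\<^sub>R ad_Lam k x"
proof -
  \<comment> \<open>\<open>B\<close> plays the role of the preceding commutator, from which
    \<open>ad_Lam k\<close> arises by one more commutator with Lam. Multiplied by c, this condition
    also holds at the start, where c = 0 and any operator can serve as \<open>B\<close>.\<close>
  have step: "L (ad_Lam (Suc k) x) = ad_Lam (Suc k) (L x) + (c + 1 - 2 * real k) *\<^sub>R ad_Lam k x"
    if IH: "\<And>x. x \<in> V \<Longrightarrow> L (ad_Lam k x) = ad_Lam k (L x) + c *\<^sub>R B x"
      and B: "lin_op V B" "\<And>x. x \<in> V \<Longrightarrow> c *\<^sub>R ad_Lam k x = c *\<^sub>R (Lam (B x) - B (Lam x))"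
      and x: "x \<in> V" for k c B x
  proof -
    have "L (ad_Lam (Suc k) x) = ad_Lam (Suc k) (L x) + (c + 1 - 2 * real k) *\<^sub>R ad_Lam k x"
      if x: "x \<in> hom_part m" for m x
    proof -
      have xV: "x \<in> V" "P m x = x" using x hom_partD by auto
      have "L (Lam (ad_Lam k x)) = Lam (L (ad_Lam k x)) - (real n - real m - 1 + 2 * real k) *\<^sub>R ad_Lam k x"
      proof (cases "2 * k \<le> m + 1")
        case True
        then have "real (m + 1 - 2 * k) = real m + 1 - 2 * real k" by (simp add: of_nat_diff)
        then show ?thesis using L_Lam[OF hom_ad_Lam[OF x True]] by (simp add: algebra_simps)
      qed (simp add: hom_ad_Lam0[OF x])
      also have "Lam (L (ad_Lam k x)) = Lam (ad_Lam k (L x)) + c *\<^sub>R Lam (B x)"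
        using xV lin_op_mem[OF B(1)] by (simp add: IH lin_op_add[OF Lam] lin_op_scale[OF Lam])
      finally have 1: "L (Lam (ad_Lam k x)) = Lam (ad_Lam k (L x)) + c *\<^sub>R Lam (B x) -
        (real n - real m - 1 + 2 * real k) *\<^sub>R ad_Lam k x" .
      have 2: "L (ad_Lam k (Lam x)) = ad_Lam k (Lam (L x)) - (real n - real m) *\<^sub>R ad_Lam k x + c *\<^sub>R B (Lam x)"
        using xV L_Lam[OF x] by (simp add: IH lin_op_diff[OF ad_Lam V] lin_op_scale[OF ad_Lam])
      have "(c + 1 - 2 * real k) *\<^sub>R ad_Lam k x = c *\<^sub>R ad_Lam k x + (1 - 2 * real k) *\<^sub>R ad_Lam k x"
        by (simp flip: scaleR_left_distrib)
      also have "c *\<^sub>R ad_Lam k x = c *\<^sub>R Lam (B x) - c *\<^sub>R B (Lam x)"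
        using B(2)[OF xV(1)] by (simp add: scaleR_diff_right)
      finally show ?thesis
        using xV by (simp add: lin_op_diff[OF L V] 1 2 algebra_simps scaleR_2)
    qed
    note * = this
    show ?thesis
    proof (rule eq_on_hom_parts[where f = "\<lambda>x. L (ad_Lam (Suc k) x)", OF _ _ * x])
      show "lin_op V (\<lambda>x. L (ad_Lam (Suc k) x))" by (rule lin_op_comp[OF L ad_Lam])
      have "lin_op V (\<lambda>x. ad_Lam (Suc k) (L x) - (- (c + 1 - 2 * real k)) *\<^sub>R ad_Lam k x)"
        by (rule lin_op_sub[OF V lin_op_comp[OF ad_Lam L] lin_op_scaleR[OF V ad_Lam]])
      then show "lin_op V (\<lambda>x. ad_Lam (Suc k) (L x) + (c + 1 - 2 * real k) *\<^sub>R ad_Lam k x)"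
        by (simp only: scaleR_minus_left diff_minus_eq_add)
    qed
  qed
  show ?thesis using assms
  proof (induction k arbitrary: x)
    case 0
    then show ?case using step[of 0 0 d x] d L_d by simp
  next
    case (Suc k)
    have "L (ad_Lam (Suc (Suc k)) x) = ad_Lam (Suc (Suc k)) (L x) +
      (real (Suc k) * (1 - real k) + 1 - 2 * real (Suc k)) *\<^sub>R ad_Lam (Suc k) x"
      by (rule step[OF Suc.IH ad_Lam _ Suc.prems]) auto
    moreover have "real (Suc k) * (1 - real k) + 1 - 2 * real (Suc k) = real (Suc (Suc k)) * (1 - real (Suc k))"
      by (simp add: algebra_simps)
    ultimately show ?case by presburger
  qed
qed

text \<open>\<open>ad_Lam (n + 2)\<close> lowers the degree by 2 n + 3 and hence is zero. If
  \<open>ad_Lam (k + 1)\<close> is zero then so is \<open>ad_Lam k\<close>, as long as the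
  coefficient (k + 1) (1 - k) of \<open>L_ad_Lam\<close> is nonzero; the descent ends at k = 2 and
  spares D, which is \<open>ad_Lam 1\<close>.\<close>

lemma ad_Lam_2: "x \<in> V \<Longrightarrow> ad_Lam 2 x = 0"
proof -
  have *: "ad_Lam 2 x = 0" if "\<And>x. x \<in> V \<Longrightarrow> ad_Lam (j + 2) x = 0" "x \<in> V" for j x
    using that
  proof (induction j arbitrary: x)
    case (Suc j)
    have "ad_Lam (j + 2) x = 0" if x: "x \<in> V" for x
    proof -
      have "(real (Suc (j + 2)) * (1 - real (j + 2))) *\<^sub>R ad_Lam (j + 2) x = 0"
        using L_ad_Lam[OF x, of "j + 2"] Suc.prems(1)[of x] Suc.prems(1)[of "L x"] x
        by (simp del: ad_Lam.simps add: add.commute)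
      moreover have "real (Suc (j + 2)) * (1 - real (j + 2)) \<noteq> 0" by simp
      ultimately show ?thesis by (metis scaleR_eq_0_iff)
    qed
    then show ?case using Suc by blast
  qed (simp only: add_0)
  assume x: "x \<in> V"
  have "ad_Lam (n + 2) y = 0" if "y \<in> V" for y
  proof (rule zero_if_P[OF ad_Lam_mem[OF that]])
    fix j
    have "P (j + 2 * (n + 2) - 1) y = 0" using that by (intro P_high) auto
    then show "P j (ad_Lam (n + 2) y) = 0"
      using P_ad_Lam[OF that, of j "n + 2"] lin_op_zero[OF ad_Lam V] by (metis (full_types))
  qed
  then show ?thesis using * x by blast
qed

lemma D_eq: "D = ad_Lam 1"
  by (auto simp: D_def)

lemma D: "lin_op V D"
  unfolding D_eq by (rule ad_Lam)

lemmas D_mem [simp] = lin_op_mem[OF D]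

lemma Lam_D: "x \<in> V \<Longrightarrow> Lam (D x) = D (Lam x)"
  using ad_Lam_2[of x] by (simp add: D_def numeral_2_eq_2)

lemma L_D: "x \<in> V \<Longrightarrow> L (D x) = D (L x) + d x"
  using L_ad_Lam[of x 0] unfolding D_eq by simp

lemma Lam_d: "Lam (d x) = d (Lam x) + D x"
  by (simp add: D_def)

lemma W_d: "x \<in> V \<Longrightarrow> W (d x) = - D (W x)" and W_D: "x \<in> V \<Longrightarrow> W (D x) = d (W x)"
  using W_conjugate[OF d D L_d Lam_d Lam_D L_D] by auto

lemma d_D: "x \<in> V \<Longrightarrow> d (D x) = - D (d x)"
  using lin_op_diff[OF d V] by (simp add: D_def d_d)

text \<open>Applying Lam to d D + D d = 0 and commuting it to the right produces 2 D D, because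
  [Lam, d] = D and [Lam, D] = 0.\<close>

lemma D_D: "x \<in> V \<Longrightarrow> D (D x) = 0"
proof -
  assume x: "x \<in> V"
  have "0 = Lam (d (D x) + D (d x))" using x by (simp add: d_D)
  also have "\<dots> = Lam (d (D x)) + Lam (D (d x))" using x by (simp add: lin_op_add[OF Lam])
  also have "\<dots> = d (D (Lam x)) + D (D x) + D (d (Lam x) + D x)"
    using x by (simp add: Lam_d Lam_D)
  also have "\<dots> = 2 *\<^sub>R D (D x)" using x by (simp add: d_D lin_op_add[OF D] scaleR_2)
  finally show ?thesis by simp
qed

lemma P_D: "x \<in> V \<Longrightarrow> P k (D x) = D (P (k + 1) x)"
  unfolding D_eq using P_ad_Lam[of x k 1] by simp

lemma hom_d: "x \<in> hom_part k \<Longrightarrow> d x \<in> hom_part (k + 1)"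
  and hom_D: "x \<in> hom_part (k + 1) \<Longrightarrow> D x \<in> hom_part k"
  by (auto simp: hom_part_def P_d P_D)

definition harmonic where "harmonic = {x \<in> V. d x = 0 \<and> D x = 0}"

definition exact where "exact = d ` V"

lemma harmonicD: "x \<in> harmonic \<Longrightarrow> x \<in> V" "x \<in> harmonic \<Longrightarrow> d x = 0" "x \<in> harmonic \<Longrightarrow> D x = 0"
  by (auto simp: harmonic_def)

lemma subspace_harmonic: "subspace harmonic"
  unfolding subspace_def harmonic_def
  by (auto simp: lin_op_zero[OF d V] lin_op_zero[OF D V] lin_op_add[OF d] lin_op_add[OF D] lin_op_scale[OF d] lin_op_scale[OF D])

lemma subspace_exact: "subspace exact"
  unfolding subspace_def exact_def
proof (intro conjI ballI allI)
  show "0 \<in> d ` V" using lin_op_zero[OF d V] by (metis Vsub(1) imageI)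
  show "x + y \<in> d ` V" if "x \<in> d ` V" "y \<in> d ` V" for x y
    using that by clarify (metis lin_op_add[OF d] Vsub(3) imageI)
  show "c *\<^sub>R x \<in> d ` V" if "x \<in> d ` V" for c x
    using that by clarify (metis lin_op_scale[OF d] Vsub(2) imageI)
qed

text \<open>Together with \<open>harmonic_Lam\<close> this makes the harmonic elements an
  sl(2)-submodule, so that \<open>L_pow_onto\<close> can be applied inside them.\<close>

lemma harmonic_L: "x \<in> harmonic \<Longrightarrow> L x \<in> harmonic"
  using L_D L_d by (force simp: harmonic_def)

lemma harmonic_Lam: "x \<in> harmonic \<Longrightarrow> Lam x \<in> harmonic"
  using Lam_D[of x] Lam_d[of x] by (auto simp: harmonic_def)

lemma D_low: "x \<in> hom_part 0 \<Longrightarrow> D x = 0"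
  unfolding D_eq using hom_ad_Lam0[of x 0 1] by simp

lemma harmonic_P: "x \<in> harmonic \<Longrightarrow> P k x \<in> harmonic"
proof -
  assume x: "x \<in> harmonic"
  then have "D (P k x) = 0"
    using P_D[of x "k - 1"] D_low[OF P_hom, of x] by (cases k) (auto simp: harmonic_def)
  moreover have "d (P k x) = 0" using P_d[of x "k + 1"] x by (auto simp: harmonic_def)
  ultimately show ?thesis using x by (auto simp: harmonic_def)
qed

lemma harmonic_pow: "x \<in> harmonic \<Longrightarrow> (L ^^ k) x \<in> harmonic"
  by (induction k) (auto simp: harmonic_L)

lemma exact_L: "x \<in> exact \<Longrightarrow> L x \<in> exact"
  by (auto simp: exact_def L_d)

lemma exact_pow: "x \<in> exact \<Longrightarrow> (L ^^ k) x \<in> exact"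
  by (induction k) (auto simp: exact_L)

lemma exact_P: "x \<in> exact \<Longrightarrow> P k x \<in> exact"
  using subspace_0[OF subspace_exact] by (auto simp: exact_def P_d)

end

section \<open>The equivariant d-delta lemma for abstract complexes\<close>

text \<open>The Lefschetz property is phrased through representatives, so that no quotient spaces
  enter. \<open>W_W\<close> is what the exchange rules of \<open>W_conjugate\<close> leave open
  about \<open>W\<close>; it is checked later in the exterior algebra.\<close>

locale lefschetz_hodge = lefschetz_complex +
  assumes lefschetz_surj: "k \<le> n \<Longrightarrow> b \<in> hom_part (n + k) \<Longrightarrow> d b = 0 \<Longrightarrow>
      \<exists>a\<in>hom_part (n - k). d a = 0 \<and> (\<exists>c\<in>V. b = (L ^^ k) a + d c)"
    and lefschetz_inj: "k \<le> n \<Longrightarrow> a \<in> hom_part (n - k) \<Longrightarrow> d a = 0 \<Longrightarrow> c \<in> V \<Longrightarrow> (L ^^ k) a = d c \<Longrightarrow>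
      \<exists>e\<in>V. a = d e"
    and W_W: "x \<in> hom_part k \<Longrightarrow> W (W x) = (- 1) ^ (n + k) *\<^sub>R x"
begin

lemma exactI: "x \<in> V \<Longrightarrow> d x \<in> exact"
  by (simp add: exact_def)

lemma lefschetz_inj_exact: "k \<le> n \<Longrightarrow> a \<in> hom_part (n - k) \<Longrightarrow> d a = 0 \<Longrightarrow> (L ^^ k) a \<in> exact \<Longrightarrow> a \<in> exact"
  using lefschetz_inj[of k a] by (auto simp: exact_def)

text \<open>A closed element is cohomologous to a harmonic one. By the Lefschetz property it suffices to treat
  an \<open>a\<close> of degree \<open>n - k\<close> with \<open>L\<^sup>k\<^sup>+\<^sup>1 a\<close> exact; such an \<open>a\<close> can be made primitive.\<close>

lemma harmonic_representative_hom:
  assumes "b \<in> hom_part j" "d b = 0"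
  shows "\<exists>h\<in>harmonic. b - h \<in> exact"
proof -
  have low: "\<exists>h\<in>harmonic. b - h \<in> exact" if "m \<le> n" "b \<in> hom_part m" "d b = 0" for b m
    using that
  proof (induction m arbitrary: b rule: less_induct)
    case (less m)
    define k where "k = n - m"
    have m: "m = n - k" and k: "k \<le> n" using less.prems(1) by (auto simp: k_def)
    have bV: "b \<in> V" using less.prems by (auto simp: hom_part_def)
    have "(L ^^ Suc k) b \<in> hom_part (n + (k + 2))" "d ((L ^^ Suc k) b) = 0"
    proof -
      show "(L ^^ Suc k) b \<in> hom_part (n + (k + 2))"
      proof -
        have "m + 2 * Suc k = n + (k + 2)" using less.prems(1) by (simp add: k_def)
        then show ?thesis using hom_pow_L[OF less.prems(2), of "Suc k"] by (simp only:)
      qed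
      have "d ((L ^^ i) b) = 0" for i
        by (induction i) (use bV in \<open>auto simp: less.prems(3) simp flip: L_d\<close>)
      then show "d ((L ^^ Suc k) b) = 0" .
    qed
    \<comment> \<open>Surjectivity in degree n + (k + 2) provides a of degree m - 2 such that
      \<open>L ^^ Suc k\<close> maps b - L a to an exact element. For m < 2 that degree exceeds 2 n,
      and a = 0 serves.\<close>
    then have "\<exists>a c. (m \<ge> 2 \<longrightarrow> a \<in> hom_part (m - 2)) \<and> (m < 2 \<longrightarrow> a = 0) \<and> a \<in> V \<and> d a = 0 \<and> c \<in> V \<and>
      (L ^^ Suc k) b = (L ^^ (k + 2)) a + d c"
    proof (cases "k + 2 \<le> n")
      case True
      then obtain a c where ac: "a \<in> hom_part (n - (k + 2))" "d a = 0" "c \<in> V" "(L ^^ Suc k) b = (L ^^ (k + 2)) a + d c"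
        using lefschetz_surj[OF True \<open>(L ^^ Suc k) b \<in> _\<close> \<open>d ((L ^^ Suc k) b) = 0\<close>] by blast
      moreover have "n - (k + 2) = m - 2" "\<not> m < 2" using True less.prems(1) by (auto simp: k_def)
      moreover have "a \<in> V" using hom_partD(1)[OF ac(1)] .
      ultimately show ?thesis by metis
    next
      case False
      then have "(L ^^ Suc k) b = 0" using hom_high[OF \<open>(L ^^ Suc k) b \<in> _\<close>] by simp
      then show ?thesis
        using False less.prems(1) by (intro exI[of _ 0]) (auto simp: k_def simp del: funpow.simps)
    qed
    then obtain a c where a: "m \<ge> 2 \<Longrightarrow> a \<in> hom_part (m - 2)" "m < 2 \<Longrightarrow> a = 0" "a \<in> V" "d a = 0" and c: "c \<in> V"
      and ac: "(L ^^ Suc k) b = (L ^^ (k + 2)) a + d c" by blast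
    have "(\<exists>h'\<in>harmonic. a - h' \<in> exact) \<and> L a \<in> hom_part m"
    proof (cases "m < 2")
      case True
      then show ?thesis
        using a(2) subspace_0[OF subspace_harmonic] subspace_0[OF subspace_exact] subspace_0[OF subspace_hom_part]
        by (intro conjI bexI[of _ 0]) auto
    next
      case False
      then have "m - 2 + 2 = m" "m - 2 < m" "m - 2 \<le> n" "a \<in> hom_part (m - 2)" using less.prems(1) a(1) by auto
      then show ?thesis using hom_L[of a "m - 2"] less.IH[of "m - 2" a] a(4) by metis
    qed
    then obtain h' where h': "h' \<in> harmonic" "a - h' \<in> exact" and La: "L a \<in> hom_part m" by blast
    let ?x = "b - L a"
    have x: "?x \<in> hom_part m" using La less.prems subspace_diff[OF subspace_hom_part] by blast
    have Lx: "(L ^^ Suc k) ?x = d c"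
      using ac bV a(3) by (subst lin_op_diff[OF lin_op_pow[OF L] V]) (auto simp: funpow_swap1)
    have "(L ^^ Suc k) ?x \<in> hom_part (n + k + 2)"
    proof -
      have "m + 2 * Suc k = n + k + 2" using less.prems(1) by (simp add: k_def)
      then show ?thesis using hom_pow_L[OF x, of "Suc k"] by (simp only:)
    qed
    then have "d c = P (n + k + 2) (d c)" using Lx hom_partD by metis
    then have dc: "d c = d (P (n + k + 1) c)" using P_d[OF c, of "n + k + 2"] by simp
    \<comment> \<open>Since \<open>L ^^ Suc k\<close> is onto degree n + k + 1 already on the level
      of elements, the potential can be taken to be \<open>(L ^^ Suc k) c'\<close>; then
      \<open>L ^^ Suc k\<close> kills b - L a - d c'.\<close>
    have "\<exists>c'\<in>hom_part (m - 1). P (n + k + 1) c = (L ^^ Suc k) c' \<and> d c' \<in> hom_part m"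
    proof (cases "k + 1 \<le> n")
      case True
      have "P (n + k + 1) c \<in> hom_part (n + (k + 1))" using c by simp
      from L_pow_onto[OF V order_refl _ _ _ this True] c obtain c' where
        c': "c' \<in> hom_part (n - (k + 1))" "P (n + k + 1) c = (L ^^ Suc k) c'" by auto
      have "n - (k + 1) + 1 = m" "n - (k + 1) = m - 1" using True m by auto
      then show ?thesis using hom_d[OF c'(1)] c' by (intro bexI[of _ c']) (simp_all only: simp_thms)
    next
      case False
      then have "P (n + k + 1) c = 0" using c by (intro P_high) auto
      then show ?thesis using subspace_0[OF subspace_hom_part] by (intro bexI[of _ 0]) auto
    qed
    then obtain c' where c': "c' \<in> hom_part (m - 1)" "P (n + k + 1) c = (L ^^ Suc k) c'" "d c' \<in> hom_part m" by auto
    have c'V: "c' \<in> V" using c' by (auto simp: hom_part_def)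
    let ?y = "?x - d c'"
    have dpow: "d ((L ^^ i) c') = (L ^^ i) (d c')" for i
      by (induction i) (use c'V in \<open>auto simp flip: L_d\<close>)
    have y: "?y \<in> hom_part m" using x c' subspace_diff[OF subspace_hom_part] by blast
    have "(L ^^ Suc k) ?y = 0"
    proof -
      have "(L ^^ Suc k) (d c') = d c" by (simp only: dc c'(2) dpow)
      then show ?thesis
        using Lx bV a(3) c'V by (subst lin_op_diff[OF lin_op_pow[OF L] V]) (simp_all del: funpow.simps)
    qed
    \<comment> \<open>A closed element killed by Lam is killed by D = [Lam, d], so primitivity gives
      harmonicity.\<close>
    then have "Lam ?y = 0"
      using primitive_if_L_pow_vanish[OF y less.prems(1)] by (simp only: k_def)
    moreover have "d ?y = 0"
      using bV a c'V less.prems(3) by (simp add: lin_op_diff[OF d V] d_d flip: L_d)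
    ultimately have yh: "?y \<in> harmonic" using y hom_partD by (auto simp: harmonic_def D_def)
    have "b - (?y + L h') = d c' + L (a - h')"
      using a(3) h' harmonicD by (simp add: lin_op_diff[OF L V])
    then show ?case
      using yh h' harmonic_L exactI[OF c'V] exact_L subspace_add[OF subspace_harmonic] subspace_add[OF subspace_exact]
      by metis
  qed
  show ?thesis
  proof (cases "j \<le> n")
    case False
    define k where "k = j - n"
    show ?thesis
    proof (cases "k \<le> n")
      case True
      then obtain a c where a: "a \<in> hom_part (n - k)" "d a = 0" "c \<in> V" "b = (L ^^ k) a + d c"
        using lefschetz_surj[of k b] assms False by (auto simp: k_def)
      \<comment> \<open>Above the middle degree the representative is transported by
        \<open>L ^^ k\<close>, which preserves harmonic and exact elements.\<close>
      obtain h where h: "h \<in> harmonic" "a - h \<in> exact" using low[of "n - k" a] a by auto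
      have "b - (L ^^ k) h = (L ^^ k) (a - h) + d c"
        using a h harmonicD hom_partD by (simp add: lin_op_diff[OF lin_op_pow[OF L] V])
      then show ?thesis
        using h harmonic_pow exact_pow exactI[OF a(3)] subspace_add[OF subspace_exact] by metis
    next
      case False
      then have "b = 0" using hom_high[OF assms(1)] by (simp add: k_def)
      then show ?thesis using subspace_0[OF subspace_harmonic] subspace_0[OF subspace_exact] by force
    qed
  qed (use low assms in blast)
qed

text \<open>Harmonicity and exactness are compatible with the grading, so both summands can be cut
  down to one degree. The vanishing of the other components of e keeps the horizontal differential
  of e in lower degree in \<open>exact_case\<close>.\<close>

lemma harmonic_representative:
  assumes b: "b \<in> hom_part j" "d b = 0"
  shows "\<exists>h\<in>harmonic \<inter> hom_part j. \<exists>e\<in>V. b = h + d e \<and> (\<forall>k. k + 1 \<noteq> j \<longrightarrow> P k e = 0)"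
proof -
  obtain h e where h: "h \<in> harmonic" "e \<in> V" "b - h = d e"
    using harmonic_representative_hom[OF assms] by (auto simp: exact_def)
  have bV: "b \<in> V" "P j b = b" using b by (auto simp: hom_part_def)
  have hV: "h \<in> V" using h harmonicD by auto
  define e' where "e' = (if j = 0 then 0 else P (j - 1) e)"
  have "b - P j h = P j (b - h)" using bV hV by (simp add: lin_op_diff[OF P V])
  also have "\<dots> = d e'" using h P_d[of e j] by (simp add: e'_def)
  finally have "b = P j h + d e'" by (simp add: algebra_simps)
  moreover have "P j h \<in> harmonic \<inter> hom_part j" using h hV harmonic_P by auto
  moreover have "e' \<in> V" "\<forall>k. k + 1 \<noteq> j \<longrightarrow> P k e' = 0" using h by (auto simp: e'_def P_P)
  ultimately show ?thesis by blast
qed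

text \<open>The kernel of the map from harmonic elements to cohomology is stable under \<open>Lam\<close>, because the
  operators \<open>Lam\<close> of both sides are determined by those of \<open>L\<close>.\<close>

lemma Lam_harmonic_exact_hom:
  assumes "x \<in> hom_part m" "x \<in> harmonic" "x \<in> exact"
  shows "Lam x \<in> exact"
  using assms
proof (induction m arbitrary: x rule: less_induct)
  case (less m)
  \<comment> \<open>In degree n + j the element is \<open>(L ^^ j) y\<close> with y harmonic of
    degree n - j < m and, by injectivity, exact. The induction hypothesis for y and
    \<open>Lam_pow_L\<close> then yield the claim.\<close>
  have upper: "Lam x \<in> exact" if x: "x \<in> hom_part (n + j)" "x \<in> harmonic" "x \<in> exact" and j: "1 \<le> j" "n - j < m" for x j
  proof (cases "j \<le> n")
    case True
    obtain y where y: "y \<in> harmonic" "y \<in> hom_part (n - j)" "x = (L ^^ j) y"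
      using L_pow_onto[OF subspace_harmonic _ _ _ x(2,1) True] harmonicD(1) harmonic_L harmonic_Lam by auto
    have ye: "y \<in> exact" using lefschetz_inj_exact[OF True y(2)] y x harmonicD by auto
    obtain i where i: "j = Suc i" using j by (cases j) auto
    have "Lam y \<in> exact" using less.IH[OF j(2) y(2,1) ye] .
    then have "(L ^^ j) (Lam y) \<in> exact" "(L ^^ i) y \<in> exact" using exact_pow ye by auto
    then show ?thesis
      unfolding y(3) using Lam_pow_L[OF y(2), of i] subspace_add[OF subspace_exact] subspace_scale[OF subspace_exact]
      by (simp only: i)
  next
    case False
    then have "x = 0" using hom_high[OF x(1)] by auto
    then show ?thesis using subspace_0[OF subspace_exact] by simp
  qed
  show ?case
  proof (cases "m < 2")
    case True
    then show ?thesis using Lam_low[OF less.prems(1)] subspace_0[OF subspace_exact] by simp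
  next
    case False
    show ?thesis
    proof (cases "m \<le> n + 2")
      case True
      \<comment> \<open>Chosen so that \<open>Lam x\<close> has degree n - k, where injectivity of
        \<open>L ^^ k\<close> on cohomology decides exactness. The commutator of Lam and
        \<open>L ^^ k\<close> on x is a multiple of a lower power of L applied to x, hence exact,
        and \<open>(L ^^ k) x\<close> is in the range of \<open>upper\<close>.\<close>
      define k where "k = n + 2 - m"
      have k: "k \<le> n" "m = n - k + 2" using True False by (auto simp: k_def)
      have Lx: "(L ^^ k) x \<in> hom_part (n + (k + 2))" "(L ^^ k) x \<in> harmonic" "(L ^^ k) x \<in> exact"
        using hom_pow_L[OF less.prems(1), of k] less.prems harmonic_pow exact_pow k by (auto simp: algebra_simps)
      have "Lam ((L ^^ k) x) \<in> exact"
      proof (rule upper[OF Lx])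
        show "n - (k + 2) < m" using k False by auto
      qed auto
      moreover have "Lam ((L ^^ k) x) - (L ^^ k) (Lam x) \<in> exact"
      proof (cases k)
        case 0
        then show ?thesis using subspace_0[OF subspace_exact] by simp
      next
        case (Suc i)
        then show ?thesis
          using Lam_pow_L[OF less.prems(1), of i] subspace_scale[OF subspace_exact exact_pow[OF less.prems(3)]]
          by (simp del: funpow.simps)
      qed
      ultimately have "(L ^^ k) (Lam x) \<in> exact" using subspace_diff[OF subspace_exact] by fastforce
      moreover have "Lam x \<in> hom_part (n - k)" using hom_Lam less.prems(1) k by simp
      ultimately show ?thesis
        using lefschetz_inj_exact[OF k(1)] harmonicD(2)[OF harmonic_Lam[OF less.prems(2)]] by blast
    next
      case False
      then show ?thesis using upper[of x "m - n"] less.prems by auto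
    qed
  qed
qed

lemma Lam_harmonic_exact:
  assumes "x \<in> harmonic" "x \<in> exact" shows "Lam x \<in> exact"
  using sum_hom_parts[OF Lam subspace_exact, of x] Lam_harmonic_exact_hom harmonic_P[OF assms(1)] exact_P[OF assms(2)]
    harmonicD(1)[OF assms(1)] by blast

text \<open>Here d x is exact and harmonic because d D = - D d; hence Lam (d x) is exact, and D x
  differs from it by d (Lam x).\<close>

lemma coexact_closed_imp_exact:
  assumes "x \<in> V" "d (D x) = 0" shows "D x \<in> exact"
proof -
  have "d x \<in> harmonic" using assms by (simp add: harmonic_def d_d d_D)
  then have "Lam (d x) - d (Lam x) \<in> exact"
    using Lam_harmonic_exact[of "d x"] assms exactI subspace_diff[OF subspace_exact] by auto
  then show ?thesis by (simp add: D_def)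
qed

text \<open>The dual statement, obtained by conjugation with \<open>W\<close>.\<close>

lemma exact_coclosed_imp_coexact:
  assumes x: "x \<in> hom_part k" "D (d x) = 0"
  shows "\<exists>e\<in>hom_part (k + 2). d x = D e"
proof -
  note WV [simp] = lin_op_mem[OF W]
  have xV: "x \<in> V" using x by (auto simp: hom_part_def)
  \<comment> \<open>As \<open>W\<close> exchanges d and D up to sign, the hypothesis says that D (-
    W x) = W (d x) is closed. \<open>coexact_closed_imp_exact\<close> writes it as d e, and a second
    application of \<open>W\<close> turns d e into - D (W e).\<close>
  have "d (D (- W x)) = d (W (d x))" using xV by (simp add: W_d lin_op_minus[OF D])
  also have "\<dots> = 0" using xV x(2) by (simp add: lin_op_zero[OF W V] flip: W_D)
  finally obtain e where e: "e \<in> V" "D (- W x) = d e"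
    using coexact_closed_imp_exact[of "- W x"] xV by (auto simp: exact_def)
  have "W (d x) = d e" using xV e by (simp add: W_d lin_op_minus[OF D])
  then have "W (W (d x)) = - D (W e)" using e by (simp add: W_d)
  then have "(- 1) ^ (n + (k + 1)) *\<^sub>R d x = - D (W e)" using W_W[OF hom_d[OF x(1)]] by simp
  then have "(- 1) ^ (n + (k + 1)) *\<^sub>R ((- 1) ^ (n + (k + 1)) *\<^sub>R d x) = D (- ((- 1) ^ (n + (k + 1)) *\<^sub>R W e))"
    using e by (simp add: lin_op_minus[OF D] lin_op_scale[OF D])
  then have "d x = D (- ((- 1) ^ (n + (k + 1)) *\<^sub>R W e))" by (simp flip: power_add mult_2)
  moreover define e' where "e' = - ((- 1) ^ (n + (k + 1)) *\<^sub>R W e)"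
  ultimately have e': "d x = D e'" "e' \<in> V" using e by auto
  have "d x = P (k + 1) (d x)" using hom_d[OF x(1)] by (simp add: hom_part_def)
  also have "\<dots> = D (P (k + 2) e')" using P_D[OF e'(2), of "k + 1"] e' by simp
  finally show ?thesis using e' by auto
qed

text \<open>Downward induction on the degree. A coclosed d x equals D e with e two degrees higher,
  and D e is closed, so the induction hypothesis applies to it. For a closed D x, the second claim
  for x itself allows x to be replaced by a closed element; writing that as harmonic plus d e
  reduces D x to D (d e) = d (D (- e)).\<close>

lemma dD_lemma:
  assumes "x \<in> hom_part m"
  shows "d (D x) = 0 \<Longrightarrow> \<exists>b\<in>V. D x = d (D b)"
    and "D (d x) = 0 \<Longrightarrow> \<exists>b\<in>V. d x = d (D b)"
proof -
  have "(d (D x) = 0 \<longrightarrow> (\<exists>b\<in>V. D x = d (D b))) \<and> (D (d x) = 0 \<longrightarrow> (\<exists>b\<in>V. d x = d (D b)))"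
    using assms
  proof (induction "2 * n - m" arbitrary: m x rule: less_induct)
    case less
    have xV: "x \<in> V" using less.prems by (auto simp: hom_part_def)
    show ?case
    proof (cases "m > 2 * n")
      case True
      then have "x = 0" using hom_high less.prems by auto
      then show ?thesis using lin_op_zero[OF D V] by (auto intro!: bexI[of _ 0])
    next
      case False
      have E: "\<exists>b\<in>V. d x = d (D b)" if "D (d x) = 0"
      proof -
        obtain e where e: "e \<in> hom_part (m + 2)" "d x = D e"
          using exact_coclosed_imp_coexact[OF less.prems \<open>D (d x) = 0\<close>] by auto
        have "d (D e) = 0" using e xV by (simp add: d_d flip: e(2))
        show ?thesis
        proof (cases "m = 2 * n")
          case True
          then have "e = 0" using hom_high e by auto
          then show ?thesis using e lin_op_zero[OF D V] by (auto intro!: bexI[of _ 0])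
        next
          case neq: False
          then show ?thesis
            using less.hyps[of "m + 2" e] e False \<open>d (D e) = 0\<close> by auto
        qed
      qed
      moreover have "\<exists>b\<in>V. D x = d (D b)" if "d (D x) = 0"
      proof -
        have "D (d x) = 0" using that d_D[OF xV] by simp
        then obtain b where b: "b \<in> V" "d x = d (D b)" using E by auto
        have "d x = P (m + 1) (d x)" using hom_d[OF less.prems] by (simp add: hom_part_def)
        also have "\<dots> = d (D (P (m + 1) b))" using b P_d[of "D b" "m + 1"] P_D[of b m] by simp
        finally have b': "d x = d (D (P (m + 1) b))" .
        define y where "y = x - D (P (m + 1) b)"
        have y: "y \<in> hom_part m" unfolding y_def
          using less.prems hom_D[OF P_hom[OF b(1)]] subspace_diff[OF subspace_hom_part] by blast
        have yV: "y \<in> V" using y by (auto simp: hom_part_def)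
        have "d y = 0" using b' xV b by (simp add: y_def lin_op_diff[OF d V])
        then obtain h e where he: "h \<in> harmonic" "e \<in> V" "y = h + d e" using harmonic_representative[OF y] by blast
        have "D x = D y" unfolding y_def using xV b by (simp add: lin_op_diff[OF D V] D_D)
        also have "\<dots> = D (d e)" using he harmonicD by (simp add: lin_op_add[OF D])
        also have "\<dots> = d (D (- e))" using he by (simp add: d_D lin_op_minus[OF D] lin_op_minus[OF d])
        finally show ?thesis using he(2) by (intro bexI[of _ "- e"]) auto
      qed
      ultimately show ?thesis by blast
    qed
  qed
  then show "d (D x) = 0 \<Longrightarrow> \<exists>b\<in>V. D x = d (D b)" "D (d x) = 0 \<Longrightarrow> \<exists>b\<in>V. d x = d (D b)" by blast+
qed

end

section \<open>The passage from d to d_G by induction on the form degree\<close>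

locale equivariant_lefschetz_hodge = lefschetz_hodge +
  fixes h Phi and c :: real
  assumes h: "lin_op V h" and Phi: "lin_op V Phi"
    and P_h: "x \<in> V \<Longrightarrow> P k (h x) = h (P (k + 1) x)"
    and d_h: "x \<in> V \<Longrightarrow> d (h x) = - h (d x)"
    and h_h: "x \<in> V \<Longrightarrow> h (h x) = 0"
    and Lam_h: "x \<in> V \<Longrightarrow> Lam (h x) = h (Lam x)"
    and h_Phi: "x \<in> V \<Longrightarrow> h x = c *\<^sub>R (D (Phi x) - Phi (D x))"
begin

definition dG where "dG x = d x + h x"

lemmas h_mem [simp] = lin_op_mem[OF h] lin_op_mem[OF Phi]

lemma dG: "lin_op V dG"
  unfolding lin_op_def dG_def
  by (auto simp: lin_op_add[OF d] lin_op_add[OF h] lin_op_scale[OF d] lin_op_scale[OF h] scaleR_add_right)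

lemmas dG_mem [simp] = lin_op_mem[OF dG]

lemma dG_dG: "x \<in> V \<Longrightarrow> dG (dG x) = 0"
  by (simp add: dG_def lin_op_add[OF d] lin_op_add[OF h] d_d h_h d_h)

lemma D_h: "x \<in> V \<Longrightarrow> D (h x) = - h (D x)"
  using d_h[of "Lam x"] by (simp add: D_def d_h lin_op_minus[OF Lam] Lam_h lin_op_diff[OF h V])

lemma dG_D: "x \<in> V \<Longrightarrow> dG (D x) = - D (dG x)"
  by (simp add: dG_def lin_op_add[OF D] d_D D_h)

text \<open>A filtration by form degree only: on the Cartan complex \<open>P k\<close> ignores the
  polynomial degree, so d raises the index by one and h lowers it by one.\<close>

definition below where "below m = {x \<in> V. \<forall>k\<ge>m. P k x = 0}"

lemma subspace_below: "subspace (below m)"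
  using P by (auto simp: below_def subspace_def lin_op_def)

lemma belowD: "x \<in> below m \<Longrightarrow> x \<in> V" "x \<in> below m \<Longrightarrow> k \<ge> m \<Longrightarrow> P k x = 0"
  by (auto simp: below_def)

lemma hom_below: "x \<in> hom_part k \<Longrightarrow> k < m \<Longrightarrow> x \<in> below m"
proof -
  assume x: "x \<in> hom_part k" and "k < m"
  have "P j x = 0" if "j \<ge> m" for j
    using P_P[OF hom_partD(1)[OF x], of j k] hom_partD(2)[OF x] that \<open>k < m\<close> by simp
  then show "x \<in> below m" using hom_partD(1)[OF x] by (simp add: below_def)
qed

lemma below_mono: "x \<in> below m \<Longrightarrow> m \<le> k \<Longrightarrow> x \<in> below k"
  by (auto simp: below_def)

lemma below_D: "x \<in> below (m + 1) \<Longrightarrow> D x \<in> below m"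
  by (auto simp: below_def P_D lin_op_zero[OF D V])

lemma below_top: "x \<in> V \<Longrightarrow> x \<in> below (2 * n + 1)"
  by (auto simp: below_def P_high)

lemma below_split:
  assumes "x \<in> below (m + 1)" shows "x - P m x \<in> below m"
  using assms by (auto simp: below_def lin_op_diff[OF P V] P_P)

lemma below_P_dG: "x \<in> below (m + 1) \<Longrightarrow> P (m + 1) (dG x) = d (P m x)"
  by (simp add: below_def dG_def lin_op_add[OF P] P_d P_h lin_op_zero[OF h V])

text \<open>The component of degree m is coexact and, by \<open>below_P_dG\<close>, closed, so
  \<open>dD_lemma\<close> writes it as d (D b). Subtracting d_G D b, which is coexact as d_G and D
  anticommute, leaves an element in lower degrees. The bound on the degree of the result is used in
  \<open>exact_case\<close>.\<close>

lemma coexact_case: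
  assumes "x \<in> below m" "dG x = 0" "y \<in> V" "x = D y"
  shows "\<exists>b\<in>below m. x = dG (D b)"
  using assms
proof (induction m arbitrary: x y)
  case 0
  then have "x = 0" using zero_if_P[of x] by (auto simp: below_def)
  then show ?case
    using subspace_0[OF subspace_below] lin_op_zero[OF D V] lin_op_zero[OF dG V] by (intro bexI[of _ 0]) auto
next
  case (Suc m)
  have xV: "x \<in> V" using Suc.prems belowD by auto
  have x: "x \<in> below (m + 1)" using Suc.prems by simp
  have Px: "P m x = D (P (m + 1) y)" using Suc.prems P_D by simp
  have "d (P m x) = 0" using below_P_dG[OF x] Suc.prems by simp
  then obtain b where b: "b \<in> V" "P m x = d (D b)"
    using dD_lemma(1)[OF P_hom, of y "m + 1"] Px Suc.prems(3) by auto
  have "P m x = P m (d (D b))" using b xV P_P[OF xV, of m m] by simp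
  also have "\<dots> = d (D (P m b))" using b P_d[of "D b" m] P_D[of b "m - 1"] D_low[OF P_hom[OF b(1)]] by (cases m) auto
  finally have b': "P m x = d (D (P m b))" .
  let ?b = "P m b"
  have bb: "?b \<in> below (m + 1)" "?b \<in> V" using hom_below[OF P_hom[OF b(1)]] b by auto
  define x' where "x' = x - dG (D ?b)"
  have "x' = (x - P m x) - h (D ?b)" unfolding x'_def dG_def b' by simp
  moreover have "h (D ?b) \<in> below m"
    using bb by (auto simp: below_def P_h P_D lin_op_zero[OF D V] lin_op_zero[OF h V])
  ultimately have x'm: "x' \<in> below m" using below_split[OF x] subspace_diff[OF subspace_below] by simp
  have "dG x' = 0" unfolding x'_def using xV bb Suc.prems(2) by (simp add: lin_op_diff[OF dG V] dG_dG)
  moreover have "x' = D (y + dG ?b)"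
    unfolding x'_def using Suc.prems bb by (simp add: dG_D lin_op_add[OF D])
  ultimately obtain b'' where b'': "b'' \<in> below m" "x' = dG (D b'')"
    using Suc.IH[OF x'm, of "y + dG ?b"] Suc.prems bb by auto
  have "x = dG (D (?b + b''))"
    using b'' bb belowD(1)[OF b''(1)] unfolding x'_def by (simp add: lin_op_add[OF D] lin_op_add[OF dG] algebra_simps)
  moreover have "?b + b'' \<in> below (Suc m)"
    using bb b'' below_mono[of b'' m "Suc m"] subspace_add[OF subspace_below] by auto
  ultimately show ?case by blast
qed

text \<open>Only the leading component of y enters D (d_G y) in degree m, so up to D b it can be
  replaced by a closed element a + d e with a harmonic. Removing d_G e does not change d_G y;
  removing a changes it by d_G a = h a, which is coexact and hence equal to d_G D b' by
  \<open>coexact_case\<close>. What remains of y lies in lower degrees.\<close>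

lemma exact_case:
  assumes "y \<in> below m" "D (dG y) = 0"
  shows "\<exists>b\<in>V. dG y = dG (D b)"
  using assms
proof (induction m arbitrary: y)
  case 0
  then have "y = 0" using zero_if_P[of y] by (auto simp: below_def)
  then show ?case using lin_op_zero[OF D V] lin_op_zero[OF dG V] by (intro bexI[of _ 0]) auto
next
  case (Suc m)
  have y: "y \<in> below (m + 1)" and yV: "y \<in> V" using Suc.prems belowD by auto
  have "D (d (P m y)) = P m (D (dG y))" using P_D[OF dG_mem[OF yV], of m] by (simp only: below_P_dG[OF y])
  then have "D (d (P m y)) = 0" using Suc.prems by simp
  then obtain b where b: "b \<in> V" "d (P m y) = d (D b)" using dD_lemma(2)[OF P_hom[OF yV]] by blast
  have "d (P m y) = P (m + 1) (d (P m y))" using hom_d[OF P_hom[OF yV]] by (auto simp: hom_part_def)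
  also have "\<dots> = d (D (P (m + 1) b))" unfolding b(2) using b(1) P_d[of "D b" "m + 1"] P_D[of b m] by simp
  finally have b': "d (P m y) = d (D (P (m + 1) b))" .
  let ?b = "P (m + 1) b"
  have bV: "?b \<in> V" using b by simp
  let ?z = "P m y - D ?b"
  have z: "?z \<in> hom_part m" using P_hom[OF yV] hom_D[OF P_hom[OF b(1)]] subspace_diff[OF subspace_hom_part] by blast
  have "d ?z = 0" using b' yV bV by (simp add: lin_op_diff[OF d V])
  then obtain a e where a: "a \<in> harmonic" "a \<in> hom_part m" and e: "e \<in> V" "\<And>k. k + 1 \<noteq> m \<Longrightarrow> P k e = 0"
    and z_eq: "?z = a + d e" using harmonic_representative[OF z] by blast
  have aV: "a \<in> V" using a harmonicD by auto
  \<comment> \<open>For harmonic a the second term of \<open>h_Phi\<close> vanishes, so h a is D of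
    c Phi a.\<close>
  have dGa: "dG a = D (c *\<^sub>R Phi a)"
    using h_Phi[OF aV] harmonicD(2,3)[OF a(1)] aV by (simp add: dG_def lin_op_scale[OF D] lin_op_zero[OF Phi V])
  have "dG a \<in> below m"
  proof -
    have "P k (h a) = 0" if "k \<ge> m" for k
      using P_h[OF aV, of k] P_P[OF aV, of "k + 1" m] a(2) that lin_op_zero[OF h V] hom_partD by fastforce
    then show ?thesis using aV harmonicD(2)[OF a(1)] by (simp add: below_def dG_def)
  qed
  then obtain b' where b': "b' \<in> below m" "dG a = dG (D b')"
    using coexact_case[OF _ dG_dG[OF aV] _ dGa] aV by auto
  have b'V: "b' \<in> V" using b'(1) by (rule belowD(1))
  define y' where "y' = y - D ?b - dG e - (a - D b')"
  have "y' = (y - P m y) - h e + D b'" unfolding y'_def dG_def using z_eq by (simp add: algebra_simps)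
  moreover have "h e \<in> below m" using e by (auto simp: below_def P_h lin_op_zero[OF h V])
  moreover have "D b' \<in> below m" using below_D below_mono[OF b'(1), of "m + 1"] by simp
  ultimately have y'm: "y' \<in> below m"
    using below_split[OF y] subspace_add[OF subspace_below] subspace_diff[OF subspace_below] by metis
  have dGy': "dG y' = dG y - dG (D ?b)"
    unfolding y'_def using yV bV e aV b'V b'(2) by (simp add: lin_op_diff[OF dG V] dG_dG)
  have "D (dG y') = 0" unfolding dGy' using yV bV Suc.prems(2) dG_D[of "D ?b"]
    by (simp add: lin_op_diff[OF D V] D_D lin_op_zero[OF dG V])
  then obtain b'' where "b'' \<in> V" "dG y' = dG (D b'')" using Suc.IH[OF y'm] by auto
  then have "dG y = dG (D (?b + b''))" "?b + b'' \<in> V"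
    using bV dGy' by (auto simp: lin_op_add[OF D] lin_op_add[OF dG] algebra_simps)
  then show ?case by blast
qed

theorem dG_D_lemma:
  assumes "x \<in> V" "dG x = 0" "D x = 0" "y \<in> V" "x = dG y \<or> x = D y"
  shows "\<exists>b\<in>V. x = dG (D b)"
proof (cases "x = D y")
  case True
  then show ?thesis using coexact_case[OF below_top[OF assms(1)] assms(2,4)] belowD(1) by blast
next
  case False
  then show ?thesis using exact_case[OF below_top[OF assms(4)]] assms(3,5) by auto
qed

end

section \<open>Exterior algebra\<close>

definition contr :: "'e \<Rightarrow> 'e ext \<Rightarrow> 'e ext" where
  "contr v a = (\<lambda>vs. a (v # vs))"

text \<open>Carrying signs by the parity automorphism lets the product rules hold for inhomogeneous
  elements, which is how forms are represented.\<close>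

definition grade_inv :: "'e ext \<Rightarrow> 'e ext" where
  "grade_inv a = (\<lambda>vs. (- 1) ^ length vs * a vs)"

lemma wedge_Nil [simp]: "wedge a b [] = a [] * b []"
  by (simp add: wedge_def)

definition inversions :: "nat \<Rightarrow> nat set \<Rightarrow> (nat \<times> nat) set" where
  "inversions N I = {(i, j). i \<in> I \<and> j \<in> {..<N} - I \<and> j < i}"

text \<open>Putting position 0 into the index set creates no inversion, while leaving it in the
  complement creates one with every element of J.\<close>

lemma inversions_Suc:
  assumes "J \<subseteq> {..<N}"
  shows "card (inversions (Suc N) (insert 0 (Suc ` J))) = card (inversions N J)"
    and "card (inversions (Suc N) (Suc ` J)) = card (inversions N J) + card J"
proof -
  let ?s = "\<lambda>(i, j). (Suc i, Suc j)"
  have inj: "inj_on ?s X" for X by (auto simp: inj_on_def)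
  have fin: "finite (inversions N J)"
    by (rule finite_subset[of _ "{..<N} \<times> {..<N}"]) (use assms in \<open>auto simp: inversions_def\<close>)
  have "inversions (Suc N) (insert 0 (Suc ` J)) = ?s ` inversions N J"
    by (auto simp: inversions_def image_iff less_Suc_eq_0_disj gr0_conv_Suc)
  then show "card (inversions (Suc N) (insert 0 (Suc ` J))) = card (inversions N J)"
    by (simp add: card_image[OF inj])
  have "inversions (Suc N) (Suc ` J) = ?s ` inversions N J \<union> (\<lambda>i. (Suc i, 0)) ` J"
    by (auto simp: inversions_def image_iff less_Suc_eq_0_disj gr0_conv_Suc)
  also have "card \<dots> = card (?s ` inversions N J) + card ((\<lambda>i. (Suc i, 0 :: nat)) ` J)"
    by (rule card_Un_disjoint) (use fin assms finite_subset[OF assms] in auto)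
  finally show "card (inversions (Suc N) (Suc ` J)) = card (inversions N J) + card J"
    by (simp add: card_image[OF inj] card_image inj_on_def)
qed

lemma Pow_lessThan_Suc:
  "Pow {..<Suc N} = (\<lambda>J. insert 0 (Suc ` J)) ` Pow {..<N} \<union> (\<lambda>J. Suc ` J) ` Pow {..<N}"
proof -
  have "I \<in> (\<lambda>J. insert 0 (Suc ` J)) ` Pow {..<N} \<union> (\<lambda>J. Suc ` J) ` Pow {..<N}" if "I \<subseteq> {..<Suc N}" for I
  proof -
    have J: "{j. Suc j \<in> I} \<in> Pow {..<N}" using that by auto
    have "I = (if 0 \<in> I then insert 0 (Suc ` {j. Suc j \<in> I}) else Suc ` {j. Suc j \<in> I})"
      by (auto simp: image_iff) (metis not0_implies_Suc)+
    then show ?thesis using J by (metis (no_types, lifting) UnI1 UnI2 image_eqI)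
  qed
  then show ?thesis by (auto simp: less_Suc_eq_0_disj)
qed

text \<open>Together with \<open>wedge_Nil\<close> this characterizes the wedge product; almost all identities
  below follow from it by induction on the list of arguments.\<close>

lemma wedge_Cons: "wedge a b (v # vs) = wedge (contr v a) b vs + wedge (grade_inv a) (contr v b) vs"
proof -
  define N where "N = length vs"
  define T where "T = (\<lambda>I. (- 1) ^ card (inversions (Suc N) I) * a (nths (v # vs) I) * b (nths (v # vs) (- I)))"
  have "wedge a b (v # vs) = (\<Sum>I\<in>Pow {..<Suc N}. T I)"
    by (simp add: wedge_def T_def N_def inversions_def)
  also have "\<dots> = (\<Sum>I\<in>(\<lambda>J. insert 0 (Suc ` J)) ` Pow {..<N}. T I) + (\<Sum>I\<in>(\<lambda>J. Suc ` J) ` Pow {..<N}. T I)"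
    unfolding Pow_lessThan_Suc by (rule sum.union_disjoint) auto
  also have "(\<Sum>I\<in>(\<lambda>J. insert 0 (Suc ` J)) ` Pow {..<N}. T I) = (\<Sum>J\<in>Pow {..<N}. T (insert 0 (Suc ` J)))"
    by (rule sum.reindex_cong[OF _ refl refl]) (auto simp: inj_on_def dest: injD[OF inj_Suc])
  also have "\<dots> = wedge (contr v a) b vs"
    unfolding wedge_def
  proof (rule sum.cong)
    fix J assume "J \<in> Pow {..<length vs}"
    moreover have "{j. Suc j \<in> insert 0 (Suc ` J)} = J" "{j. Suc j \<in> - insert 0 (Suc ` J)} = - J" by auto
    ultimately show "T (insert 0 (Suc ` J)) = (- 1) ^ card {(i, j). i \<in> J \<and> j \<in> {..<length vs} - J \<and> j < i} *
        contr v a (nths vs J) * b (nths vs (- J))"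
      using inversions_Suc(1)[of J N] by (simp add: T_def nths_Cons contr_def N_def inversions_def)
  qed (simp add: N_def)
  also have "(\<Sum>I\<in>(\<lambda>J. Suc ` J) ` Pow {..<N}. T I) = (\<Sum>J\<in>Pow {..<N}. T (Suc ` J))"
    by (rule sum.reindex_cong[OF _ refl refl]) (auto simp: inj_on_def dest: injD[OF inj_Suc])
  also have "\<dots> = wedge (grade_inv a) (contr v b) vs"
    unfolding wedge_def
  proof (rule sum.cong)
    fix J assume J: "J \<in> Pow {..<length vs}"
    moreover have "{j. Suc j \<in> Suc ` J} = J" "{j. Suc j \<in> - Suc ` J} = - J" by auto
    moreover have "length (nths vs J) = card J" using J by (auto simp: length_nths intro!: arg_cong[of _ _ card])
    ultimately show "T (Suc ` J) = (- 1) ^ card {(i, j). i \<in> J \<and> j \<in> {..<length vs} - J \<and> j < i} *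
        grade_inv a (nths vs J) * contr v b (nths vs (- J))"
      using inversions_Suc(2)[of J N]
      by (simp add: T_def nths_Cons contr_def N_def inversions_def grade_inv_def power_add)
  qed (simp add: N_def)
  finally show ?thesis .
qed

lemma contr_wedge: "contr v (wedge a b) = wedge (contr v a) b + wedge (grade_inv a) (contr v b)"
  by (rule ext) (simp add: contr_def[of _ "wedge a b"] wedge_Cons)

lemma contr_lin [simp]:
  "contr v (a + b) = contr v a + contr v b" "contr v (c *\<^sub>R a) = c *\<^sub>R contr v a" "contr v (- a) = - contr v a"
  "contr v (a - b) = contr v a - contr v b" "contr v 0 = 0"
  by (auto simp: contr_def fun_eq_iff)

lemma contr_sum [simp]: "contr v (\<Sum>i\<in>I. f i) = (\<Sum>i\<in>I. contr v (f i))"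
  by (auto simp: contr_def fun_eq_iff)

lemma grade_inv_lin [simp]:
  "grade_inv (a + b) = grade_inv a + grade_inv b" "grade_inv (c *\<^sub>R a) = c *\<^sub>R grade_inv a"
  "grade_inv (- a) = - grade_inv a" "grade_inv (a - b) = grade_inv a - grade_inv b" "grade_inv 0 = 0"
  "grade_inv (grade_inv a) = a"
  by (auto simp: grade_inv_def fun_eq_iff algebra_simps simp flip: power_add mult_2)

lemma contr_grade_inv [simp]: "contr v (grade_inv a) = - grade_inv (contr v a)"
  by (auto simp: contr_def grade_inv_def)

lemma wedge_add_left: "wedge (a + b) c = wedge a c + wedge b c"
  and wedge_add_right: "wedge c (a + b) = wedge c a + wedge c b"
  and wedge_scale_left [simp]: "wedge (r *\<^sub>R a) c = r *\<^sub>R wedge a c"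
  and wedge_scale_right [simp]: "wedge c (r *\<^sub>R a) = r *\<^sub>R wedge c a"
  by (auto simp: wedge_def fun_eq_iff algebra_simps sum.distrib sum_distrib_left)

lemma wedge_minus_left [simp]: "wedge (- a) c = - wedge a c"
  and wedge_minus_right [simp]: "wedge c (- a) = - wedge c a"
  and wedge_zero_left [simp]: "wedge 0 c = 0" and wedge_zero_right [simp]: "wedge c 0 = 0"
  using wedge_scale_left[of "-1" a c] wedge_scale_right[of c "-1" a]
    wedge_scale_left[of 0 a c] wedge_scale_right[of c 0 a] by auto

lemma wedge_diff_left: "wedge (a - b) c = wedge a c - wedge b c"
  and wedge_diff_right: "wedge c (a - b) = wedge c a - wedge c b"
  using wedge_add_left[of a "- b" c] wedge_add_right[of c a "- b"] by auto

lemma wedge_sum_left: "wedge (\<Sum>i\<in>I. f i) c = (\<Sum>i\<in>I. wedge (f i) c)"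
  and wedge_sum_right: "wedge c (\<Sum>i\<in>I. f i) = (\<Sum>i\<in>I. wedge c (f i))"
  by (induction I rule: infinite_finite_induct) (auto simp: wedge_add_left wedge_add_right)

lemma ext_list_eqI:
  assumes "a [] = b []" "\<And>v vs. contr v a vs = contr v b vs" shows "a = (b :: 'e ext)"
proof
  fix vs show "a vs = b vs" using assms by (cases vs) (auto simp: contr_def)
qed

lemma grade_inv_wedge: "grade_inv (wedge a b) = wedge (grade_inv a) (grade_inv b)"
proof
  fix vs show "grade_inv (wedge a b) vs = wedge (grade_inv a) (grade_inv b) vs"
  proof (induction vs arbitrary: a b)
    case (Cons v vs)
    have "grade_inv (wedge a b) (v # vs) = contr v (grade_inv (wedge a b)) vs" by (simp add: contr_def)
    also have "\<dots> = - grade_inv (wedge (contr v a) b) vs - grade_inv (wedge (grade_inv a) (contr v b)) vs"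
      by (simp add: contr_wedge)
    finally show ?case by (simp add: Cons wedge_Cons)
  qed (simp add: grade_inv_def)
qed

lemma wedge_assoc: "wedge (wedge a b) c = wedge a (wedge b c)"
proof
  fix vs show "wedge (wedge a b) c vs = wedge a (wedge b c) vs"
  proof (induction vs arbitrary: a b c)
    case (Cons v vs)
    show ?case
      by (simp add: wedge_Cons contr_wedge wedge_add_left wedge_add_right grade_inv_wedge Cons)
  qed simp
qed

lemma wedge_one [simp]: "wedge ext_one a = a" "wedge a ext_one = a"
proof -
  have c: "contr v ext_one = 0" "grade_inv (ext_one :: 'e ext) = ext_one" for v :: 'e
    by (auto simp: contr_def ext_one_def grade_inv_def)
  have one: "ext_one [] = 1" by (simp add: ext_one_def)
  have "wedge ext_one a vs = a vs" for vs
  proof (induction vs arbitrary: a)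
    case (Cons v vs)
    then show ?case by (simp add: wedge_Cons c) (simp add: contr_def)
  qed (simp add: one)
  moreover have "wedge a ext_one vs = a vs" for vs
  proof (induction vs arbitrary: a)
    case (Cons v vs)
    then show ?case by (simp add: wedge_Cons c) (simp add: contr_def)
  qed (simp add: one)
  ultimately have "wedge ext_one a vs = a vs" "wedge a ext_one vs = a vs" for vs by auto
  then show "wedge ext_one a = a" "wedge a ext_one = a" by auto
qed

text \<open>Homogeneity is separated from alternation because the sign rules depend on the degree
  alone.\<close>

definition supp_deg :: "nat \<Rightarrow> 'e ext \<Rightarrow> bool" where
  "supp_deg k a \<longleftrightarrow> (\<forall>vs. length vs \<noteq> k \<longrightarrow> a vs = 0)"

lemma supp_deg_contr: "supp_deg (Suc k) a \<Longrightarrow> supp_deg k (contr v a)"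
  and supp_deg_contr0: "supp_deg 0 a \<Longrightarrow> contr v a = 0"
  by (auto simp: supp_deg_def contr_def)

lemma supp_deg_grade_inv: "supp_deg k a \<Longrightarrow> grade_inv a = (- 1) ^ k *\<^sub>R a"
  by (auto simp: supp_deg_def grade_inv_def fun_eq_iff)

lemma supp_deg_wedge: "supp_deg k a \<Longrightarrow> supp_deg l b \<Longrightarrow> supp_deg (k + l) (wedge a b)"
proof -
  have "wedge a b vs = 0" if "supp_deg k a" "supp_deg l b" "length vs \<noteq> k + l" for vs
    using that
  proof (induction vs arbitrary: a b k l)
    case Nil
    then show ?case by (auto simp: supp_deg_def)
  next
    case (Cons v vs)
    have "wedge (contr v a) b vs = 0"
    proof (cases k)
      case 0 then show ?thesis using Cons.prems supp_deg_contr0 by (metis wedge_zero_left zero_fun_apply)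
    next
      case (Suc i) then show ?thesis using Cons.IH[of i "contr v a" l b] Cons.prems by (simp add: supp_deg_contr)
    qed
    moreover have "wedge (grade_inv a) (contr v b) vs = 0"
    proof (cases l)
      case 0 then show ?thesis using Cons.prems supp_deg_contr0 by (metis wedge_zero_right zero_fun_apply)
    next
      case (Suc i) then show ?thesis using Cons.IH[of k a i "contr v b"] Cons.prems
        by (simp add: supp_deg_grade_inv supp_deg_contr)
    qed
    ultimately show ?case by (simp add: wedge_Cons)
  qed
  then show "supp_deg k a \<Longrightarrow> supp_deg l b \<Longrightarrow> supp_deg (k + l) (wedge a b)" by (simp add: supp_deg_def)
qed

text \<open>Iterating the parity automorphism k times encodes the sign (-1)^(k l) on each component
  of degree l of b, so that only a has to be homogeneous.\<close>

lemma wedge_commute: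
  "supp_deg k a \<Longrightarrow> wedge a b = wedge ((grade_inv ^^ k) b) a"
proof
  fix vs
  have iter: "contr v ((grade_inv ^^ k) b) = (- 1) ^ k *\<^sub>R (grade_inv ^^ k) (contr v b)" for v k and b :: "'a ext"
  proof -
    have "(grade_inv ^^ k) b vs = (- 1) ^ (k * length vs) * b vs" for vs and b :: "'a ext"
      by (induction k) (auto simp: grade_inv_def power_add)
    then show ?thesis by (simp add: contr_def fun_eq_iff power_add)
  qed
  show "supp_deg k a \<Longrightarrow> wedge a b vs = wedge ((grade_inv ^^ k) b) a vs"
  proof (induction vs arbitrary: a b k)
    case Nil
    have "(grade_inv ^^ k) b [] = b []" by (induction k) (auto simp: grade_inv_def)
    then show ?case by simp
  next
    case (Cons v vs)
    have 1: "wedge (grade_inv a) (contr v b) vs = (- 1) ^ k *\<^sub>R wedge ((grade_inv ^^ k) (contr v b)) a vs"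
      using Cons by (simp add: supp_deg_grade_inv)
    have 2: "wedge (contr v a) b vs = wedge (grade_inv ((grade_inv ^^ k) b)) (contr v a) vs"
    proof (cases k)
      case 0
      then show ?thesis using Cons.prems supp_deg_contr0[of a v] by simp
    next
      case (Suc i)
      then show ?thesis using Cons.IH[OF supp_deg_contr, of i a v b] Cons.prems by simp
    qed
    show ?case unfolding wedge_Cons[of a] wedge_Cons[of "(grade_inv ^^ k) b"] 1 2 iter by simp
  qed
qed

subsection \<open>Alternating forms\<close>

lemma alt_formD: "alt_form a \<Longrightarrow> linear (\<lambda>v. a (us @ v # ws))" "alt_form a \<Longrightarrow> \<not> distinct vs \<Longrightarrow> a vs = 0"
  by (auto simp: alt_form_def)

lemma alt_contr: "alt_form a \<Longrightarrow> alt_form (contr v a)"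
proof -
  assume a: "alt_form a"
  have "linear (\<lambda>u. a (v # us @ u # ws))" for us ws
    using alt_formD(1)[OF a, of "v # us" ws] by simp
  then show ?thesis using a by (auto simp: alt_form_def contr_def)
qed

lemma linear_contr: "alt_form a \<Longrightarrow> linear (\<lambda>v. contr v a)"
  using alt_formD(1)[of a "[]"] by (auto simp: linear_iff contr_def fun_eq_iff)

lemma alt_form_swap:
  assumes lin: "\<And>us ws. linear (\<lambda>v. a (us @ v # ws))" and adj: "\<And>us v ws. a (us @ v # v # ws) = (0 :: real)"
  shows "a (us @ u # v # ws) = - a (us @ v # u # ws)"
proof -
  have 1: "a (us @ (u + v) # x # ws) = a (us @ u # x # ws) + a (us @ v # x # ws)" for x
    using linear_add[OF lin[of us "x # ws"]] by simp
  have 2: "a (us @ x # (u + v) # ws) = a (us @ x # u # ws) + a (us @ x # v # ws)" for x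
    using linear_add[OF lin[of "us @ [x]" ws]] by simp
  show ?thesis using adj[of us "u + v" ws] adj[of us u ws] adj[of us v ws] by (simp add: 1 2)
qed

text \<open>Two equal arguments can be made adjacent by transpositions, each of which only changes
  the sign.\<close>

lemma alt_formI:
  assumes lin: "\<And>us ws. linear (\<lambda>v. a (us @ v # ws))" and adj: "\<And>us v ws. a (us @ v # v # ws) = (0 :: real)"
  shows "alt_form a"
proof -
  have *: "a (us @ v # ms @ v # ws) = 0" for us v ms ws
  proof (induction ms arbitrary: us)
    case (Cons m ms)
    have "a (us @ v # m # ms @ v # ws) = - a ((us @ [m]) @ v # ms @ v # ws)"
      using alt_form_swap[of a us v m "ms @ v # ws", OF lin adj] by simp
    then show ?case using Cons[of "us @ [m]"] by simp
  qed (use adj in simp)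
  then have "a vs = 0" if "\<not> distinct vs" for vs
    using not_distinct_decomp[OF that] by auto
  then show ?thesis using lin by (simp add: alt_form_def)
qed

lemma alt_zero: "alt_form 0"
  by (auto simp: alt_form_def linear_iff)

lemma subspace_alt: "subspace {a. alt_form a}"
  by (auto simp: subspace_def alt_zero) (auto simp: alt_form_def linear_iff algebra_simps)

lemma alt_add: "alt_form a \<Longrightarrow> alt_form b \<Longrightarrow> alt_form (a + b)"
  and alt_scale: "alt_form a \<Longrightarrow> alt_form (c *\<^sub>R a)"
  and alt_minus: "alt_form a \<Longrightarrow> alt_form (- a)"
  using subspace_add[OF subspace_alt] subspace_scale[OF subspace_alt] subspace_neg[OF subspace_alt] by auto

lemma alt_sum: "(\<And>i. i \<in> I \<Longrightarrow> alt_form (f i)) \<Longrightarrow> alt_form (\<Sum>i\<in>I. f i)"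
  using subspace_sum[OF subspace_alt, of I f] by auto

lemma alt_ext_part: "alt_form a \<Longrightarrow> alt_form (ext_part k a)"
proof -
  assume a: "alt_form a"
  have "linear (\<lambda>v. ext_part k a (us @ v # ws))" for us ws
    using alt_formD(1)[OF a, of us ws] by (cases "length (us @ ws) + 1 = k") (auto simp: ext_part_def linear_iff)
  then show ?thesis using a by (auto simp: alt_form_def ext_part_def)
qed

lemma alt_grade_inv: "alt_form a \<Longrightarrow> alt_form (grade_inv a)"
proof -
  assume a: "alt_form a"
  have "linear (\<lambda>v. grade_inv a (us @ v # ws))" for us ws
    using alt_formD(1)[OF a, of us ws] by (auto simp: grade_inv_def linear_iff algebra_simps)
  then show ?thesis using a by (auto simp: alt_form_def grade_inv_def)
qed

lemma contr_contr:
  assumes "alt_form a" shows "contr u (contr v a) = - contr v (contr u a)"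
proof -
  have adj: "a (us @ v # v # ws) = 0" for us v ws by (rule alt_formD(2)[OF assms]) auto
  show ?thesis
    using alt_form_swap[of a "[]" v u, OF alt_formD(1)[OF assms] adj] by (auto simp: contr_def fun_eq_iff)
qed

lemma contr_contr_same: "alt_form a \<Longrightarrow> contr v (contr v a) = 0"
  using contr_contr[of a v v] by (simp add: eq_neg_iff_add_eq_0 fun_eq_iff)

lemma alt_wedge:
  assumes "alt_form a" "alt_form b" shows "alt_form (wedge a b)"
proof (rule alt_formI)
  fix us ws :: "'a list"
  show "linear (\<lambda>v. wedge a b (us @ v # ws))" using assms
  proof (induction us arbitrary: a b)
    case Nil
    have "linear (\<lambda>v. contr v a)" "linear (\<lambda>v. contr v b)" using Nil linear_contr by auto
    then show ?case
      by (auto simp: wedge_Cons linear_iff wedge_add_left wedge_add_right algebra_simps)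
  next
    case (Cons u us)
    show ?case
      using linear_compose_add[OF Cons.IH[OF alt_contr[OF Cons.prems(1)] Cons.prems(2)]
          Cons.IH[OF alt_grade_inv[OF Cons.prems(1)] alt_contr[OF Cons.prems(2)]]]
      by (simp add: wedge_Cons)
  qed
next
  fix us ws :: "'a list" and v
  show "wedge a b (us @ v # v # ws) = 0" using assms
  proof (induction us arbitrary: a b)
    case Nil
    then show ?case by (simp add: wedge_Cons contr_contr_same)
  next
    case (Cons u us)
    then show ?case by (simp add: wedge_Cons alt_contr alt_grade_inv)
  qed
qed

lemma alt_one: "alt_form ext_one"
  by (auto simp: alt_form_def ext_one_def linear_iff)

lemma Alt_iff: "a \<in> Alt k \<longleftrightarrow> alt_form a \<and> supp_deg k a"
  by (auto simp: Alt_def supp_deg_def)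

lemma Alt_contr: "a \<in> Alt (Suc k) \<Longrightarrow> contr v a \<in> Alt k"
  by (simp add: Alt_iff alt_contr supp_deg_contr)

lemma Alt_wedge: "a \<in> Alt k \<Longrightarrow> b \<in> Alt l \<Longrightarrow> wedge a b \<in> Alt (k + l)"
  by (simp add: Alt_iff alt_wedge supp_deg_wedge)

lemma Alt_ext_part: "alt_form a \<Longrightarrow> ext_part k a \<in> Alt k"
  using alt_ext_part[of a k] by (simp add: Alt_iff supp_deg_def) (simp add: ext_part_def)

lemma ext_part_id: "supp_deg k a \<Longrightarrow> ext_part k a = a"
  and ext_part_neq: "supp_deg k a \<Longrightarrow> j \<noteq> k \<Longrightarrow> ext_part j a = 0"
  by (auto simp: supp_deg_def ext_part_def)

lemma Alt_eq: "a \<in> Alt k \<longleftrightarrow> alt_form a \<and> ext_part k a = a"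
  by (metis Alt_ext_part Alt_iff ext_part_id)

lemma subspace_Alt: "subspace (Alt k)"
  by (auto simp: subspace_def Alt_iff alt_zero alt_add alt_scale supp_deg_def)

lemma Alt_one: "ext_one \<in> Alt 0"
  using alt_one by (simp add: Alt_iff supp_deg_def) (simp add: ext_one_def)

lemma Alt_0: "a \<in> Alt 0 \<Longrightarrow> a = a [] *\<^sub>R ext_one"
  by (auto simp: Alt_def ext_one_def fun_eq_iff)

lemma ext_part_lin [simp]:
  "ext_part k (a + b) = ext_part k a + ext_part k b" "ext_part k (c *\<^sub>R a) = c *\<^sub>R ext_part k a" "ext_part k 0 = 0"
  by (auto simp: ext_part_def)

lemma contr_ext_part: "contr v (ext_part (Suc k) a) = ext_part k (contr v a)"
  "contr v (ext_part 0 a) = 0"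
  by (auto simp: contr_def ext_part_def)

lemma ext_part_wedge:
  assumes "supp_deg j a"
  shows "ext_part k (wedge a b) = (if k < j then 0 else wedge a (ext_part (k - j) b))"
proof
  fix vs
  show "ext_part k (wedge a b) vs = (if k < j then 0 else wedge a (ext_part (k - j) b)) vs"
    using assms
  proof (induction vs arbitrary: a b j k)
    case Nil
    then show ?case by (auto simp: ext_part_def supp_deg_def)
  next
    case (Cons v vs)
    show ?case
    proof (cases k)
      case 0
      have "wedge a (ext_part 0 b) (v # vs) = 0" if "j = 0"
        using that supp_deg_wedge[OF Cons.prems, of 0 "ext_part 0 b"] by (auto simp: supp_deg_def ext_part_def)
      then show ?thesis using 0 by (auto simp: ext_part_def)
    next
      case (Suc i)
      have "ext_part k (wedge a b) (v # vs) = ext_part i (contr v (wedge a b)) vs"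
        by (simp add: Suc ext_part_def contr_def)
      also have "\<dots> = ext_part i (wedge (contr v a) b) vs + (- 1) ^ j * ext_part i (wedge a (contr v b)) vs"
        using Cons.prems by (simp add: contr_wedge supp_deg_grade_inv)
      also have "ext_part i (wedge (contr v a) b) vs = (if k < j then 0 else wedge (contr v a) (ext_part (k - j) b)) vs"
      proof (cases j)
        case 0
        then show ?thesis using supp_deg_contr0[of a v] Cons.prems by simp
      next
        case (Suc j')
        then show ?thesis using Cons.IH[of j' "contr v a" i b] supp_deg_contr[of j' a v] Cons.prems \<open>k = Suc i\<close> by auto
      qed
      also have "ext_part i (wedge a (contr v b)) vs = (if k < j then 0 else wedge a (contr v (ext_part (k - j) b))) vs"
        using Cons.IH[OF Cons.prems, of i "contr v b"] Suc contr_ext_part(2)[of v b]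
        by (cases "k = j") (auto simp: Suc_diff_le contr_ext_part)
      finally show ?thesis using Cons.prems by (auto simp: wedge_Cons supp_deg_grade_inv)
    qed
  qed
qed

section \<open>Orthonormal bases\<close>

text \<open>The model space may have dimension 0, so a basis is a set obtained by orthogonalizing a
  finite spanning set, not a distinguished basis of the type.\<close>

definition onb :: "'e::real_inner set \<Rightarrow> bool" where
  "onb B \<longleftrightarrow> finite B \<and> (\<forall>b\<in>B. \<forall>c\<in>B. inner b c = (if b = c then 1 else 0)) \<and> span B = UNIV"

lemma exists_onb:
  assumes "\<exists>B::'e::real_inner set. finite B \<and> span B = UNIV"
  shows "\<exists>B::'e set. onb B"
proof -
  obtain C :: "'e set" where C: "finite C" "span C = UNIV" "pairwise real_inner_class.orthogonal C"
    using assms basis_orthogonal by (metis (no_types, lifting))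
  define B where "B = (\<lambda>c. c /\<^sub>R norm c) ` (C - {0})"
  have "inner b c = (if b = c then 1 else 0)" if bc: "b \<in> B" "c \<in> B" for b c
  proof -
    obtain x y where xy: "x \<in> C" "x \<noteq> 0" "b = x /\<^sub>R norm x" "y \<in> C" "y \<noteq> 0" "c = y /\<^sub>R norm y"
      using bc by (auto simp: B_def)
    show ?thesis
    proof (cases "x = y")
      case True
      then show ?thesis using xy by (simp add: dot_square_norm power2_eq_square)
    next
      case False
      then have "inner x y = 0" using C(3) xy(1,4) unfolding pairwise_def real_inner_class.orthogonal_def by blast
      then have "inner b c = 0" by (simp add: xy(3,6))
      moreover have "inner b b = 1" using xy(2) by (simp add: xy(3) dot_square_norm power2_eq_square)
      ultimately show ?thesis by (cases "b = c") simp_all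
    qed
  qed
  moreover have "c \<in> span B" if "c \<in> C" for c
  proof (cases "c = 0")
    case False
    then have "c /\<^sub>R norm c \<in> span B" using that by (auto simp: B_def intro: span_base)
    then have "norm c *\<^sub>R (c /\<^sub>R norm c) \<in> span B" by (rule span_scale)
    then show ?thesis using False by simp
  qed (simp add: span_zero)
  then have "span B = UNIV" using C(2) span_minimal[OF subsetI subspace_span, of C B] by blast
  moreover have "finite B" using C(1) by (simp add: B_def)
  ultimately have "onb B" unfolding onb_def by blast
  then show ?thesis ..
qed

context
  fixes B :: "'e::real_inner set"
  assumes B: "onb B"
begin

lemma onb_finite: "finite B" and onb_span: "span B = UNIV"
  and onb_inner: "b \<in> B \<Longrightarrow> c \<in> B \<Longrightarrow> inner b c = (if b = c then 1 else 0)"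
  using B by (auto simp: onb_def)

lemma onb_sum: "(\<Sum>b\<in>B. inner b v *\<^sub>R b) = v"
proof -
  have "v \<in> span B" by (simp add: onb_span)
  then show ?thesis
  proof (induction v rule: span_induct_alt)
    case base
    then show ?case by simp
  next
    case (step c x y)
    have "(\<Sum>b\<in>B. inner b x *\<^sub>R b) = (\<Sum>b\<in>B. if b = x then b else 0)"
      by (rule sum.cong) (use step onb_inner in auto)
    then have "(\<Sum>b\<in>B. inner b x *\<^sub>R b) = x" using step onb_finite by simp
    moreover have "(\<Sum>b\<in>B. inner b (c *\<^sub>R x + y) *\<^sub>R b) = c *\<^sub>R (\<Sum>b\<in>B. inner b x *\<^sub>R b) + (\<Sum>b\<in>B. inner b y *\<^sub>R b)"
      by (simp add: inner_add_right scaleR_add_left sum.distrib scaleR_sum_right)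
    ultimately show ?case using step by simp
  qed
qed

lemma onb_linear: "linear f \<Longrightarrow> f v = (\<Sum>b\<in>B. inner b v *\<^sub>R f b)"
  by (metis (no_types, lifting) linear_scale linear_sum onb_sum sum.cong)

lemma onb_bounded_linear:
  fixes f :: "'e \<Rightarrow> 'c::real_normed_vector"
  assumes "linear f" shows "bounded_linear f"
proof (rule bounded_linear_intro[where K = "\<Sum>b\<in>B. norm b * norm (f b)"])
  fix x
  have "norm (f x) \<le> (\<Sum>b\<in>B. norm (inner b x *\<^sub>R f b))"
    unfolding onb_linear[OF assms, of x] by (rule norm_sum)
  also have "\<dots> \<le> (\<Sum>b\<in>B. norm x * (norm b * norm (f b)))"
  proof (rule sum_mono)
    fix b
    have "\<bar>inner b x\<bar> * norm (f b) \<le> (norm b * norm x) * norm (f b)"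
      by (intro mult_right_mono Cauchy_Schwarz_ineq2) auto
    then show "norm (inner b x *\<^sub>R f b) \<le> norm x * (norm b * norm (f b))" by (simp add: mult_ac)
  qed
  finally show "norm (f x) \<le> norm x * (\<Sum>b\<in>B. norm b * norm (f b))" by (simp add: sum_distrib_left)
qed (use assms in \<open>auto simp: linear_iff\<close>)

lemma onb_independent: "independent B"
proof (rule pairwise_orthogonal_independent)
  show "pairwise real_inner_class.orthogonal B" by (simp add: pairwise_def real_inner_class.orthogonal_def onb_inner)
  show "0 \<notin> B" using onb_inner[of 0 0] by auto
qed

lemma onb_card: "card B = dim (UNIV :: 'e set)"
  using dim_eq_card[of B UNIV] onb_span onb_independent by simp

lemma onb_inj_surj:
  fixes f :: "'e \<Rightarrow> 'e"
  assumes "linear f" "inj f" shows "surj f"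
proof -
  have "inj_on f (span B)" using assms(2) inj_on_subset by blast
  then have ind: "independent (f ` B)"
    using linear_independent_injective_image[OF assms(1) onb_independent] by blast
  have "card (f ` B) = card B" using assms(2) by (simp add: card_image inj_on_subset)
  have "UNIV \<subseteq> span (f ` B)"
  proof (rule ccontr)
    assume "\<not> UNIV \<subseteq> span (f ` B)"
    then obtain x where x: "x \<notin> span (f ` B)" by auto
    then have "independent (insert x (f ` B))" "x \<notin> f ` B" using independent_insertI[OF x ind] span_base[of x "f ` B"] by blast+
    then have "card (insert x (f ` B)) \<le> card B"
      using conjunct2[OF independent_span_bound[OF onb_finite, of "insert x (f ` B)"]] onb_span by (metis subset_UNIV)
    then show False using \<open>x \<notin> f ` B\<close> \<open>card (f ` B) = card B\<close> onb_finite by simp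
  qed
  then show ?thesis using linear_span_image[OF assms(1), of B] onb_span by auto
qed

text \<open>Expanding the arguments one by one in the basis leaves lists of more than
  \<open>card B\<close> basis vectors, which must repeat.\<close>

lemma alt_form_high:
  assumes a: "alt_form (a :: 'e ext)" and "length vs > card B" shows "a vs = 0"
proof -
  have "a (us @ vs) = 0" if "set us \<subseteq> B" "length us + length vs > card B" for us
    using that
  proof (induction vs arbitrary: us)
    case Nil
    then have "\<not> distinct us" using distinct_card[of us] card_mono[OF onb_finite Nil(1)] by auto
    then show ?case using alt_formD(2)[OF a] by simp
  next
    case (Cons v vs)
    have "a (us @ v # vs) = (\<Sum>b\<in>B. inner b v *\<^sub>R a (us @ b # vs))"
      by (rule onb_linear[OF alt_formD(1)[OF a]])
    also have "\<dots> = 0" using Cons.IH[of "us @ [_]"] Cons.prems by (intro sum.neutral) auto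
    finally show ?case .
  qed
  from this[of "[]"] assms show ?thesis by simp
qed

end

section \<open>Symplectic linear algebra\<close>

definition covec :: "('e \<Rightarrow> real) \<Rightarrow> 'e ext" where
  "covec f = (\<lambda>vs. if length vs = 1 then f (hd vs) else 0)"

lemma covec_apply [simp]: "covec f [v] = f v"
  by (simp add: covec_def)

lemma Alt_1_eqI:
  assumes "a \<in> Alt 1" "b \<in> Alt 1" "\<And>v. a [v] = b [v]" shows "a = b"
proof
  fix vs show "a vs = b vs"
    using assms by (cases "length vs = 1") (auto simp: Alt_def length_Suc_conv)
qed

lemma covec_Alt: "linear f \<Longrightarrow> covec f \<in> Alt 1"
proof -
  assume f: "linear f"
  have "linear (\<lambda>v. covec f (us @ v # ws))" for us ws
    using f by (cases "us = [] \<and> ws = []") (auto simp: covec_def linear_iff)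
  moreover have "covec f vs = 0" if "\<not> distinct vs" for vs
    using that by (auto simp: covec_def length_Suc_conv)
  ultimately show ?thesis by (auto simp: Alt_def alt_form_def) (auto simp: covec_def)
qed

lemma Alt_1_linear: "a \<in> Alt 1 \<Longrightarrow> linear (\<lambda>v. a [v])"
  using alt_formD(1)[of a "[]" "[]"] by (auto simp: Alt_def)

lemma Alt_1_contr: "a \<in> Alt 1 \<Longrightarrow> contr v a = a [v] *\<^sub>R ext_one"
  using Alt_contr[of a 0 v] Alt_0[of "contr v a"] by (auto simp: contr_def)

lemma supp_deg_Alt: "a \<in> Alt k \<Longrightarrow> supp_deg k a"
  by (simp add: Alt_iff)

lemma contr_wedge_covector:
  assumes "t \<in> Alt 1" shows "contr v (wedge t a) = t [v] *\<^sub>R a - wedge t (contr v a)"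
  using Alt_1_contr[OF assms] by (simp add: contr_wedge supp_deg_grade_inv[OF supp_deg_Alt[OF assms]])

text \<open>A generalization of the fact that \<open>\<Sum>\<^sub>i e\<^sup>i \<and> \<iota>(e\<^sub>i)\<close> multiplies a form by its degree.\<close>

lemma sum_wedge_contr:
  assumes "\<And>i. i \<in> I \<Longrightarrow> t i \<in> Alt 1" "\<And>v. (\<Sum>i\<in>I. t i [v] *\<^sub>R x i) = c *\<^sub>R v" "alt_form a"
  shows "(\<Sum>i\<in>I. wedge (t i) (contr (x i) a)) = (\<lambda>vs. c * real (length vs) * a vs)"
proof
  fix vs show "(\<Sum>i\<in>I. wedge (t i) (contr (x i) a)) vs = c * real (length vs) * a vs"
    using assms(3)
  proof (induction vs arbitrary: a)
    case Nil
    then show ?case using assms(1) by (auto simp: Alt_def intro!: sum.neutral)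
  next
    case (Cons v vs)
    have "(\<Sum>i\<in>I. t i [v] *\<^sub>R contr (x i) a) = contr (\<Sum>i\<in>I. t i [v] *\<^sub>R x i) a"
      by (simp add: linear_sum[OF linear_contr[OF Cons.prems]] linear_scale[OF linear_contr[OF Cons.prems]])
    also have "\<dots> = c *\<^sub>R contr v a"
      by (simp add: assms(2) linear_scale[OF linear_contr[OF Cons.prems]])
    finally have 1: "(\<Sum>i\<in>I. t i [v] *\<^sub>R contr (x i) a) = c *\<^sub>R contr v a" .
    have "(\<Sum>i\<in>I. wedge (t i) (contr (x i) a)) (v # vs) = contr v (\<Sum>i\<in>I. wedge (t i) (contr (x i) a)) vs"
      by (simp add: contr_def)
    also have "\<dots> = (\<Sum>i\<in>I. t i [v] *\<^sub>R contr (x i) a + wedge (t i) (contr (x i) (contr v a))) vs"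
      using assms(1) Cons.prems by (simp add: contr_wedge_covector contr_contr[of a v])
    also have "\<dots> = c * contr v a vs + c * real (length vs) * contr v a vs"
      using Cons.IH[OF alt_contr[OF Cons.prems]] fun_cong[OF 1, of vs] by (simp add: sum.distrib)
    finally show ?case by (simp add: contr_def algebra_simps)
  qed
qed

locale symplectic_space =
  fixes B :: "'e::real_inner set" and n :: nat and w :: "'e ext"
  assumes B: "onb B" and card_B: "card B = 2 * n" and w: "w \<in> Alt 2"
    and nondeg: "(\<And>v. w [u, v] = 0) \<Longrightarrow> u = 0"
begin

lemma alt_w: "alt_form w" and supp_w: "supp_deg 2 w"
  using w by (auto simp: Alt_iff)

lemma w_skew: "w [u, v] = - w [v, u]"
  using fun_cong[OF contr_contr[OF alt_w, of v u], of "[]"] by (simp add: contr_def)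

lemma linear_w: "linear (\<lambda>u. w [u, v])" "linear (\<lambda>v. w [u, v])"
  using alt_formD(1)[OF alt_w, of "[]" "[v]"] alt_formD(1)[OF alt_w, of "[u]" "[]"] by auto

lemma flat_Alt: "contr u w \<in> Alt 1"
  using Alt_contr[of w 1 u] w by (simp add: numeral_2_eq_2)

lemma sharp_eqI: "(\<And>v. w [u, v] = t [v]) \<Longrightarrow> sharp w t = u"
proof -
  assume u: "\<And>v. w [u, v] = t [v]"
  show ?thesis unfolding sharp_def
  proof (rule the_equality)
    fix a assume "\<forall>b. w [a, b] = t [b]"
    then have "w [a - u, v] = 0" for v using u linear_diff[OF linear_w(1)] by simp
    then show "a = u" using nondeg[of "a - u"] by simp
  qed (use u in simp)
qed

text \<open>Nondegeneracy makes the map f, which represents w by means of the inner product,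
  injective and hence onto; this justifies the definite description in \<open>sharp\<close>.\<close>

lemma sharp:
  assumes "t \<in> Alt 1" shows "w [sharp w t, v] = t [v]"
proof -
  define f where "f u = (\<Sum>b\<in>B. w [u, b] *\<^sub>R b)" for u
  have lf: "linear f"
    using linear_w(1) by (auto simp: f_def linear_iff scaleR_add_left sum.distrib scaleR_sum_right)
  have fi: "inner c (f u) = w [u, c]" if "c \<in> B" for c u
  proof -
    have "inner c (f u) = (\<Sum>b\<in>B. if b = c then w [u, b] else 0)"
      unfolding f_def inner_sum_right by (rule sum.cong) (use onb_inner[OF B] that in auto)
    then show ?thesis using that onb_finite[OF B] by simp
  qed
  have "inj f"
  proof (rule linear_injective_0[OF lf, THEN iffD2], intro allI impI)
    fix u assume "f u = 0"
    then have "w [u, c] = 0" if "c \<in> B" for c using fi[OF that, of u] by simp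
    then have "w [u, v] = 0" for v using onb_linear[OF B linear_w(2), of u v] by simp
    then show "u = 0" by (rule nondeg)
  qed
  then have "surj f" using onb_inj_surj[OF B lf] by simp
  then obtain u where "f u = (\<Sum>b\<in>B. t [b] *\<^sub>R b)" by (metis surjD)
  moreover have "inner c (\<Sum>b\<in>B. t [b] *\<^sub>R b) = t [c]" if "c \<in> B" for c
  proof -
    have "inner c (\<Sum>b\<in>B. t [b] *\<^sub>R b) = (\<Sum>b\<in>B. if b = c then t [b] else 0)"
      unfolding inner_sum_right by (rule sum.cong) (use onb_inner[OF B] that in auto)
    then show ?thesis using that onb_finite[OF B] by simp
  qed
  ultimately have "w [u, c] = t [c]" if "c \<in> B" for c using fi[OF that, of u] that by simp
  then have "w [u, v] = t [v]" for v
    using onb_linear[OF B linear_w(2), of u v] onb_linear[OF B Alt_1_linear[OF assms], of v] by simp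
  then show ?thesis using sharp_eqI by metis
qed

lemma contr_sharp: "t \<in> Alt 1 \<Longrightarrow> contr (sharp w t) w = t"
  by (rule Alt_1_eqI[OF flat_Alt]) (auto simp: contr_def sharp)

definition L :: "'e ext \<Rightarrow> 'e ext" where "L = wedge w"

definition dual :: "'e \<Rightarrow> 'e" where "dual b = sharp w (covec (inner b))"

text \<open>Contraction with the bivector inverse to w, with the usual factor 1/2; the sign is the
  one that gives \<open>Lam_L_eq\<close>. That the choice of basis does not matter is what lies
  behind \<open>Lam_comp\<close>.\<close>

definition Lam :: "'e ext \<Rightarrow> 'e ext" where
  "Lam a = (1 / 2) *\<^sub>R (\<Sum>b\<in>B. contr b (contr (dual b) a))"

lemma covec_inner: "covec (inner b) \<in> Alt 1"
  by (intro covec_Alt) (auto simp: linear_iff inner_add_right)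

lemma w_dual: "w [dual b, v] = inner b v"
  by (simp add: dual_def sharp[OF covec_inner])

lemma sum_dual: "(\<Sum>b\<in>B. w [b, v] *\<^sub>R dual b) = - v"
proof -
  have "w [(\<Sum>b\<in>B. w [b, v] *\<^sub>R dual b) + v, z] = 0" for z
  proof -
    have "w [(\<Sum>b\<in>B. w [b, v] *\<^sub>R dual b) + v, z] = (\<Sum>b\<in>B. inner b z * w [b, v]) + w [v, z]"
      by (simp add: linear_add[OF linear_w(1)] linear_sum[OF linear_w(1)] linear_scale[OF linear_w(1)] w_dual mult.commute)
    also have "(\<Sum>b\<in>B. inner b z * w [b, v]) = w [z, v]"
      using onb_linear[OF B linear_w(1), of z v] by simp
    finally show ?thesis using w_skew[of z v] by simp
  qed
  then show ?thesis using nondeg by (simp add: eq_neg_iff_add_eq_0)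
qed

lemma Lam_alt: "alt_form a \<Longrightarrow> alt_form (Lam a)"
  unfolding Lam_def by (intro alt_scale alt_sum alt_contr)

lemma Lam_contr: "alt_form a \<Longrightarrow> Lam (contr v a) = contr v (Lam a)"
proof -
  assume a: "alt_form a"
  have "contr b (contr u (contr v a)) = contr v (contr b (contr u a))" for b u
    using contr_contr[OF a, of u v] contr_contr[OF alt_contr[OF a], of b v u] by simp
  then show ?thesis by (simp add: Lam_def)
qed

lemma sum_inner_onb: "(\<Sum>b\<in>B. inner b b *\<^sub>R a) = (2 * real n) *\<^sub>R (a :: 'e ext)"
proof -
  have "(\<Sum>b\<in>B. inner b b *\<^sub>R a) = (\<Sum>b\<in>B. a)" by (rule sum.cong) (use onb_inner[OF B] in auto)
  then show ?thesis using card_B by (simp add: sum_constant_scaleR del: sum_constant)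
qed

text \<open>In the double contraction of w wedge a, the term in which both contractions meet w
  contributes the dimension 2 n, and each of the two mixed terms contributes minus the degree by
  \<open>sum_wedge_contr\<close>; halving gives n minus the degree.\<close>

lemma Lam_L_eq:
  assumes a: "alt_form a"
  shows "Lam (L a) = L (Lam a) + (\<lambda>vs. (real n - real (length vs)) * a vs)"
proof -
  have gw: "grade_inv w = w" using supp_deg_grade_inv[OF supp_w] by simp
  have gf: "grade_inv (contr u w) = - contr u w" for u
    using supp_deg_grade_inv[OF supp_deg_Alt[OF flat_Alt]] by simp
  have "contr b (contr u (L a)) = w [u, b] *\<^sub>R a - wedge (contr u w) (contr b a) + wedge (contr b w) (contr u a)
      + L (contr b (contr u a))" for b u
    using Alt_1_contr[OF flat_Alt, of b u]
    by (simp add: L_def contr_wedge gw gf) (simp add: contr_def)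
  then have "2 *\<^sub>R Lam (L a) = (\<Sum>b\<in>B. w [dual b, b] *\<^sub>R a) - (\<Sum>b\<in>B. wedge (contr (dual b) w) (contr b a))
      + (\<Sum>b\<in>B. wedge (contr b w) (contr (dual b) a)) + 2 *\<^sub>R L (Lam a)"
    by (simp add: Lam_def L_def sum.distrib sum_subtractf wedge_sum_right)
  also have "(\<Sum>b\<in>B. w [dual b, b] *\<^sub>R a) = (2 * real n) *\<^sub>R a"
    by (simp add: w_dual sum_inner_onb)
  also have "(\<Sum>b\<in>B. wedge (contr (dual b) w) (contr b a)) = (\<lambda>vs. 1 * real (length vs) * a vs)"
    by (rule sum_wedge_contr[OF flat_Alt _ a]) (simp add: contr_def w_dual onb_sum[OF B])
  also have "(\<Sum>b\<in>B. wedge (contr b w) (contr (dual b) a)) = (\<lambda>vs. (- 1) * real (length vs) * a vs)"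
    by (rule sum_wedge_contr[OF flat_Alt _ a]) (simp add: contr_def sum_dual)
  finally have e: "2 *\<^sub>R Lam (L a) = (2 * real n) *\<^sub>R a - (\<lambda>vs. 1 * real (length vs) * a vs) +
      (\<lambda>vs. (- 1) * real (length vs) * a vs) + 2 *\<^sub>R L (Lam a)" .
  show ?thesis
  proof
    fix vs show "Lam (L a) vs = (L (Lam a) + (\<lambda>vs. (real n - real (length vs)) * a vs)) vs"
    proof -
      have "2 * Lam (L a) vs = 2 * (L (Lam a) vs + (real n - real (length vs)) * a vs)"
        using fun_cong[OF e, of vs] by (simp add: algebra_simps)
      then show ?thesis by simp
    qed
  qed
qed

lemma L_alt: "alt_form a \<Longrightarrow> alt_form (L a)"
  by (simp add: L_def alt_wedge alt_w)

sublocale lefschetz_module "{a. alt_form a}" n ext_part L Lam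
proof
  show "subspace {a::'e ext. alt_form a}" by (rule subspace_alt)
  show "lin_op {a. alt_form a} (ext_part k)" for k :: nat
    by (rule lin_opI) (auto simp: alt_ext_part)
  show "lin_op {a. alt_form a} L"
    by (rule lin_opI) (auto simp: L_alt, auto simp: L_def wedge_add_right)
  show "lin_op {a. alt_form a} Lam"
    by (rule lin_opI) (auto simp: Lam_alt, auto simp: Lam_def sum.distrib scaleR_sum_right scaleR_add_right)
  fix a :: "'e ext" and j k :: nat assume "a \<in> {a. alt_form a}"
  then have a: "alt_form a" by simp
  show "ext_part j (ext_part k a) = (if j = k then ext_part k a else 0)"
    by (auto simp: ext_part_def)
  have "(\<Sum>k\<le>2 * n. ext_part k a) vs = a vs" for vs
    using alt_form_high[OF B a, of vs] card_B by (cases "length vs \<le> 2 * n") (auto simp: ext_part_def)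
  then show "(\<Sum>k\<le>2 * n. ext_part k a) = a" by blast
  show "ext_part k (L a) = (if k < 2 then 0 else L (ext_part (k - 2) a))"
    unfolding L_def by (rule ext_part_wedge[OF supp_w])
  show "ext_part k (Lam a) = Lam (ext_part (k + 2) a)"
    by (auto simp: Lam_def ext_part_def contr_def fun_eq_iff)
  assume "ext_part k a = a"
  then have "a vs = 0" if "length vs \<noteq> k" for vs using that by (metis ext_part_def)
  then have "(\<lambda>vs. (real n - real (length vs)) * a vs) = (real n - real k) *\<^sub>R a" by (auto simp: fun_eq_iff)
  then show "Lam (L a) = L (Lam a) + (real n - real k) *\<^sub>R a" using Lam_L_eq[OF a] by simp
qed

lemma hom_part_Alt: "hom_part k = Alt k"
  by (auto simp: hom_part_def Alt_eq)

lemma contr_L: "contr v (L a) = wedge (contr v w) a + L (contr v a)"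
  using supp_deg_grade_inv[OF supp_w] by (simp add: L_def contr_wedge)

lemma L_wedge: "supp_deg 1 t \<Longrightarrow> L (wedge t a) = wedge t (L a)"
  using wedge_commute[OF supp_w, of t] by (simp add: L_def wedge_assoc[symmetric] numeral_2_eq_2)

text \<open>Wedging with \<open>contr v w\<close> is the commutator of \<open>contr v\<close> with
  L, and \<open>contr v\<close> commutes with Lam; so the commutator with Lam is that of
  \<open>contr v\<close> with the operator n minus degree.\<close>

lemma Lam_wedge_flat:
  assumes a: "alt_form a"
  shows "Lam (wedge (contr v w) a) = wedge (contr v w) (Lam a) - contr v a"
proof -
  have Lam_diff: "Lam (x - y) = Lam x - Lam y" for x y :: "'e ext"
    by (simp add: Lam_def sum_subtractf scaleR_diff_right)
  have e: "wedge (contr v w) x = contr v (L x) - L (contr v x)" for x by (simp add: contr_L)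
  have "Lam (wedge (contr v w) a) = contr v (Lam (L a)) - Lam (L (contr v a))"
    unfolding e Lam_diff using Lam_contr[OF L_alt[OF a]] by simp
  also have "\<dots> = contr v (L (Lam a)) - L (contr v (Lam a)) - contr v a"
    unfolding Lam_L_eq[OF a] Lam_L_eq[OF alt_contr[OF a]] Lam_contr[OF a]
    by (simp add: fun_eq_iff) (simp add: contr_def algebra_simps)
  finally show ?thesis by (simp add: e)
qed

text \<open>Wedging with \<open>contr v w\<close> and minus the contraction with v form a doublet,
  so \<open>W\<close> exchanges them. The third claim will be applied to the scalar 1: the first two
  exponentials send it to an element killed by wedging with any covector.\<close>

lemma
  assumes a: "alt_form a"
  shows W_wedge: "W (wedge (contr v w) a) = contr v (W a)"
    and W_contr: "W (contr v a) = - wedge (contr v w) (W a)"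
    and trunc_exp_wedge_contr: "contr v a = 0 \<Longrightarrow>
      wedge (contr v w) (trunc_exp (Suc n) (- 1) Lam (trunc_exp (Suc n) 1 L a)) = 0"
proof -
  let ?V = "{a::'e ext. alt_form a}" and ?f = "wedge (contr v w)" and ?g = "\<lambda>a::'e ext. - contr v a"
  have f: "lin_op ?V ?f"
    using flat_Alt by (intro lin_opI) (auto simp: wedge_add_right Alt_iff alt_wedge)
  have g: "lin_op ?V ?g" by (intro lin_opI) (auto simp: alt_contr alt_minus)
  have a': "a \<in> ?V" using a by simp
  have Lf: "L (?f x) = ?f (L x)" if "x \<in> ?V" for x by (rule L_wedge) (rule supp_deg_Alt[OF flat_Alt])
  have Lamf: "Lam (?f x) = ?f (Lam x) + ?g x" if "x \<in> ?V" for x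
    using Lam_wedge_flat[of x v] that by simp
  have Lamg: "Lam (?g x) = ?g (Lam x)" if "x \<in> ?V" for x
    using Lam_contr[of x v] that lin_op_minus[OF Lam, of "contr v x"] by (simp add: alt_contr)
  have Lg: "L (?g x) = ?g (L x) + ?f x" if "x \<in> ?V" for x
    by (simp add: contr_L) (simp add: L_def)
  note conj = W_conjugate[OF f g Lf Lamf Lamg Lg a']
  show "W (wedge (contr v w) a) = contr v (W a)" using conj(1) by (simp only: minus_minus)
  have "alt_form (contr v a)" using alt_contr[OF a] .
  then show "W (contr v a) = - wedge (contr v w) (W a)"
    using conj(2) lin_op_minus[OF W, of "contr v a"] by (metis mem_Collect_eq minus_minus)
  let ?E = "trunc_exp (Suc n) 1 L" and ?F = "trunc_exp (Suc n) (- 1) Lam"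
  have ex: "?E (- contr v x) = - contr v (?E x) + ?f (?E x)" "?F (?f x) = ?f (?F x) + contr v (?F x)"
    "?F (contr v x) = contr v (?F x)" if x: "x \<in> ?V" for x
  proof -
    show "?E (- contr v x) = - contr v (?E x) + ?f (?E x)"
      by (rule trunc_exp_doublet(2)[OF f g Lf Lamf Lamg Lg x])
    have "?F (?f x) = ?f (?F x) - - contr v (?F x)"
      by (rule trunc_exp_doublet(3)[OF f g Lf Lamf Lamg Lg x])
    then show "?F (?f x) = ?f (?F x) + contr v (?F x)" by simp
    have "?F (- contr v x) = - contr v (?F x)"
      by (rule trunc_exp_doublet(4)[OF f g Lf Lamf Lamg Lg x])
    then show "?F (contr v x) = contr v (?F x)"
      using lin_op_minus[OF lin_op_trunc_exp[OF V Lam], of "contr v x"] x alt_contr by (metis mem_Collect_eq minus_minus)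
  qed
  have E: "alt_form (?E x)" if "alt_form x" for x using lin_op_mem[OF lin_op_trunc_exp[OF V L], of x] that by simp
  assume z: "contr v a = 0"
  have E0: "?E 0 = 0" by (rule lin_op_zero[OF lin_op_trunc_exp[OF V L] V])
  have 1: "?f (?E a) = contr v (?E a)" using ex(1)[OF a'] z E0 by (simp add: add_eq_0_iff)
  have "?f (?F (?E a)) + contr v (?F (?E a)) = ?F (?f (?E a))" using ex(2)[of "?E a"] E[OF a] by simp
  also have "\<dots> = contr v (?F (?E a))" unfolding 1 using ex(3)[of "?E a"] E[OF a] by simp
  finally show "wedge (contr v w) (?F (?E a)) = 0" by simp
qed

section \<open>The values of W on 1 and on the volume form, and the square of W\<close>

lemma sum_contr_wedge:
  assumes a: "alt_form a"
  shows "(\<Sum>b\<in>B. contr b (wedge (contr (dual b) w) a)) = (\<lambda>vs. (2 * real n - real (length vs)) * a vs)"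
proof -
  have "(\<Sum>b\<in>B. contr b (wedge (contr (dual b) w) a)) = (\<Sum>b\<in>B. inner b b *\<^sub>R a - wedge (contr (dual b) w) (contr b a))"
    by (rule sum.cong) (simp_all add: contr_wedge_covector[OF flat_Alt], simp add: contr_def w_dual)
  also have "\<dots> = (2 * real n) *\<^sub>R a - (\<Sum>b\<in>B. wedge (contr (dual b) w) (contr b a))"
    by (simp add: sum_subtractf sum_inner_onb)
  also have "(\<Sum>b\<in>B. wedge (contr (dual b) w) (contr b a)) = (\<lambda>vs. 1 * real (length vs) * a vs)"
    by (rule sum_wedge_contr[OF flat_Alt _ a]) (simp add: contr_def w_dual onb_sum[OF B])
  finally show ?thesis by (auto simp: fun_eq_iff algebra_simps)
qed

text \<open>The operator in \<open>sum_contr_wedge\<close> multiplies by 2 n minus the degree; as it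
  vanishes on a, only degree 2 n survives.\<close>

lemma top_deg_if_wedge_zero:
  assumes "alt_form a" "\<And>v. wedge (contr v w) a = 0"
  shows "a \<in> Alt (2 * n)"
proof -
  have *: "(2 * real n - real (length vs)) * a vs = 0" for vs
    using fun_cong[OF sum_contr_wedge[OF assms(1)], of vs] assms(2) by (simp add: contr_def)
  then have "a vs = 0" if "length vs \<noteq> 2 * n" for vs
  proof -
    have "real (length vs) \<noteq> real (2 * n)" using that of_nat_eq_iff[where 'a = real] by blast
    then show ?thesis using *[of vs] by auto
  qed
  then show ?thesis using assms(1) by (simp add: Alt_iff supp_deg_def)
qed

definition vol :: "'e ext" where "vol = (1 / fact n) *\<^sub>R (L ^^ n) ext_one"

lemma pow_L_one: "(L ^^ k) ext_one \<in> Alt (2 * k)"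
  using hom_pow_L[of ext_one 0 k] Alt_one by (simp add: hom_part_Alt)

lemma vol_Alt: "vol \<in> Alt (2 * n)"
  unfolding vol_def using pow_L_one subspace_scale[OF subspace_Alt] by blast

lemma Alt_high: "(a :: 'e ext) \<in> Alt k \<Longrightarrow> k > 2 * n \<Longrightarrow> a = 0"
  by (rule hom_high[unfolded hom_part_Alt])

lemma P_trunc_exp_L:
  assumes "alt_form a" "\<And>j. j < k \<Longrightarrow> ext_part j a = 0" shows "ext_part k (trunc_exp (Suc n) c L a) = ext_part k a"
proof -
  have *: "ext_part m ((L ^^ i) a) = 0" if "m < k + 2 * i" for i m
    using that
  proof (induction i arbitrary: m)
    case (Suc i)
    have "alt_form ((L ^^ i) a)" using mem(4)[of a i] assms(1) by simp
    then have "ext_part m ((L ^^ Suc i) a) = (if m < 2 then 0 else L (ext_part (m - 2) ((L ^^ i) a)))"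
      using P_L[of "(L ^^ i) a" m] by simp
    moreover have "ext_part (m - 2) ((L ^^ i) a) = 0" if "\<not> m < 2" by (rule Suc.IH) (use Suc.prems that in simp)
    ultimately show ?case using lin_op_zero[OF L V] by (metis (full_types))
  qed (use assms(2) in simp)
  have "ext_part k (trunc_exp (Suc n) c L a) = (\<Sum>i\<le>Suc n. (c ^ i / fact i) *\<^sub>R ext_part k ((L ^^ i) a))"
    unfolding trunc_exp_def
    using lin_op_sum[OF P[of k] V, of "{..Suc n}" "\<lambda>i. (c ^ i / fact i) *\<^sub>R (L ^^ i) a"] mem(4)[of a] assms(1)
    by (simp add: alt_scale del: funpow.simps)
  also have "\<dots> = (\<Sum>i\<le>Suc n. if i = 0 then ext_part k a else 0)"
    by (rule sum.cong) (auto simp: * simp del: funpow.simps)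
  finally show ?thesis by simp
qed

lemma P_trunc_exp_Lam:
  assumes "alt_form a" shows "ext_part k (trunc_exp (Suc n) c Lam a) =
    (\<Sum>i\<le>Suc n. (c ^ i / fact i) *\<^sub>R (Lam ^^ i) (ext_part (k + 2 * i) a))"
proof -
  have *: "ext_part m ((Lam ^^ i) a) = (Lam ^^ i) (ext_part (m + 2 * i) a)" for i m
  proof (induction i arbitrary: m)
    case (Suc i)
    have "alt_form ((Lam ^^ i) a)" using mem(5)[of a i] assms(1) by simp
    then show ?case using P_Lam[of "(Lam ^^ i) a" m] Suc[of "m + 2"] by (simp add: add.assoc add.commute)
  qed simp
  show ?thesis
    unfolding trunc_exp_def
    using lin_op_sum[OF P[of k] V, of "{..Suc n}" "\<lambda>i. (c ^ i / fact i) *\<^sub>R (Lam ^^ i) a"] mem(5)[of a] assms(1)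
    by (simp add: alt_scale * del: funpow.simps)
qed

text \<open>By \<open>top_deg_if_wedge_zero\<close> the first two exponentials send 1 into degree 2
  n, to which no positive power of Lam can contribute. So the value is the component w^n / n! of exp
  L applied to 1, and the last exponential fixes it.\<close>

lemma W_one: "W ext_one = vol"
proof -
  let ?E = "trunc_exp (Suc n) 1 L" and ?F = "trunc_exp (Suc n) (- 1) Lam"
  have one: "alt_form ext_one" "contr v ext_one = 0" for v :: 'e by (auto simp: alt_one) (auto simp: contr_def ext_one_def)
  have E: "alt_form (?E ext_one)" using lin_op_mem[OF lin_op_trunc_exp[OF V L]] one by simp
  have z: "alt_form (?F (?E ext_one))" using lin_op_mem[OF lin_op_trunc_exp[OF V Lam]] E by simp
  have zt: "?F (?E ext_one) \<in> Alt (2 * n)"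
    by (rule top_deg_if_wedge_zero[OF z trunc_exp_wedge_contr[OF one]])
  have "?F (?E ext_one) = ext_part (2 * n) (?F (?E ext_one))" using zt by (simp add: Alt_eq)
  also have "\<dots> = (\<Sum>i\<le>Suc n. if i = 0 then ext_part (2 * n) (?E ext_one) else 0)"
    unfolding P_trunc_exp_Lam[OF E]
  proof (rule sum.cong)
    fix i
    show "((- 1) ^ i / fact i) *\<^sub>R (Lam ^^ i) (ext_part (2 * n + 2 * i) (?E ext_one)) =
      (if i = 0 then ext_part (2 * n) (?E ext_one) else 0)"
    proof (cases i)
      case (Suc j)
      then have "ext_part (2 * n + 2 * i) (?E ext_one) = 0" using P_high[of "?E ext_one" "2 * n + 2 * i"] E by simp
      then show ?thesis using Suc zero(5)[of i] by (simp del: funpow.simps)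
    qed simp
  qed simp
  also have "\<dots> = ext_part (2 * n) (?E ext_one)" by simp
  also have "\<dots> = (\<Sum>i\<le>Suc n. (1 / fact i) *\<^sub>R ext_part (2 * n) ((L ^^ i) ext_one))"
    unfolding trunc_exp_def
    using lin_op_sum[OF P[of "2 * n"] V, of "{..Suc n}" "\<lambda>i. (1 ^ i / fact i) *\<^sub>R (L ^^ i) ext_one"] pow_L_one
    by (simp add: Alt_iff alt_scale del: funpow.simps)
  also have "\<dots> = (\<Sum>i\<le>Suc n. if i = n then vol else 0)"
    by (rule sum.cong)
      (use pow_L_one in \<open>auto simp: vol_def ext_part_neq[OF supp_deg_Alt[OF pow_L_one]]
        ext_part_id[OF supp_deg_Alt[OF pow_L_one]] simp del: funpow.simps\<close>)
  also have "\<dots> = vol" by simp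
  finally have zv: "?F (?E ext_one) = vol" .
  have "L vol \<in> Alt (2 * n + 2)" using hom_L[of vol "2 * n"] vol_Alt by (simp add: hom_part_Alt)
  then have Lv: "L vol = 0" using Alt_high by simp
  have "(L ^^ i) vol = (if i = 0 then vol else 0)" for i
    by (induction i) (use Lv lin_op_zero[OF L V] in auto)
  then have "?E vol = (\<Sum>i\<le>Suc n. if i = 0 then vol else 0)"
    unfolding trunc_exp_def by (intro sum.cong) auto
  then have "?E vol = vol" by simp
  then show ?thesis by (simp add: W_def zv)
qed

text \<open>Wedging \<open>vol\<close> with a covector gives 0, so every contraction of
  \<open>W vol\<close> vanishes and it is a scalar. That scalar is the degree 0 part of exp (- Lam)
  vol, namely (-1)^n / n! times Lam^n vol; since vol is L^n 1 / n! and the ladder product is n! n!,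
  the result is (-1)^n.\<close>

lemma W_vol: "W vol = (- 1) ^ n *\<^sub>R ext_one"
proof -
  let ?E = "trunc_exp (Suc n) 1 L" and ?F = "trunc_exp (Suc n) (- 1) Lam"
  have va: "alt_form vol" using vol_Alt by (simp add: Alt_iff)
  have "wedge (contr v w) vol \<in> Alt (1 + 2 * n)" for v by (rule Alt_wedge[OF flat_Alt vol_Alt])
  then have "wedge (contr v w) vol = 0" for v using Alt_high[of _ "1 + 2 * n"] by simp
  then have "contr v (W vol) = 0" for v
    using W_wedge[OF va, of v] lin_op_zero[OF W V] by simp
  then have W0: "W vol = W vol [] *\<^sub>R ext_one"
    by (intro ext_list_eqI) (auto simp: ext_one_def, auto simp: contr_def)
  have "(L ^^ i) vol = (if i = 0 then vol else 0)" for i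
  proof (induction i)
    case (Suc i)
    have "L vol \<in> Alt (2 * n + 2)" using hom_L[of vol "2 * n"] vol_Alt by (simp add: hom_part_Alt)
    then have "L vol = 0" using Alt_high by simp
    then show ?case using Suc lin_op_zero[OF L V] by auto
  qed simp
  then have "?E vol = (\<Sum>i\<le>Suc n. if i = 0 then vol else 0)"
    unfolding trunc_exp_def by (intro sum.cong) auto
  then have Ev: "?E vol = vol" by simp
  have Fa: "alt_form (?F vol)" using lin_op_mem[OF lin_op_trunc_exp[OF V Lam]] va by simp
  have "ext_part 0 (W vol) = ext_part 0 (?F vol)"
    unfolding W_def Ev by (rule P_trunc_exp_L[OF Fa]) simp
  also have "\<dots> = (\<Sum>i\<le>Suc n. if i = n then ((- 1) ^ n / fact n) *\<^sub>R (Lam ^^ n) vol else 0)"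
    unfolding P_trunc_exp_Lam[OF va]
  proof (rule sum.cong)
    fix i
    show "((- 1) ^ i / fact i) *\<^sub>R (Lam ^^ i) (ext_part (0 + 2 * i) vol) =
      (if i = n then ((- 1) ^ n / fact n) *\<^sub>R (Lam ^^ n) vol else 0)"
      using ext_part_neq[OF supp_deg_Alt[OF vol_Alt], of "2 * i"] ext_part_id[OF supp_deg_Alt[OF vol_Alt]] zero(5)[of i]
      by (auto simp del: funpow.simps)
  qed simp
  also have "\<dots> = ((- 1) ^ n / fact n) *\<^sub>R (Lam ^^ n) vol" by simp
  also have "(Lam ^^ n) vol = (1 / fact n) *\<^sub>R (Lam ^^ n) ((L ^^ n) ext_one)"
    unfolding vol_def using lin_op_scale[OF lin_op_pow[OF Lam]] pow_L_one by (simp add: Alt_iff del: funpow.simps)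
  also have "(Lam ^^ n) ((L ^^ n) ext_one) = (\<Prod>i<n. real (Suc i) * (real n - real i)) *\<^sub>R ext_one"
    by (rule Lam_pow_L_pow) (use Alt_one Lam_low[of ext_one 0] in \<open>auto simp: hom_part_Alt\<close>)
  also have "(\<Prod>i<n. real (Suc i) * (real n - real i)) = fact n * fact n"
  proof -
    have 1: "(\<Prod>i<n. real (Suc i)) = fact n"
      by (simp add: fact_prod_Suc lessThan_atLeast0)
    have "(\<Prod>i<n. real n - real i) = (\<Prod>i<n. real (Suc i))"
      by (rule prod.reindex_bij_witness[of _ "\<lambda>i. n - Suc i" "\<lambda>i. n - Suc i"]) (auto simp: of_nat_diff)
    then show ?thesis using 1 by (simp add: prod.distrib)
  qed
  finally have "ext_part 0 (W vol) = ((- 1) ^ n / fact n * (1 / fact n * (fact n * fact n))) *\<^sub>R ext_one"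
    by (simp only: scaleR_scaleR)
  moreover have "(- 1 :: real) ^ n / fact n * (1 / fact n * (fact n * fact n)) = (- 1) ^ n" by simp
  ultimately have "ext_part 0 (W vol) = (- 1) ^ n *\<^sub>R ext_one" by (simp only:)
  then have "W vol [] = (- 1) ^ n" by (drule_tac fun_cong[of _ _ "[]"]) (simp add: ext_part_def ext_one_def)
  then show ?thesis using W0 by (simp only:)
qed

lemma Alt_expand:
  assumes a: "a \<in> Alt (Suc k)"
  shows "a = (1 / real (Suc k)) *\<^sub>R (\<Sum>b\<in>B. wedge (contr (dual b) w) (contr b a))"
proof -
  have "(\<Sum>b\<in>B. wedge (contr (dual b) w) (contr b a)) = (\<lambda>vs. 1 * real (length vs) * a vs)"
  proof (rule sum_wedge_contr[OF flat_Alt])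
    show "(\<Sum>b\<in>B. contr (dual b) w [v] *\<^sub>R b) = 1 *\<^sub>R v" for v
      by (simp add: contr_def w_dual onb_sum[OF B])
  qed (use a in \<open>simp add: Alt_iff\<close>)
  moreover have "real (length vs) * a vs = real (Suc k) * a vs" for vs
    using a by (cases "length vs = Suc k") (auto simp: Alt_def)
  ultimately show ?thesis by (simp add: fun_eq_iff)
qed

text \<open>By nondegeneracy every covector is of the form \<open>contr v w\<close>, for which
  \<open>W_wedge\<close> is stated; the step case therefore reaches all of \<open>Alt k\<close> up
  to linear combinations.\<close>

lemma Alt_induct [consumes 1, case_names zero one step add scale]:
  assumes "a \<in> Alt k"
    and zero: "\<And>k. Q k 0" and one: "Q 0 ext_one"
    and step: "\<And>k v a. a \<in> Alt k \<Longrightarrow> Q k a \<Longrightarrow> Q (Suc k) (wedge (contr v w) a)"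
    and add: "\<And>k a b. a \<in> Alt k \<Longrightarrow> b \<in> Alt k \<Longrightarrow> Q k a \<Longrightarrow> Q k b \<Longrightarrow> Q k (a + b)"
    and scale: "\<And>k a c. a \<in> Alt k \<Longrightarrow> Q k a \<Longrightarrow> Q k (c *\<^sub>R a)"
  shows "Q k a"
  using assms(1)
proof (induction k arbitrary: a)
  case 0
  then have "a = a [] *\<^sub>R ext_one" by (rule Alt_0)
  then show ?case using scale[OF Alt_one one] by metis
next
  case (Suc k)
  have c: "contr b a \<in> Alt k" for b using Alt_contr Suc.prems by blast
  have w: "wedge (contr (dual b) w) (contr b a) \<in> Alt (Suc k)" for b
    using Alt_wedge[OF flat_Alt c] by simp
  have A: "Q (Suc k) (\<Sum>b\<in>C. wedge (contr (dual b) w) (contr b a)) \<and>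
      (\<Sum>b\<in>C. wedge (contr (dual b) w) (contr b a)) \<in> Alt (Suc k)" for C
  proof (induction C rule: infinite_finite_induct)
    case (insert b C)
    then show ?case using add[OF w] step[OF c Suc.IH[OF c]] w
      by (auto simp del: fun_apply intro: subspace_add[OF subspace_Alt])
  qed (use zero in \<open>simp_all add: subspace_0[OF subspace_Alt] del: fun_apply\<close>)
  have "Q (Suc k) ((1 / real (Suc k)) *\<^sub>R (\<Sum>b\<in>B. wedge (contr (dual b) w) (contr b a)))"
    by (rule scale) (use A in auto)
  then show ?case unfolding Alt_expand[OF Suc.prems, symmetric] .
qed

text \<open>Each additional covector costs one sign, by \<open>W_wedge\<close> followed by
  \<open>W_contr\<close>, so the claim reduces to \<open>W_one\<close> and
  \<open>W_vol\<close>.\<close>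

lemma W_W: "a \<in> Alt k \<Longrightarrow> W (W a) = (- 1) ^ (n + k) *\<^sub>R a"
proof (induction k a rule: Alt_induct)
  case (zero k)
  show ?case by (simp only: lin_op_zero[OF W V] scaleR_zero_right)
next
  case one
  show ?case by (simp add: W_one W_vol)
next
  case (step k v a)
  then have a: "alt_form a" "alt_form (W a)" using lin_op_mem[OF W, of a] by (auto simp: Alt_iff)
  show ?case using W_wedge[OF a(1), of v] W_contr[OF a(2), of v] step by (simp del: fun_apply)
next
  case (add k a b)
  then have "alt_form a" "alt_form b" "alt_form (W a)" "alt_form (W b)"
    using lin_op_mem[OF W, of a] lin_op_mem[OF W, of b] by (auto simp: Alt_iff)
  then show ?case using add by (simp add: lin_op_add[OF W] scaleR_add_right del: fun_apply)
next
  case (scale k a c)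
  then have "alt_form a" "alt_form (W a)" using lin_op_mem[OF W, of a] by (auto simp: Alt_iff)
  then show ?case using scale by (simp add: lin_op_scale[OF W] del: fun_apply)
qed

lemma W_Alt: "a \<in> Alt k \<Longrightarrow> k \<le> 2 * n \<longrightarrow> W a \<in> Alt (2 * n - k)"
proof (induction k a rule: Alt_induct)
  case (zero k)
  then show ?case by (simp add: lin_op_zero[OF W V] subspace_0[OF subspace_Alt] del: fun_apply)
next
  case one
  show ?case using vol_Alt by (simp add: W_one)
next
  case (step k v a)
  then have a: "alt_form a" by (simp add: Alt_iff)
  show ?case
  proof
    assume k: "Suc k \<le> 2 * n"
    then have "W a \<in> Alt (Suc (2 * n - Suc k))" using step by (simp add: Suc_diff_Suc)
    then show "W (wedge (contr v w) a) \<in> Alt (2 * n - Suc k)" using W_wedge[OF a] Alt_contr by (simp del: fun_apply)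
  qed
next
  case (add k a b)
  then have "alt_form a" "alt_form b" by (auto simp: Alt_iff)
  then show ?case using add by (simp add: lin_op_add[OF W] subspace_add[OF subspace_Alt] del: fun_apply)
next
  case (scale k a c)
  then have "alt_form a" by (auto simp: Alt_iff)
  then show ?case using scale by (simp add: lin_op_scale[OF W] subspace_scale[OF subspace_Alt] del: fun_apply)
qed

end

section \<open>The symplectic star operator\<close>

declare fun_apply [simp del]

text \<open>The sign of reversing k factors; it is the factor by which the star and \<open>W\<close>
  differ in degree k.\<close>

definition star_sign :: "nat \<Rightarrow> real" where "star_sign k = (- 1) ^ (k * (k - 1) div 2)"

lemma star_sign_0 [simp]: "star_sign 0 = 1"
  by (simp add: star_sign_def)

lemma star_sign_Suc: "star_sign (Suc k) = (- 1) ^ k * star_sign k"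
proof -
  have "Suc k * k div 2 = k * (k - 1) div 2 + k"
  proof (cases k)
    case (Suc j)
    have "Suc k * k = (k * (k - 1)) + k * 2" by (simp add: Suc)
    then show ?thesis by (simp only: div_mult_self1 zero_neq_numeral not_False_eq_True)
  qed simp
  then show ?thesis by (simp add: star_sign_def power_add mult.commute)
qed

lemma wedge_list_Alt: "set as \<subseteq> Alt 1 \<Longrightarrow> wedge_list as \<in> Alt (length as)"
proof (induction as)
  case (Cons a as)
  then show ?case using Alt_wedge[of a 1 "wedge_list as" "length as"] by (simp add: wedge_list_def)
qed (simp add: wedge_list_def Alt_one)

lemma contr_wedge_list:
  assumes "set as \<subseteq> Alt 1"
  shows "contr u (wedge_list as) =
    (\<Sum>i<length as. ((- 1) ^ i * (as ! i) [u]) *\<^sub>R wedge_list (take i as @ drop (Suc i) as))"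
  using assms
proof (induction as)
  case Nil
  then show ?case by (auto simp: wedge_list_def contr_def ext_one_def fun_apply)
next
  case (Cons a as)
  have "contr u (wedge_list (a # as)) = a [u] *\<^sub>R wedge_list as - wedge a (contr u (wedge_list as))"
    using Cons.prems contr_wedge_covector[of a u "wedge_list as"] by (simp add: wedge_list_def)
  also have "wedge a (contr u (wedge_list as)) =
      (\<Sum>i<length as. ((- 1) ^ i * (as ! i) [u]) *\<^sub>R wedge_list (a # take i as @ drop (Suc i) as))"
  proof -
    have IH: "contr u (wedge_list as) =
        (\<Sum>i<length as. ((- 1) ^ i * (as ! i) [u]) *\<^sub>R wedge_list (take i as @ drop (Suc i) as))"
      using Cons by simp
    have wl: "wedge_list (a # xs) = wedge a (wedge_list xs)" for xs by (simp add: wedge_list_def)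
    show ?thesis unfolding IH wl wedge_sum_right wedge_scale_right by (rule refl)
  qed
  finally show ?case by (simp add: sum.lessThan_Suc_shift sum_negf[symmetric] del: sum.lessThan_Suc)
qed

definition decomposables :: "nat \<Rightarrow> 'e::real_vector ext set" where
  "decomposables k = {wedge_list as | as. set as \<subseteq> Alt 1 \<and> length as = k}"

context symplectic_space begin

lemma wedge_above_top:
  assumes "(a :: 'e ext) \<in> Alt j" "b \<in> Alt k" "j + k > 2 * n" shows "wedge a b = 0"
  using Alt_high[OF Alt_wedge[OF assms(1,2)]] assms(3) by simp

text \<open>The product of a and \<open>W b\<close> would have degree 2 n + 1 and so vanishes.
  Contracting it with \<open>sharp w t\<close>, and using that \<open>W\<close> turns wedging by t
  into this contraction, gives the identity, which trades a covector on the right for a contraction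
  on the left.\<close>

lemma wedge_W_wedge:
  assumes a: "a \<in> Alt (Suc k)" and t: "t \<in> Alt 1" and b: "b \<in> Alt k"
  shows "wedge a (star_sign (Suc k) *\<^sub>R W (wedge t b)) = wedge (contr (sharp w t) a) (star_sign k *\<^sub>R W b)"
proof -
  define u where "u = sharp w t"
  have tu: "t = contr u w" using contr_sharp[OF t] by (simp add: u_def)
  have bb: "alt_form b" using b by (simp add: Alt_iff)
  have "wedge a (W b) = 0"
  proof (cases "k \<le> 2 * n")
    case True
    then have "W b \<in> Alt (2 * n - k)" using W_Alt b by blast
    then show ?thesis using wedge_above_top[OF a] True by simp
  next
    case False
    then have "b = 0" using Alt_high[OF b] by simp
    then show ?thesis using lin_op_zero[OF W V] by simp
  qed
  then have "contr u (wedge a (W b)) = 0" by simp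
  then have "wedge (contr u a) (W b) = - ((- 1) ^ Suc k *\<^sub>R wedge a (contr u (W b)))"
    unfolding contr_wedge supp_deg_grade_inv[OF supp_deg_Alt[OF a]]
    by (simp only: add_eq_0_iff2 wedge_scale_left)
  also have "\<dots> = (- 1) ^ k *\<^sub>R wedge a (W (wedge t b))"
    unfolding tu W_wedge[OF bb] by (simp)
  finally have "wedge (contr u a) (W b) = (- 1) ^ k *\<^sub>R wedge a (W (wedge t b))" .
  then show ?thesis unfolding u_def[symmetric] by (simp add: star_sign_Suc mult.commute)
qed

text \<open>By \<open>wedge_W_wedge\<close> the first covector on the right is contracted into the
  left product, and the resulting alternating sum is the Laplace expansion along the first
  column.\<close>

lemma wedge_W_decomposable:
  assumes "set as \<subseteq> Alt 1" "set bs \<subseteq> Alt 1" "length as = k" "length bs = k"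
  shows "wedge (wedge_list as) (star_sign k *\<^sub>R W (wedge_list bs)) =
    Determinant.det (mat k k (\<lambda>(i, j). covector_pairing w (as ! i) (bs ! j))) *\<^sub>R vol"
  using assms
proof (induction k arbitrary: as bs)
  case 0
  then show ?case by (simp add: wedge_list_def W_one)
next
  case (Suc k)
  obtain t bs' where bs: "bs = t # bs'" "t \<in> Alt 1" "set bs' \<subseteq> Alt 1" "length bs' = k"
    using Suc.prems by (cases bs) auto
  define u where "u = sharp w t"
  let ?A = "mat (Suc k) (Suc k) (\<lambda>(i, j). covector_pairing w (as ! i) (bs ! j))"
  let ?o = "\<lambda>i. take i as @ drop (Suc i) as"
  have asA: "as ! i \<in> Alt 1" if "i < Suc k" for i using Suc.prems that by (metis nth_mem subsetD)
  have o: "set (?o i) \<subseteq> Alt 1" "length (?o i) = k" if "i < Suc k" for i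
    using Suc.prems that set_take_subset[of i as] set_drop_subset[of "Suc i" as] by auto
  have bk: "wedge_list bs' \<in> Alt k" using wedge_list_Alt[of bs'] bs by simp
  have ak: "wedge_list as \<in> Alt (Suc k)" using wedge_list_Alt[of as] Suc.prems by simp
  have "wedge (wedge_list as) (star_sign (Suc k) *\<^sub>R W (wedge_list bs)) =
      wedge (contr u (wedge_list as)) (star_sign k *\<^sub>R W (wedge_list bs'))"
    unfolding u_def using wedge_W_wedge[OF ak bs(2) bk] bs by (simp add: wedge_list_def)
  also have "\<dots> = (\<Sum>i<Suc k. ((- 1) ^ i * (as ! i) [u]) *\<^sub>R
      wedge (wedge_list (?o i)) (star_sign k *\<^sub>R W (wedge_list bs')))"
    by (simp only: contr_wedge_list[OF Suc.prems(1)] wedge_sum_left wedge_scale_left Suc.prems(3))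
  also have "\<dots> = (\<Sum>i<Suc k. (?A $$ (i, 0) * cofactor ?A i 0) *\<^sub>R vol)"
  proof (rule sum.cong)
    fix i assume "i \<in> {..<Suc k}"
    then have i: "i < Suc k" by simp
    have 1: "?A $$ (i, 0) = (as ! i) [u]"
      using i bs asA[OF i] by (simp add: covector_pairing_def sharp u_def)
    have "mat_delete ?A i 0 = mat k k (\<lambda>(l, j). covector_pairing w (?o i ! l) (bs' ! j))"
    proof (rule eq_matI)
      fix l j assume "l < dim_row (mat k k (\<lambda>(l, j). covector_pairing w (?o i ! l) (bs' ! j)))"
        "j < dim_col (mat k k (\<lambda>(l, j). covector_pairing w (?o i ! l) (bs' ! j)))"
      then have lj: "l < k" "j < k" by auto
      have "?o i ! l = as ! (if l < i then l else Suc l)"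
        using i lj Suc.prems by (auto simp: nth_append min_def)
      then show "mat_delete ?A i 0 $$ (l, j) = mat k k (\<lambda>(l, j). covector_pairing w (?o i ! l) (bs' ! j)) $$ (l, j)"
        using lj i bs by (simp add: mat_delete_def)
    qed (auto simp: mat_delete_def)
    then have "wedge (wedge_list (?o i)) (star_sign k *\<^sub>R W (wedge_list bs')) =
        Determinant.det (mat_delete ?A i 0) *\<^sub>R vol"
      using Suc.IH[OF o(1)[OF i] bs(3) o(2)[OF i] bs(4)] by simp
    then show "((- 1) ^ i * (as ! i) [u]) *\<^sub>R wedge (wedge_list (?o i)) (star_sign k *\<^sub>R W (wedge_list bs')) =
        (?A $$ (i, 0) * cofactor ?A i 0) *\<^sub>R vol"
      unfolding 1 by (simp add: cofactor_def mult_ac)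
  qed simp
  also have "\<dots> = Determinant.det ?A *\<^sub>R vol"
    by (subst laplace_expansion_column[of ?A "Suc k" 0]) (simp_all add: scaleR_left.sum del: sum.lessThan_Suc)
  finally show ?case .
qed

lemma decomposable_Alt: "a \<in> decomposables k \<Longrightarrow> a \<in> Alt k"
  using wedge_list_Alt by (auto simp: decomposables_def)

lemma Alt_span: "(a :: 'e ext) \<in> Alt k \<Longrightarrow> a \<in> span (decomposables k)"
proof (induction k a rule: Alt_induct)
  case (step k v a)
  have "wedge (contr v w) x \<in> span (decomposables (Suc k))" if "x \<in> span (decomposables k)" for x
    using that
  proof (induction x rule: span_induct_alt)
    case (step c x y)
    then obtain as where as: "x = wedge_list as" "set as \<subseteq> Alt 1" "length as = k" by (auto simp: decomposables_def)
    then have "wedge (contr v w) x = wedge_list (contr v w # as)" by (simp add: wedge_list_def)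
    then have "wedge (contr v w) x \<in> decomposables (Suc k)"
      using as flat_Alt unfolding decomposables_def by (metis (mono_tags, lifting) insert_subset length_Cons list.set(2) mem_Collect_eq)
    then show ?case using step by (simp add: wedge_add_right span_add span_scale span_base)
  qed (simp add: span_zero)
  then show ?case using step by blast
next
  case one
  show ?case by (rule span_base) (auto simp: decomposables_def wedge_list_def)
qed (auto simp: span_zero span_add span_scale)

section \<open>The pairing of forms and the defining property of the star\<close>

lemma vol_nonzero: "\<exists>xs. vol xs \<noteq> 0"
proof (rule ccontr)
  assume "\<not> ?thesis"
  then have "vol = 0" by (auto simp: fun_eq_iff fun_apply)
  then have "(- 1) ^ n *\<^sub>R (ext_one :: 'e ext) = 0" using W_vol lin_op_zero[OF W V] by simp
  then have "((- 1) ^ n *\<^sub>R (ext_one :: 'e ext)) [] = 0" by (simp add: zero_fun_apply)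
  then show False by (simp add: ext_one_def fun_apply)
qed

lemma wedge_W_lin:
  assumes "b \<in> Alt k" "c \<in> Alt k"
  shows "wedge a (star_sign k *\<^sub>R W (r *\<^sub>R b + s *\<^sub>R c)) =
    r *\<^sub>R wedge a (star_sign k *\<^sub>R W b) + s *\<^sub>R wedge a (star_sign k *\<^sub>R W c)"
  using assms lin_op_add[OF W, of "r *\<^sub>R b" "s *\<^sub>R c"] lin_op_scale[OF W, of b r] lin_op_scale[OF W, of c s]
  by (simp add: Alt_iff alt_scale wedge_add_right algebra_simps)

text \<open>The pairing is defined by choice, so existence has to be shown: the coefficient of
  \<open>vol\<close> in a wedge the signed \<open>W b\<close> has the required properties. It is
  read off at a list xs on which \<open>vol\<close> is nonzero.\<close>

lemma ext_pairing_exists: "\<exists>Q. is_ext_pairing w k Q"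
proof -
  obtain xs where xs: "vol xs \<noteq> 0" using vol_nonzero by blast
  define Q where "Q a b = wedge a (star_sign k *\<^sub>R W b) xs / vol xs" for a b
  have "is_ext_pairing w k Q"
    unfolding is_ext_pairing_def
  proof (intro conjI ballI allI impI)
    fix a b c :: "'e ext" and r s :: real assume A: "a \<in> Alt k" "b \<in> Alt k" "c \<in> Alt k"
    have e: "(\<lambda>vs. r * a vs + s * b vs) = r *\<^sub>R a + s *\<^sub>R b" by (auto simp: fun_apply)
    show "Q (\<lambda>vs. r * a vs + s * b vs) c = r * Q a c + s * Q b c"
      unfolding e Q_def by (simp add: wedge_add_left add_divide_distrib algebra_simps fun_apply)
    show "Q c (\<lambda>vs. r * a vs + s * b vs) = r * Q c a + s * Q c b"
      unfolding e Q_def wedge_W_lin[OF A(1,2)] by (simp add: add_divide_distrib fun_apply)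
  next
    fix as bs :: "'e ext list"
    assume "set as \<subseteq> Alt 1 \<and> set bs \<subseteq> Alt 1 \<and> length as = k \<and> length bs = k"
    then show "Q (wedge_list as) (wedge_list bs) =
        Determinant.det (mat k k (\<lambda>(i, j). covector_pairing w (as ! i) (bs ! j)))"
      unfolding Q_def using wedge_W_decomposable[of as bs k] xs by (simp add: fun_apply)
  qed
  then show ?thesis by blast
qed

text \<open>Whichever pairing was chosen, its values on decomposables are the determinants of
  \<open>wedge_W_decomposable\<close>; the identity then extends linearly, first in a with b
  decomposable and then in b.\<close>

lemma ext_pairing_vol:
  assumes "a \<in> Alt k" "b \<in> Alt k"
  shows "wedge a (star_sign k *\<^sub>R W b) = ext_pairing w k a b *\<^sub>R vol"
proof -
  define Q where "Q = ext_pairing w k"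
  have Q: "is_ext_pairing w k Q" unfolding Q_def ext_pairing_def using ext_pairing_exists by (rule someI_ex)
  have Q1: "Q (r *\<^sub>R a + s *\<^sub>R b) c = r * Q a c + s * Q b c" "Q c (r *\<^sub>R a + s *\<^sub>R b) = r * Q c a + s * Q c b"
    if "a \<in> Alt k" "b \<in> Alt k" "c \<in> Alt k" for a b c r s
  proof -
    have e: "(\<lambda>vs. r * a vs + s * b vs) = r *\<^sub>R a + s *\<^sub>R b" by (auto simp: fun_apply)
    show "Q (r *\<^sub>R a + s *\<^sub>R b) c = r * Q a c + s * Q b c" "Q c (r *\<^sub>R a + s *\<^sub>R b) = r * Q c a + s * Q c b"
      using Q that unfolding is_ext_pairing_def e[symmetric] by blast+
  qed
  have z: "(0 :: 'e ext) \<in> Alt k" by (rule subspace_0[OF subspace_Alt])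
  have Q0: "Q 0 c = 0" "Q c 0 = 0" if "c \<in> Alt k" for c
    using Q1(1)[OF z z that, of 0 0] Q1(2)[OF z z that, of 0 0] by (simp_all)
  have dec: "wedge x (star_sign k *\<^sub>R W b) = Q x b *\<^sub>R vol" if x: "x \<in> decomposables k" and b: "b \<in> decomposables k" for x b
  proof -
    obtain as bs where ab: "x = wedge_list as" "b = wedge_list bs" "set as \<subseteq> Alt 1" "set bs \<subseteq> Alt 1"
      "length as = k" "length bs = k" using x b by (auto simp: decomposables_def)
    have "Q x b = Determinant.det (mat k k (\<lambda>(i, j). covector_pairing w (as ! i) (bs ! j)))"
      using Q ab unfolding is_ext_pairing_def by blast
    then show ?thesis using wedge_W_decomposable[OF ab(3-6)] by (simp only: ab)
  qed
  have 1: "wedge a (star_sign k *\<^sub>R W b) = Q a b *\<^sub>R vol \<and> a \<in> Alt k" if b: "b \<in> decomposables k" and a: "a \<in> span (decomposables k)" for a b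
    using a
  proof (induction a rule: span_induct_alt)
    case base
    then show ?case using Q0(1)[OF decomposable_Alt[OF b]] z by (simp)
  next
    case (step c x y)
    have "c *\<^sub>R wedge x (star_sign k *\<^sub>R W b) = (c * Q x b) *\<^sub>R vol"
      unfolding scaleR_scaleR[symmetric] dec[OF step(1) b] by (rule refl)
    moreover have "Q (c *\<^sub>R x + 1 *\<^sub>R y) b = c * Q x b + 1 * Q y b"
      using Q1(1) step decomposable_Alt b by blast
    moreover have "c *\<^sub>R x + y \<in> Alt k"
      using step decomposable_Alt subspace_add[OF subspace_Alt] subspace_scale[OF subspace_Alt] by blast
    ultimately show ?case using step(2)
      by (simp only: wedge_add_left wedge_scale_left scaleR_add_left scaleR_scaleR scaleR_one mult_1 simp_thms)
  qed
  have 2: "wedge a (star_sign k *\<^sub>R W b) = Q a b *\<^sub>R vol \<and> b \<in> Alt k" if b: "b \<in> span (decomposables k)" and a: "a \<in> Alt k" for a b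
    using b
  proof (induction b rule: span_induct_alt)
    case base
    then show ?case using Q0(2)[OF a] z lin_op_zero[OF W V] by (simp)
  next
    case (step c x y)
    have x: "x \<in> Alt k" using step decomposable_Alt by blast
    have "Q a (c *\<^sub>R x + 1 *\<^sub>R y) = c * Q a x + 1 * Q a y"
      using Q1(2) step x a by blast
    moreover have "c *\<^sub>R x + y \<in> Alt k"
      using step x subspace_add[OF subspace_Alt] subspace_scale[OF subspace_Alt] by blast
    moreover have "wedge a (star_sign k *\<^sub>R W x) = Q a x *\<^sub>R vol" using 1[OF step(1) Alt_span[OF a]] by blast
    ultimately show ?case using step wedge_W_lin[of x k y a c 1] x by (simp add: scaleR_add_left)
  qed
  show ?thesis using 2[OF Alt_span[OF assms(2)] assms(1)] by (simp add: Q_def)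
qed

text \<open>Induction on k by moving a covector from a to c: if c wedged with every covector is
  zero, then c has top degree, which for k > 0 contradicts its degree unless c = 0.\<close>

lemma wedge_nondegenerate:
  assumes "c \<in> Alt (2 * n - k)" "k \<le> 2 * n" "\<And>a. a \<in> Alt k \<Longrightarrow> wedge a c = (0 :: 'e ext)" shows "c = 0"
  using assms
proof (induction k arbitrary: c)
  case 0
  then show ?case using Alt_one wedge_one(1) by metis
next
  case (Suc k)
  have "wedge (contr v w) c = 0" for v
  proof (rule Suc.IH)
    show "wedge (contr v w) c \<in> Alt (2 * n - k)"
    proof -
      have "1 + (2 * n - Suc k) = 2 * n - k" using Suc.prems(2) by simp
      then show ?thesis using Alt_wedge[OF flat_Alt Suc.prems(1), of v] by simp
    qed
    show "wedge a (wedge (contr v w) c) = 0" if "a \<in> Alt k" for a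
      using Suc.prems(3)[of "wedge a (contr v w)"] Alt_wedge[OF that flat_Alt, of v] by (simp add: wedge_assoc)
  qed (use Suc.prems in simp)
  then have "c \<in> Alt (2 * n)" using top_deg_if_wedge_zero Suc.prems(1) by (simp add: Alt_iff)
  moreover have "2 * n - Suc k \<noteq> 2 * n" using Suc.prems(2) by auto
  ultimately show ?case using hom_eq[unfolded hom_part_Alt] Suc.prems(1) by blast
qed

lemma vol_eq: "vol = (\<lambda>vs. wedge_power w n vs / fact n)"
proof -
  have "wedge_power w k = (L ^^ k) ext_one" for k
    by (induction k) (simp_all add: wedge_power_def wedge_list_def L_def)
  then show ?thesis by (auto simp: vol_def fun_apply)
qed

text \<open>Existence by \<open>ext_pairing_vol\<close> and uniqueness by
  \<open>wedge_nondegenerate\<close> give a meaning to the definite description of the star.\<close>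

lemma ext_star_deg_eq:
  assumes b: "b \<in> Alt k" and k: "k \<le> 2 * n"
  shows "ext_star_deg n w k b = star_sign k *\<^sub>R W b"
  unfolding ext_star_deg_def
proof (rule the_equality, intro conjI ballI)
  have e: "(\<lambda>vs. ext_pairing w k a b * (wedge_power w n vs / fact n)) = ext_pairing w k a b *\<^sub>R vol" for a
    by (auto simp: vol_eq fun_apply)
  show WA: "star_sign k *\<^sub>R W b \<in> Alt (2 * n - k)"
    using W_Alt b k subspace_scale[OF subspace_Alt] by blast
  show "wedge a (star_sign k *\<^sub>R W b) = (\<lambda>vs. ext_pairing w k a b * (wedge_power w n vs / fact n))" if "a \<in> Alt k" for a
    unfolding e by (rule ext_pairing_vol[OF that b])
  fix c assume c: "c \<in> Alt (2 * n - k) \<and>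
    (\<forall>a\<in>Alt k. wedge a c = (\<lambda>vs. ext_pairing w k a b * (wedge_power w n vs / fact n)))"
  have "c - star_sign k *\<^sub>R W b = 0"
  proof (rule wedge_nondegenerate[OF _ k])
    show "c - star_sign k *\<^sub>R W b \<in> Alt (2 * n - k)" using c WA subspace_diff[OF subspace_Alt] by blast
    show "wedge a (c - star_sign k *\<^sub>R W b) = 0" if "a \<in> Alt k" for a
      using c that ext_pairing_vol[OF that b] by (simp only: e wedge_diff_right) simp
  qed
  then show "c = star_sign k *\<^sub>R W b" by (simp)
qed

lemma ext_star_eq:
  assumes b: "b \<in> Alt k" shows "ext_star n w b = star_sign k *\<^sub>R W b"
proof -
  have "ext_star_deg n w j (ext_part j b) = (if j = k then star_sign k *\<^sub>R W b else 0)" if "j \<le> 2 * n" for j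
    using ext_star_deg_eq[of "ext_part j b" j] that b Alt_ext_part[of b j] ext_part_id[of k b] ext_part_neq[of k b j]
      lin_op_zero[OF W V] by (auto simp: Alt_iff)
  then have "(\<Sum>j\<le>2 * n. ext_star_deg n w j (ext_part j b)) = (\<Sum>j\<le>2 * n. if j = k then star_sign k *\<^sub>R W b else 0)"
    by (intro sum.cong) auto
  moreover have "ext_star n w b = (\<Sum>j\<le>2 * n. ext_star_deg n w j (ext_part j b))"
    by (auto simp: ext_star_def fun_apply)
  ultimately have "ext_star n w b = (\<Sum>j\<le>2 * n. if j = k then star_sign k *\<^sub>R W b else 0)" by simp
  also have "\<dots> = star_sign k *\<^sub>R W b"
    using Alt_high[OF b] lin_op_zero[OF W V] by (cases "k \<le> 2 * n") (auto)
  finally show ?thesis .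
qed

end

declare fun_apply [simp]

section \<open>Smooth functions\<close>

definition dd :: "'a::real_normed_vector \<Rightarrow> ('a \<Rightarrow> 'b::real_normed_vector) \<Rightarrow> 'a \<Rightarrow> 'b" where
  "dd v f = (\<lambda>x. frechet_derivative f (at x) v)"

lemma dd_eq: "(f has_derivative f') (at x) \<Longrightarrow> dd v f x = f' v"
  by (simp add: dd_def frechet_derivative_at[symmetric])

lemma dd_cong:
  assumes "open S" "x \<in> S" "\<And>y. y \<in> S \<Longrightarrow> f y = g y" "f differentiable at x"
  shows "dd v f x = dd v g x"
  using frechet_derivative_transform_within_open[OF assms(4,1,2,3)] by (simp add: dd_def)

lemma has_derivative_dd: "f differentiable at x \<Longrightarrow> (f has_derivative (\<lambda>v. dd v f x)) (at x)"
  using frechet_derivative_works[of f "at x"] by (simp add: dd_def)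

lemma Ck_on_Suc: "Ck_on (Suc k) S f \<longleftrightarrow> (\<forall>x\<in>S. f differentiable (at x)) \<and> (\<forall>v. Ck_on k S (dd v f))"
  by (simp add: dd_def)

declare Ck_on.simps(2) [simp del]

lemma Ck_on_subset: "Ck_on k S f \<Longrightarrow> T \<subseteq> S \<Longrightarrow> Ck_on k T f"
  by (induction k arbitrary: f) (auto simp: Ck_on_Suc intro: continuous_on_subset)

lemma differentiable_transform:
  assumes "open S" "x \<in> S" "\<And>y. y \<in> S \<Longrightarrow> f y = g y" "f differentiable at x"
  shows "g differentiable at x"
  by (rule differentiableI[OF has_derivative_transform_within_open[OF has_derivative_dd[OF assms(4)] assms(1,2,3)]])

lemma Ck_on_cong:
  assumes S: "open S" and "\<And>x. x \<in> S \<Longrightarrow> f x = g x" "Ck_on k S f" shows "Ck_on k S g"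
  using assms(2,3)
proof (induction k arbitrary: f g)
  case 0
  then show ?case using continuous_on_cong by (metis Ck_on.simps(1))
next
  case (Suc k)
  have f: "f differentiable at x" if "x \<in> S" for x using Suc.prems(2) that by (simp add: Ck_on_Suc)
  have g: "g differentiable at x" if "x \<in> S" for x
    by (rule differentiable_transform[OF S that Suc.prems(1) f[OF that]])
  have "Ck_on k S (dd v g)" for v
  proof (rule Suc.IH[of "dd v f"])
    show "dd v f x = dd v g x" if "x \<in> S" for x
      by (rule dd_cong[OF S that Suc.prems(1) f[OF that]])
    show "Ck_on k S (dd v f)" using Suc.prems(2) by (simp add: Ck_on_Suc)
  qed
  then show ?case using g by (simp add: Ck_on_Suc)
qed

lemma Ck_on_SucI:
  assumes "open S" "\<And>x. x \<in> S \<Longrightarrow> (f has_derivative f' x) (at x)" "\<And>v. Ck_on k S (\<lambda>x. f' x v)"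
  shows "Ck_on (Suc k) S f"
proof -
  have "Ck_on k S (dd v f)" for v
    by (rule Ck_on_cong[OF assms(1) _ assms(3)[of v]]) (use assms(2) dd_eq in fastforce)
  then show ?thesis using assms(2) by (auto simp: Ck_on_Suc intro: differentiableI)
qed

lemma Ck_on_SucD:
  assumes "Ck_on (Suc k) S f"
  shows "x \<in> S \<Longrightarrow> (f has_derivative (\<lambda>v. dd v f x)) (at x)" "Ck_on k S (dd v f)"
  using assms by (auto simp: Ck_on_Suc has_derivative_dd)

lemma Ck_on_Suc_imp: "Ck_on (Suc k) S f \<Longrightarrow> Ck_on k S f"
proof (induction k arbitrary: f)
  case 0
  then show ?case
    by (auto simp: Ck_on_Suc intro!: continuous_at_imp_continuous_on differentiable_imp_continuous_within)
next
  case (Suc k)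
  then show ?case using Ck_on_Suc[of k] Ck_on_Suc[of "Suc k"] by blast
qed

lemma Ck_on_continuous: "Ck_on k S f \<Longrightarrow> continuous_on S f"
  by (induction k) (auto dest: Ck_on_Suc_imp)

lemma Ck_on_const: "open S \<Longrightarrow> Ck_on k S (\<lambda>x. c)"
proof (induction k arbitrary: c)
  case (Suc k)
  show ?case by (rule Ck_on_SucI[OF Suc.prems has_derivative_const]) (rule Suc.IH[OF Suc.prems])
qed simp

lemma Ck_on_add: "open S \<Longrightarrow> Ck_on k S f \<Longrightarrow> Ck_on k S g \<Longrightarrow> Ck_on k S (\<lambda>x. f x + g x)"
proof (induction k arbitrary: f g)
  case (Suc k)
  have 1: "((\<lambda>x. f x + g x) has_derivative (\<lambda>v. dd v f x + dd v g x)) (at x)" if "x \<in> S" for x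
    by (rule has_derivative_add[OF Ck_on_SucD(1)[OF Suc.prems(2) that] Ck_on_SucD(1)[OF Suc.prems(3) that]])
  have 2: "Ck_on k S (\<lambda>x. dd v f x + dd v g x)" for v
    by (rule Suc.IH[OF Suc.prems(1) Ck_on_SucD(2)[OF Suc.prems(2)] Ck_on_SucD(2)[OF Suc.prems(3)]])
  show ?case by (rule Ck_on_SucI[OF Suc.prems(1) 1 2])
qed (auto intro: continuous_on_add)

lemma Ck_on_linear: "bounded_linear L \<Longrightarrow> open S \<Longrightarrow> Ck_on k S f \<Longrightarrow> Ck_on k S (\<lambda>x. L (f x))"
proof (induction k arbitrary: f)
  case (Suc k)
  have 1: "((\<lambda>x. L (f x)) has_derivative (\<lambda>v. L (dd v f x))) (at x)" if "x \<in> S" for x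
    by (rule bounded_linear.has_derivative[OF Suc.prems(1) Ck_on_SucD(1)[OF Suc.prems(3) that]])
  have 2: "Ck_on k S (\<lambda>x. L (dd v f x))" for v
    by (rule Suc.IH[OF Suc.prems(1,2) Ck_on_SucD(2)[OF Suc.prems(3)]])
  show ?case by (rule Ck_on_SucI[OF Suc.prems(2) 1 2])
qed (auto intro: bounded_linear.continuous_on)

lemma Ck_on_bilinear:
  assumes h: "bounded_bilinear h" and S: "open S"
  shows "Ck_on k S f \<Longrightarrow> Ck_on k S g \<Longrightarrow> Ck_on k S (\<lambda>x. h (f x) (g x))"
proof (induction k arbitrary: f g)
  case 0
  then show ?case using bounded_bilinear.continuous_on[OF h] by auto
next
  case (Suc k)
  have "Ck_on k S (\<lambda>x. h (f x) (dd v g x) + h (dd v f x) (g x))" for v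
    by (intro Ck_on_add[OF S] Suc.IH Ck_on_Suc_imp[OF Suc.prems(1)] Ck_on_Suc_imp[OF Suc.prems(2)]
        Ck_on_SucD(2)[OF Suc.prems(1)] Ck_on_SucD(2)[OF Suc.prems(2)])
  then show ?case
    using Ck_on_SucI[OF S bounded_bilinear.FDERIV[OF h Ck_on_SucD(1)[OF Suc.prems(1)] Ck_on_SucD(1)[OF Suc.prems(2)]]]
    by blast
qed

lemma Ck_on_id: "bounded_linear L \<Longrightarrow> open S \<Longrightarrow> Ck_on k S L"
proof (cases k)
  case 0
  then show "bounded_linear L \<Longrightarrow> ?thesis" by (simp add: linear_continuous_on)
next
  case (Suc j)
  assume L: "bounded_linear L" and S: "open S"
  show ?thesis unfolding Suc
    by (rule Ck_on_SucI[OF S bounded_linear.has_derivative[OF L has_derivative_ident]]) (rule Ck_on_const[OF S])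
qed

lemma Ck_on_sum: "open S \<Longrightarrow> (\<And>i. i \<in> I \<Longrightarrow> Ck_on k S (f i)) \<Longrightarrow> Ck_on k S (\<lambda>x. \<Sum>i\<in>I. f i x)"
  by (induction I rule: infinite_finite_induct) (auto intro: Ck_on_const Ck_on_add)

text \<open>\<open>Ck_on\<close> differentiates in constant directions, whereas the chain rule
  produces the varying direction \<open>dd v g x\<close>; expanding it in an orthonormal basis
  restores constant directions.\<close>

lemma Ck_on_compose:
  fixes g :: "'a::real_normed_vector \<Rightarrow> 'b::real_inner" and f :: "'b \<Rightarrow> 'c::real_normed_vector"
  assumes B: "onb (B :: 'b set)" and S: "open S" and T: "open T" and sub: "\<And>x. x \<in> S \<Longrightarrow> g x \<in> T"
  shows "Ck_on k T f \<Longrightarrow> Ck_on k S g \<Longrightarrow> Ck_on k S (\<lambda>x. f (g x))"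
proof (induction k arbitrary: f)
  case 0
  then show ?case using continuous_on_compose2[of T f S g] sub by auto
next
  case (Suc k)
  have f': "(f has_derivative (\<lambda>v. dd v f (g x))) (at (g x))" if "x \<in> S" for x
    using Ck_on_SucD(1)[OF Suc.prems(1)] sub[OF that] by blast
  have chain: "((\<lambda>x. f (g x)) has_derivative (\<lambda>v. dd (dd v g x) f (g x))) (at x)" if "x \<in> S" for x
    using has_derivative_compose[OF Ck_on_SucD(1)[OF Suc.prems(2) that] f'[OF that]] .
  have "Ck_on k S (\<lambda>x. dd (dd v g x) f (g x))" for v
  proof (rule Ck_on_cong[OF S])
    show "(\<Sum>b\<in>B. inner b (dd v g x) *\<^sub>R dd b f (g x)) = dd (dd v g x) f (g x)" if "x \<in> S" for x
      using onb_linear[OF B has_derivative_linear[OF f'[OF that]], of "dd v g x"] by simp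
    show "Ck_on k S (\<lambda>x. \<Sum>b\<in>B. inner b (dd v g x) *\<^sub>R dd b f (g x))"
      by (intro Ck_on_sum[OF S] Ck_on_bilinear[OF bounded_bilinear_scaleR S] Ck_on_linear[OF bounded_linear_inner_right S]
          Ck_on_SucD(2)[OF Suc.prems(2)] Suc.IH Ck_on_SucD(2)[OF Suc.prems(1)] Ck_on_Suc_imp[OF Suc.prems(2)])
  qed
  then show ?case using Ck_on_SucI[OF S chain] by blast
qed

lemma Ck_on_inverse:
  fixes f :: "'a::real_normed_vector \<Rightarrow> real"
  assumes S: "open S" and nz: "\<And>x. x \<in> S \<Longrightarrow> f x \<noteq> 0"
  shows "Ck_on k S f \<Longrightarrow> Ck_on k S (\<lambda>x. inverse (f x))"
proof (induction k)
  case 0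
  then show ?case using nz by (auto intro: continuous_on_inverse)
next
  case (Suc k)
  have 1: "((\<lambda>x. inverse (f x)) has_derivative (\<lambda>v. - (inverse (f x) * dd v f x * inverse (f x)))) (at x)" if "x \<in> S" for x
    by (rule Deriv.has_derivative_inverse[OF nz[OF that] Ck_on_SucD(1)[OF Suc.prems that]])
  have "Ck_on k S (\<lambda>x. - (inverse (f x) * dd v f x * inverse (f x)))" for v
    by (intro Ck_on_linear[OF bounded_linear_minus[OF bounded_linear_ident] S] Ck_on_bilinear[OF bounded_bilinear_mult S]
        Suc.IH Ck_on_Suc_imp[OF Suc.prems] Ck_on_SucD(2)[OF Suc.prems])
  then show ?case using Ck_on_SucI[OF S 1] by blast
qed

lemma Ck_on_local:
  assumes "\<And>x. x \<in> S \<Longrightarrow> \<exists>T. open T \<and> x \<in> T \<and> Ck_on k T f"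
  shows "Ck_on k S f"
  using assms
proof (induction k arbitrary: f)
  case 0
  have "continuous (at x) f" if "x \<in> S" for x
    using 0[OF that] continuous_on_eq_continuous_at by (metis Ck_on.simps(1))
  then show ?case by (simp add: continuous_at_imp_continuous_on)
next
  case (Suc k)
  have "f differentiable at x" if "x \<in> S" for x using Suc.prems[OF that] by (auto simp: Ck_on_Suc)
  moreover have "Ck_on k S (dd v f)" for v
    by (rule Suc.IH) (use Suc.prems in \<open>auto simp: Ck_on_Suc, blast\<close>)
  ultimately show ?case by (simp add: Ck_on_Suc)
qed

lemma smooth_onD: "smooth_on S f \<Longrightarrow> Ck_on k S f"
  by (simp add: smooth_on_def)

lemma smooth_on_subset: "smooth_on S f \<Longrightarrow> T \<subseteq> S \<Longrightarrow> smooth_on T f"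
  by (auto simp: smooth_on_def intro: Ck_on_subset)

lemma smooth_on_cong: "open S \<Longrightarrow> (\<And>x. x \<in> S \<Longrightarrow> f x = g x) \<Longrightarrow> smooth_on S f \<Longrightarrow> smooth_on S g"
  unfolding smooth_on_def using Ck_on_cong by blast

lemma smooth_on_local:
  "(\<And>x. x \<in> S \<Longrightarrow> \<exists>T. open T \<and> x \<in> T \<and> smooth_on T f) \<Longrightarrow> smooth_on S f"
  unfolding smooth_on_def by (intro allI Ck_on_local) blast

lemma smooth_on_continuous: "smooth_on S f \<Longrightarrow> continuous_on S f"
  using Ck_on_continuous smooth_onD by blast

lemma smooth_on_has_derivative: "smooth_on S f \<Longrightarrow> x \<in> S \<Longrightarrow> (f has_derivative (\<lambda>v. dd v f x)) (at x)"
  using Ck_on_SucD(1) smooth_onD by blast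

lemma smooth_on_differentiable: "smooth_on S f \<Longrightarrow> x \<in> S \<Longrightarrow> f differentiable at x"
  using smooth_on_has_derivative[of S f x] by (rule differentiableI)

lemma smooth_on_dd: "smooth_on S f \<Longrightarrow> smooth_on S (dd v f)"
  unfolding smooth_on_def using Ck_on_SucD(2) by blast

lemma smooth_on_const [simp]: "open S \<Longrightarrow> smooth_on S (\<lambda>x. c)"
  and smooth_on_add: "open S \<Longrightarrow> smooth_on S f \<Longrightarrow> smooth_on S g \<Longrightarrow> smooth_on S (\<lambda>x. f x + g x)"
  and smooth_on_linear: "bounded_linear L \<Longrightarrow> open S \<Longrightarrow> smooth_on S h \<Longrightarrow> smooth_on S (\<lambda>x. L (h x))"
  and smooth_on_id: "bounded_linear L' \<Longrightarrow> open S \<Longrightarrow> smooth_on S L'"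
  and smooth_on_sum: "open S \<Longrightarrow> (\<And>i. i \<in> I \<Longrightarrow> smooth_on S (F i)) \<Longrightarrow> smooth_on S (\<lambda>x. \<Sum>i\<in>I. F i x)"
  by (auto simp: smooth_on_def intro: Ck_on_const Ck_on_add Ck_on_linear Ck_on_id Ck_on_sum)

lemma smooth_on_mult: "open S \<Longrightarrow> smooth_on S f \<Longrightarrow> smooth_on S g \<Longrightarrow> smooth_on S (\<lambda>x. f x * (g x :: real))"
  by (auto simp: smooth_on_def intro: Ck_on_bilinear[OF bounded_bilinear_mult])

lemma smooth_on_inner: "open S \<Longrightarrow> smooth_on S f \<Longrightarrow> smooth_on S (\<lambda>x. inner b (f x))"
  by (rule smooth_on_linear[OF bounded_linear_inner_right])

lemma smooth_on_prod:
  assumes "open S" "\<And>i. i \<in> I \<Longrightarrow> smooth_on S (f i)" shows "smooth_on S (\<lambda>x. \<Prod>i\<in>I. (f i x :: real))"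
  using assms by (induction I rule: infinite_finite_induct) (auto intro: smooth_on_mult)

lemma smooth_on_inverse:
  "open S \<Longrightarrow> (\<And>x. x \<in> S \<Longrightarrow> f x \<noteq> 0) \<Longrightarrow> smooth_on S f \<Longrightarrow> smooth_on S (\<lambda>x. inverse (f x :: real))"
  by (rule smooth_on_def[THEN iffD2], rule allI, rule Ck_on_inverse) (simp_all add: smooth_on_def)

lemma smooth_on_compose:
  fixes g :: "'a::real_normed_vector \<Rightarrow> 'b::real_inner" and f :: "'b \<Rightarrow> 'c::real_normed_vector"
  assumes "onb (B :: 'b set)" "open S" "open T" "\<And>x. x \<in> S \<Longrightarrow> g x \<in> T" "smooth_on T f" "smooth_on S g"
  shows "smooth_on S (\<lambda>x. f (g x))"
  by (rule smooth_on_def[THEN iffD2], rule allI,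
      rule Ck_on_compose[OF assms(1-4) smooth_onD[OF assms(5)] smooth_onD[OF assms(6)]])

lemma smooth_on_Pair:
  fixes f :: "'a::real_normed_vector \<Rightarrow> 'b::real_normed_vector" and g :: "'a \<Rightarrow> 'c::real_normed_vector"
  assumes "open S" "smooth_on S f" "smooth_on S g" shows "smooth_on S (\<lambda>x. (f x, g x))"
proof -
  have l: "bounded_linear (\<lambda>y :: 'b. (y, 0 :: 'c))" "bounded_linear (\<lambda>y :: 'c. (0 :: 'b, y))"
    by (auto intro!: bounded_linear_Pair bounded_linear_ident bounded_linear_zero)
  have "smooth_on S (\<lambda>x. (f x, 0) + (0, g x))"
    by (rule smooth_on_add[OF assms(1) smooth_on_linear[OF l(1) assms(1,2)] smooth_on_linear[OF l(2) assms(1,3)]])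
  then show ?thesis by simp
qed

lemma linear_dd: "f differentiable at x \<Longrightarrow> linear (\<lambda>v. dd v f x)"
  by (rule has_derivative_linear[OF has_derivative_dd])

lemma dd_chain:
  assumes "g differentiable at x" "f differentiable at (g x)"
  shows "dd v (\<lambda>x. f (g x)) x = dd (dd v g x) f (g x)"
  by (rule dd_eq[OF has_derivative_compose[OF has_derivative_dd[OF assms(1)] has_derivative_dd[OF assms(2)]]])

lemma onb_Times:
  assumes "onb (B :: 'a::real_inner set)" "onb (C :: 'b::real_inner set)"
  shows "onb ((\<lambda>b. (b, 0)) ` B \<union> (\<lambda>c. (0, c)) ` C)"
  unfolding onb_def
proof (intro conjI)
  show "finite ((\<lambda>b. (b, 0 :: 'b)) ` B \<union> (\<lambda>c. (0 :: 'a, c)) ` C)" using assms by (simp add: onb_def)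
  have "0 \<notin> B" "0 \<notin> C" using assms unfolding onb_def by (metis inner_zero_left zero_neq_one)+
  then show "\<forall>b\<in>(\<lambda>b. (b, 0)) ` B \<union> (\<lambda>c. (0, c)) ` C. \<forall>c\<in>(\<lambda>b. (b, 0)) ` B \<union> (\<lambda>c. (0, c)) ` C.
      inner b c = (if b = c then 1 else 0)"
    by (auto simp: inner_prod_def onb_inner[OF assms(1)] onb_inner[OF assms(2)] split: if_split_asm)
  have "(x, y) \<in> span ((\<lambda>b. (b, 0)) ` B \<union> (\<lambda>c. (0, c)) ` C)" for x y
  proof -
    have "(x, y) = (\<Sum>b\<in>B. inner b x *\<^sub>R (b, 0)) + (\<Sum>c\<in>C. inner c y *\<^sub>R (0, c))"
      using onb_sum[OF assms(1), of x] onb_sum[OF assms(2), of y]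
      by (simp add: prod_eq_iff fst_sum snd_sum)
    moreover have "\<dots> \<in> span ((\<lambda>b. (b, 0)) ` B \<union> (\<lambda>c. (0, c)) ` C)"
      by (intro span_add span_sum span_scale span_base) auto
    ultimately show ?thesis by simp
  qed
  then show "span ((\<lambda>b. (b, 0)) ` B \<union> (\<lambda>c. (0, c)) ` C) = UNIV" by auto
qed

subsection \<open>Symmetry of second derivatives\<close>

lemma has_real_derivative_line:
  fixes f :: "'a::real_normed_vector \<Rightarrow> real"
  assumes "f differentiable at (p + s *\<^sub>R v)"
  shows "((\<lambda>s. f (p + s *\<^sub>R v)) has_real_derivative dd v f (p + s *\<^sub>R v)) (at s)"
proof -
  have "((\<lambda>s. f (p + s *\<^sub>R v)) has_derivative (\<lambda>h. dd (h *\<^sub>R v) f (p + s *\<^sub>R v))) (at s)"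
  proof (rule has_derivative_compose[where g = f and g' = "\<lambda>u. dd u f (p + s *\<^sub>R v)"])
    show "((\<lambda>s. p + s *\<^sub>R v) has_derivative (\<lambda>h. h *\<^sub>R v)) (at s)" by (auto intro!: derivative_eq_intros)
    show "(f has_derivative (\<lambda>u. dd u f (p + s *\<^sub>R v))) (at (p + s *\<^sub>R v))" by (rule has_derivative_dd[OF assms])
  qed
  moreover have "dd (h *\<^sub>R v) f (p + s *\<^sub>R v) = dd v f (p + s *\<^sub>R v) * h" for h
    using linear_scale[OF linear_dd[OF assms], of h v] by simp
  ultimately have "((\<lambda>s. f (p + s *\<^sub>R v)) has_derivative (\<lambda>h. dd v f (p + s *\<^sub>R v) * h)) (at s)" by simp
  then show ?thesis by (simp only: has_field_derivative_def)
qed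

text \<open>Mean value theorem in s for f (x + h w + s v) - f (x + s v), then in t for the
  difference of the derivatives along v.\<close>

lemma second_difference:
  fixes f :: "'a::real_normed_vector \<Rightarrow> real"
  assumes f: "Ck_on 2 S f" and h: "h > 0"
    and S: "\<And>s t. 0 \<le> s \<Longrightarrow> s \<le> h \<Longrightarrow> 0 \<le> t \<Longrightarrow> t \<le> h \<Longrightarrow> x + s *\<^sub>R v + t *\<^sub>R w \<in> S"
  shows "\<exists>s t. 0 \<le> s \<and> s \<le> h \<and> 0 \<le> t \<and> t \<le> h \<and>
    f (x + h *\<^sub>R v + h *\<^sub>R w) - f (x + h *\<^sub>R v) - f (x + h *\<^sub>R w) + f x = h * h * dd w (dd v f) (x + s *\<^sub>R v + t *\<^sub>R w)"
proof -
  have d1: "f differentiable at y" if "y \<in> S" for y using f that by (simp add: numeral_2_eq_2 Ck_on_Suc)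
  have d2: "dd v f differentiable at y" if "y \<in> S" for y using f that by (simp add: numeral_2_eq_2 Ck_on_Suc)
  have g: "((\<lambda>s. f ((x + h *\<^sub>R w) + s *\<^sub>R v) - f (x + s *\<^sub>R v)) has_real_derivative
      dd v f ((x + h *\<^sub>R w) + s *\<^sub>R v) - dd v f (x + s *\<^sub>R v)) (at s)" if "0 \<le> s" "s \<le> h" for s
    using S[OF that, of h] S[OF that, of 0] h
    by (intro DERIV_diff has_real_derivative_line d1) (simp_all add: ac_simps)
  obtain s where s: "0 < s" "s < h" "f ((x + h *\<^sub>R w) + h *\<^sub>R v) - f (x + h *\<^sub>R v) - (f ((x + h *\<^sub>R w) + 0 *\<^sub>R v) - f (x + 0 *\<^sub>R v)) =
      (h - 0) * (dd v f ((x + h *\<^sub>R w) + s *\<^sub>R v) - dd v f (x + s *\<^sub>R v))"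
    using MVT2[OF h g] by auto
  have k: "((\<lambda>t. dd v f ((x + s *\<^sub>R v) + t *\<^sub>R w)) has_real_derivative dd w (dd v f) ((x + s *\<^sub>R v) + t *\<^sub>R w)) (at t)"
    if "0 \<le> t" "t \<le> h" for t
    by (intro has_real_derivative_line d2 S) (use s that in auto)
  obtain t where t: "0 < t" "t < h" "dd v f ((x + s *\<^sub>R v) + h *\<^sub>R w) - dd v f ((x + s *\<^sub>R v) + 0 *\<^sub>R w) =
      (h - 0) * dd w (dd v f) ((x + s *\<^sub>R v) + t *\<^sub>R w)"
    using MVT2[OF h k] by auto
  show ?thesis
    by (rule exI[of _ s], rule exI[of _ t]) (use s t in \<open>simp add: ac_simps\<close>)
qed

lemma dd_commute_real:
  fixes f :: "'a::real_normed_vector \<Rightarrow> real"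
  assumes S: "open S" and f: "Ck_on 2 S f" and x: "x \<in> S"
  shows "dd w (dd v f) x = dd v (dd w f) x"
proof (rule ccontr)
  define e where "e = \<bar>dd w (dd v f) x - dd v (dd w f) x\<bar> / 2"
  assume "dd w (dd v f) x \<noteq> dd v (dd w f) x"
  then have e: "e > 0" by (simp add: e_def)
  have cont: "isCont (dd w (dd v f)) x" "isCont (dd v (dd w f)) x"
    using f S x by (auto simp: numeral_2_eq_2 Ck_on_Suc continuous_on_eq_continuous_at)
  obtain r where r: "r > 0" "ball x r \<subseteq> S" using S x open_contains_ball by blast
  obtain r1 where r1: "r1 > 0" "\<And>y. dist y x < r1 \<Longrightarrow> dist (dd w (dd v f) y) (dd w (dd v f) x) < e"
    using cont(1) e unfolding continuous_at_eps_delta by metis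
  obtain r2 where r2: "r2 > 0" "\<And>y. dist y x < r2 \<Longrightarrow> dist (dd v (dd w f) y) (dd v (dd w f) x) < e"
    using cont(2) e unfolding continuous_at_eps_delta by metis
  define R where "R = min r (min r1 r2)"
  \<comment> \<open>Small enough that the parallelogram spanned by h v and h w stays within distance
    R of x; the summand 1 covers v = w = 0.\<close>
  define h where "h = R / (norm v + norm w + 1)"
  have R: "R > 0" using r r1 r2 by (simp add: R_def)
  have h: "h > 0" unfolding h_def using R by (intro divide_pos_pos) (auto intro: add_nonneg_pos)
  have small: "dist (x + s *\<^sub>R v + t *\<^sub>R w) x < R" if "0 \<le> s" "s \<le> h" "0 \<le> t" "t \<le> h" for s t
  proof -
    have "dist (x + s *\<^sub>R v + t *\<^sub>R w) x = norm (s *\<^sub>R v + t *\<^sub>R w)" by (simp add: dist_norm add.assoc)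
    also have "\<dots> \<le> s * norm v + t * norm w" using that norm_triangle_ineq[of "s *\<^sub>R v" "t *\<^sub>R w"] by simp
    also have "\<dots> \<le> h * norm v + h * norm w" using that by (intro add_mono mult_right_mono) auto
    also have "\<dots> < h * (norm v + norm w + 1)" using h by (simp add: algebra_simps)
    also have "\<dots> = R" unfolding h_def by (simp add: add_nonneg_pos less_imp_neq[symmetric])
    finally show ?thesis .
  qed
  have inS: "x + s *\<^sub>R v + t *\<^sub>R w \<in> S" if "0 \<le> s" "s \<le> h" "0 \<le> t" "t \<le> h" for s t
    using small[OF that] r by (auto simp: R_def dist_commute subset_iff)
  obtain s t where st: "0 \<le> s" "s \<le> h" "0 \<le> t" "t \<le> h"
    "f (x + h *\<^sub>R v + h *\<^sub>R w) - f (x + h *\<^sub>R v) - f (x + h *\<^sub>R w) + f x = h * h * dd w (dd v f) (x + s *\<^sub>R v + t *\<^sub>R w)"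
    using second_difference[OF f h inS] by blast
  have inS': "x + s *\<^sub>R w + t *\<^sub>R v \<in> S" if "0 \<le> s" "s \<le> h" "0 \<le> t" "t \<le> h" for s t
    using inS[OF that(3,4,1,2)] by (simp add: ac_simps)
  obtain s' t' where st': "0 \<le> s'" "s' \<le> h" "0 \<le> t'" "t' \<le> h"
    "f (x + h *\<^sub>R w + h *\<^sub>R v) - f (x + h *\<^sub>R w) - f (x + h *\<^sub>R v) + f x = h * h * dd v (dd w f) (x + s' *\<^sub>R w + t' *\<^sub>R v)"
    using second_difference[OF f h inS'] by blast
  have "h * h * dd w (dd v f) (x + s *\<^sub>R v + t *\<^sub>R w) = h * h * dd v (dd w f) (x + s' *\<^sub>R w + t' *\<^sub>R v)"
  proof -
    have sw: "x + h *\<^sub>R w + h *\<^sub>R v = x + h *\<^sub>R v + h *\<^sub>R w" by simp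
    show ?thesis using st(5) st'(5)[unfolded sw] by linarith
  qed
  then have eq: "dd w (dd v f) (x + s *\<^sub>R v + t *\<^sub>R w) = dd v (dd w f) (x + t' *\<^sub>R v + s' *\<^sub>R w)"
    using h by (simp add: ac_simps)
  have 1: "dist (dd w (dd v f) (x + s *\<^sub>R v + t *\<^sub>R w)) (dd w (dd v f) x) < e"
    using small[OF st(1-4)] by (intro r1) (simp add: R_def)
  have 2: "dist (dd v (dd w f) (x + t' *\<^sub>R v + s' *\<^sub>R w)) (dd v (dd w f) x) < e"
    using small[OF st'(3,4,1,2)] by (intro r2) (simp add: R_def)
  have "dist (dd w (dd v f) x) (dd v (dd w f) x) < 2 * e"
    using dist_triangle_less_add[OF 1[unfolded dist_commute[of _ "dd w (dd v f) x"]]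
        2[folded eq, unfolded dist_commute[of _ "dd v (dd w f) x"]]] by simp
  then show False by (simp add: e_def dist_real_def)
qed

lemma dd_commute:
  fixes f :: "'a::real_normed_vector \<Rightarrow> 'c::real_inner"
  assumes S: "open S" and f: "smooth_on S f" and x: "x \<in> S"
  shows "dd w (dd v f) x = dd v (dd w f) x"
proof -
  have in1: "dd v (\<lambda>y. inner c (f y)) y = inner c (dd v f y)" if "smooth_on S f" "y \<in> S" for c v y and f :: "'a \<Rightarrow> 'c"
    by (rule dd_eq[OF bounded_linear.has_derivative[OF bounded_linear_inner_right smooth_on_has_derivative[OF that]]])
  have sm: "smooth_on S (\<lambda>y. inner c (f y))" for c by (rule smooth_on_inner[OF S f])
  have *: "inner c (dd w (dd v f) x) = dd w (dd v (\<lambda>y. inner c (f y))) x" for c v w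
  proof -
    have "dd w (\<lambda>y. inner c (dd v f y)) x = dd w (dd v (\<lambda>y. inner c (f y))) x"
      by (rule dd_cong[OF S x]) (use in1[OF f] smooth_on_differentiable[OF smooth_on_inner[OF S smooth_on_dd[OF f]] x] in auto)
    then show ?thesis using in1[OF smooth_on_dd[OF f] x] by simp
  qed
  have "inner c (dd w (dd v f) x) = inner c (dd v (dd w f) x)" for c
    by (subst *, subst *, rule dd_commute_real[OF S smooth_onD[OF sm] x])
  then show ?thesis by (rule vector_eq_ldot[THEN iffD1, OF allI])
qed

section \<open>Differential forms on open sets\<close>

declare fun_apply [simp del]

lemma dd_const [simp]: "dd v (\<lambda>x. c) x = 0"
  by (rule dd_eq[OF has_derivative_const, simplified])

lemma dd_add: "f differentiable at x \<Longrightarrow> g differentiable at x \<Longrightarrow> dd v (\<lambda>x. f x + g x) x = dd v f x + dd v g x"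
  by (rule dd_eq[OF has_derivative_add[OF has_derivative_dd has_derivative_dd]])

lemma dd_scaleR: "f differentiable at x \<Longrightarrow> dd v (\<lambda>x. c *\<^sub>R f x) x = c *\<^sub>R dd v f x"
  by (rule dd_eq[OF has_derivative_scaleR_right[OF has_derivative_dd]])

lemma dd_cmult: "f differentiable at x \<Longrightarrow> dd v (\<lambda>x. c * f x) x = c * dd v f x" for c :: real
  using dd_scaleR[of f x v c] by simp

lemma dd_mult: "f differentiable at x \<Longrightarrow> g differentiable at x \<Longrightarrow>
    dd v (\<lambda>x. f x * g x) x = f x * dd v g x + dd v f x * g x" for f g :: "_ \<Rightarrow> real"
  by (rule dd_eq[OF has_derivative_mult[OF has_derivative_dd has_derivative_dd]])

lemma dd_sum:
  assumes "\<And>i. i \<in> I \<Longrightarrow> f i differentiable at x"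
  shows "dd v (\<lambda>x. \<Sum>i\<in>I. f i x) x = (\<Sum>i\<in>I. dd v (f i) x)"
  by (rule dd_eq[OF has_derivative_sum[OF has_derivative_dd[OF assms]]])

definition ed :: "('a::real_normed_vector \<Rightarrow> 'a ext) \<Rightarrow> 'a \<Rightarrow> 'a ext" where
  "ed a x = (\<lambda>vs. \<Sum>i<length vs. (- 1) ^ i * dd (vs ! i) (\<lambda>y. a y (take i vs @ drop (Suc i) vs)) x)"

lemma ed_Nil [simp]: "ed a x [] = 0"
  by (simp add: ed_def)

text \<open>Cartan's formula for a constant vector field v. As with \<open>wedge_Cons\<close>, it
  turns later identities into inductions over the list of arguments.\<close>

lemma ed_Cons: "ed a x (v # vs) = dd v (\<lambda>y. a y vs) x - ed (\<lambda>y. contr v (a y)) x vs"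
  by (simp add: ed_def sum.lessThan_Suc_shift sum_negf[symmetric] contr_def del: sum.lessThan_Suc)

definition sform :: "'a::real_normed_vector set \<Rightarrow> ('a \<Rightarrow> 'b ext) \<Rightarrow> bool" where
  "sform S a \<longleftrightarrow> open S \<and> (\<forall>vs. smooth_on S (\<lambda>x. a x vs))"

definition ddf :: "'a::real_normed_vector \<Rightarrow> ('a \<Rightarrow> 'b ext) \<Rightarrow> 'a \<Rightarrow> 'b ext" where
  "ddf v a x = (\<lambda>vs. dd v (\<lambda>y. a y vs) x)"

lemma contr_ed: "contr v (ed a x) = ddf v a x - ed (\<lambda>y. contr v (a y)) x"
  by (auto simp: fun_eq_iff fun_apply ddf_def ed_Cons contr_def[of v "ed a x"])

lemma sformD: "sform S a \<Longrightarrow> open S" "sform S a \<Longrightarrow> smooth_on S (\<lambda>x. a x vs)"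
  by (auto simp: sform_def)

lemma sform_diff: "sform S a \<Longrightarrow> x \<in> S \<Longrightarrow> (\<lambda>x. a x vs) differentiable at x"
  using smooth_on_differentiable sformD(2) by blast

lemma sform_contr: "sform S a \<Longrightarrow> sform S (\<lambda>x. contr v (a x))"
  by (simp add: sform_def contr_def)

lemma sform_ddf: "sform S a \<Longrightarrow> sform S (ddf v a)"
  using smooth_on_dd[of S] by (auto simp: sform_def ddf_def)

lemma sform_add: "sform S a \<Longrightarrow> sform S b \<Longrightarrow> sform S (\<lambda>x. a x + b x)"
  and sform_scaleR: "sform S a \<Longrightarrow> sform S (\<lambda>x. c *\<^sub>R a x)"
  and sform_grade_inv: "sform S a \<Longrightarrow> sform S (\<lambda>x. grade_inv (a x))"
  by (auto simp: sform_def fun_apply grade_inv_def intro: smooth_on_add smooth_on_mult)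

lemma sform_minus: "sform S a \<Longrightarrow> sform S (\<lambda>x. - a x)"
  using sform_scaleR[of S a "-1"] by simp

lemma sform_sum: "open S \<Longrightarrow> (\<And>i. i \<in> I \<Longrightarrow> sform S (a i)) \<Longrightarrow> sform S (\<lambda>x. \<Sum>i\<in>I. a i x)"
  by (auto simp: sform_def fun_apply intro: smooth_on_sum)

lemma sform_const: "open S \<Longrightarrow> sform S (\<lambda>x. a)"
  by (simp add: sform_def)

lemma sform_wedge: "sform S a \<Longrightarrow> sform S b \<Longrightarrow> sform S (\<lambda>x. wedge (a x) (b x))"
  by (auto simp: sform_def wedge_def intro!: smooth_on_sum smooth_on_mult)

lemma sform_ed: "sform S a \<Longrightarrow> sform S (ed a)"
  using smooth_on_dd[of S] by (auto simp: sform_def ed_def intro!: smooth_on_sum smooth_on_mult)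

lemma sform_subset: "sform S a \<Longrightarrow> open T \<Longrightarrow> T \<subseteq> S \<Longrightarrow> sform T a"
  by (auto simp: sform_def intro: smooth_on_subset)

lemma sform_cong: "(\<And>x. x \<in> S \<Longrightarrow> a x = b x) \<Longrightarrow> sform S a \<Longrightarrow> sform S b"
  unfolding sform_def by (metis (no_types, lifting) smooth_on_cong)

lemma ed_cong:
  assumes "sform S a" "x \<in> S" "\<And>y. y \<in> S \<Longrightarrow> a y = b y" shows "ed a x = ed b x"
  unfolding ed_def
proof (intro ext sum.cong refl arg_cong2[where f = "(*)"])
  fix vs i show "dd (vs ! i) (\<lambda>y. a y (take i vs @ drop (Suc i) vs)) x = dd (vs ! i) (\<lambda>y. b y (take i vs @ drop (Suc i) vs)) x"
    by (rule dd_cong[OF sformD(1)[OF assms(1)] assms(2)]) (use assms sform_diff in auto)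
qed

lemma ed_add: "sform S a \<Longrightarrow> sform S b \<Longrightarrow> x \<in> S \<Longrightarrow> ed (\<lambda>x. a x + b x) x = ed a x + ed b x"
  by (auto simp: ed_def fun_eq_iff fun_apply dd_add sform_diff algebra_simps sum.distrib)

lemma ed_scaleR: "sform S a \<Longrightarrow> x \<in> S \<Longrightarrow> ed (\<lambda>x. c *\<^sub>R a x) x = c *\<^sub>R ed a x"
  by (auto simp: ed_def fun_eq_iff fun_apply dd_cmult sform_diff sum_distrib_left mult_ac)

lemma ed_minus: "sform S a \<Longrightarrow> x \<in> S \<Longrightarrow> ed (\<lambda>x. - a x) x = - ed a x"
  using ed_scaleR[of S a x "-1"] by simp

lemma ed_diff: "sform S a \<Longrightarrow> sform S b \<Longrightarrow> x \<in> S \<Longrightarrow> ed (\<lambda>x. a x - b x) x = ed a x - ed b x"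
  using ed_add[OF _ sform_minus, of S a b x] ed_minus[of S b x] by simp

lemma ed_sum: "open S \<Longrightarrow> (\<And>i. i \<in> I \<Longrightarrow> sform S (a i)) \<Longrightarrow> x \<in> S \<Longrightarrow>
    ed (\<lambda>x. \<Sum>i\<in>I. a i x) x = (\<Sum>i\<in>I. ed (a i) x)"
proof (induction I rule: infinite_finite_induct)
  case (insert i I)
  then show ?case using ed_add[of S "a i" "\<lambda>x. \<Sum>i\<in>I. a i x" x] sform_sum[of S I a] by simp
qed (auto simp: ed_def fun_eq_iff fun_apply)

lemma ed_grade_inv: "sform S a \<Longrightarrow> x \<in> S \<Longrightarrow> ed (\<lambda>x. grade_inv (a x)) x = - grade_inv (ed a x)"
proof
  fix vs assume a: "sform S a" "x \<in> S"
  show "ed (\<lambda>x. grade_inv (a x)) x vs = (- grade_inv (ed a x)) vs"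
  proof (cases vs)
    case (Cons v ws)
    have "length (take i vs @ drop (Suc i) vs) = length ws" if "i < length vs" for i
      using that Cons by simp
    then have "ed (\<lambda>x. grade_inv (a x)) x vs = (\<Sum>i<length vs. (- 1) ^ length ws * ((- 1) ^ i * dd (vs ! i) (\<lambda>y. a y (take i vs @ drop (Suc i) vs)) x))"
      unfolding ed_def by (intro sum.cong) (auto simp: grade_inv_def dd_cmult sform_diff[OF a] simp del: length_append)
    then show ?thesis by (simp add: ed_def grade_inv_def fun_apply sum_distrib_left[symmetric] Cons)
  qed (simp add: grade_inv_def fun_apply)
qed

lemma ddf_wedge:
  assumes "sform S a" "sform S b" "x \<in> S"
  shows "ddf v (\<lambda>x. wedge (a x) (b x)) x = wedge (ddf v a x) (b x) + wedge (a x) (ddf v b x)"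
proof
  fix vs
  note d = sform_diff[OF assms(1,3)] sform_diff[OF assms(2,3)]
  have "ddf v (\<lambda>x. wedge (a x) (b x)) x vs = (\<Sum>I\<in>Pow {..<length vs}.
     (-1) ^ card {(i, j). i \<in> I \<and> j \<in> {..<length vs} - I \<and> j < i} *
       (a x (nths vs I) * dd v (\<lambda>x. b x (nths vs (- I))) x + dd v (\<lambda>x. a x (nths vs I)) x * b x (nths vs (- I))))"
    unfolding ddf_def wedge_def
    by (subst dd_sum) (auto intro!: differentiable_mult d sum.cong simp: dd_cmult dd_mult d mult.assoc)
  then show "ddf v (\<lambda>x. wedge (a x) (b x)) x vs = (wedge (ddf v a x) (b x) + wedge (a x) (ddf v b x)) vs"
    by (simp add: wedge_def ddf_def fun_apply algebra_simps sum.distrib)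
qed

lemma ed_wedge:
  assumes "sform S a" "sform S b" "x \<in> S"
  shows "ed (\<lambda>x. wedge (a x) (b x)) x = wedge (ed a x) (b x) + wedge (grade_inv (a x)) (ed b x)"
proof
  fix vs
  show "ed (\<lambda>x. wedge (a x) (b x)) x vs = (wedge (ed a x) (b x) + wedge (grade_inv (a x)) (ed b x)) vs"
    using assms
  proof (induction vs arbitrary: a b)
    case Nil
    then show ?case by (simp add: fun_apply)
  next
    case (Cons v vs)
    note sm = Cons.prems
    have "ed (\<lambda>y. contr v (wedge (a y) (b y))) x vs =
        (ed (\<lambda>y. wedge (contr v (a y)) (b y)) x + ed (\<lambda>y. wedge (grade_inv (a y)) (contr v (b y))) x) vs"
      unfolding contr_wedge
      by (subst ed_add[OF sform_wedge[OF sform_contr[OF sm(1)] sm(2)] sform_wedge[OF sform_grade_inv[OF sm(1)] sform_contr[OF sm(2)]] sm(3)]) simp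
    also have "\<dots> = (wedge (ed (\<lambda>y. contr v (a y)) x) (b x) - wedge (grade_inv (contr v (a x))) (- ed b x)
        + (wedge (- grade_inv (ed a x)) (contr v (b x)) + wedge (a x) (ed (\<lambda>y. contr v (b y)) x))) vs"
      using Cons.IH[OF sform_contr[OF sm(1)] sm(2,3), of v] Cons.IH[OF sform_grade_inv[OF sm(1)] sform_contr[OF sm(2)] sm(3), of v]
      by (simp add: plus_fun_apply minus_apply ed_grade_inv[OF sm(1,3)])
    finally have 1: "ed (\<lambda>y. contr v (wedge (a y) (b y))) x vs = \<dots>" .
    have 2: "dd v (\<lambda>y. wedge (a y) (b y) vs) x = (wedge (ddf v a x) (b x) + wedge (a x) (ddf v b x)) vs"
      using fun_cong[OF ddf_wedge[OF sm], of v vs] by (simp add: ddf_def)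
    have "(wedge (ed a x) (b x) + wedge (grade_inv (a x)) (ed b x)) (v # vs) =
       contr v (wedge (ed a x) (b x) + wedge (grade_inv (a x)) (ed b x)) vs" by (simp add: contr_def)
    also have "\<dots> = ((wedge (ddf v a x) (b x) + wedge (a x) (ddf v b x)) -
      (wedge (ed (\<lambda>y. contr v (a y)) x) (b x) - wedge (grade_inv (contr v (a x))) (- ed b x)
        + (wedge (- grade_inv (ed a x)) (contr v (b x)) + wedge (a x) (ed (\<lambda>y. contr v (b y)) x)))) vs"
      by (rule arg_cong[where f = "\<lambda>g. g vs"])
        (simp add: contr_wedge contr_ed wedge_diff_left wedge_diff_right)
    finally show ?case unfolding ed_Cons 1 2 by (simp add: minus_apply)
  qed
qed

text \<open>This is where the symmetry of second derivatives enters; \<open>ed_ed\<close> then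
  follows from the recursion over the arguments.\<close>

lemma dd_ed:
  assumes a: "sform S a" and x: "x \<in> S"
  shows "dd v (\<lambda>y. ed a y vs) x = ed (ddf v a) x vs"
proof -
  have *: "(\<lambda>y. dd (vs ! i) (\<lambda>z. a z ws) y) differentiable at x" for i ws
    using smooth_on_differentiable[OF smooth_on_dd[OF sformD(2)[OF a]] x] by simp
  have "dd v (\<lambda>y. ed a y vs) x = (\<Sum>i<length vs. (- 1) ^ i * dd v (dd (vs ! i) (\<lambda>z. a z (take i vs @ drop (Suc i) vs))) x)"
    unfolding ed_def by (subst dd_sum) (auto intro!: sum.cong differentiable_mult * simp: dd_cmult *)
  also have "\<dots> = ed (ddf v a) x vs"
    unfolding ed_def ddf_def
    by (intro sum.cong refl) (simp add: dd_commute[OF sformD(1)[OF a] sformD(2)[OF a] x, of v])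
  finally show ?thesis .
qed

lemma ed_ed:
  assumes "sform S a" "x \<in> S" shows "ed (ed a) x = 0"
proof
  fix vs show "ed (ed a) x vs = 0 vs"
    using assms
  proof (induction vs arbitrary: a)
    case (Cons v vs)
    have "ed (\<lambda>y. contr v (ed a y)) x = ed (ddf v a) x - ed (ed (\<lambda>y. contr v (a y))) x"
      unfolding contr_ed by (rule ed_diff[OF sform_ddf[OF Cons.prems(1)] sform_ed[OF sform_contr[OF Cons.prems(1)]] Cons.prems(2)])
    then show ?case
      using Cons.IH[OF sform_contr[OF Cons.prems(1)] Cons.prems(2), of v] dd_ed[OF Cons.prems, of v vs]
      by (simp add: ed_Cons fun_apply)
  qed (simp add: zero_fun_apply)
qed

lemma ed_function: "ed (\<lambda>y. u y *\<^sub>R ext_one) x = covec (\<lambda>v. dd v u x)"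
proof
  fix vs show "ed (\<lambda>y. u y *\<^sub>R ext_one) x vs = covec (\<lambda>v. dd v u x) vs"
  proof (cases vs)
    case (Cons v ws)
    have c: "contr v (u y *\<^sub>R ext_one) = 0" for y by (auto simp: contr_def ext_one_def fun_apply)
    have "ed (\<lambda>y. 0) x ws = 0" by (simp add: ed_def zero_fun_apply)
    then show ?thesis using Cons unfolding Cons ed_Cons c by (cases ws) (auto simp: covec_def ext_one_def fun_apply)
  qed (simp add: covec_def)
qed

definition pbk :: "('a::real_normed_vector \<Rightarrow> 'b::real_normed_vector) \<Rightarrow> ('b \<Rightarrow> 'b ext) \<Rightarrow> 'a \<Rightarrow> 'a ext" where
  "pbk f a x = (\<lambda>vs. a (f x) (map (\<lambda>v. dd v f x) vs))"

lemma wedge_map: "wedge a b (map F vs) = wedge (\<lambda>vs. a (map F vs)) (\<lambda>vs. b (map F vs)) vs"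
  by (simp add: wedge_def nths_map)

lemma pbk_wedge: "pbk f (\<lambda>y. wedge (a y) (b y)) x = wedge (pbk f a x) (pbk f b x)"
  by (simp add: pbk_def wedge_map fun_eq_iff)

lemma alt_comp_map: "alt_form a \<Longrightarrow> linear F \<Longrightarrow> alt_form (\<lambda>vs. a (map F vs))"
proof -
  assume a: "alt_form a" and F: "linear F"
  have "linear (\<lambda>v. a (map F (us @ v # ws)))" for us ws
    using linear_compose[OF F alt_formD(1)[OF a, of "map F us" "map F ws"]] by (simp add: o_def)
  moreover have "\<not> distinct (map F vs)" if "\<not> distinct vs" for vs using that by (simp add: distinct_map)
  ultimately show ?thesis using alt_formD(2)[OF a] by (simp add: alt_form_def)
qed

lemma sform_pbk:
  fixes f :: "'a::real_normed_vector \<Rightarrow> 'b::real_inner"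
  assumes B: "onb (B :: 'b set)" and S: "open S" and f: "smooth_on S f" "\<And>x. x \<in> S \<Longrightarrow> f x \<in> T"
    and a: "sform T a" "\<And>y. y \<in> T \<Longrightarrow> alt_form (a y)"
  shows "sform S (pbk f a)"
proof -
  \<comment> \<open>Generalized to a list starting with constant vectors, so that the arguments
    depending on x can be expanded in the basis one at a time.\<close>
  have "smooth_on S (\<lambda>x. a (f x) (us @ map (\<lambda>v. dd v f x) vs))" for us vs
  proof (induction vs arbitrary: us)
    case Nil
    show ?case using smooth_on_compose[OF B S sformD(1)[OF a(1)] f(2) sformD(2)[OF a(1)] f(1)] by simp
  next
    case (Cons v vs)
    show ?case
    proof (rule smooth_on_cong[OF S])
      show "(\<Sum>b\<in>B. inner b (dd v f x) * a (f x) ((us @ [b]) @ map (\<lambda>v. dd v f x) vs)) = a (f x) (us @ map (\<lambda>v. dd v f x) (v # vs))"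
        if "x \<in> S" for x
        using onb_linear[OF B alt_formD(1)[OF a(2)[OF f(2)[OF that]]], of us "dd v f x" "map (\<lambda>v. dd v f x) vs"] by simp
      show "smooth_on S (\<lambda>x. \<Sum>b\<in>B. inner b (dd v f x) * a (f x) ((us @ [b]) @ map (\<lambda>v. dd v f x) vs))"
        by (intro smooth_on_sum S smooth_on_mult smooth_on_inner smooth_on_dd f(1) Cons.IH)
    qed
  qed
  from this[of "[]"] show ?thesis using S by (simp add: sform_def pbk_def)
qed

text \<open>Naturality of the exterior derivative, by induction on the degree: write
  \<open>a = (k + 1)\<^sup>-\<^sup>1 \<Sum>\<^sub>b \<theta>\<^sub>b \<and> \<iota>\<^sub>b a\<close> with constant covectors and use the Leibniz rule.\<close>

lemma ed_pbk:
  fixes f :: "'a::real_normed_vector \<Rightarrow> 'b::real_inner"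
  assumes B: "onb (B :: 'b set)" and S: "open S" and f: "smooth_on S f" "\<And>x. x \<in> S \<Longrightarrow> f x \<in> T"
    and a: "sform T a" "\<And>y. y \<in> T \<Longrightarrow> alt_form (a y)" and x: "x \<in> S"
  shows "ed (pbk f a) x = pbk f (ed a) x"
proof -
  note T = sformD(1)[OF a(1)]
  have hom: "ed (pbk f a) x = pbk f (ed a) x" if "sform T a" "\<And>y. y \<in> T \<Longrightarrow> a y \<in> Alt k" for a k
    using that
  proof (induction k arbitrary: a)
    case 0
    define u where "u y = a y []" for y
    have u: "smooth_on T u" unfolding u_def by (rule sformD(2)[OF 0(1)])
    have au: "a y = u y *\<^sub>R ext_one" if "y \<in> T" for y unfolding u_def by (rule Alt_0[OF 0(2)[OF that]])
    have pf: "pbk f a y = u (f y) *\<^sub>R ext_one" if "y \<in> S" for y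
      unfolding pbk_def au[OF f(2)[OF that]] by (auto simp: fun_eq_iff fun_apply ext_one_def)
    have "ed (pbk f a) x = ed (\<lambda>y. u (f y) *\<^sub>R ext_one) x"
      by (rule ed_cong[OF sform_pbk[OF B S f 0(1)] x pf]) (use 0(2) in \<open>auto simp: Alt_iff\<close>)
    also have "\<dots> = covec (\<lambda>v. dd (dd v f x) u (f x))"
      unfolding ed_function
      by (simp add: dd_chain[OF smooth_on_differentiable[OF f(1) x] smooth_on_differentiable[OF u f(2)[OF x]]])
    also have "\<dots> = pbk f (ed (\<lambda>y. u y *\<^sub>R ext_one)) x"
      unfolding pbk_def ed_function by (auto simp: covec_def fun_eq_iff length_Suc_conv)
    also have "\<dots> = pbk f (ed a) x"
      unfolding pbk_def using ed_cong[OF 0(1) f(2)[OF x] au] by simp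
    finally show ?case .
  next
    case (Suc k)
    define t where "t b = covec (inner b :: 'b \<Rightarrow> real)" for b
    have t: "t b \<in> Alt 1" for b unfolding t_def by (intro covec_Alt) (auto simp: linear_iff inner_add_right)
    have tg: "grade_inv (t b) = - t b" for b using supp_deg_grade_inv[OF supp_deg_Alt[OF t]] by simp
    let ?c = "\<lambda>b y. contr b (a y)"
    have expand: "a y = (1 / real (Suc k)) *\<^sub>R (\<Sum>b\<in>B. wedge (t b) (?c b y))" if "y \<in> T" for y
    proof -
      have "(\<Sum>b\<in>B. wedge (t b) (?c b y)) = (\<lambda>vs. 1 * real (length vs) * a y vs)"
      proof (rule sum_wedge_contr[OF t])
        show "(\<Sum>b\<in>B. t b [v] *\<^sub>R b) = 1 *\<^sub>R v" for v by (simp add: t_def onb_sum[OF B])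
      qed (use Suc.prems(2)[OF that] in \<open>simp add: Alt_iff\<close>)
      moreover have "real (length vs) * a y vs = real (Suc k) * a y vs" for vs
        using Suc.prems(2)[OF that] by (cases "length vs = Suc k") (auto simp: Alt_def)
      ultimately show ?thesis by (simp add: fun_eq_iff fun_apply)
    qed
    have c: "sform T (?c b)" "\<And>y. y \<in> T \<Longrightarrow> ?c b y \<in> Alt k" "\<And>y. y \<in> T \<Longrightarrow> alt_form (?c b y)" for b
    proof -
      show "sform T (?c b)" by (rule sform_contr[OF Suc.prems(1)])
      show "?c b y \<in> Alt k" if "y \<in> T" for y by (rule Alt_contr[OF Suc.prems(2)[OF that]])
      then show "alt_form (?c b y)" if "y \<in> T" for y using that by (simp add: Alt_iff)
    qed
    have ct: "sform T (\<lambda>y. t b)" "alt_form (t b)" for b using sform_const[OF T] t by (auto simp: Alt_iff)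
    have ed_t: "ed (\<lambda>y. t b) y = 0" for b y by (auto simp: ed_def fun_eq_iff fun_apply)
    have sw: "sform T (\<lambda>y. wedge (t b) (?c b y))" for b by (rule sform_wedge[OF ct(1) c(1)])
    have eda: "ed a y = (1 / real (Suc k)) *\<^sub>R (\<Sum>b\<in>B. - wedge (t b) (ed (?c b) y))" if y: "y \<in> T" for y
    proof -
      have "ed a y = ed (\<lambda>y. (1 / real (Suc k)) *\<^sub>R (\<Sum>b\<in>B. wedge (t b) (?c b y))) y"
        by (rule ed_cong[OF Suc.prems(1) y expand])
      also have "\<dots> = (1 / real (Suc k)) *\<^sub>R (\<Sum>b\<in>B. ed (\<lambda>y. wedge (t b) (?c b y)) y)"
        by (subst ed_scaleR[OF sform_sum[OF T sw] y], subst ed_sum[OF T sw y]) (rule refl)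
      finally show ?thesis by (simp add: ed_wedge[OF ct(1) c(1) y] ed_t tg)
    qed
    \<comment> \<open>The pullback of a constant covector is the differential of a coordinate
      function of f, hence closed; so the Leibniz rule produces matching terms before and after
      pulling back.\<close>
    define s where "s b y = pbk f (\<lambda>y. t b) y" for b y
    have s_ed: "s b y = ed (\<lambda>z. inner b (f z) *\<^sub>R ext_one) y" if "y \<in> S" for b y
      unfolding s_def ed_function pbk_def
      by (auto simp: fun_eq_iff covec_def t_def length_Suc_conv
          dd_eq[OF bounded_linear.has_derivative[OF bounded_linear_inner_right smooth_on_has_derivative[OF f(1) that]]])
    have g0: "sform S (\<lambda>z. inner b (f z) *\<^sub>R ext_one)" for b
      using S smooth_on_inner[OF S f(1)] by (auto simp: sform_def fun_apply intro: smooth_on_mult)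
    have s: "sform S (s b)" for b by (rule sform_cong[OF s_ed[symmetric] sform_ed[OF g0]])
    have ed_s: "ed (s b) x = 0" for b
      using ed_cong[OF s x s_ed] ed_ed[OF g0 x] by simp
    have sg: "grade_inv (s b y) = - s b y" for b y
      by (auto simp: s_def pbk_def grade_inv_def t_def covec_def fun_eq_iff fun_apply)
    note pc = sform_pbk[OF B S f c(1) c(3)]
    have sw': "sform S (\<lambda>y. wedge (s b y) (pbk f (?c b) y))" for b by (rule sform_wedge[OF s pc])
    have pa: "pbk f a y = (1 / real (Suc k)) *\<^sub>R (\<Sum>b\<in>B. wedge (s b y) (pbk f (?c b) y))" if "y \<in> S" for y
    proof -
      have "pbk f a y = (\<lambda>vs. (1 / real (Suc k)) * (\<Sum>b\<in>B. pbk f (\<lambda>y. wedge (t b) (?c b y)) y vs))"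
        unfolding pbk_def fun_eq_iff by (subst expand[OF f(2)[OF that]]) (simp add: fun_apply)
      then show ?thesis by (simp add: pbk_wedge s_def fun_eq_iff fun_apply)
    qed
    have "ed (pbk f a) x = ed (\<lambda>y. (1 / real (Suc k)) *\<^sub>R (\<Sum>b\<in>B. wedge (s b y) (pbk f (?c b) y))) x"
      by (rule ed_cong[OF sform_pbk[OF B S f Suc.prems(1)] x pa]) (use Suc.prems(2) in \<open>auto simp: Alt_iff\<close>)
    also have "\<dots> = (1 / real (Suc k)) *\<^sub>R (\<Sum>b\<in>B. ed (\<lambda>y. wedge (s b y) (pbk f (?c b) y)) x)"
      by (subst ed_scaleR[OF sform_sum[OF S sw'] x], subst ed_sum[OF S sw' x]) (rule refl)
    also have "\<dots> = (1 / real (Suc k)) *\<^sub>R (\<Sum>b\<in>B. - wedge (s b x) (pbk f (ed (?c b)) x))"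
      by (simp add: ed_wedge[OF s pc x] ed_s sg Suc.IH[OF c(1,2)])
    also have "\<dots> = pbk f (ed a) x"
      unfolding pbk_def[of f "ed a"] eda[OF f(2)[OF x]]
      by (simp add: fun_eq_iff fun_apply s_def pbk_def wedge_map)
    finally show ?case .
  qed
  show ?thesis
  proof
    fix vs :: "'a list"
    \<comment> \<open>At a list vs only the component of degree \<open>length vs - 1\<close> enters,
      so the homogeneous case suffices; for the empty list both sides are 0.\<close>
    define k where "k = length vs - 1"
    let ?p = "\<lambda>y. ext_part k (a y)"
    have p: "sform T ?p" "\<And>y. y \<in> T \<Longrightarrow> ?p y \<in> Alt k"
    proof -
      have "smooth_on T (\<lambda>y. ext_part k (a y) vs)" for vs
        using sformD(2)[OF a(1)] T by (cases "length vs = k") (auto simp: ext_part_def)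
      then show "sform T ?p" using T by (simp add: sform_def)
      show "?p y \<in> Alt k" if "y \<in> T" for y by (rule Alt_ext_part[OF a(2)[OF that]])
    qed
    have len: "length (take i vs @ drop (Suc i) vs) = k" if "i < length vs" for i using that by (simp add: k_def)
    have 1: "ed (pbk f a) x vs = ed (pbk f ?p) x vs"
      unfolding ed_def by (intro sum.cong refl) (auto simp: pbk_def ext_part_def k_def)
    have "ed a (f x) (map (\<lambda>v. dd v f x) vs) = ed ?p (f x) (map (\<lambda>v. dd v f x) vs)"
      unfolding ed_def by (intro sum.cong refl) (auto simp: ext_part_def k_def)
    then show "ed (pbk f a) x vs = pbk f (ed a) x vs"
      unfolding 1 using fun_cong[OF hom[of ?p k, OF p], of vs] by (simp add: pbk_def)
  qed
qed

lemma alt_ed: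
  assumes B: "onb (B :: 'b::real_inner set)" and a: "sform T a" "\<And>y. y \<in> T \<Longrightarrow> alt_form (a y :: 'b ext)" and y: "y \<in> T"
  shows "alt_form (ed a y)"
proof -
  note T = sformD(1)[OF a(1)]
  have lin: "linear (\<lambda>v. ed a y (us @ v # ws))" if "sform T a" "\<And>y. y \<in> T \<Longrightarrow> alt_form (a y)" for a us ws
    using that
  proof (induction us arbitrary: a)
    case Nil
    have 1: "linear (\<lambda>v. dd v (\<lambda>y. a y ws) y)" by (rule linear_dd[OF sform_diff[OF Nil(1) y]])
    have 2: "linear (\<lambda>v. ed (\<lambda>y. contr v (a y)) y ws)"
    proof (rule linearI)
      fix u v and c :: real
      have "ed (\<lambda>y. contr (u + v) (a y)) y = ed (\<lambda>y. contr u (a y) + contr v (a y)) y"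
        by (rule ed_cong[OF sform_contr[OF Nil(1)] y]) (simp add: linear_add[OF linear_contr[OF Nil(2)]])
      then show "ed (\<lambda>y. contr (u + v) (a y)) y ws = ed (\<lambda>y. contr u (a y)) y ws + ed (\<lambda>y. contr v (a y)) y ws"
        by (simp add: ed_add[OF sform_contr[OF Nil(1)] sform_contr[OF Nil(1)] y] fun_apply)
      have "ed (\<lambda>y. contr (c *\<^sub>R u) (a y)) y = ed (\<lambda>y. c *\<^sub>R contr u (a y)) y"
        by (rule ed_cong[OF sform_contr[OF Nil(1)] y]) (simp add: linear_scale[OF linear_contr[OF Nil(2)]])
      then show "ed (\<lambda>y. contr (c *\<^sub>R u) (a y)) y ws = c *\<^sub>R ed (\<lambda>y. contr u (a y)) y ws"
        by (simp add: ed_scaleR[OF sform_contr[OF Nil(1)] y] fun_apply)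
    qed
    show ?case using linear_compose_sub[OF 1 2] by (simp add: ed_Cons)
  next
    case (Cons u us)
    have 1: "linear (\<lambda>v. dd u (\<lambda>y. a y (us @ v # ws)) y)"
    proof (rule linearI)
      fix v v' and c :: real
      have "dd u (\<lambda>y. a y (us @ (v + v') # ws)) y = dd u (\<lambda>y. a y (us @ v # ws) + a y (us @ v' # ws)) y"
        by (rule dd_cong[OF T y _ sform_diff[OF Cons.prems(1) y]]) (simp add: linear_add[OF alt_formD(1)[OF Cons.prems(2)]])
      then show "dd u (\<lambda>y. a y (us @ (v + v') # ws)) y = dd u (\<lambda>y. a y (us @ v # ws)) y + dd u (\<lambda>y. a y (us @ v' # ws)) y"
        by (simp add: dd_add sform_diff[OF Cons.prems(1) y])
      have "dd u (\<lambda>y. a y (us @ (c *\<^sub>R v) # ws)) y = dd u (\<lambda>y. c *\<^sub>R a y (us @ v # ws)) y"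
        by (rule dd_cong[OF T y _ sform_diff[OF Cons.prems(1) y]]) (simp only: linear_scale[OF alt_formD(1)[OF Cons.prems(2)]])
      then show "dd u (\<lambda>y. a y (us @ (c *\<^sub>R v) # ws)) y = c *\<^sub>R dd u (\<lambda>y. a y (us @ v # ws)) y"
        by (simp add: dd_scaleR[OF sform_diff[OF Cons.prems(1) y], unfolded real_scaleR_def])
    qed
    have 2: "linear (\<lambda>v. ed (\<lambda>y. contr u (a y)) y (us @ v # ws))"
      by (rule Cons.IH[OF sform_contr[OF Cons.prems(1)] alt_contr[OF Cons.prems(2)]])
    show ?case using linear_compose_sub[OF 1 2] by (simp add: ed_Cons)
  qed
  have adj: "ed a y (us @ v # v # ws) = 0" if "sform T a" "\<And>y. y \<in> T \<Longrightarrow> alt_form (a y)" for a us v ws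
    using that
  proof (induction us arbitrary: a)
    case Nil
    have "ed (\<lambda>y. contr v (contr v (a y))) y = ed (\<lambda>y. 0) y"
      by (rule ed_cong[OF sform_contr[OF sform_contr[OF Nil(1)]] y]) (rule contr_contr_same[OF Nil(2)])
    then have "ed (\<lambda>y. contr v (contr v (a y))) y ws = 0" by (simp add: ed_def fun_apply)
    then show ?case by (simp add: ed_Cons) (simp add: contr_def)
  next
    case (Cons u us)
    have "dd u (\<lambda>y. a y (us @ v # v # ws)) y = dd u (\<lambda>y. 0) y"
      by (rule dd_cong[OF T y _ sform_diff[OF Cons.prems(1) y]]) (auto intro: alt_formD(2)[OF Cons.prems(2)])
    then show ?case using Cons.IH[OF sform_contr[OF Cons.prems(1)] alt_contr[OF Cons.prems(2)]] by (simp add: ed_Cons)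
  qed
  show ?thesis using alt_formI[of "ed a y", OF lin[OF a] adj[OF a]] .
qed

section \<open>Differential forms on manifolds\<close>

lemma chart_rep_o: "snd c' \<circ> f \<circ> chart_inv c = (\<lambda>x. snd c' (f (chart_inv c x)))"
  by auto

definition rep :: "('m, 'e) chart \<Rightarrow> ('m \<Rightarrow> 'k) \<Rightarrow> ('k, 'f) chart \<Rightarrow> 'e \<Rightarrow> 'f" where
  "rep c f c' = (\<lambda>x. snd c' (f (chart_inv c x)))"

definition rep_dom :: "('m, 'e) chart \<Rightarrow> ('m \<Rightarrow> 'k) \<Rightarrow> ('k, 'f) chart \<Rightarrow> 'e set" where
  "rep_dom c f c' = snd c ` (fst c \<inter> f -` fst c')"

context smooth_manifold begin

definition E :: "'e set" where "E = (SOME B. onb B)"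

lemma onb_E: "onb E"
  unfolding E_def using someI_ex[OF exists_onb[OF finite_dim]] .

lemma chart_at: "chart_at A p \<in> A" "p \<in> fst (chart_at A p)"
proof -
  have "\<exists>c. c \<in> A \<and> p \<in> fst c" using covering by blast
  from someI_ex[OF this] show "chart_at A p \<in> A" "p \<in> fst (chart_at A p)" by (auto simp: chart_at_def)
qed

lemma chart_inv:
  assumes c: "c \<in> A"
  shows "p \<in> fst c \<Longrightarrow> chart_inv c (snd c p) = p" "x \<in> chart_image c \<Longrightarrow> snd c (chart_inv c x) = x"
    "x \<in> chart_image c \<Longrightarrow> chart_inv c x \<in> fst c" "p \<in> fst c \<Longrightarrow> snd c p \<in> chart_image c"
  using chart_homeomorphism[OF c] by (auto simp: homeomorphism_def chart_image_def)

lemma open_chart_image: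
  assumes c: "c \<in> A" and U: "open U" shows "open (snd c ` (fst c \<inter> U))"
proof -
  have "openin (top_of_set (chart_image c)) (snd c ` (fst c \<inter> U))"
    by (rule homeomorphism_imp_open_map[OF chart_homeomorphism[OF c]]) (use U in \<open>auto simp: openin_open\<close>)
  then show ?thesis using open_image[OF c] openin_open_eq by blast
qed

lemma rep_domD: "c \<in> A \<Longrightarrow> x \<in> rep_dom c f c' \<Longrightarrow> x \<in> chart_image c" "c \<in> A \<Longrightarrow> x \<in> rep_dom c f c' \<Longrightarrow> f (chart_inv c x) \<in> fst c'"
  and rep_domI: "c \<in> A \<Longrightarrow> x \<in> chart_image c \<Longrightarrow> f (chart_inv c x) \<in> fst c' \<Longrightarrow> x \<in> rep_dom c f c'"
  using chart_inv[of c] by (auto simp: rep_dom_def chart_image_def image_iff)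

lemma rep_dom_iff: "c \<in> A \<Longrightarrow> x \<in> rep_dom c f c' \<longleftrightarrow> x \<in> chart_image c \<and> f (chart_inv c x) \<in> fst c'"
  using chart_inv[of c] by (auto simp: rep_dom_def chart_image_def image_iff)

lemma rep_id: "c \<in> A \<Longrightarrow> x \<in> chart_image c \<Longrightarrow> dd v (rep c (\<lambda>p. p) c) x = v"
proof -
  assume c: "c \<in> A" and x: "x \<in> chart_image c"
  have "dd v (\<lambda>x. x) x = dd v (rep c (\<lambda>p. p) c) x"
    by (rule dd_cong[OF open_image[OF c] x]) (auto simp: rep_def chart_inv[OF c])
  then show ?thesis using dd_eq[OF has_derivative_ident, of v x] by simp
qed

lemma smooth_map_id: "smooth_map A A (\<lambda>p. p)"
  unfolding smooth_map_def using smooth_transition by (auto simp: o_def vimage_def)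

end

lemma smooth_map_rep:
  assumes "smooth_manifold A" "smooth_manifold C" "smooth_map A C f" "c \<in> A" "c' \<in> C"
  shows "open (rep_dom c f c')" "smooth_on (rep_dom c f c') (rep c f c')"
proof -
  have "continuous_on UNIV f" using assms(3) by (simp add: smooth_map_def)
  then have "open (f -` fst c')"
    using smooth_manifold.open_domain[OF assms(2,5)] by (simp add: continuous_on_open_vimage)
  then show "open (rep_dom c f c')"
    unfolding rep_dom_def by (rule smooth_manifold.open_chart_image[OF assms(1,4)])
  show "smooth_on (rep_dom c f c') (rep c f c')"
    using assms(3-5) by (auto simp: smooth_map_def rep_def rep_dom_def chart_rep_o)
qed

text \<open>The definition of \<open>smooth_map\<close> quantifies over all pairs of charts; by
  composing with transition maps, one pair around each point is enough.\<close>

lemma smooth_mapI: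
  assumes A: "smooth_manifold A" and C: "smooth_manifold C" and "continuous_on UNIV f"
    and "\<And>p. \<exists>c\<in>A. \<exists>c'\<in>C. \<exists>U. open U \<and> snd c p \<in> U \<and> U \<subseteq> rep_dom c f c' \<and> p \<in> fst c \<and> smooth_on U (rep c f c')"
  shows "smooth_map A C f"
proof -
  have "smooth_on (rep_dom c f c') (rep c f c')" if c: "c \<in> A" "c' \<in> C" for c c'
  proof (rule smooth_on_local)
    fix x assume x: "x \<in> rep_dom c f c'"
    define p where "p = chart_inv c x"
    have xp: "x \<in> chart_image c" "f p \<in> fst c'" "x = snd c p" "p \<in> fst c"
      using smooth_manifold.rep_domD[OF A c(1) x] by (auto simp: p_def smooth_manifold.chart_inv[OF A c(1)])
    obtain c1 c2 U where c1: "c1 \<in> A" "c2 \<in> C" "open U" "snd c1 p \<in> U" "U \<subseteq> rep_dom c1 f c2" "p \<in> fst c1"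
      "smooth_on U (rep c1 f c2)" using assms(4) by blast
    have id: "smooth_map A A (\<lambda>p. p)" "smooth_map C C (\<lambda>p. p)"
      by (rule smooth_manifold.smooth_map_id[OF A] smooth_manifold.smooth_map_id[OF C])+
    note r1 = smooth_map_rep[OF A A id(1) c(1) c1(1)] and r2 = smooth_map_rep[OF C C id(2) c1(2) c(2)]
    define T where "T = rep_dom c (\<lambda>p. p) c1 \<inter> rep c (\<lambda>p. p) c1 -` U"
    have T: "open T" unfolding T_def by (rule continuous_open_preimage[OF smooth_on_continuous[OF r1(2)] r1(1) c1(3)])
    have Tc: "y \<in> chart_image c" "chart_inv c y \<in> fst c1" "rep c (\<lambda>p. p) c1 y \<in> U" if "y \<in> T" for y
      using that by (auto simp: T_def smooth_manifold.rep_dom_iff[OF A c(1)])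
    have inv1: "chart_inv c1 (rep c (\<lambda>p. p) c1 y) = chart_inv c y" if "y \<in> T" for y
      unfolding rep_def using smooth_manifold.chart_inv(1)[OF A c1(1) Tc(2)[OF that]] by simp
    have fc2: "f (chart_inv c y) \<in> fst c2" if "y \<in> T" for y
      using smooth_manifold.rep_domD(2)[OF A c1(1) subsetD[OF c1(5) Tc(3)[OF that]]] by (simp add: inv1[OF that])
    have "open (fst c2 \<inter> fst c')" by (intro open_Int smooth_manifold.open_domain[OF C] c(2) c1(2))
    then have "open (f -` (fst c2 \<inter> fst c'))" by (rule open_vimage[OF _ assms(3)])
    then have W: "open (snd c ` (fst c \<inter> f -` (fst c2 \<inter> fst c')))" by (rule smooth_manifold.open_chart_image[OF A c(1)])
    define S where "S = T \<inter> rep_dom c f c' \<inter> snd c ` (fst c \<inter> f -` (fst c2 \<inter> fst c'))"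
    have "open (T \<inter> snd c ` (fst c \<inter> f -` (fst c2 \<inter> fst c')))" using T W by auto
    moreover have "S = T \<inter> snd c ` (fst c \<inter> f -` (fst c2 \<inter> fst c'))"
      unfolding S_def rep_dom_def by blast
    ultimately have S: "open S" by simp
    have xT: "x \<in> T"
    proof -
      have "x \<in> rep_dom c (\<lambda>p. p) c1"
        by (rule smooth_manifold.rep_domI[OF A c(1) xp(1)]) (unfold p_def[symmetric], rule c1(6))
      moreover have "rep c (\<lambda>p. p) c1 x \<in> U" unfolding rep_def p_def[symmetric] by (rule c1(4))
      ultimately show ?thesis unfolding T_def by blast
    qed
    have "f p \<in> fst c2" unfolding p_def by (rule fc2[OF xT])
    then have "snd c p \<in> snd c ` (fst c \<inter> f -` (fst c2 \<inter> fst c'))" using xp(2,4) by blast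
    then have "x \<in> snd c ` (fst c \<inter> f -` (fst c2 \<inter> fst c'))" unfolding xp(3)[symmetric] .
    then have xS: "x \<in> S" unfolding S_def using xT x by simp
    have s1: "smooth_on S (\<lambda>y. rep c1 f c2 (rep c (\<lambda>p. p) c1 y))"
      by (rule smooth_on_compose[OF smooth_manifold.onb_E[OF A] S c1(3) _ c1(7) smooth_on_subset[OF r1(2)]])
        (auto simp: S_def T_def)
    have e: "rep c1 f c2 (rep c (\<lambda>p. p) c1 y) = snd c2 (f (chart_inv c y))" if "y \<in> S" for y
      using inv1[of y] that by (simp add: rep_def[of c1] S_def)
    have s2: "smooth_on S (\<lambda>y. rep c2 (\<lambda>p. p) c' (rep c1 f c2 (rep c (\<lambda>p. p) c1 y)))"
    proof (rule smooth_on_compose[OF smooth_manifold.onb_E[OF C] S r2(1) _ r2(2) s1])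
      fix y assume y: "y \<in> S"
      have "f (chart_inv c y) \<in> fst c2" "f (chart_inv c y) \<in> fst c'"
        using y fc2 by (auto simp: S_def smooth_manifold.rep_dom_iff[OF A c(1)])
      then show "rep c1 f c2 (rep c (\<lambda>p. p) c1 y) \<in> rep_dom c2 (\<lambda>p. p) c'"
        unfolding e[OF y] by (auto simp: rep_dom_def)
    qed
    have "smooth_on S (rep c f c')"
    proof (rule smooth_on_cong[OF S _ s2])
      fix y assume y: "y \<in> S"
      then show "rep c2 (\<lambda>p. p) c' (rep c1 f c2 (rep c (\<lambda>p. p) c1 y)) = rep c f c' y"
        unfolding e[OF y] by (simp add: rep_def S_def smooth_manifold.chart_inv(1)[OF C c1(2) fc2])
    qed
    then show "\<exists>T. open T \<and> x \<in> T \<and> smooth_on T (rep c f c')" using S xS by blast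
  qed
  then show ?thesis using assms(3) by (simp add: smooth_map_def rep_def rep_dom_def chart_rep_o)
qed

lemma rep_chain:
  assumes A: "smooth_manifold A" and C: "smooth_manifold C" and D: "smooth_manifold D"
    and f: "smooth_map A C f" and g: "smooth_map C D g" and c: "c \<in> A" "c' \<in> C" "c'' \<in> D"
    and x: "x \<in> chart_image c" "f (chart_inv c x) \<in> fst c'" "g (f (chart_inv c x)) \<in> fst c''"
  shows "dd v (rep c (\<lambda>p. g (f p)) c'') x = dd (dd v (rep c f c') x) (rep c' g c'') (rep c f c' x)"
    "rep c (\<lambda>p. g (f p)) c'' differentiable at x"
proof -
  note rf = smooth_map_rep[OF A C f c(1,2)] and rg = smooth_map_rep[OF C D g c(2,3)]
  have xd: "x \<in> rep_dom c f c'" by (rule smooth_manifold.rep_domI[OF A c(1)]) (rule x)+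
  have yd: "rep c f c' x \<in> rep_dom c' g c''" using x by (auto simp: rep_def rep_dom_def)
  have eq: "rep c' g c'' (rep c f c' y) = rep c (\<lambda>p. g (f p)) c'' y" if "y \<in> rep_dom c f c'" for y
    using smooth_manifold.rep_domD[OF A c(1) that] by (auto simp: rep_def smooth_manifold.chart_inv(1)[OF C c(2)])
  have d: "rep c f c' differentiable at x" "rep c' g c'' differentiable at (rep c f c' x)"
    using smooth_on_differentiable[OF rf(2) xd] smooth_on_differentiable[OF rg(2) yd] by auto
  have dc: "(\<lambda>y. rep c' g c'' (rep c f c' y)) differentiable at x"
    using differentiable_chain_at[OF d] by (simp add: o_def)
  show "rep c (\<lambda>p. g (f p)) c'' differentiable at x"
    by (rule differentiable_transform[OF rf(1) xd eq dc])
  show "dd v (rep c (\<lambda>p. g (f p)) c'') x = dd (dd v (rep c f c') x) (rep c' g c'') (rep c f c' x)"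
    using dd_cong[OF rf(1) xd eq dc] dd_chain[OF d, of v] by simp
qed

lemma smooth_map_comp:
  assumes A: "smooth_manifold A" and C: "smooth_manifold C" and D: "smooth_manifold D"
    and f: "smooth_map A C f" and g: "smooth_map C D g"
  shows "smooth_map A D (\<lambda>p. g (f p))"
proof (rule smooth_mapI[OF A D])
  show ct: "continuous_on UNIV (\<lambda>p. g (f p))"
    using f g continuous_on_compose2[of UNIV g UNIV f] by (auto simp: smooth_map_def)
  fix p
  let ?c = "chart_at A p" and ?c' = "chart_at C (f p)" and ?c'' = "chart_at D (g (f p))"
  have c: "?c \<in> A" "p \<in> fst ?c" "?c' \<in> C" "f p \<in> fst ?c'" "?c'' \<in> D" "g (f p) \<in> fst ?c''"
    by (rule smooth_manifold.chart_at[OF A] smooth_manifold.chart_at[OF C] smooth_manifold.chart_at[OF D])+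
  note rf = smooth_map_rep[OF A C f c(1,3)] and rg = smooth_map_rep[OF C D g c(3,5)]
  define U where "U = rep_dom ?c f ?c' \<inter> rep ?c f ?c' -` rep_dom ?c' g ?c''"
  have U: "open U" unfolding U_def by (rule continuous_open_preimage[OF smooth_on_continuous[OF rf(2)] rf(1) rg(1)])
  have inv: "chart_inv ?c' (rep ?c f ?c' y) = f (chart_inv ?c y)" if "y \<in> U" for y
    using that by (auto simp: rep_def U_def smooth_manifold.rep_dom_iff[OF A c(1)] smooth_manifold.chart_inv(1)[OF C c(3)])
  have "smooth_on U (rep ?c (\<lambda>p. g (f p)) ?c'')"
  proof (rule smooth_on_cong[OF U])
    show "smooth_on U (\<lambda>y. rep ?c' g ?c'' (rep ?c f ?c' y))"
      by (rule smooth_on_compose[OF smooth_manifold.onb_E[OF C] U rg(1) _ rg(2) smooth_on_subset[OF rf(2)]]) (auto simp: U_def)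
    show "rep ?c' g ?c'' (rep ?c f ?c' y) = rep ?c (\<lambda>p. g (f p)) ?c'' y" if "y \<in> U" for y
      using inv[OF that] by (simp add: rep_def)
  qed
  moreover have "snd ?c p \<in> U"
    using c by (auto simp: U_def rep_def rep_dom_def smooth_manifold.chart_inv(1)[OF A c(1,2)])
  moreover have "U \<subseteq> rep_dom ?c (\<lambda>p. g (f p)) ?c''"
  proof
    fix y assume y: "y \<in> U"
    then have "y \<in> rep_dom ?c f ?c'" "rep ?c f ?c' y \<in> rep_dom ?c' g ?c''" by (auto simp: U_def)
    note y' = smooth_manifold.rep_domD(1)[OF A c(1) this(1)] smooth_manifold.rep_domD(2)[OF C c(3) this(2)]
    have "y \<in> chart_image ?c" "g (f (chart_inv ?c y)) \<in> fst ?c''"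
      using y' by (auto simp: inv[OF y])
    then show "y \<in> rep_dom ?c (\<lambda>p. g (f p)) ?c''" by (rule smooth_manifold.rep_domI[OF A c(1)])
  qed
  ultimately show "\<exists>c\<in>A. \<exists>c'\<in>D. \<exists>U. open U \<and> snd c p \<in> U \<and> U \<subseteq> rep_dom c (\<lambda>p. g (f p)) c' \<and> p \<in> fst c \<and>
      smooth_on U (rep c (\<lambda>p. g (f p)) c')"
    using U c by blast
qed

lemma tangent_map_dd: "tangent_map A C f p v = dd v (rep (chart_at A p) f (chart_at C (f p))) (snd (chart_at A p) p)"
  by (simp add: tangent_map_def dd_def rep_def chart_rep_o)

lemma tangent_map_comp:
  assumes A: "smooth_manifold A" and C: "smooth_manifold C" and D: "smooth_manifold D"
    and f: "smooth_map A C f" and g: "smooth_map C D g"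
  shows "tangent_map A D (\<lambda>p. g (f p)) p v = tangent_map C D g (f p) (tangent_map A C f p v)"
  unfolding tangent_map_dd
  using rep_chain(1)[OF A C D f g smooth_manifold.chart_at(1)[OF A, of p] smooth_manifold.chart_at(1)[OF C, of "f p"]
      smooth_manifold.chart_at(1)[OF D, of "g (f p)"], of "snd (chart_at A p) p" v]
    smooth_manifold.chart_at(2)[OF A, of p] smooth_manifold.chart_at(2)[OF C, of "f p"] smooth_manifold.chart_at(2)[OF D, of "g (f p)"]
    smooth_manifold.chart_inv(1,4)[OF A smooth_manifold.chart_at[OF A, of p]]
  by (simp add: rep_def)

lemma tangent_map_id: "smooth_manifold A \<Longrightarrow> tangent_map A A (\<lambda>p. p) p v = v"
  unfolding tangent_map_dd
  by (rule smooth_manifold.rep_id) (auto intro: smooth_manifold.chart_at smooth_manifold.chart_inv(4))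

lemma tangent_map_linear:
  assumes A: "smooth_manifold A" and C: "smooth_manifold C" and f: "smooth_map A C f"
  shows "linear (tangent_map A C f p)"
proof -
  have c: "chart_at A p \<in> A" "chart_at C (f p) \<in> C"
    by (rule smooth_manifold.chart_at[OF A] smooth_manifold.chart_at[OF C])+
  have "snd (chart_at A p) p \<in> rep_dom (chart_at A p) f (chart_at C (f p))"
    using smooth_manifold.chart_at(2)[OF A, of p] smooth_manifold.chart_at(2)[OF C, of "f p"] by (auto simp: rep_dom_def)
  then show ?thesis
    unfolding tangent_map_dd[abs_def] by (rule linear_dd[OF smooth_on_differentiable[OF smooth_map_rep(2)[OF A C f c]]])
qed

lemma local_form_rep:
  "local_form A c \<alpha> x = (\<lambda>vs. \<alpha> (chart_inv c x) (map (\<lambda>v. dd v (rep c (\<lambda>p. p) (chart_at A (chart_inv c x))) x) vs))"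
  by (simp add: local_form_def dd_def rep_def o_def)

text \<open>Both sides involve the derivative of f from the chart c to the selected chart at f p; it
  factors once through the selected chart at p and once through c'.\<close>

lemma local_form_pullback:
  assumes A: "smooth_manifold A" and C: "smooth_manifold C" and f: "smooth_map A C f"
    and c: "c \<in> A" "c' \<in> C" and x: "x \<in> rep_dom c f c'"
  shows "local_form A c (pullback A C f \<beta>) x = pbk (rep c f c') (local_form C c' \<beta>) x"
proof -
  define p where "p = chart_inv c x"
  have xc: "x \<in> chart_image c" "f p \<in> fst c'" "p \<in> fst c" "snd c p = x"
    using smooth_manifold.rep_domD[OF A c(1) x] by (auto simp: p_def smooth_manifold.chart_inv[OF A c(1)])
  have inv: "chart_inv c' (rep c f c' x) = f p"
    using smooth_manifold.chart_inv(1)[OF C c(2) xc(2)] by (simp add: rep_def p_def)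
  have cA: "chart_at A p \<in> A" "p \<in> fst (chart_at A p)" and cC: "chart_at C (f p) \<in> C" "f p \<in> fst (chart_at C (f p))"
    by (rule smooth_manifold.chart_at[OF A] smooth_manifold.chart_at[OF C])+
  have id: "smooth_map A A (\<lambda>p. p)" "smooth_map C C (\<lambda>p. p)" by (rule smooth_manifold.smooth_map_id[OF A] smooth_manifold.smooth_map_id[OF C])+
  have 1: "dd v (rep c f (chart_at C (f p))) x =
      tangent_map A C f p (dd v (rep c (\<lambda>p. p) (chart_at A p)) x)" for v
    using rep_chain(1)[OF A A C id(1) f c(1) cA(1) cC(1) xc(1)] cA cC by (simp add: p_def tangent_map_dd rep_def[of c "\<lambda>p. p"])
  have 2: "dd v (rep c f (chart_at C (f p))) x =
      dd (dd v (rep c f c') x) (rep c' (\<lambda>p. p) (chart_at C (f p))) (rep c f c' x)" for v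
    using rep_chain(1)[OF A C C f id(2) c(1,2) cC(1) xc(1)] xc cC by (simp add: p_def)
  show ?thesis
    unfolding local_form_rep pbk_def pullback_def inv p_def[symmetric]
    using 1 2 by (simp add: o_def)
qed

lemma pullback_id: "smooth_manifold A \<Longrightarrow> pullback A A (\<lambda>p. p) \<beta> = \<beta>"
proof -
  assume A: "smooth_manifold A"
  have "tangent_map A A (\<lambda>p. p) p = (\<lambda>v. v)" for p by (rule ext, rule tangent_map_id[OF A])
  then show ?thesis by (simp add: pullback_def)
qed

lemma pullback_comp:
  assumes "smooth_manifold A" "smooth_manifold C" "smooth_manifold D" "smooth_map A C f" "smooth_map C D g"
  shows "pullback A D (\<lambda>p. g (f p)) \<beta> = pullback A C f (pullback C D g \<beta>)"
proof -
  have "tangent_map A D (\<lambda>p. g (f p)) p = (\<lambda>v. tangent_map C D g (f p) (tangent_map A C f p v))" for p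
    by (rule ext, rule tangent_map_comp[OF assms])
  then show ?thesis by (simp add: pullback_def o_def)
qed

section \<open>Exterior calculus in terms of local expressions\<close>

context smooth_manifold begin

lemmas M = smooth_manifold_axioms

lemma local_form_change:
  assumes "c \<in> A" "c' \<in> A" "x \<in> rep_dom c (\<lambda>p. p) c'"
  shows "local_form A c \<alpha> x = pbk (rep c (\<lambda>p. p) c') (local_form A c' \<alpha>) x"
  using local_form_pullback[OF M M smooth_map_id assms, of \<alpha>] by (simp add: pullback_id[OF M])

lemma frame_linear:
  assumes "c \<in> A" "x \<in> chart_image c"
  shows "linear (\<lambda>v. dd v (rep c (\<lambda>p. p) (chart_at A (chart_inv c x))) x)"
proof -
  have "x \<in> rep_dom c (\<lambda>p. p) (chart_at A (chart_inv c x))"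
    by (rule rep_domI[OF assms chart_at(2)])
  then show ?thesis
    by (intro linear_dd smooth_on_differentiable[OF smooth_map_rep(2)[OF M M smooth_map_id assms(1) chart_at(1)]])
qed

lemma local_form_alt: "c \<in> A \<Longrightarrow> x \<in> chart_image c \<Longrightarrow> alt_form (\<alpha> (chart_inv c x)) \<Longrightarrow> alt_form (local_form A c \<alpha> x)"
  unfolding local_form_rep by (rule alt_comp_map[OF _ frame_linear])

lemma local_form_at: "local_form A (chart_at A p) \<alpha> (snd (chart_at A p) p) = \<alpha> p"
  using chart_inv[OF chart_at(1)[of p]] chart_at(2)[of p] rep_id[OF chart_at(1)[of p]]
  by (simp add: local_form_rep)

lemma base_point: "snd (chart_at A p) p \<in> chart_image (chart_at A p)"
  using chart_inv(4)[OF chart_at] .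

lemma form_eqI:
  assumes "\<And>p. local_form A (chart_at A p) \<alpha> (snd (chart_at A p) p) = local_form A (chart_at A p) \<beta> (snd (chart_at A p) p)"
  shows "\<alpha> = \<beta>"
  using assms by (intro ext) (simp add: local_form_at)

lemma OmegaD: "\<alpha> \<in> Omega A \<Longrightarrow> alt_form (\<alpha> p)" "\<alpha> \<in> Omega A \<Longrightarrow> c \<in> A \<Longrightarrow> sform (chart_image c) (local_form A c \<alpha>)"
  "\<alpha> \<in> Omega A \<Longrightarrow> c \<in> A \<Longrightarrow> x \<in> chart_image c \<Longrightarrow> alt_form (local_form A c \<alpha> x)"
  using open_image local_form_alt by (auto simp: Omega_def sform_def)

lemma OmegaI: "(\<And>p. alt_form (\<alpha> p)) \<Longrightarrow> (\<And>c. c \<in> A \<Longrightarrow> sform (chart_image c) (local_form A c \<alpha>)) \<Longrightarrow> \<alpha> \<in> Omega A"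
  by (auto simp: Omega_def sform_def)

lemma ext_d_eq: "ext_d A \<alpha> p = ed (local_form A (chart_at A p) \<alpha>) (snd (chart_at A p) p)"
  by (simp add: ext_d_def ed_def dd_def)

text \<open>\<open>ext_d\<close> uses a different chart at every point; naturality under the
  transition map shows that in a fixed chart it is the coordinate derivative everywhere, so that it
  can be differentiated again.\<close>

lemma local_form_ext_d:
  assumes a: "\<alpha> \<in> Omega A" and c: "c \<in> A" and x: "x \<in> chart_image c"
  shows "local_form A c (ext_d A \<alpha>) x = ed (local_form A c \<alpha>) x"
proof -
  define p where "p = chart_inv c x"
  let ?c = "chart_at A p" let ?t = "rep c (\<lambda>p. p) ?c"
  have p: "p \<in> fst c" "snd c p = x" "?c \<in> A" "p \<in> fst ?c" using chart_inv[OF c] x chart_at by (auto simp: p_def)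
  have xd: "x \<in> rep_dom c (\<lambda>p. p) ?c" by (rule rep_domI[OF c x]) (unfold p_def[symmetric], rule p(4))
  note r = smooth_map_rep[OF M M smooth_map_id c p(3)]
  have tx: "?t y \<in> chart_image ?c" if "y \<in> rep_dom c (\<lambda>p. p) ?c" for y
    using rep_domD[OF c that] chart_inv(4)[OF p(3)] by (auto simp: rep_def)
  have "local_form A c (ext_d A \<alpha>) x = pbk ?t (ed (local_form A ?c \<alpha>)) x"
    unfolding local_form_rep[of A c "ext_d A \<alpha>"] ext_d_eq pbk_def p_def[symmetric] by (simp add: rep_def p_def)
  also have "\<dots> = ed (pbk ?t (local_form A ?c \<alpha>)) x"
    by (rule ed_pbk[OF onb_E r(1,2) tx OmegaD(2)[OF a p(3)] OmegaD(3)[OF a p(3)] xd, symmetric])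
  also have "\<dots> = ed (local_form A c \<alpha>) x"
  proof (rule ed_cong[OF _ xd, symmetric])
    show "sform (rep_dom c (\<lambda>p. p) ?c) (local_form A c \<alpha>)"
      by (rule sform_subset[OF OmegaD(2)[OF a c] r(1)]) (rule subsetI, rule rep_domD(1)[OF c])
    show "local_form A c \<alpha> y = pbk ?t (local_form A ?c \<alpha>) y" if "y \<in> rep_dom c (\<lambda>p. p) ?c" for y
      by (rule local_form_change[OF c p(3) that])
  qed
  finally show ?thesis .
qed

lemma Omega_ext_d: "\<alpha> \<in> Omega A \<Longrightarrow> ext_d A \<alpha> \<in> Omega A"
proof (rule OmegaI)
  assume a: "\<alpha> \<in> Omega A"
  show "alt_form (ext_d A \<alpha> p)" for p
    unfolding ext_d_eq by (rule alt_ed[OF onb_E OmegaD(2)[OF a chart_at(1)] OmegaD(3)[OF a chart_at(1)] base_point])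
  show "sform (chart_image c) (local_form A c (ext_d A \<alpha>))" if c: "c \<in> A" for c
    by (rule sform_cong[OF local_form_ext_d[OF a c, symmetric] sform_ed[OF OmegaD(2)[OF a c]]])
qed

lemma ext_d_ext_d: "\<alpha> \<in> Omega A \<Longrightarrow> ext_d A (ext_d A \<alpha>) = 0"
proof
  fix p assume a: "\<alpha> \<in> Omega A"
  have "ext_d A (ext_d A \<alpha>) p = ed (ed (local_form A (chart_at A p) \<alpha>)) (snd (chart_at A p) p)"
    unfolding ext_d_eq[of "ext_d A \<alpha>"]
    by (rule ed_cong[OF OmegaD(2)[OF Omega_ext_d[OF a] chart_at(1)] base_point local_form_ext_d[OF a chart_at(1)]])
  then show "ext_d A (ext_d A \<alpha>) p = 0 p"
    using ed_ed[OF OmegaD(2)[OF a chart_at(1)] base_point] by (simp add: zero_fun_apply)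
qed

lemma local_form_lin:
  "local_form A c (\<alpha> + \<beta>) = (\<lambda>x. local_form A c \<alpha> x + local_form A c \<beta> x)"
  "local_form A c (r *\<^sub>R \<alpha>) = (\<lambda>x. r *\<^sub>R local_form A c \<alpha> x)"
  "local_form A c 0 = (\<lambda>x. 0)"
  by (auto simp: local_form_def fun_eq_iff fun_apply)

lemma subspace_Omega: "subspace (Omega A)"
  unfolding subspace_def
proof (intro conjI ballI allI)
  show "0 \<in> Omega A" by (rule OmegaI) (auto simp: local_form_lin zero_fun_apply alt_zero intro: sform_const open_image)
  show "\<alpha> + \<beta> \<in> Omega A" if "\<alpha> \<in> Omega A" "\<beta> \<in> Omega A" for \<alpha> \<beta>
    using that by (intro OmegaI) (auto simp: local_form_lin plus_fun_apply intro: alt_add OmegaD sform_add)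
  show "r *\<^sub>R \<alpha> \<in> Omega A" if "\<alpha> \<in> Omega A" for \<alpha> r
    using that by (intro OmegaI) (auto simp: local_form_lin scaleR_fun_apply intro: alt_scale OmegaD sform_scaleR)
qed

lemma ext_d_lin: "lin_op (Omega A) (ext_d A)"
proof (rule lin_opI)
  fix \<alpha> \<beta> and r :: real assume a: "\<alpha> \<in> Omega A"
  show "ext_d A \<alpha> \<in> Omega A" by (rule Omega_ext_d[OF a])
  show "ext_d A (r *\<^sub>R \<alpha>) = r *\<^sub>R ext_d A \<alpha>"
    by (auto simp: ext_d_eq fun_eq_iff local_form_lin scaleR_fun_apply ed_scaleR[OF OmegaD(2)[OF a chart_at(1)] base_point])
  assume b: "\<beta> \<in> Omega A"
  show "ext_d A (\<alpha> + \<beta>) = ext_d A \<alpha> + ext_d A \<beta>"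
    by (auto simp: ext_d_eq fun_eq_iff local_form_lin plus_fun_apply
      ed_add[OF OmegaD(2)[OF a chart_at(1)] OmegaD(2)[OF b chart_at(1)] base_point])
qed

lemma local_form_wedge: "local_form A c (form_wedge \<alpha> \<beta>) x = wedge (local_form A c \<alpha> x) (local_form A c \<beta> x)"
  by (simp add: local_form_rep form_wedge_def wedge_map fun_eq_iff)

lemma Omega_wedge: "\<alpha> \<in> Omega A \<Longrightarrow> \<beta> \<in> Omega A \<Longrightarrow> form_wedge \<alpha> \<beta> \<in> Omega A"
proof (rule OmegaI)
  assume a: "\<alpha> \<in> Omega A" and b: "\<beta> \<in> Omega A"
  show "alt_form (form_wedge \<alpha> \<beta> p)" for p unfolding form_wedge_def by (rule alt_wedge[OF OmegaD(1)[OF a] OmegaD(1)[OF b]])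
  show "sform (chart_image c) (local_form A c (form_wedge \<alpha> \<beta>))" if c: "c \<in> A" for c
    unfolding local_form_wedge[abs_def] by (rule sform_wedge[OF OmegaD(2)[OF a c] OmegaD(2)[OF b c]])
qed

lemma ext_d_wedge:
  assumes "\<alpha> \<in> Omega A" "\<beta> \<in> Omega A"
  shows "ext_d A (form_wedge \<alpha> \<beta>) p = wedge (ext_d A \<alpha> p) (\<beta> p) + wedge (grade_inv (\<alpha> p)) (ext_d A \<beta> p)"
  using ed_wedge[OF OmegaD(2)[OF assms(1) chart_at(1)] OmegaD(2)[OF assms(2) chart_at(1)] base_point, of p]
  by (simp add: ext_d_eq local_form_wedge[abs_def] local_form_at)

lemma local_form_part: "local_form A c (form_part k \<alpha>) x = ext_part k (local_form A c \<alpha> x)"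
  by (auto simp: local_form_rep form_part_def ext_part_def)

lemma Omega_form_part: "\<alpha> \<in> Omega A \<Longrightarrow> form_part k \<alpha> \<in> Omega A"
proof (rule OmegaI)
  assume a: "\<alpha> \<in> Omega A"
  show "alt_form (form_part k \<alpha> p)" for p unfolding form_part_def by (rule alt_ext_part[OF OmegaD(1)[OF a]])
  fix c assume c: "c \<in> A"
  have "smooth_on (chart_image c) (\<lambda>x. ext_part k (local_form A c \<alpha> x) vs)" for vs
    using sformD[OF OmegaD(2)[OF a c]] by (cases "length vs = k") (auto simp: ext_part_def)
  then show "sform (chart_image c) (local_form A c (form_part k \<alpha>))"
    using open_image[OF c] by (simp add: sform_def local_form_part)
qed

lemma form_part_ext_d: "form_part k (ext_d A \<alpha>) = (if k = 0 then 0 else ext_d A (form_part (k - 1) \<alpha>))"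
proof (intro ext)
  fix p and vs :: "'e list"
  have "local_form A c (form_part j \<alpha>) x (take i vs @ drop (Suc i) vs) =
      (if length vs = Suc j then local_form A c \<alpha> x (take i vs @ drop (Suc i) vs) else 0)" if "i < length vs" for c j x i
    using that by (auto simp: local_form_part ext_part_def)
  then show "form_part k (ext_d A \<alpha>) p vs = (if k = 0 then 0 else ext_d A (form_part (k - 1) \<alpha>)) p vs"
    by (cases k) (auto simp: form_part_def[of _ "ext_d A \<alpha>"] ext_part_def ext_d_eq ed_def zero_fun_apply intro!: sum.cong sum.neutral)
qed

end

lemma Omega_pullback:
  assumes A: "smooth_manifold A" and C: "smooth_manifold C" and f: "smooth_map A C f" and b: "\<beta> \<in> Omega C"
  shows "pullback A C f \<beta> \<in> Omega A"
proof (rule smooth_manifold.OmegaI[OF A])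
  show "alt_form (pullback A C f \<beta> p)" for p
    unfolding pullback_def by (rule alt_comp_map[OF smooth_manifold.OmegaD(1)[OF C b] tangent_map_linear[OF A C f]])
  fix c assume c: "c \<in> A"
  have "smooth_on (chart_image c) (\<lambda>x. local_form A c (pullback A C f \<beta>) x vs)" for vs
  proof (rule smooth_on_local)
    fix x assume x: "x \<in> chart_image c"
    define c' where "c' = chart_at C (f (chart_inv c x))"
    have c': "c' \<in> C" "x \<in> rep_dom c f c'"
      using x by (auto simp: c'_def smooth_manifold.chart_at[OF C] smooth_manifold.rep_dom_iff[OF A c])
    note r = smooth_map_rep[OF A C f c c'(1)]
    have fx: "rep c f c' y \<in> chart_image c'" if "y \<in> rep_dom c f c'" for y
      using that by (auto simp: rep_def smooth_manifold.rep_dom_iff[OF A c] smooth_manifold.chart_inv(4)[OF C c'(1)])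
    have pb: "sform (rep_dom c f c') (pbk (rep c f c') (local_form C c' \<beta>))"
      by (rule sform_pbk[OF smooth_manifold.onb_E[OF C] r fx smooth_manifold.OmegaD(2)[OF C b c'(1)] smooth_manifold.OmegaD(3)[OF C b c'(1)]])
    have "sform (rep_dom c f c') (local_form A c (pullback A C f \<beta>))"
      by (rule sform_cong[OF local_form_pullback[OF A C f c c'(1), symmetric] pb])
    then show "\<exists>T. open T \<and> x \<in> T \<and> smooth_on T (\<lambda>x. local_form A c (pullback A C f \<beta>) x vs)"
      using c'(2) r(1) by (auto simp: sform_def)
  qed
  then show "sform (chart_image c) (local_form A c (pullback A C f \<beta>))"
    using smooth_manifold.open_image[OF A c] by (simp add: sform_def)
qed

lemma pullback_ext_d:
  assumes A: "smooth_manifold A" and C: "smooth_manifold C" and f: "smooth_map A C f" and b: "\<beta> \<in> Omega C"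
  shows "ext_d A (pullback A C f \<beta>) = pullback A C f (ext_d C \<beta>)"
proof (rule smooth_manifold.form_eqI[OF A])
  fix p
  define c where "c = chart_at A p"
  define c' where "c' = chart_at C (f p)"
  define x where "x = snd c p"
  have c: "c \<in> A" "c' \<in> C" "x \<in> rep_dom c f c'" "x \<in> chart_image c"
    using smooth_manifold.chart_at[OF A, of p] smooth_manifold.chart_at[OF C, of "f p"]
    by (auto simp: c_def c'_def x_def rep_dom_def chart_image_def)
  note r = smooth_map_rep[OF A C f c(1,2)]
  have fx: "rep c f c' y \<in> chart_image c'" if "y \<in> rep_dom c f c'" for y
    using that by (auto simp: rep_def smooth_manifold.rep_dom_iff[OF A c(1)] smooth_manifold.chart_inv(4)[OF C c(2)])
  note lp = local_form_pullback[OF A C f c(1,2)]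
  note sm = smooth_manifold.OmegaD(2)[OF C b c(2)] smooth_manifold.OmegaD(3)[OF C b c(2)]
  have "local_form A c (ext_d A (pullback A C f \<beta>)) x = ed (local_form A c (pullback A C f \<beta>)) x"
    by (rule smooth_manifold.local_form_ext_d[OF A Omega_pullback[OF A C f b] c(1,4)])
  also have "\<dots> = ed (pbk (rep c f c') (local_form C c' \<beta>)) x"
    by (rule ed_cong[OF sform_cong[OF lp[symmetric] sform_pbk[OF smooth_manifold.onb_E[OF C] r fx sm]] c(3) lp])
  also have "\<dots> = pbk (rep c f c') (ed (local_form C c' \<beta>)) x"
    by (rule ed_pbk[OF smooth_manifold.onb_E[OF C] r fx sm c(3)])
  also have "\<dots> = pbk (rep c f c') (local_form C c' (ext_d C \<beta>)) x"
    unfolding pbk_def smooth_manifold.local_form_ext_d[OF C b c(2) fx[OF c(3)]] by (rule refl)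
  also have "\<dots> = local_form A c (pullback A C f (ext_d C \<beta>)) x" by (rule lp[OF c(3), symmetric])
  finally show "local_form A (chart_at A p) (ext_d A (pullback A C f \<beta>)) (snd (chart_at A p) p) =
      local_form A (chart_at A p) (pullback A C f (ext_d C \<beta>)) (snd (chart_at A p) p)"
    by (simp add: c_def x_def)
qed

declare fun_apply [simp]

section \<open>Dual bases depending on a parameter\<close>

context symplectic_space begin

lemma symplectic_space_comp:
  fixes T :: "'e \<Rightarrow> 'e"
  assumes T: "linear T" "inj T" shows "symplectic_space B n (\<lambda>vs. w (map T vs))"
proof
  show "(\<lambda>vs. w (map T vs)) \<in> Alt 2"
    using alt_comp_map[OF alt_w T(1)] w by (auto simp: Alt_def)
  fix u assume "\<And>v. w (map T [u, v]) = 0"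
  then have "w [T u, z] = 0" for z using surjD[OF onb_inj_surj[OF B T], of z] by auto
  then have "T u = 0" by (rule nondeg)
  then show "u = 0" using linear_injective_0[OF T(1)] T(2) by blast
qed (rule B card_B)+

text \<open>Lam is defined by a fixed orthonormal basis, which T need not preserve; its naturality
  amounts to independence of the basis.\<close>

lemma Lam_comp:
  fixes T :: "'e \<Rightarrow> 'e"
  assumes T: "linear T" "inj T" and a: "alt_form a"
  shows "symplectic_space.Lam B (\<lambda>vs. w (map T vs)) (\<lambda>vs. a (map T vs)) = (\<lambda>vs. Lam a (map T vs))"
proof
  fix vs
  interpret T: symplectic_space B n "\<lambda>vs. w (map T vs)" by (rule symplectic_space_comp[OF T])
  let ?f = "\<lambda>u v. a (u # v # map T vs)"
  have lf: "linear (\<lambda>u. ?f u v)" "linear (\<lambda>v. ?f u v)" for u v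
    using alt_formD(1)[OF a, of "[]" "v # map T vs"] alt_formD(1)[OF a, of "[u]" "map T vs"] by auto
  \<comment> \<open>The images T b are expanded in \<open>B\<close>; the coefficients recombine the
    transported dual vectors into the dual vectors of \<open>B\<close>.\<close>
  have du: "(\<Sum>b\<in>B. inner c (T b) *\<^sub>R T (T.dual b)) = dual c" if c: "c \<in> B" for c
    unfolding dual_def
  proof (rule sharp_eqI[symmetric])
    fix z
    obtain v where z: "z = T v" using surjD[OF onb_inj_surj[OF B T], of z] by auto
    have "w [\<Sum>b\<in>B. inner c (T b) *\<^sub>R T (T.dual b), T v] = (\<Sum>b\<in>B. inner c (T b) * w [T (T.dual b), T v])"
      by (simp add: linear_sum[OF linear_w(1)] linear_scale[OF linear_w(1)])
    also have "\<dots> = (\<Sum>b\<in>B. inner b v * inner c (T b))" using T.w_dual[of _ v] by (simp add: mult.commute)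
    also have "\<dots> = inner c (T v)"
    proof -
      have "linear (\<lambda>x. inner c (T x))" using T(1) by (auto simp: linear_iff inner_add_right)
      from onb_linear[OF B this, of v] show ?thesis by simp
    qed
    finally show "w [\<Sum>b\<in>B. inner c (T b) *\<^sub>R T (T.dual b), z] = covec (inner c) [z]" by (simp add: z)
  qed
  have "(\<Sum>b\<in>B. ?f (T (T.dual b)) (T b)) = (\<Sum>b\<in>B. \<Sum>c\<in>B. inner c (T b) * ?f (T (T.dual b)) c)"
  proof (rule sum.cong[OF refl])
    fix b show "?f (T (T.dual b)) (T b) = (\<Sum>c\<in>B. inner c (T b) * ?f (T (T.dual b)) c)"
      using onb_linear[OF B lf(2), of "T (T.dual b)" "T b"] by (simp only: real_scaleR_def)
  qed
  also have "\<dots> = (\<Sum>c\<in>B. \<Sum>b\<in>B. inner c (T b) * ?f (T (T.dual b)) c)" by (rule sum.swap)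
  also have "\<dots> = (\<Sum>c\<in>B. ?f (\<Sum>b\<in>B. inner c (T b) *\<^sub>R T (T.dual b)) c)"
    by (simp add: linear_sum[OF lf(1)] linear_scale[OF lf(1)])
  also have "\<dots> = (\<Sum>c\<in>B. ?f (dual c) c)" by (simp add: du)
  finally show "T.Lam (\<lambda>vs. a (map T vs)) vs = Lam a (map T vs)"
    by (simp add: Lam_def T.Lam_def contr_def fun_apply)
qed

end

lemma smooth_on_det:
  assumes "open S" "\<And>i j. i < m \<Longrightarrow> j < m \<Longrightarrow> smooth_on S (\<lambda>x. M x i j :: real)"
  shows "smooth_on S (\<lambda>x. Determinant.det (mat m m (\<lambda>(i, j). M x i j)))"
proof -
  have "smooth_on S (\<lambda>x. \<Sum>p\<in>{p. p permutes {0..<m}}. signof p * (\<Prod>i = 0..<m. M x i (p i)))"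
    using assms by (intro smooth_on_sum smooth_on_mult smooth_on_prod) (auto simp: permutes_in_image)
  moreover have "(\<Prod>i = 0..<m. mat m m (\<lambda>(i, j). M x i j) $$ (i, p i)) = (\<Prod>i = 0..<m. M x i (p i))"
    if "p permutes {0..<m}" for p x
    by (rule prod.cong) (use permutes_in_image[OF that] in auto)
  ultimately show ?thesis by (simp add: Determinant.det_def)
qed

text \<open>Cramer's rule: an entry of the inverse is a cofactor divided by the determinant, and
  determinants are polynomial in the entries.\<close>

lemma smooth_on_inverse_matrix:
  fixes M R :: "'a::real_inner \<Rightarrow> nat \<Rightarrow> nat \<Rightarrow> real"
  assumes S: "open S" and M: "\<And>i j. i < m \<Longrightarrow> j < m \<Longrightarrow> smooth_on S (\<lambda>x. M x i j)"
    and MR: "\<And>x i j. x \<in> S \<Longrightarrow> i < m \<Longrightarrow> j < m \<Longrightarrow> (\<Sum>k<m. M x i k * R x k j) = (if i = j then 1 else 0)"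
    and ij: "i < m" "j < m"
  shows "smooth_on S (\<lambda>x. R x i j)"
proof -
  let ?M = "\<lambda>x. mat m m (\<lambda>(i, j). M x i j)" and ?R = "\<lambda>x. mat m m (\<lambda>(i, j). R x i j)"
  let ?d = "\<lambda>x. Determinant.det (?M x)"
  have d: "smooth_on S ?d" by (rule smooth_on_det[OF S M])
  have mr: "?M x * ?R x = 1\<^sub>m m" if "x \<in> S" for x
    by (rule eq_matI) (use MR[OF that] in \<open>auto simp: scalar_prod_def lessThan_atLeast0\<close>)
  have d0: "?d x \<noteq> 0" if "x \<in> S" for x
  proof
    assume "?d x = 0"
    then have "Determinant.det (?M x * ?R x) = 0" by (subst det_mult[of _ m]) auto
    then show False by (simp add: mr[OF that])
  qed
  have R: "R x i j = inverse (?d x) * adj_mat (?M x) $$ (i, j)" if x: "x \<in> S" for x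
  proof -
    have A: "adj_mat (?M x) \<in> carrier_mat m m" "adj_mat (?M x) * ?M x = ?d x \<cdot>\<^sub>m 1\<^sub>m m"
      using adj_mat[of "?M x" m] by auto
    have "adj_mat (?M x) = adj_mat (?M x) * (?M x * ?R x)" using A by (simp add: mr[OF x])
    also have "\<dots> = (adj_mat (?M x) * ?M x) * ?R x" by (rule assoc_mult_mat[symmetric, OF A(1)]) auto
    also have "\<dots> = ?d x \<cdot>\<^sub>m ?R x" unfolding A(2) by (subst mult_smult_assoc_mat[of _ m m _ m]) auto
    finally have "adj_mat (?M x) $$ (i, j) = ?d x * R x i j" using ij by simp
    then show ?thesis using d0[OF x] by simp
  qed
  have "mat_delete (?M x) j i = mat (m - 1) (m - 1) (\<lambda>(k, l). M x (insert_index j k) (insert_index i l))" for x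
    unfolding mat_delete_def using ij by (intro eq_matI) (auto simp: insert_index_def)
  then have adj: "adj_mat (?M x) $$ (i, j) = (- 1) ^ (j + i) *
      Determinant.det (mat (m - 1) (m - 1) (\<lambda>(k, l). M x (insert_index j k) (insert_index i l)))" for x
    using ij by (simp add: adj_mat_def cofactor_def)
  have "smooth_on S (\<lambda>x. inverse (?d x) * ((- 1) ^ (j + i) *
      Determinant.det (mat (m - 1) (m - 1) (\<lambda>(k, l). M x (insert_index j k) (insert_index i l)))))"
  proof (intro smooth_on_mult)
    show "smooth_on S (\<lambda>x. inverse (?d x))" by (rule smooth_on_inverse[OF S d0 d])
    show "smooth_on S (\<lambda>x. Determinant.det (mat (m - 1) (m - 1) (\<lambda>(k, l). M x (insert_index j k) (insert_index i l))))"
      by (rule smooth_on_det[OF S M]) (use ij in \<open>auto simp: insert_index_def\<close>)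
  qed (use S in auto)
  note s = this
  show ?thesis by (rule smooth_on_cong[OF S _ s]) (simp add: R adj)
qed

text \<open>The coordinates of the vectors \<open>dual b\<close> form the inverse of the matrix of
  w, up to transposition.\<close>

lemma smooth_on_dual:
  fixes w :: "'a::real_inner \<Rightarrow> 'e::real_inner ext"
  assumes w: "sform S w" and sp: "\<And>x. x \<in> S \<Longrightarrow> symplectic_space B n (w x)" and b: "b \<in> B" "c \<in> B" and B: "onb B"
  shows "smooth_on S (\<lambda>x. inner c (symplectic_space.dual (w x) b))"
proof -
  obtain es where es: "set es = B" "distinct es" using finite_distinct_list[OF onb_finite[OF B]] by blast
  obtain i j where ij: "i < length es" "j < length es" "c = es ! i" "b = es ! j" using b es by (metis in_set_conv_nth)
  have "smooth_on S (\<lambda>x. inner (es ! i) (symplectic_space.dual (w x) (es ! j)))"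
  proof (rule smooth_on_inverse_matrix[where m = "length es" and M = "\<lambda>x i j. w x [es ! j, es ! i]"])
    fix x i j assume x: "x \<in> S" and l: "i < length es" "j < length es"
    interpret symplectic_space B n "w x" by (rule sp[OF x])
    have "(\<Sum>k<length es. w x [es ! k, es ! i] * inner (es ! k) (dual (es ! j))) =
        (\<Sum>c\<in>B. w x [c, es ! i] * inner c (dual (es ! j)))"
      using sum.reindex_bij_betw[OF bij_betw_nth[OF es(2) refl es(1)[symmetric]]] by simp
    also have "\<dots> = w x [dual (es ! j), es ! i]"
      using onb_linear[OF B linear_w(1), of "dual (es ! j)"] by (simp add: mult.commute)
    also have "\<dots> = (if i = j then 1 else 0)"
      using onb_inner[OF B, of "es ! j" "es ! i"] l es nth_eq_iff_index_eq[OF es(2), of i j]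
      by (auto simp: w_dual inner_commute)
    finally show "(\<Sum>k<length es. w x [es ! k, es ! i] * inner (es ! k) (dual (es ! j))) = (if i = j then 1 else 0)" .
  qed (use w ij in \<open>auto simp: sform_def\<close>)
  then show ?thesis using ij by simp
qed

lemma sform_Lam:
  fixes w a :: "'a::real_inner \<Rightarrow> 'e::real_inner ext"
  assumes w: "sform S w" and sp: "\<And>x. x \<in> S \<Longrightarrow> symplectic_space B n (w x)" and B: "onb B"
    and a: "sform S a" "\<And>x. x \<in> S \<Longrightarrow> alt_form (a x)"
  shows "sform S (\<lambda>x. symplectic_space.Lam B (w x) (a x))"
  unfolding sform_def
proof (intro conjI allI)
  show S: "open S" by (rule sformD(1)[OF w])
  fix vs
  have "smooth_on S (\<lambda>x. (1 / 2) * (\<Sum>b\<in>B. \<Sum>c\<in>B. inner c (symplectic_space.dual (w x) b) * a x (c # b # vs)))"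
    using S sformD(2)[OF a(1)] smooth_on_dual[OF w sp _ _ B] onb_finite[OF B]
    by (intro smooth_on_mult smooth_on_sum) auto
  then show "smooth_on S (\<lambda>x. symplectic_space.Lam B (w x) (a x) vs)"
  proof (rule smooth_on_cong[OF S, rotated])
    fix x assume x: "x \<in> S"
    interpret symplectic_space B n "w x" by (rule sp[OF x])
    have "a x (dual b # b # vs) = (\<Sum>c\<in>B. inner c (dual b) * a x (c # b # vs))" for b
      using onb_linear[OF B, of "\<lambda>u. a x (u # b # vs)" "dual b"] alt_formD(1)[OF a(2)[OF x], of "[]" "b # vs"] by auto
    then show "(1 / 2) * (\<Sum>b\<in>B. \<Sum>c\<in>B. inner c (dual b) * a x (c # b # vs)) = Lam (a x) vs"
      by (simp add: Lam_def contr_def fun_apply)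
  qed
qed

section \<open>Symplectic manifolds\<close>

lemma (in smooth_manifold) frame_inj:
  assumes c: "c \<in> A" and x: "x \<in> chart_image c"
  shows "inj (\<lambda>v. dd v (rep c (\<lambda>p. p) (chart_at A (chart_inv c x))) x)"
proof (rule inj_on_inverseI)
  let ?c = "chart_at A (chart_inv c x)"
  fix v
  have "dd v (rep c (\<lambda>p. p) c) x = dd (dd v (rep c (\<lambda>p. p) ?c) x) (rep ?c (\<lambda>p. p) c) (rep c (\<lambda>p. p) ?c x)"
    by (rule rep_chain(1)[OF M M M smooth_map_id smooth_map_id c chart_at(1) c x chart_at(2) chart_inv(3)[OF c x]])
  then show "dd (dd v (rep c (\<lambda>p. p) ?c) x) (rep ?c (\<lambda>p. p) c) (rep c (\<lambda>p. p) ?c x) = v"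
    using rep_id[OF c x] by simp
qed

lemma trunc_exp_at:
  assumes "\<And>x. T x p = T' (x p)" shows "trunc_exp N c T x p = trunc_exp N c T' (x p)"
proof -
  have "(T ^^ i) x p = (T' ^^ i) (x p)" for i by (induction i) (simp_all add: assms)
  then show ?thesis by (simp add: trunc_exp_def sum_fun_apply scaleR_fun_apply)
qed

text \<open>In the codifferential the star is applied twice, in degrees that add up to 2 n +
  1.\<close>

lemma star_sign_mult: "k \<le> 2 * n + 1 \<Longrightarrow> star_sign k * star_sign (2 * n + 1 - k) = (- 1) ^ n"
proof (induction k)
  case 0
  have "Suc (2 * n) * (2 * n) div 2 = 2 * n * n + n" by (simp add: algebra_simps)
  then show ?case by (simp add: star_sign_def power_add power_mult)
next
  case (Suc k)
  have "2 * n + 1 - k = Suc (2 * n - k)" using Suc.prems by simp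
  then have "star_sign (2 * n + 1 - k) = (- 1) ^ (2 * n - k) * star_sign (2 * n + 1 - Suc k)"
    using star_sign_Suc[of "2 * n - k"] by simp
  moreover have "(- 1 :: real) ^ (2 * n - k) = (- 1) ^ k"
    using Suc.prems by (simp add: minus_one_power_iff)
  ultimately show ?case using Suc by (simp add: star_sign_Suc mult_ac)
qed

lemma wedge_form_of_fun: "form_wedge (form_of_fun f) \<alpha> = (\<lambda>p. f p *\<^sub>R \<alpha> p)"
proof
  fix p
  have "form_of_fun f p = f p *\<^sub>R ext_one" by (auto simp: form_of_fun_def ext_one_def fun_apply)
  show "form_wedge (form_of_fun f) \<alpha> p = f p *\<^sub>R \<alpha> p"
    unfolding form_wedge_def \<open>form_of_fun f p = f p *\<^sub>R ext_one\<close> by simp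
qed

context symplectic_manifold begin

definition form_L :: "('m, 'e) form \<Rightarrow> ('m, 'e) form" where "form_L = form_wedge \<omega>"

definition form_Lam :: "('m, 'e) form \<Rightarrow> ('m, 'e) form" where
  "form_Lam \<alpha> = (\<lambda>p. symplectic_space.Lam E (\<omega> p) (\<alpha> p))"

lemma sp: "symplectic_space E n (\<omega> p)"
proof
  show "card E = 2 * n" using onb_card[OF onb_E] dimension by simp
  show "\<omega> p \<in> Alt 2" using two_form by (simp add: Omega_deg_def)
qed (use onb_E nondegenerate in auto)

lemma \<omega>: "\<omega> \<in> Omega A"
  using two_form by (simp add: Omega_deg_def)

lemma sp_local: "c \<in> A \<Longrightarrow> x \<in> chart_image c \<Longrightarrow> symplectic_space E n (local_form A c \<omega> x)"
  unfolding local_form_rep by (rule symplectic_space.symplectic_space_comp[OF sp frame_linear frame_inj])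

lemma local_form_Lam:
  assumes c: "c \<in> A" and x: "x \<in> chart_image c" and a: "\<alpha> \<in> Omega A"
  shows "local_form A c (form_Lam \<alpha>) x = symplectic_space.Lam E (local_form A c \<omega> x) (local_form A c \<alpha> x)"
  unfolding local_form_rep form_Lam_def
  by (rule symplectic_space.Lam_comp[OF sp frame_linear[OF c x] frame_inj[OF c x] OmegaD(1)[OF a], symmetric])

lemma Omega_Lam: "\<alpha> \<in> Omega A \<Longrightarrow> form_Lam \<alpha> \<in> Omega A"
proof (rule OmegaI)
  assume a: "\<alpha> \<in> Omega A"
  show "alt_form (form_Lam \<alpha> p)" for p
    unfolding form_Lam_def by (rule symplectic_space.Lam_alt[OF sp OmegaD(1)[OF a]])
  show "sform (chart_image c) (local_form A c (form_Lam \<alpha>))" if c: "c \<in> A" for c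
    by (rule sform_cong[OF local_form_Lam[OF c _ a, symmetric]
        sform_Lam[OF OmegaD(2)[OF \<omega> c] sp_local[OF c] onb_E OmegaD(2)[OF a c] OmegaD(3)[OF a c]]])
qed

lemma pullback_Lam:
  assumes f: "smooth_map A A f" and inj: "inj (tangent_map A A f p)" and w: "pullback A A f \<omega> p = \<omega> p" and a: "\<alpha> \<in> Omega A"
  shows "pullback A A f (form_Lam \<alpha>) p = form_Lam (pullback A A f \<alpha>) p"
proof -
  have "pullback A A f (form_Lam \<alpha>) p =
      symplectic_space.Lam E (pullback A A f \<omega> p) (pullback A A f \<alpha> p)"
    unfolding pullback_def form_Lam_def
    by (rule symplectic_space.Lam_comp[OF sp tangent_map_linear[OF M M f] inj OmegaD(1)[OF a], symmetric])
  then show ?thesis by (simp add: form_Lam_def w)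
qed

sublocale lefschetz_complex "Omega A" n form_part form_L form_Lam "ext_d A"
proof
  show "subspace (Omega A)" by (rule subspace_Omega)
  show "lin_op (Omega A) (form_part k)" for k
    by (rule lin_opI[OF Omega_form_part]) (auto simp: form_part_def ext_part_def fun_eq_iff fun_apply)
  show "lin_op (Omega A) form_L"
    unfolding form_L_def by (rule lin_opI[OF Omega_wedge[OF \<omega>]]) (auto simp: form_wedge_def wedge_add_right fun_eq_iff plus_fun_apply scaleR_fun_apply)
  show "lin_op (Omega A) form_Lam"
  proof (rule lin_opI)
    fix \<alpha> \<beta> and r :: real assume "\<alpha> \<in> Omega A"
    show "form_Lam \<alpha> \<in> Omega A" by (rule Omega_Lam[OF \<open>\<alpha> \<in> Omega A\<close>])
    show "form_Lam (r *\<^sub>R \<alpha>) = r *\<^sub>R form_Lam \<alpha>"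
      by (auto simp: form_Lam_def fun_eq_iff scaleR_fun_apply symplectic_space.Lam_def[OF sp] scaleR_sum_right sum_fun_apply contr_def)
    show "form_Lam (\<alpha> + \<beta>) = form_Lam \<alpha> + form_Lam \<beta>"
      by (auto simp: form_Lam_def fun_eq_iff plus_fun_apply symplectic_space.Lam_def[OF sp] sum_fun_apply contr_def sum.distrib algebra_simps)
  qed
  show "lin_op (Omega A) (ext_d A)" by (rule ext_d_lin)
  fix \<alpha> and j k :: nat assume a: "\<alpha> \<in> Omega A"
  show "form_part j (form_part k \<alpha>) = (if j = k then form_part k \<alpha> else 0)"
    by (auto simp: form_part_def ext_part_def fun_eq_iff fun_apply)
  show "ext_d A (ext_d A \<alpha>) = 0" by (rule ext_d_ext_d[OF a])
  show "form_part k (ext_d A \<alpha>) = (if k = 0 then 0 else ext_d A (form_part (k - 1) \<alpha>))" by (rule form_part_ext_d)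
  show "form_L (ext_d A \<alpha>) = ext_d A (form_L \<alpha>)"
  proof
    fix p
    have "grade_inv (\<omega> p) = \<omega> p"
      using supp_deg_grade_inv[OF symplectic_space.supp_w[OF sp]] by simp
    then show "form_L (ext_d A \<alpha>) p = ext_d A (form_L \<alpha>) p"
      unfolding form_L_def ext_d_wedge[OF \<omega> a] closed by (simp add: form_wedge_def) (simp add: zero_form_def wedge_def fun_eq_iff fun_apply)
  qed
  \<comment> \<open>The remaining axioms are pointwise and inherited from the exterior algebra at
    p.\<close>
  { fix p
    interpret S: symplectic_space E n "\<omega> p" by (rule sp)
    have ap: "\<alpha> p \<in> {a. alt_form a}" using OmegaD(1)[OF a] by simp
    have 1: "(\<Sum>k\<le>2 * n. form_part k \<alpha>) p = \<alpha> p"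
      using S.P_sum[OF ap] by (simp add: sum_fun_apply[of _ _ p] form_part_def)
    have 2: "form_part k (form_L \<alpha>) p = (if k < 2 then 0 else form_L (form_part (k - 2) \<alpha>)) p"
      using S.P_L[OF ap, of k] by (auto simp: form_part_def form_L_def form_wedge_def S.L_def zero_fun_apply)
    have 3: "form_part k (form_Lam \<alpha>) p = form_Lam (form_part (k + 2) \<alpha>) p"
      using S.P_Lam[OF ap, of k] by (simp add: form_part_def form_Lam_def)
    have 4: "form_Lam (form_L \<alpha>) p = (form_L (form_Lam \<alpha>) + (real n - real k) *\<^sub>R \<alpha>) p" if "form_part k \<alpha> = \<alpha>"
      using S.Lam_L[OF ap, of k] fun_cong[OF that, of p]
      by (simp add: form_part_def form_Lam_def form_L_def form_wedge_def S.L_def plus_fun_apply[of _ _ p] scaleR_fun_apply[of _ _ p])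
    note 1 2 3 4 }
  note pt = this
  show "(\<Sum>k\<le>2 * n. form_part k \<alpha>) = \<alpha>"
    "form_part k (form_L \<alpha>) = (if k < 2 then 0 else form_L (form_part (k - 2) \<alpha>))"
    "form_part k (form_Lam \<alpha>) = form_Lam (form_part (k + 2) \<alpha>)"
    "form_part k \<alpha> = \<alpha> \<Longrightarrow> form_Lam (form_L \<alpha>) = form_L (form_Lam \<alpha>) + (real n - real k) *\<^sub>R \<alpha>"
    by (rule ext, erule pt | rule ext, rule pt)+
qed

lemma form_L_at: "form_L \<alpha> p = symplectic_space.L (\<omega> p) (\<alpha> p)"
  by (simp add: form_L_def form_wedge_def symplectic_space.L_def[OF sp])

lemma W_at: "W \<alpha> p = lefschetz_module.W n (symplectic_space.L (\<omega> p)) (symplectic_space.Lam E (\<omega> p)) (\<alpha> p)"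
proof -
  interpret S: symplectic_space E n "\<omega> p" by (rule sp)
  note L = trunc_exp_at[of form_L p S.L, OF form_L_at]
  have Lam: "trunc_exp N c form_Lam \<beta> p = trunc_exp N c S.Lam (\<beta> p)" for N c \<beta>
    by (rule trunc_exp_at) (simp add: form_Lam_def)
  show ?thesis by (simp only: W_def S.W_def L Lam)
qed

lemma hom_part_Alt: "\<alpha> \<in> hom_part k \<Longrightarrow> \<alpha> p \<in> Alt k"
proof -
  assume "\<alpha> \<in> hom_part k"
  then have "\<alpha> \<in> Omega A" "ext_part k (\<alpha> p) = \<alpha> p" by (auto simp: hom_part_def form_part_def fun_eq_iff)
  then show ?thesis using OmegaD(1)[of \<alpha> p] by (simp add: Alt_eq)
qed

lemma hom_part_Omega_deg: "hom_part k = Omega_deg A k"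
proof -
  have "\<alpha> \<in> hom_part k" if "\<alpha> \<in> Omega_deg A k" for \<alpha>
    using that by (auto simp: hom_part_def Omega_deg_def form_part_def fun_eq_iff Alt_eq)
  then show ?thesis using hom_part_Alt by (auto simp: Omega_deg_def hom_part_def)
qed

lemma form_W_W: "\<alpha> \<in> hom_part k \<Longrightarrow> W (W \<alpha>) = (- 1) ^ (n + k) *\<^sub>R \<alpha>"
proof
  fix p assume "\<alpha> \<in> hom_part k"
  from symplectic_space.W_W[OF sp hom_part_Alt[OF this], of p]
  show "W (W \<alpha>) p = ((- 1) ^ (n + k) *\<^sub>R \<alpha>) p" by (simp add: W_at scaleR_fun_apply)
qed

lemma hom_W: "\<alpha> \<in> hom_part k \<Longrightarrow> k \<le> 2 * n \<Longrightarrow> W \<alpha> \<in> hom_part (2 * n - k)"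
proof -
  assume a: "\<alpha> \<in> hom_part k" and k: "k \<le> 2 * n"
  have "W \<alpha> \<in> Omega A" by (rule lin_op_mem[OF W hom_partD(1)[OF a]])
  moreover have "W \<alpha> p \<in> Alt (2 * n - k)" for p
    unfolding W_at using symplectic_space.W_Alt[OF sp hom_part_Alt[OF a], of p] k by simp
  ultimately show ?thesis by (simp add: hom_part_Omega_deg Omega_deg_def)
qed

lemma sympl_star_eq: "\<alpha> \<in> hom_part k \<Longrightarrow> sympl_star n \<omega> \<alpha> = star_sign k *\<^sub>R W \<alpha>"
proof
  fix p assume "\<alpha> \<in> hom_part k"
  from symplectic_space.ext_star_eq[OF sp hom_part_Alt[OF this], of p]
  show "sympl_star n \<omega> \<alpha> p = (star_sign k *\<^sub>R W \<alpha>) p" by (simp add: sympl_star_def W_at scaleR_fun_apply)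
qed

text \<open>The rule W D = d W turns the derivative of the first star into a multiple of W (D
  \<alpha>), and the second star produces W W. With j = k - 1 the signs are (-1)^n from
  \<open>star_sign_mult\<close> and (-1)^(n + j) from \<open>form_W_W\<close>, so exactly the sign
  in the definition of the codifferential is left.\<close>

lemma sympl_delta_hom:
  assumes a: "\<alpha> \<in> hom_part k" and k: "k \<le> 2 * n"
  shows "(- 1) ^ (k + 1) *\<^sub>R sympl_star n \<omega> (ext_d A (sympl_star n \<omega> \<alpha>)) = D \<alpha>"
proof (cases k)
  \<comment> \<open>The star of a function has top degree, so its derivative vanishes, as does D of
    a function.\<close>
  case 0
  have "ext_d A (W \<alpha>) = W (D \<alpha>)" by (rule W_D[OF hom_partD(1)[OF a], symmetric])
  then have "ext_d A (W \<alpha>) = 0" using D_low[of \<alpha>] a 0 lin_op_zero[OF W V] by simp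
  then have "ext_d A (sympl_star n \<omega> \<alpha>) = 0"
    using lin_op_scale[OF d lin_op_mem[OF W hom_partD(1)[OF a]]] by (simp add: sympl_star_eq[OF a])
  moreover have "sympl_star n \<omega> 0 = 0"
    using sympl_star_eq[of 0 0] lin_op_zero[OF W V] subspace_0[OF subspace_hom_part] by simp
  ultimately show ?thesis using D_low[of \<alpha>] a 0 by simp
next
  case (Suc j)
  have aV: "\<alpha> \<in> Omega A" and Wa: "W \<alpha> \<in> Omega A" using lin_op_mem[OF W] hom_partD(1)[OF a] by auto
  have Da: "D \<alpha> \<in> hom_part j" using hom_D[of \<alpha> j] a Suc by simp
  have DV: "D \<alpha> \<in> Omega A" by (rule hom_partD(1)[OF Da])
  have e: "ext_d A (sympl_star n \<omega> \<alpha>) = star_sign k *\<^sub>R W (D \<alpha>)"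
    unfolding sympl_star_eq[OF a] lin_op_scale[OF d Wa] W_D[OF aV] ..
  have h: "star_sign k *\<^sub>R W (D \<alpha>) \<in> hom_part (2 * n - j)"
    by (rule subspace_scale[OF subspace_hom_part hom_W[OF Da]]) (use k Suc in simp)
  have "sympl_star n \<omega> (ext_d A (sympl_star n \<omega> \<alpha>)) = star_sign (2 * n - j) *\<^sub>R W (star_sign k *\<^sub>R W (D \<alpha>))"
    unfolding e by (rule sympl_star_eq[OF h])
  also have "\<dots> = (star_sign k * star_sign (2 * n - j)) *\<^sub>R W (W (D \<alpha>))"
    by (simp add: lin_op_scale[OF W lin_op_mem[OF W DV]] mult.commute)
  also have "\<dots> = ((- 1) ^ n * (- 1) ^ (n + j)) *\<^sub>R D \<alpha>"
    using star_sign_mult[of k n] k Suc by (simp add: form_W_W[OF Da])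
  also have "(- 1) ^ n * (- 1) ^ (n + j) = ((- 1) ^ (k + 1) :: real)" by (simp add: Suc power_add)
  finally have "sympl_star n \<omega> (ext_d A (sympl_star n \<omega> \<alpha>)) = (- 1) ^ (k + 1) *\<^sub>R D \<alpha>" .
  then show ?thesis by (simp add: power_mult_distrib[symmetric])
qed

theorem sympl_delta_eq: "\<alpha> \<in> Omega A \<Longrightarrow> sympl_delta A n \<omega> \<alpha> = D \<alpha>"
proof -
  assume a: "\<alpha> \<in> Omega A"
  have "sympl_delta A n \<omega> \<alpha> = (\<Sum>k\<le>2 * n. (- 1) ^ (k + 1) *\<^sub>R
      sympl_star n \<omega> (ext_d A (sympl_star n \<omega> (form_part k \<alpha>))))"
    by (simp add: sympl_delta_def fun_eq_iff sum_fun_apply scaleR_fun_apply)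
  also have "\<dots> = (\<Sum>k\<le>2 * n. D (form_part k \<alpha>))"
    by (rule sum.cong[OF refl], rule sympl_delta_hom) (use P_hom[OF a] in auto)
  also have "\<dots> = D (\<Sum>k\<le>2 * n. form_part k \<alpha>)"
    by (rule lin_op_sum[OF D V, symmetric]) (use a Omega_form_part in auto)
  finally show ?thesis using P_sum[OF a] by simp
qed

text \<open>Since df is the contraction of \<omega> with X, the Leibniz rule reduces the commutator
  of D with f to that of Lam with wedging by \<open>contr (X p) (\<omega> p)\<close>, which is minus
  the contraction by \<open>Lam_wedge_flat\<close>.\<close>

lemma D_function_mult:
  assumes f: "form_of_fun f \<in> Omega A" and X: "ext_d A (form_of_fun f) = contract X \<omega>" and a: "\<alpha> \<in> Omega A"
  shows "D (\<lambda>p. f p *\<^sub>R \<alpha> p) p = f p *\<^sub>R D \<alpha> p - contr (X p) (\<alpha> p)"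
proof -
  interpret S: symplectic_space E n "\<omega> p" by (rule sp)
  let ?t = "contr (X p) (\<omega> p)"
  have ed: "ext_d A (\<lambda>p. f p *\<^sub>R \<beta> p) p = wedge ?t (\<beta> p) + f p *\<^sub>R ext_d A \<beta> p" if b: "\<beta> \<in> Omega A" for \<beta>
  proof -
    have g: "grade_inv (form_of_fun f p) = f p *\<^sub>R ext_one"
      by (auto simp: form_of_fun_def ext_one_def fun_apply grade_inv_def)
    have "ext_d A (form_of_fun f) p = ?t" by (simp add: X contract_def contr_def)
    then show ?thesis using ext_d_wedge[OF f b, of p] by (simp add: wedge_form_of_fun g)
  qed
  have alt: "alt_form (\<alpha> p)" "alt_form (ext_d A \<alpha> p)" "alt_form (wedge ?t (\<alpha> p))"
    using OmegaD(1)[OF a] OmegaD(1)[OF Omega_ext_d[OF a]] S.flat_Alt by (auto simp: Alt_iff alt_wedge)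
  have lam: "form_Lam (\<lambda>p. f p *\<^sub>R \<alpha> p) = (\<lambda>p. f p *\<^sub>R form_Lam \<alpha> p)"
  proof
    fix q
    interpret Q: symplectic_space E n "\<omega> q" by (rule sp)
    show "form_Lam (\<lambda>p. f p *\<^sub>R \<alpha> p) q = f q *\<^sub>R form_Lam \<alpha> q"
      unfolding form_Lam_def by (rule lin_op_scale[OF Q.Lam]) (simp add: OmegaD(1)[OF a])
  qed
  have "D (\<lambda>p. f p *\<^sub>R \<alpha> p) p = S.Lam (ext_d A (\<lambda>p. f p *\<^sub>R \<alpha> p) p) - ext_d A (\<lambda>p. f p *\<^sub>R form_Lam \<alpha> p) p"
    unfolding D_def lam minus_apply by (simp add: form_Lam_def)
  also have "\<dots> = S.Lam (wedge ?t (\<alpha> p)) + f p *\<^sub>R S.Lam (ext_d A \<alpha> p) -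
      (wedge ?t (S.Lam (\<alpha> p)) + f p *\<^sub>R ext_d A (form_Lam \<alpha>) p)"
    unfolding ed[OF a] ed[OF Omega_Lam[OF a]]
    using alt by (simp add: lin_op_add[OF S.Lam] lin_op_scale[OF S.Lam] alt_scale form_Lam_def)
  also have "\<dots> = f p *\<^sub>R (S.Lam (ext_d A \<alpha> p) - ext_d A (form_Lam \<alpha>) p) - contr (X p) (\<alpha> p)"
    using S.Lam_wedge_flat[OF alt(1), of "X p"] by (simp add: scaleR_diff_right)
  finally show ?thesis unfolding D_def minus_apply form_Lam_def .
qed

section \<open>The Lefschetz property on representatives\<close>

lemma form_L_pow: "(form_L ^^ k) \<alpha> = form_wedge (form_power \<omega> k) \<alpha>"
  by (induction k) (simp_all add: form_L_def form_wedge_def form_power_def wedge_power_def wedge_list_def wedge_assoc)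

lemma zero_form_eq: "zero_form = (0 :: ('m, 'e) form)"
  by (simp add: zero_form_def fun_eq_iff fun_apply)

lemma cohomology_class_iff:
  "\<beta> \<in> cohomology_class A \<alpha> \<longleftrightarrow> \<beta> \<in> Omega A \<and> ext_d A \<beta> = 0 \<and> (\<exists>\<gamma>\<in>Omega A. \<beta> = \<alpha> + ext_d A \<gamma>)"
proof -
  have "(\<lambda>p vs. \<alpha> p vs + ext_d A \<gamma> p vs) = \<alpha> + ext_d A \<gamma>" for \<gamma> by (simp add: fun_eq_iff fun_apply)
  then show ?thesis by (simp add: cohomology_class_def zero_form_eq)
qed

lemma cohomology_class_self: "\<alpha> \<in> Omega A \<Longrightarrow> ext_d A \<alpha> = 0 \<Longrightarrow> \<alpha> \<in> cohomology_class A \<alpha>"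
  unfolding cohomology_class_iff using d_zero Vsub(1) by fastforce

text \<open>The union in \<open>lefschetz_map\<close> runs over representatives whose images differ
  by exact forms, because L commutes with d; so it is a single class.\<close>

lemma lefschetz_map_iff:
  assumes a: "\<alpha> \<in> Omega A" "ext_d A \<alpha> = 0"
  shows "\<beta> \<in> lefschetz_map A \<omega> k (cohomology_class A \<alpha>) \<longleftrightarrow> \<beta> \<in> cohomology_class A ((form_L ^^ k) \<alpha>)"
proof
  have Ld: "(form_L ^^ k) (ext_d A \<gamma>) = ext_d A ((form_L ^^ k) \<gamma>)" if "\<gamma> \<in> Omega A" for \<gamma>
    using that by (induction k) (simp_all add: L_d)
  assume "\<beta> \<in> lefschetz_map A \<omega> k (cohomology_class A \<alpha>)"
  then obtain \<alpha>' where a': "\<alpha>' \<in> cohomology_class A \<alpha>" "\<beta> \<in> cohomology_class A ((form_L ^^ k) \<alpha>')"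
    by (auto simp: lefschetz_map_def form_L_pow)
  then obtain \<gamma> where g: "\<gamma> \<in> Omega A" "\<alpha>' = \<alpha> + ext_d A \<gamma>" by (auto simp: cohomology_class_iff)
  obtain \<gamma>' where g': "\<gamma>' \<in> Omega A" "\<beta> = (form_L ^^ k) \<alpha>' + ext_d A \<gamma>'" "\<beta> \<in> Omega A" "ext_d A \<beta> = 0"
    using a'(2) by (auto simp: cohomology_class_iff)
  have "\<beta> = (form_L ^^ k) \<alpha> + ext_d A ((form_L ^^ k) \<gamma> + \<gamma>')"
    using g g' a by (simp add: lin_op_add[OF lin_op_pow[OF L]] lin_op_add[OF d] Ld)
  moreover have "(form_L ^^ k) \<gamma> + \<gamma>' \<in> Omega A" using g g' by simp
  ultimately show "\<beta> \<in> cohomology_class A ((form_L ^^ k) \<alpha>)" using g'(3,4) unfolding cohomology_class_iff by blast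
next
  assume "\<beta> \<in> cohomology_class A ((form_L ^^ k) \<alpha>)"
  then show "\<beta> \<in> lefschetz_map A \<omega> k (cohomology_class A \<alpha>)"
    using cohomology_class_self[OF a] by (auto simp: lefschetz_map_def form_L_pow)
qed

lemma form_lefschetz_surj:
  assumes "strong_lefschetz A n \<omega>" and k: "k \<le> n" and b: "b \<in> hom_part (n + k)" "ext_d A b = 0"
  shows "\<exists>a\<in>hom_part (n - k). ext_d A a = 0 \<and> (\<exists>c\<in>Omega A. b = (form_L ^^ k) a + ext_d A c)"
proof -
  have "cohomology_class A b \<in> cohomology A (n + k)"
    using b by (auto simp: cohomology_def hom_part_Omega_deg zero_form_eq)
  then have "cohomology_class A b \<in> lefschetz_map A \<omega> k ` cohomology A (n - k)"
    using assms(1) k by (auto simp: strong_lefschetz_def bij_betw_def)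
  then obtain a where a: "a \<in> hom_part (n - k)" "ext_d A a = 0"
    "cohomology_class A b = lefschetz_map A \<omega> k (cohomology_class A a)"
    by (auto simp: cohomology_def hom_part_Omega_deg zero_form_eq)
  have "b \<in> lefschetz_map A \<omega> k (cohomology_class A a)"
    using cohomology_class_self[of b] hom_partD(1)[OF b(1)] b(2) a(3) by blast
  then show ?thesis using a(1,2) hom_partD(1)[OF a(1)] by (auto simp: lefschetz_map_iff cohomology_class_iff)
qed

text \<open>An exact image has the same class as 0, so injectivity identifies the class of a with
  the class of 0.\<close>

lemma form_lefschetz_inj:
  assumes "strong_lefschetz A n \<omega>" and k: "k \<le> n" and a: "a \<in> hom_part (n - k)" "ext_d A a = 0"
    and c: "c \<in> Omega A" "(form_L ^^ k) a = ext_d A c"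
  shows "\<exists>e\<in>Omega A. a = ext_d A e"
proof -
  have aV: "a \<in> Omega A" by (rule hom_partD(1)[OF a(1)])
  have "(\<exists>g\<in>Omega A. \<beta> = ext_d A c + ext_d A g) \<longleftrightarrow> (\<exists>g\<in>Omega A. \<beta> = 0 + ext_d A g)" for \<beta>
  proof
    assume "\<exists>g\<in>Omega A. \<beta> = ext_d A c + ext_d A g"
    then obtain g where "g \<in> Omega A" "\<beta> = ext_d A c + ext_d A g" by blast
    then have "\<beta> = 0 + ext_d A (c + g)" "c + g \<in> Omega A" using c(1) by (simp_all add: lin_op_add[OF d])
    then show "\<exists>g\<in>Omega A. \<beta> = 0 + ext_d A g" by blast
  next
    assume "\<exists>g\<in>Omega A. \<beta> = 0 + ext_d A g"
    then obtain g where "g \<in> Omega A" "\<beta> = 0 + ext_d A g" by blast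
    then have "\<beta> = ext_d A c + ext_d A (g - c)" "g - c \<in> Omega A" using c(1) by (simp_all add: lin_op_diff[OF d V])
    then show "\<exists>g\<in>Omega A. \<beta> = ext_d A c + ext_d A g" by blast
  qed
  then have "\<beta> \<in> cohomology_class A ((form_L ^^ k) a) \<longleftrightarrow> \<beta> \<in> cohomology_class A ((form_L ^^ k) 0)" for \<beta>
    unfolding cohomology_class_iff c(2) by simp
  then have eq: "lefschetz_map A \<omega> k (cohomology_class A a) = lefschetz_map A \<omega> k (cohomology_class A 0)"
    using a(2) aV by (auto simp: lefschetz_map_iff)
  have "inj_on (lefschetz_map A \<omega> k) (cohomology A (n - k))"
    using assms(1) k by (auto simp: strong_lefschetz_def bij_betw_def)
  moreover have "cohomology_class A a \<in> cohomology A (n - k)" "cohomology_class A 0 \<in> cohomology A (n - k)"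
    using a subspace_0[OF subspace_hom_part] d_zero by (auto simp: cohomology_def hom_part_Omega_deg zero_form_eq)
  ultimately have "cohomology_class A a = cohomology_class A 0" using eq by (simp add: inj_on_def)
  then have "a \<in> cohomology_class A 0" using cohomology_class_self[OF aV a(2)] by simp
  then show ?thesis by (auto simp: cohomology_class_iff)
qed

end

section \<open>Maps defined on products\<close>

lemma dd_slice:
  assumes "H differentiable at (y, x)"
  shows "dd v (\<lambda>x. H (y, x)) x = dd (0, v) H (y, x)" "dd u (\<lambda>y. H (y, x)) y = dd (u, 0) H (y, x)"
    "(\<lambda>x. H (y, x)) differentiable at x" "(\<lambda>y. H (y, x)) differentiable at y"
proof -
  have 1: "((\<lambda>x. (y, x)) has_derivative (\<lambda>v. (0, v))) (at x)"
    by (rule has_derivative_Pair[OF has_derivative_const has_derivative_ident])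
  have 2: "((\<lambda>y. (y, x)) has_derivative (\<lambda>v. (v, 0))) (at y)"
    by (rule has_derivative_Pair[OF has_derivative_ident has_derivative_const])
  note H = has_derivative_dd[OF assms]
  note c1 = has_derivative_compose[OF 1 H] and c2 = has_derivative_compose[OF 2 H]
  show "dd v (\<lambda>x. H (y, x)) x = dd (0, v) H (y, x)" "dd u (\<lambda>y. H (y, x)) y = dd (u, 0) H (y, x)"
    using dd_eq[OF c1] dd_eq[OF c2] by auto
  show "(\<lambda>x. H (y, x)) differentiable at x" "(\<lambda>y. H (y, x)) differentiable at y"
    by (rule differentiableI[OF c1], rule differentiableI[OF c2])
qed

lemma dd_ident [simp]: "dd v (\<lambda>x. x) x = v"
  using dd_eq[OF has_derivative_ident] .

text \<open>Charts of a product are kept as pairs of charts of the factors, so the product atlas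
  enters only through the assumption \<open>F\<close>.\<close>

definition prep :: "('m, 'e) chart \<Rightarrow> ('k, 'f) chart \<Rightarrow> ('m \<times> 'k \<Rightarrow> 'l) \<Rightarrow> ('l, 'h) chart \<Rightarrow> 'e \<times> 'f \<Rightarrow> 'h" where
  "prep c c' F c'' = (\<lambda>z. snd c'' (F (chart_inv c (fst z), chart_inv c' (snd z))))"

definition prep_dom :: "('m, 'e) chart \<Rightarrow> ('k, 'f) chart \<Rightarrow> ('m \<times> 'k \<Rightarrow> 'l) \<Rightarrow> ('l, 'h) chart \<Rightarrow> ('e \<times> 'f) set" where
  "prep_dom c c' F c'' = {z. fst z \<in> chart_image c \<and> snd z \<in> chart_image c' \<and>
     F (chart_inv c (fst z), chart_inv c' (snd z)) \<in> fst c''}"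

locale smooth_prod_map = A: smooth_manifold A + B: smooth_manifold B + C: smooth_manifold C
  for A :: "('m::t2_space, 'e::{real_inner, heine_borel}) atlas"
    and B :: "('k::t2_space, 'f::{real_inner, heine_borel}) atlas"
    and C :: "('l::t2_space, 'h::{real_inner, heine_borel}) atlas" +
  fixes F :: "'m \<times> 'k \<Rightarrow> 'l"
  assumes F: "smooth_map (prod_atlas A B) C F"
begin

lemma prep:
  assumes c: "c \<in> A" "c' \<in> B" "c'' \<in> C"
  shows "open (prep_dom c c' F c'')" "smooth_on (prep_dom c c' F c'') (prep c c' F c'')"
proof -
  let ?k = "(fst c \<times> fst c', map_prod (snd c) (snd c'))"
  let ?G = "\<lambda>z. F (chart_inv c (fst z), chart_inv c' (snd z))"
  have ct: "continuous_on UNIV F" using F by (simp add: smooth_map_def)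
  have ci: "continuous_on (chart_image c) (chart_inv c)" "continuous_on (chart_image c') (chart_inv c')"
    using A.chart_homeomorphism[OF c(1)] B.chart_homeomorphism[OF c(2)] by (auto simp: homeomorphism_def)
  have "continuous_on (chart_image c \<times> chart_image c') (\<lambda>z. (chart_inv c (fst z), chart_inv c' (snd z)))"
    by (intro continuous_on_Pair continuous_on_compose2[OF ci(1)] continuous_on_compose2[OF ci(2)] continuous_intros) auto
  then have "continuous_on (chart_image c \<times> chart_image c') ?G"
    by (rule continuous_on_compose2[OF ct]) auto
  then have "open ((chart_image c \<times> chart_image c') \<inter> ?G -` fst c'')"
    by (rule continuous_open_preimage) (intro open_Times A.open_image B.open_image C.open_domain c)+
  moreover have "(chart_image c \<times> chart_image c') \<inter> ?G -` fst c'' = prep_dom c c' F c''"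
    by (auto simp: prep_dom_def)
  ultimately show o: "open (prep_dom c c' F c'')" by simp
  have inj: "inj_on (map_prod (snd c) (snd c')) (fst c \<times> fst c')"
    by (rule inj_on_inverseI[where g = "map_prod (chart_inv c) (chart_inv c')"])
      (auto simp: A.chart_inv(1)[OF c(1)] B.chart_inv(1)[OF c(2)])
  have inv: "chart_inv ?k z = (chart_inv c (fst z), chart_inv c' (snd z))"
    if "fst z \<in> chart_image c" "snd z \<in> chart_image c'" for z
    unfolding chart_inv_def[of ?k] fst_conv snd_conv
    by (rule inv_into_f_eq[OF inj]) (use that in \<open>auto simp: A.chart_inv[OF c(1)] B.chart_inv[OF c(2)]\<close>)
  have "snd ?k ` (fst ?k \<inter> F -` fst c'') = prep_dom c c' F c''"
  proof
    show "snd ?k ` (fst ?k \<inter> F -` fst c'') \<subseteq> prep_dom c c' F c''"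
      by (auto simp: prep_dom_def A.chart_inv[OF c(1)] B.chart_inv[OF c(2)])
    show "prep_dom c c' F c'' \<subseteq> snd ?k ` (fst ?k \<inter> F -` fst c'')"
    proof
      fix z assume z: "z \<in> prep_dom c c' F c''"
      show "z \<in> snd ?k ` (fst ?k \<inter> F -` fst c'')"
        by (rule image_eqI[where x = "(chart_inv c (fst z), chart_inv c' (snd z))"])
          (use z in \<open>auto simp: prep_dom_def A.chart_inv[OF c(1)] B.chart_inv[OF c(2)]\<close>)
    qed
  qed
  moreover have "?k \<in> prod_atlas A B" using c unfolding prod_atlas_def by blast
  ultimately have s: "smooth_on (prep_dom c c' F c'') (snd c'' \<circ> F \<circ> chart_inv ?k)"
    using F c(3) by (fastforce simp: smooth_map_def)
  show "smooth_on (prep_dom c c' F c'') (prep c c' F c'')"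
    by (rule smooth_on_cong[OF o _ s]) (auto simp: prep_def prep_dom_def inv)
qed

lemma chart_inv_prep: "c'' \<in> C \<Longrightarrow> z \<in> prep_dom c c' F c'' \<Longrightarrow>
    chart_inv c'' (prep c c' F c'' z) = F (chart_inv c (fst z), chart_inv c' (snd z))"
  by (auto simp: prep_def prep_dom_def C.chart_inv)

lemma prep_image: "c'' \<in> C \<Longrightarrow> z \<in> prep_dom c c' F c'' \<Longrightarrow> prep c c' F c'' z \<in> chart_image c''"
  by (auto simp: prep_def prep_dom_def C.chart_inv)

lemma in_prep_dom: "c \<in> A \<Longrightarrow> c' \<in> B \<Longrightarrow> a \<in> fst c \<Longrightarrow> b \<in> fst c' \<Longrightarrow> F (a, b) \<in> fst c'' \<Longrightarrow>
    (snd c a, snd c' b) \<in> prep_dom c c' F c''"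
  by (auto simp: prep_dom_def A.chart_inv B.chart_inv)

lemma smooth_map_left: "smooth_map A C (\<lambda>a. F (a, b))"
proof (rule smooth_mapI[OF A.M C.M])
  show "continuous_on UNIV (\<lambda>a. F (a, b))"
    by (rule continuous_on_compose2[of UNIV F]) (use F in \<open>auto simp: smooth_map_def intro!: continuous_intros\<close>)
  fix p
  let ?c = "chart_at A p" and ?c' = "chart_at B b" and ?c'' = "chart_at C (F (p, b))"
  let ?S = "prep_dom ?c ?c' F ?c''" and ?f = "\<lambda>y. (y, snd ?c' b)"
  note r = prep[OF A.chart_at(1) B.chart_at(1) C.chart_at(1), of p b "F (p, b)"]
  have U: "open (?f -` ?S)" by (intro open_vimage[OF r(1)] continuous_intros)
  have f: "smooth_on (?f -` ?S) ?f" by (intro smooth_on_Pair smooth_on_const U smooth_on_id[OF bounded_linear_ident])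
  have s: "smooth_on (?f -` ?S) (\<lambda>y. prep ?c ?c' F ?c'' (?f y))"
    by (rule smooth_on_compose[OF onb_Times[OF A.onb_E B.onb_E] U r(1) _ r(2) f]) simp
  have b: "chart_inv ?c' (snd ?c' b) = b" by (simp add: B.chart_inv(1)[OF B.chart_at])
  have "prep ?c ?c' F ?c'' (?f y) = rep ?c (\<lambda>a. F (a, b)) ?c'' y" for y
    by (simp add: prep_def rep_def b)
  then have "smooth_on (?f -` ?S) (rep ?c (\<lambda>a. F (a, b)) ?c'')" using s by simp
  moreover have "?f -` ?S \<subseteq> rep_dom ?c (\<lambda>a. F (a, b)) ?c''"
    by (auto simp: prep_dom_def b A.rep_dom_iff[OF A.chart_at(1)])
  moreover have "snd ?c p \<in> ?f -` ?S"
    using in_prep_dom[OF A.chart_at(1) B.chart_at(1) A.chart_at(2) B.chart_at(2) C.chart_at(2), of p b] by simp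
  ultimately show "\<exists>c\<in>A. \<exists>c'\<in>C. \<exists>U. open U \<and> snd c p \<in> U \<and> U \<subseteq> rep_dom c (\<lambda>a. F (a, b)) c' \<and> p \<in> fst c \<and>
      smooth_on U (rep c (\<lambda>a. F (a, b)) c')"
    using U A.chart_at C.chart_at by blast
qed

lemma smooth_map_right: "smooth_map B C (\<lambda>b. F (a, b))"
proof (rule smooth_mapI[OF B.M C.M])
  show "continuous_on UNIV (\<lambda>b. F (a, b))"
    by (rule continuous_on_compose2[of UNIV F]) (use F in \<open>auto simp: smooth_map_def intro!: continuous_intros\<close>)
  fix p
  let ?c = "chart_at A a" and ?c' = "chart_at B p" and ?c'' = "chart_at C (F (a, p))"
  let ?S = "prep_dom ?c ?c' F ?c''" and ?f = "\<lambda>x. (snd ?c a, x)"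
  note r = prep[OF A.chart_at(1) B.chart_at(1) C.chart_at(1), of a p "F (a, p)"]
  have U: "open (?f -` ?S)" by (intro open_vimage[OF r(1)] continuous_intros)
  have f: "smooth_on (?f -` ?S) ?f" by (intro smooth_on_Pair smooth_on_const U smooth_on_id[OF bounded_linear_ident])
  have s: "smooth_on (?f -` ?S) (\<lambda>y. prep ?c ?c' F ?c'' (?f y))"
    by (rule smooth_on_compose[OF onb_Times[OF A.onb_E B.onb_E] U r(1) _ r(2) f]) simp
  have a: "chart_inv ?c (snd ?c a) = a" by (simp add: A.chart_inv(1)[OF A.chart_at])
  have "prep ?c ?c' F ?c'' (?f y) = rep ?c' (\<lambda>b. F (a, b)) ?c'' y" for y
    by (simp add: prep_def rep_def a)
  then have "smooth_on (?f -` ?S) (rep ?c' (\<lambda>b. F (a, b)) ?c'')" using s by simp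
  moreover have "?f -` ?S \<subseteq> rep_dom ?c' (\<lambda>b. F (a, b)) ?c''"
    by (auto simp: prep_dom_def a B.rep_dom_iff[OF B.chart_at(1)])
  moreover have "snd ?c' p \<in> ?f -` ?S"
    using in_prep_dom[OF A.chart_at(1) B.chart_at(1) A.chart_at(2) B.chart_at(2) C.chart_at(2), of a p] by simp
  ultimately show "\<exists>c\<in>B. \<exists>c'\<in>C. \<exists>U. open U \<and> snd c p \<in> U \<and> U \<subseteq> rep_dom c (\<lambda>b. F (a, b)) c' \<and> p \<in> fst c \<and>
      smooth_on U (rep c (\<lambda>b. F (a, b)) c')"
    using U B.chart_at C.chart_at by blast
qed

end

section \<open>Lie groups\<close>

context lie_group begin

lemma carrier [simp]: "x \<in> carrier G"
  by (simp add: carrier_UNIV)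

lemma mult_map: "smooth_prod_map A A A (\<lambda>(g, h). g \<otimes> h)"
  by unfold_locales (rule smooth_mult)

sublocale mult: smooth_prod_map A A A "\<lambda>(g, h). g \<otimes> h"
  by (rule mult_map)

lemma smooth_conj: "smooth_map A A (\<lambda>h. g \<otimes> h \<otimes> inv g)"
proof -
  have "smooth_map A A (\<lambda>h. g \<otimes> h)" "smooth_map A A (\<lambda>h. h \<otimes> inv g)"
    using mult.smooth_map_right[of g] mult.smooth_map_left[of "inv g"] by auto
  from smooth_map_comp[OF M M M this] show ?thesis .
qed

lemma linear_Ad: "linear (Ad G A g)"
  unfolding Ad_def by (rule tangent_map_linear[OF M M smooth_conj])

lemma Ad_one [simp]: "Ad G A \<one> \<xi> = \<xi>"
  using tangent_map_id[OF M, of \<one>] by (simp add: Ad_def)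

lemma Ad_mult: "Ad G A (g \<otimes> h) \<xi> = Ad G A g (Ad G A h \<xi>)"
proof -
  have "(\<lambda>p. g \<otimes> h \<otimes> p \<otimes> inv (g \<otimes> h)) = (\<lambda>p. g \<otimes> (h \<otimes> p \<otimes> inv h) \<otimes> inv g)"
    by (simp add: inv_mult_group m_assoc)
  then show ?thesis
    using tangent_map_comp[OF M M M smooth_conj[of h] smooth_conj[of g], of \<one> \<xi>] by (simp add: Ad_def)
qed

text \<open>Ad is the derivative of conjugation in its second variable, and its dependence on the
  first has to be controlled; hence the joint coordinate expression H, assembled from multiplication
  and inversion.\<close>

lemma conj_chart:
  "\<exists>U H. open U \<and> (snd (chart_at A g0) g0, snd (chart_at A \<one>) \<one>) \<in> U \<and> smooth_on U H \<and>
    (\<forall>y z. (y, z) \<in> U \<longrightarrow> y \<in> chart_image (chart_at A g0) \<and> z \<in> chart_image (chart_at A \<one>) \<and>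
      H (y, z) = rep (chart_at A \<one>)
        (\<lambda>h. chart_inv (chart_at A g0) y \<otimes> h \<otimes> inv (chart_inv (chart_at A g0) y)) (chart_at A \<one>) z)"
proof -
  let ?c = "chart_at A g0" and ?e = "chart_at A \<one>" and ?i = "chart_at A (inv g0)"
  let ?m = "\<lambda>(g, h). g \<otimes> h" and ?x = "(snd (chart_at A g0) g0, snd (chart_at A \<one>) \<one>)"
  define M1 where "M1 = prep ?c ?e ?m ?c"
  define M2 where "M2 = prep ?c ?i ?m ?e"
  define I where "I = rep ?c (\<lambda>g. inv g) ?i"
  define S1 where "S1 = prep_dom ?c ?e ?m ?c"
  define S2 where "S2 = prep_dom ?c ?i ?m ?e"
  define S3 where "S3 = rep_dom ?c (\<lambda>g. inv g) ?i"
  note r1 = mult.prep[OF chart_at(1) chart_at(1) chart_at(1), of g0 \<one> g0, folded M1_def S1_def]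
    and r2 = mult.prep[OF chart_at(1) chart_at(1) chart_at(1), of g0 "inv g0" \<one>, folded M2_def S2_def]
    and r3 = smooth_map_rep[OF M M smooth_inv chart_at(1) chart_at(1), of g0 "inv g0", folded I_def S3_def]
  define S0 where "S0 = S1 \<inter> fst -` S3"
  have S0: "open S0" unfolding S0_def by (intro open_Int r1(1) open_vimage[OF r3(1)] continuous_intros)
  have sf: "smooth_on S0 (\<lambda>z. I (fst z))"
    by (rule smooth_on_compose[OF onb_E S0 r3(1) _ r3(2)])
      (auto simp: S0_def intro: smooth_on_id[OF bounded_linear_fst S0[unfolded S0_def]])
  have s1: "smooth_on S0 (\<lambda>z. (M1 z, I (fst z)))"
    by (rule smooth_on_Pair[OF S0 smooth_on_subset[OF r1(2)] sf]) (simp add: S0_def)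
  define U where "U = S0 \<inter> (\<lambda>z. (M1 z, I (fst z))) -` S2"
  have U: "open U" unfolding U_def by (rule continuous_open_preimage[OF smooth_on_continuous[OF s1] S0 r2(1)])
  define H where "H = (\<lambda>z. M2 (M1 z, I (fst z)))"
  have sH: "smooth_on U H" unfolding H_def
    by (rule smooth_on_compose[OF onb_Times[OF onb_E onb_E] U r2(1) _ r2(2) smooth_on_subset[OF s1]]) (auto simp: U_def)
  have c: "chart_inv ?c (snd ?c g0) = g0" "chart_inv ?e (snd ?e \<one>) = \<one>"
    by (simp_all add: chart_inv(1)[OF chart_at])
  have x1: "?x \<in> S1" unfolding S1_def
    by (rule mult.in_prep_dom[OF chart_at(1) chart_at(1) chart_at(2) chart_at(2)]) (simp add: chart_at(2))
  have x3: "fst ?x \<in> S3" unfolding S3_def fst_conv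
    by (rule rep_domI[OF chart_at(1) base_point]) (simp add: c chart_at(2))
  have "M1 ?x = snd ?c g0" "I (fst ?x) = snd ?i (inv g0)" by (simp_all add: M1_def I_def prep_def rep_def c)
  moreover have "(snd ?c g0, snd ?i (inv g0)) \<in> S2" unfolding S2_def
    by (rule mult.in_prep_dom[OF chart_at(1) chart_at(1) chart_at(2) chart_at(2)]) (simp add: chart_at(2))
  ultimately have xU: "?x \<in> U" using x1 x3 by (simp add: U_def S0_def)
  have dom: "y \<in> chart_image ?c \<and> z \<in> chart_image ?e" if "(y, z) \<in> U" for y z
    using that by (auto simp: U_def S0_def S1_def prep_dom_def)
  have eq: "H (y, z) = rep ?e (\<lambda>h. chart_inv ?c y \<otimes> h \<otimes> inv (chart_inv ?c y)) ?e z" if yz: "(y, z) \<in> U" for y z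
  proof -
    have 1: "(y, z) \<in> S1" "y \<in> S3" using yz by (auto simp: U_def S0_def)
    have "chart_inv ?c (M1 (y, z)) = chart_inv ?c y \<otimes> chart_inv ?e z"
      using mult.chart_inv_prep[OF chart_at(1), of "(y, z)" ?c ?e g0] 1(1) by (simp add: M1_def S1_def)
    moreover have "chart_inv ?i (I y) = inv (chart_inv ?c y)"
      using rep_domD(2)[OF chart_at(1) 1(2)[unfolded S3_def]] by (simp add: I_def rep_def chart_inv(1)[OF chart_at(1)])
    ultimately show ?thesis by (simp add: H_def M2_def prep_def rep_def)
  qed
  show ?thesis using U xU sH dom eq by blast
qed

lemma Ad_chart:
  assumes "(y, snd (chart_at A \<one>) \<one>) \<in> U" "open U" "smooth_on U H"
    "\<And>y z. (y, z) \<in> U \<Longrightarrow> H (y, z) = rep (chart_at A \<one>)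
      (\<lambda>h. chart_inv c y \<otimes> h \<otimes> inv (chart_inv c y)) (chart_at A \<one>) z"
  shows "Ad G A (chart_inv c y) \<xi> = dd (0, \<xi>) H (y, snd (chart_at A \<one>) \<one>)"
proof -
  let ?e = "chart_at A \<one>" let ?z = "snd ?e \<one>" let ?g = "chart_inv c y"
  note df = smooth_on_differentiable[OF assms(3,1)]
  have o: "open (Pair y -` U)" by (intro open_vimage[OF assms(2)] continuous_intros)
  have "dd \<xi> (\<lambda>z. H (y, z)) ?z = dd \<xi> (rep ?e (\<lambda>h. ?g \<otimes> h \<otimes> inv ?g) ?e) ?z"
    by (rule dd_cong[OF o _ _ dd_slice(3)[OF df]]) (use assms in auto)
  then show ?thesis by (simp add: Ad_def tangent_map_dd dd_slice(1)[OF df])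
qed

lemma continuous_Ad: "continuous_on UNIV (\<lambda>g. Ad G A g \<xi>)"
proof -
  have "isCont (\<lambda>g. Ad G A g \<xi>) g0" for g0
  proof -
    let ?c = "chart_at A g0" and ?z = "snd (chart_at A \<one>) \<one>"
    obtain U H where U: "open U" "(snd ?c g0, ?z) \<in> U" "smooth_on U H"
      "\<And>y z. (y, z) \<in> U \<Longrightarrow> y \<in> chart_image ?c \<and> z \<in> chart_image (chart_at A \<one>)"
      "\<And>y z. (y, z) \<in> U \<Longrightarrow> H (y, z) = rep (chart_at A \<one>)
        (\<lambda>h. chart_inv ?c y \<otimes> h \<otimes> inv (chart_inv ?c y)) (chart_at A \<one>) z"
      using conj_chart[of g0] by blast
    have sc: "continuous_on (fst ?c) (snd ?c)"
      using chart_homeomorphism[OF chart_at(1)] by (auto simp: homeomorphism_def)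
    have cc: "continuous_on (fst ?c) (\<lambda>g. (snd ?c g, ?z))"
      by (intro continuous_on_Pair sc continuous_on_const)
    define N where "N = fst ?c \<inter> (\<lambda>g. (snd ?c g, ?z)) -` U"
    have N: "open N" unfolding N_def by (rule continuous_open_preimage[OF cc open_domain[OF chart_at(1)] U(1)])
    have "continuous_on U (dd (0, \<xi>) H)" by (rule smooth_on_continuous[OF smooth_on_dd[OF U(3)]])
    then have "continuous_on N (\<lambda>g. dd (0, \<xi>) H (snd ?c g, ?z))"
      by (rule continuous_on_compose2) (auto simp: N_def intro: continuous_on_subset[OF cc])
    moreover have "Ad G A g \<xi> = dd (0, \<xi>) H (snd ?c g, ?z)" if "g \<in> N" for g
      using Ad_chart[OF _ U(1,3,5), of "snd ?c g" \<xi>] that by (simp add: N_def chart_inv(1)[OF chart_at(1)])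
    ultimately have "continuous_on N (\<lambda>g. Ad G A g \<xi>)" by (simp cong: continuous_on_cong)
    moreover have "g0 \<in> N" using U(2) chart_at(2) by (simp add: N_def)
    ultimately show ?thesis using N continuous_on_eq_continuous_at by blast
  qed
  then show ?thesis by (simp add: continuous_at_imp_continuous_on)
qed

text \<open>This amounts to \<open>[\<xi>, \<xi>] = 0\<close>. In coordinates \<open>C\<close> of \<open>(g, h) \<mapsto> g h g\<^sup>-\<^sup>1\<close>, differentiate
  \<open>C(y, y) = y\<close> twice, using that \<open>C(y, 1) = 1\<close> and \<open>C(1, z) = z\<close>.\<close>

lemma Ad_derivative:
  defines "e \<equiv> chart_at A \<one>"
  shows "(\<lambda>y. Ad G A (chart_inv e y) \<xi>) differentiable at (snd e \<one>)"
    "dd \<xi> (\<lambda>y. Ad G A (chart_inv e y) \<xi>) (snd e \<one>) = 0"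
proof -
  define z0 where "z0 = snd e \<one>"
  obtain U H where U: "open U" "(z0, z0) \<in> U" "smooth_on U H"
    "\<And>y z. (y, z) \<in> U \<Longrightarrow> y \<in> chart_image e \<and> z \<in> chart_image e"
    "\<And>y z. (y, z) \<in> U \<Longrightarrow> H (y, z) = rep e (\<lambda>h. chart_inv e y \<otimes> h \<otimes> inv (chart_inv e y)) e z"
    unfolding e_def z0_def using conj_chart[of \<one>] by blast
  have inv0: "chart_inv e z0 = \<one>" by (simp add: e_def z0_def chart_inv(1)[OF chart_at])
  have inv: "snd e (chart_inv e y) = y" if "y \<in> chart_image e" for y
    using chart_inv(2)[OF chart_at(1) that[unfolded e_def]] by (simp add: e_def)
  let ?u = "(\<xi>, 0)" and ?v = "(0, \<xi>)" and ?x = "(z0, z0)"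
  let ?W = "(\<lambda>y. (y, z0)) -` U" and ?W' = "(\<lambda>z. (z0, z)) -` U" and ?D = "(\<lambda>y. (y, y)) -` U"
  have o: "open ?W" "open ?W'" "open ?D" by (intro open_vimage[OF U(1)] continuous_intros)+
  note sd = smooth_on_dd[OF U(3)]
  have df: "H differentiable at z" "dd w H differentiable at z" if "z \<in> U" for z w
    using smooth_on_differentiable[OF U(3) that] smooth_on_differentiable[OF sd that] by auto
  have uu: "dd ?u (dd ?u H) ?x = 0"
  proof -
    have "dd ?u H (y, z0) = 0" if y: "y \<in> ?W" for y
    proof -
      have "dd \<xi> (\<lambda>y. H (y, z0)) y = dd \<xi> (\<lambda>y. z0) y"
      proof (rule dd_cong[OF o(1) y _ dd_slice(4)[OF df(1)]])
        fix y' assume "y' \<in> ?W" then have "(y', z0) \<in> U" by simp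
        from U(5)[OF this] show "H (y', z0) = z0" by (simp add: rep_def inv0) (simp add: z0_def)
      qed (use y in simp)
      then show ?thesis using dd_slice(2)[OF df(1), of y z0 \<xi>] y by simp
    qed
    then have "dd \<xi> (\<lambda>y. dd ?u H (y, z0)) z0 = dd \<xi> (\<lambda>y. 0 :: 'f) z0"
      by (intro dd_cong[OF o(1) _ _ dd_slice(4)[OF df(2)]]) (use U(2) in auto)
    then show ?thesis using dd_slice(2)[OF df(2)[OF U(2)], of \<xi> ?u] by simp
  qed
  have vv: "dd ?v (dd ?v H) ?x = 0"
  proof -
    have "dd ?v H (z0, z) = \<xi>" if z: "z \<in> ?W'" for z
    proof -
      have "dd \<xi> (\<lambda>z. H (z0, z)) z = dd \<xi> (\<lambda>z. z) z"
      proof (rule dd_cong[OF o(2) z _ dd_slice(3)[OF df(1)]])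
        fix z' assume "z' \<in> ?W'" then have z': "(z0, z') \<in> U" by simp
        from U(5)[OF z'] U(4)[OF z'] show "H (z0, z') = z'" by (simp add: rep_def inv0 inv)
      qed (use z in simp)
      then show ?thesis using dd_slice(1)[OF df(1), of z0 z \<xi>] z by simp
    qed
    then have "dd \<xi> (\<lambda>z. dd ?v H (z0, z)) z0 = dd \<xi> (\<lambda>z. \<xi>) z0"
      by (intro dd_cong[OF o(2) _ _ dd_slice(3)[OF df(2)]]) (use U(2) in auto)
    then show ?thesis using dd_slice(1)[OF df(2)[OF U(2)], of \<xi> ?v] by simp
  qed
  have diag: "dd \<xi> (\<lambda>y. f (y, y)) y = dd (\<xi>, \<xi>) f (y, y)" "(\<lambda>y. f (y, y)) differentiable at y"
    if "f differentiable at (y, y)" for f :: "'f \<times> 'f \<Rightarrow> 'f" and y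
  proof -
    have 1: "((\<lambda>y. (y, y)) has_derivative (\<lambda>v. (v, v))) (at y)"
      by (rule has_derivative_Pair[OF has_derivative_ident has_derivative_ident])
    note 2 = has_derivative_compose[OF 1 has_derivative_dd[OF that]]
    show "dd \<xi> (\<lambda>y. f (y, y)) y = dd (\<xi>, \<xi>) f (y, y)" by (rule dd_eq[OF 2])
    show "(\<lambda>y. f (y, y)) differentiable at y" by (rule differentiableI[OF 2])
  qed
  have dsum: "dd (\<xi>, \<xi>) f z = dd ?u f z + dd ?v f z" if "f differentiable at z" for f :: "'f \<times> 'f \<Rightarrow> 'f" and z
    using linear_add[OF linear_dd[OF that], of ?u ?v] by simp
  have d1: "dd ?u H (y, y) + dd ?v H (y, y) = \<xi>" if y: "y \<in> ?D" for y
  proof -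
    have yU: "(y, y) \<in> U" using y by simp
    have "dd \<xi> (\<lambda>y. H (y, y)) y = dd \<xi> (\<lambda>y. y) y"
    proof (rule dd_cong[OF o(3) y _ diag(2)[OF df(1)[OF yU]]])
      fix y' assume "y' \<in> ?D" then have y': "(y', y') \<in> U" by simp
      from U(5)[OF y'] U(4)[OF y'] show "H (y', y') = y'" by (simp add: rep_def inv m_assoc)
    qed
    then show ?thesis using diag(1)[OF df(1)[OF yU]] dsum[OF df(1)[OF yU]] by simp
  qed
  let ?Q = "\<lambda>z. dd ?u H z + dd ?v H z"
  have dQ: "?Q differentiable at ?x" using df(2)[OF U(2)] by simp
  \<comment> \<open>Differentiating along the diagonal once more gives uu + 2 uv + vv = 0 for the
    second derivatives; as uu = vv = 0, the mixed one vanishes.\<close>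
  have "dd \<xi> (\<lambda>y. ?Q (y, y)) z0 = dd \<xi> (\<lambda>y. \<xi>) z0"
    by (rule dd_cong[OF o(3) _ _ diag(2)[OF dQ]]) (use U(2) d1 in auto)
  then have "dd (\<xi>, \<xi>) ?Q ?x = 0" using diag(1)[OF dQ] by simp
  then have "dd ?u (dd ?v H) ?x + dd ?v (dd ?u H) ?x = 0"
    using uu vv by (simp add: dsum[OF df(2)[OF U(2)]] dd_add[OF df(2)[OF U(2)] df(2)[OF U(2)]] add.commute)
  moreover have "dd ?v (dd ?u H) ?x = dd ?u (dd ?v H) ?x" by (rule dd_commute[OF U(1,3,2)])
  ultimately have uv: "dd ?u (dd ?v H) ?x = 0" by (simp flip: scaleR_2)
  have A: "dd ?v H (y, z0) = Ad G A (chart_inv e y) \<xi>" if "y \<in> ?W" for y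
    unfolding e_def z0_def by (rule Ad_chart[symmetric, OF _ U(1,3) U(5)[unfolded e_def]]) (use that in \<open>simp add: z0_def e_def\<close>)
  have z0W: "z0 \<in> ?W" using U(2) by simp
  have ds: "(\<lambda>y. dd ?v H (y, z0)) differentiable at z0" by (rule dd_slice(4)[OF df(2)[OF U(2)]])
  show "(\<lambda>y. Ad G A (chart_inv e y) \<xi>) differentiable at (snd e \<one>)"
    unfolding z0_def[symmetric] by (rule differentiable_transform[OF o(1) z0W A ds])
  have "dd \<xi> (\<lambda>y. dd ?v H (y, z0)) z0 = 0" using uv dd_slice(2)[OF df(2)[OF U(2)], of \<xi> ?v] by simp
  then show "dd \<xi> (\<lambda>y. Ad G A (chart_inv e y) \<xi>) (snd e \<one>) = 0"
    unfolding z0_def[symmetric] using dd_cong[OF o(1) z0W A ds, of \<xi>] by simp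
qed

end

section \<open>Hamiltonian actions\<close>

text \<open>For the coefficients q (Ad g \<xi>), which are stationary at the identity in the
  direction \<xi>; the induction follows the construction of the polynomial.\<close>

lemma polynomial_dd_zero:
  assumes "real_polynomial_function q" and A: "A differentiable at y" "dd v A y = 0"
  shows "(\<lambda>y. q (A y)) differentiable at y \<and> dd v (\<lambda>y. q (A y)) y = 0"
  using assms(1)
proof (induction q)
  case (linear f)
  note 1 = bounded_linear.has_derivative[OF linear has_derivative_dd[OF A(1)]]
  show ?case using differentiableI[OF 1] dd_eq[OF 1, of v] A(2) linear_0[OF bounded_linear.linear[OF linear]] by simp
next
  case (add f g)
  then show ?case by (simp add: dd_add)
next
  case (mult f g)
  then show ?case by (simp add: dd_mult)
qed simp

lemma local_form_sum:
  assumes "\<And>p vs. \<alpha> p vs = (\<Sum>i<N. c i * \<eta> i p vs)"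
  shows "local_form A k \<alpha> x vs = (\<Sum>i<N. c i * local_form A k (\<eta> i) x vs)"
  by (simp add: local_form_rep assms)

context hamiltonian_action begin

abbreviation "X \<equiv> induced_field G A\<^sub>G A act"

sublocale act: smooth_prod_map A\<^sub>G A A "\<lambda>(g, p). act g p"
  by unfold_locales (rule smooth_action)

lemma smooth_act: "smooth_map A A (act g)" and smooth_orbit: "smooth_map A\<^sub>G A (\<lambda>g. act g p)"
  using act.smooth_map_right[of g] act.smooth_map_left[of p] by simp_all

lemma act_one [simp]: "act \<one> p = p"
  using fun_cong[OF action.id_eq_one, of p] by simp

lemma act_mult: "act (g \<otimes> h) p = act g (act h p)"
  using action.composition_rule[of p g h] by simp

lemma pullback_mult: "pullback A A (act (g \<otimes> h)) \<beta> = pullback A A (act h) (pullback A A (act g) \<beta>)"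
proof -
  have "act (g \<otimes> h) = (\<lambda>p. act g (act h p))" by (simp add: fun_eq_iff act_mult)
  then show ?thesis
    using pullback_comp[OF Sympl.M Sympl.M Sympl.M smooth_act[of h] smooth_act[of g], of \<beta>] by simp
qed

lemma inj_act: "inj (tangent_map A A (act g) p)"
proof (rule inj_on_inverseI)
  fix v
  have "(\<lambda>q. act (inv g) (act g q)) = (\<lambda>q. q)" by (simp add: act_mult[symmetric] fun_eq_iff)
  then show "tangent_map A A (act (inv g)) (act g p) (tangent_map A A (act g) p v) = v"
    using tangent_map_comp[OF Sympl.M Sympl.M Sympl.M smooth_act[of g] smooth_act[of "inv g"], of p v]
    by (simp add: tangent_map_id[OF Sympl.M])
qed

lemma pullback_Lam: "\<alpha> \<in> Omega A \<Longrightarrow> pullback A A (act g) (Sympl.form_Lam \<alpha>) = Sympl.form_Lam (pullback A A (act g) \<alpha>)"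
  by (rule ext, rule Sympl.pullback_Lam[OF smooth_act inj_act]) (simp_all add: preserves_symplectic_form)

lemma pullback_L: "pullback A A (act g) (Sympl.form_L \<alpha>) = Sympl.form_L (pullback A A (act g) \<alpha>)"
proof -
  have "pullback A A (act g) (form_wedge \<omega> \<alpha>) = form_wedge (pullback A A (act g) \<omega>) (pullback A A (act g) \<alpha>)"
    by (simp add: pullback_def form_wedge_def wedge_map fun_eq_iff)
  then show ?thesis by (simp add: Sympl.form_L_def preserves_symplectic_form)
qed

lemma local_form_act:
  assumes e: "e \<in> A\<^sub>G" and c: "c \<in> A" "c' \<in> A" and z: "(y, x) \<in> prep_dom e c (\<lambda>(g, p). act g p) c'"
  shows "local_form A c (pullback A A (act (chart_inv e y)) \<beta>) x vs =
    pbk (prep e c (\<lambda>(g, p). act g p) c') (local_form A c' \<beta>) (y, x) (map (Pair 0) vs)"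
proof -
  let ?P = "prep e c (\<lambda>(g, p). act g p) c'" and ?g = "chart_inv e y"
  have x: "x \<in> rep_dom c (act ?g) c'"
    using z by (intro Sympl.rep_domI[OF c(1)]) (auto simp: prep_dom_def)
  have r: "rep c (act ?g) c' = (\<lambda>x. ?P (y, x))" by (simp add: rep_def prep_def)
  have d: "?P differentiable at (y, x)" by (rule smooth_on_differentiable[OF act.prep(2)[OF e c] z])
  show ?thesis
    using local_form_pullback[OF Sympl.M Sympl.M smooth_act c x, of \<beta>]
    by (simp add: pbk_def r dd_slice(1)[OF d] o_def)
qed

lemma contract_field: "\<beta> \<in> Omega A \<Longrightarrow> contract (X \<xi>) \<beta> = (\<lambda>p. \<phi> \<xi> p *\<^sub>R Sympl.D \<beta> p - Sympl.D (\<lambda>p. \<phi> \<xi> p *\<^sub>R \<beta> p) p)"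
proof -
  assume b: "\<beta> \<in> Omega A"
  have f: "form_of_fun (\<phi> \<xi>) \<in> Omega A" using moment_smooth[of \<xi>] by (simp add: Omega_deg_def)
  show ?thesis
    using Sympl.D_function_mult[OF f moment_map b] by (simp add: fun_eq_iff contract_def contr_def fun_apply)
qed

lemma Omega_moment: "\<beta> \<in> Omega A \<Longrightarrow> (\<lambda>p. \<phi> \<xi> p *\<^sub>R \<beta> p) \<in> Omega A"
proof -
  assume b: "\<beta> \<in> Omega A"
  have f: "form_of_fun (\<phi> \<xi>) \<in> Omega A" using moment_smooth[of \<xi>] by (simp add: Omega_deg_def)
  show ?thesis using Sympl.Omega_wedge[OF f b] by (simp add: wedge_form_of_fun)
qed

text \<open>Smoothness is read off the commutator formula \<open>contract_field\<close>, so the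
  induced vector field never has to be treated as a smooth section.\<close>

lemma Omega_contract: "\<beta> \<in> Omega A \<Longrightarrow> contract (X \<xi>) \<beta> \<in> Omega A"
proof -
  assume b: "\<beta> \<in> Omega A"
  have "(\<lambda>p. \<phi> \<xi> p *\<^sub>R Sympl.D \<beta> p) - Sympl.D (\<lambda>p. \<phi> \<xi> p *\<^sub>R \<beta> p) \<in> Omega A"
    using Omega_moment[OF b] Omega_moment[OF Sympl.D_mem[OF b]] by (intro Sympl.Vsub(4)) auto
  moreover have "contract (X \<xi>) \<beta> = (\<lambda>p. \<phi> \<xi> p *\<^sub>R Sympl.D \<beta> p) - Sympl.D (\<lambda>p. \<phi> \<xi> p *\<^sub>R \<beta> p)"
    unfolding contract_field[OF b] by (rule ext) (simp add: minus_apply)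
  ultimately show ?thesis by simp
qed

text \<open>Vanishing of the Lie derivative of \<alpha>(\<xi>) along \<xi>, without a flow: the form
  is pulled back by the action map P on the product of group and manifold, in coordinates, and its
  \<open>ed\<close> is evaluated at (\<xi>, 0) and vectors (0, v). By naturality this is the
  contraction of d \<alpha>(\<xi>); by \<open>ed_Cons\<close> it is the derivative of the
  coefficients in the direction \<xi> minus d of the contraction.\<close>

lemma cartan_formula:
  assumes a: "\<alpha> \<in> Omega_G G A\<^sub>G A act"
  shows "ext_d A (contract (X \<xi>) (\<alpha> \<xi>)) = - contract (X \<xi>) (ext_d A (\<alpha> \<xi>))"
proof (intro ext)
  fix p and vs :: "'e list"
  obtain N q \<eta> where N': "\<forall>i<(N::nat). real_polynomial_function (q i) \<and> \<eta> i \<in> Omega A"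
    "\<alpha> = (\<lambda>\<xi> p vs. \<Sum>i<N. q i \<xi> * \<eta> i p vs)"
    using a unfolding Omega_G_def polynomial_form_maps_def by blast
  have N: "\<And>i. i < N \<Longrightarrow> real_polynomial_function (q i)" "\<And>i. i < N \<Longrightarrow> \<eta> i \<in> Omega A"
    "\<alpha> = (\<lambda>\<xi> p vs. \<Sum>i<N. q i \<xi> * \<eta> i p vs)"
    using N'(1) by (blast, blast) (rule N'(2))
  have inv: "pullback A A (act g) (\<alpha> (Ad G A\<^sub>G g \<xi>)) = \<alpha> \<xi>" for g
    using a by (simp add: Omega_G_def)
  have aO: "\<alpha> \<zeta> \<in> Omega A" for \<zeta>
  proof -
    have "(\<Sum>i<N. q i \<zeta> *\<^sub>R \<eta> i) \<in> Omega A"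
      by (intro subspace_sum[OF Sympl.subspace_Omega] subspace_scale[OF Sympl.subspace_Omega] N(2)) simp
    moreover have "\<alpha> \<zeta> = (\<Sum>i<N. q i \<zeta> *\<^sub>R \<eta> i)" by (simp add: N(3) fun_eq_iff fun_apply)
    ultimately show ?thesis by simp
  qed
  define c where "c = chart_at A p"
  define e where "e = chart_at A\<^sub>G \<one>"
  define y0 where "y0 = snd e \<one>"
  define x0 where "x0 = snd c p"
  have c: "c \<in> A" "e \<in> A\<^sub>G" "p \<in> fst c" "\<one> \<in> fst e"
    using Sympl.chart_at[of p] Lie.chart_at[of \<one>] by (auto simp: c_def e_def)
  have inv0: "chart_inv e y0 = \<one>" "chart_inv c x0 = p" "x0 \<in> chart_image c"
    using c by (simp_all add: y0_def x0_def Lie.chart_inv Sympl.chart_inv)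
  let ?F = "\<lambda>(g, p). act g p"
  define P where "P = prep e c ?F c"
  define S where "S = prep_dom e c ?F c"
  note P = act.prep[OF c(2,1,1), folded P_def S_def]
  have PS: "P z \<in> chart_image c" if "z \<in> S" for z
    unfolding P_def by (rule act.prep_image[OF c(1) that[unfolded S_def]])
  have in_S: "(y0, x) \<in> S" if "x \<in> chart_image c" for x
    using Lie.chart_inv(4)[OF c(2,4)] that
    by (simp add: S_def prep_dom_def inv0) (simp add: y0_def Sympl.chart_inv[OF c(1)])
  have dP: "P differentiable at z" if "z \<in> S" for z by (rule smooth_on_differentiable[OF P(2) that])
  have P0: "P (y0, x) = x" if "x \<in> chart_image c" for x
    using that by (simp add: P_def prep_def inv0 Sympl.chart_inv[OF c(1)])
  have P2: "dd (0, v) P (y0, x) = v" if x: "x \<in> chart_image c" for v x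
  proof -
    have "dd v (\<lambda>x. P (y0, x)) x = dd v (\<lambda>x. x) x"
      by (rule dd_cong[OF Sympl.open_image[OF c(1)] x _ dd_slice(3)[OF dP[OF in_S[OF x]]]]) (rule P0)
    then show ?thesis using dd_slice(1)[OF dP[OF in_S[OF x]], of v] by simp
  qed
  have P1: "dd v (rep c (\<lambda>p. p) (chart_at A (chart_inv c x))) x = X \<xi> (chart_inv c x)"
    if x: "x \<in> chart_image c" and v: "v = dd (\<xi>, 0) P (y0, x)" for v x
  proof -
    let ?p = "chart_inv c x"
    have "X \<xi> ?p = dd \<xi> (rep e (\<lambda>g. act g ?p) (chart_at A ?p)) y0"
      by (simp add: induced_field_def tangent_map_dd e_def y0_def)
    also have "\<dots> = dd (dd \<xi> (rep e (\<lambda>g. act g ?p) c) y0) (rep c (\<lambda>p. p) (chart_at A ?p)) (rep e (\<lambda>g. act g ?p) c y0)"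
    proof (rule rep_chain(1)[OF Lie.M Sympl.M Sympl.M smooth_orbit Sympl.smooth_map_id c(2,1) Sympl.chart_at(1)])
      show "y0 \<in> chart_image e" unfolding y0_def by (rule Lie.chart_inv(4)[OF c(2,4)])
    qed (use x in \<open>simp_all add: inv0 Sympl.chart_inv[OF c(1)] Sympl.chart_at(2)\<close>)
    also have "rep e (\<lambda>g. act g ?p) c y0 = x" using x by (simp add: rep_def inv0 Sympl.chart_inv[OF c(1)])
    also have "dd \<xi> (rep e (\<lambda>g. act g ?p) c) y0 = v"
      using dd_slice(2)[OF dP[OF in_S[OF x]], of \<xi>] unfolding v by (simp add: P_def prep_def rep_def)
    finally show ?thesis by simp
  qed
  let ?l = "local_form A c (\<alpha> \<xi>)" and ?ws = "map (Pair (0 :: 'f)) vs" and ?z = "(y0, x0)"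
  note l = Sympl.OmegaD(2)[OF aO c(1)] Sympl.OmegaD(3)[OF aO c(1)]
  have base: "local_form A c \<beta> x0 = \<beta> p" "ext_d A \<beta> p = ed (local_form A c \<beta>) x0" for \<beta>
    unfolding c_def x0_def by (rule Sympl.local_form_at, rule Sympl.ext_d_eq)
  have zS: "?z \<in> S" by (rule in_S[OF inv0(3)])
  have "ed (pbk P ?l) ?z ((\<xi>, 0) # ?ws) = pbk P (ed ?l) ?z ((\<xi>, 0) # ?ws)"
    by (rule fun_cong[OF ed_pbk[OF Sympl.onb_E P PS l zS]])
  also have "\<dots> = ed ?l x0 (dd (\<xi>, 0) P ?z # vs)"
    by (simp add: pbk_def P0 P2 inv0(3) o_def)
  also have "\<dots> = local_form A c (ext_d A (\<alpha> \<xi>)) x0 (dd (\<xi>, 0) P ?z # vs)"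
    by (simp only: Sympl.local_form_ext_d[OF aO c(1) inv0(3)])
  also have "\<dots> = contract (X \<xi>) (ext_d A (\<alpha> \<xi>)) p vs"
  proof -
    have "dd v (rep c (\<lambda>p. p) c) x0 = v" for v by (rule Sympl.rep_id[OF c(1) inv0(3)])
    then have "dd (\<xi>, 0) P ?z = X \<xi> p" using P1[OF inv0(3) refl] by (simp add: inv0(2) c_def[symmetric])
    then show ?thesis by (simp add: base(1) contract_def)
  qed
  finally have L: "ed (pbk P ?l) ?z ((\<xi>, 0) # ?ws) = contract (X \<xi>) (ext_d A (\<alpha> \<xi>)) p vs" .
  have contr_eq: "contr (\<xi>, 0) (pbk P ?l (y0, x)) (map (Pair 0) us) = local_form A c (contract (X \<xi>) (\<alpha> \<xi>)) x us"
    if x: "x \<in> chart_image c" for x us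
    using P1[OF x refl] x
    by (simp add: contr_def pbk_def P0 P2 o_def local_form_rep[of A c "\<alpha> \<xi>"] local_form_rep[of A c "contract (X \<xi>) (\<alpha> \<xi>)"])
      (simp add: contract_def)
  have sc: "sform S (\<lambda>z. contr (\<xi>, 0) (pbk P ?l z))" by (rule sform_contr[OF sform_pbk[OF Sympl.onb_E P PS l]])
  have two: "ed (\<lambda>z. contr (\<xi>, 0) (pbk P ?l z)) ?z ?ws = ext_d A (contract (X \<xi>) (\<alpha> \<xi>)) p vs"
  proof -
    have "dd (?ws ! i) (\<lambda>z. contr (\<xi>, 0) (pbk P ?l z) (take i ?ws @ drop (Suc i) ?ws)) ?z =
        dd (vs ! i) (\<lambda>x. local_form A c (contract (X \<xi>) (\<alpha> \<xi>)) x (take i vs @ drop (Suc i) vs)) x0"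
      if i: "i < length vs" for i
    proof -
      let ?us = "take i vs @ drop (Suc i) vs"
      have m: "take i ?ws @ drop (Suc i) ?ws = map (Pair 0) ?us" by (simp add: take_map drop_map)
      note df = sform_diff[OF sc zS, of "map (Pair 0) ?us"]
      have "dd (vs ! i) (\<lambda>x. contr (\<xi>, 0) (pbk P ?l (y0, x)) (map (Pair 0) ?us)) x0 =
          dd (vs ! i) (\<lambda>x. local_form A c (contract (X \<xi>) (\<alpha> \<xi>)) x ?us) x0"
        by (rule dd_cong[OF Sympl.open_image[OF c(1)] inv0(3) contr_eq dd_slice(3)[OF df]])
      then show ?thesis using i dd_slice(1)[OF df, of "vs ! i"] by (simp only: m nth_map)
    qed
    then show ?thesis by (simp add: ed_def base(2))
  qed
  \<comment> \<open>By equivariance the pulled back coefficients of \<alpha>(Ad g \<xi>) are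
    constant in g. They differ from those of \<alpha>(\<xi>) in the factors q i (Ad g \<xi>), whose
    derivative along \<xi> is zero at the identity, so the derivative of the latter vanishes
    too.\<close>
  have one: "dd (\<xi>, 0) (\<lambda>z. pbk P ?l z ?ws) ?z = 0"
  proof -
    define f where "f i y = pbk P (local_form A c (\<eta> i)) (y, x0) ?ws" for i y
    have lsum: "local_form A c (\<alpha> \<zeta>) x us = (\<Sum>i<N. q i \<zeta> * local_form A c (\<eta> i) x us)" for \<zeta> x us
      by (rule local_form_sum) (simp add: N(3))
    have psum: "pbk P (local_form A c (\<alpha> \<zeta>)) (y, x0) ?ws = (\<Sum>i<N. q i \<zeta> * f i y)" for \<zeta> y
      by (simp add: pbk_def lsum f_def)
    define W where "W = (\<lambda>y. (y, x0)) -` S"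
    have W: "open W" "y0 \<in> W" using zS by (auto simp: W_def intro!: open_vimage[OF P(1)] continuous_intros)
    have df: "f i differentiable at y0" if "i < N" for i
      unfolding f_def using dd_slice(4)[OF sform_diff[OF sform_pbk[OF Sympl.onb_E P PS Sympl.OmegaD(2,3)[OF N(2)[OF that] c(1)]] zS]] .
    let ?A = "\<lambda>y. Ad G A\<^sub>G (chart_inv e y) \<xi>"
    note dA = Lie.Ad_derivative[of \<xi>, folded e_def, folded y0_def]
    have dq: "(\<lambda>y. q i (?A y)) differentiable at y0" "dd \<xi> (\<lambda>y. q i (?A y)) y0 = 0" if "i < N" for i
      using polynomial_dd_zero[OF N(1)[OF that] dA] by auto
    have A0: "?A y0 = \<xi>" by (simp add: inv0)
    have const: "(\<Sum>i<N. q i (?A y) * f i y) = local_form A c (\<alpha> \<xi>) x0 vs" if "y \<in> W" for y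
      using local_form_act[OF c(2,1,1), of y x0 "\<alpha> (?A y)" vs] that psum[of "?A y" y]
      by (simp add: inv W_def S_def P_def)
    have dqf: "(\<lambda>y. q i (?A y) * f i y) differentiable at y0" if "i \<in> {..<N}" for i
      using differentiable_mult[OF dq(1) df, of i i] that by blast
    have ds: "(\<lambda>y. \<Sum>i<N. q i (?A y) * f i y) differentiable at y0"
      by (rule differentiable_sum) (simp_all add: dqf)
    have "dd \<xi> (\<lambda>y. \<Sum>i<N. q i (?A y) * f i y) y0 = dd \<xi> (\<lambda>y. local_form A c (\<alpha> \<xi>) x0 vs) y0"
      by (rule dd_cong[OF W const ds])
    also have "dd \<xi> (\<lambda>y. \<Sum>i<N. q i (?A y) * f i y) y0 = (\<Sum>i<N. q i \<xi> * dd \<xi> (f i) y0)"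
      by (subst dd_sum[OF dqf]) (auto simp: dd_mult[OF dq(1) df] dq(2) A0)
    also have "\<dots> = dd \<xi> (\<lambda>y. \<Sum>i<N. q i \<xi> * f i y) y0"
      by (subst dd_sum[OF differentiable_mult[OF differentiable_const df]]) (auto simp: dd_mult[OF differentiable_const df])
    also have "\<dots> = dd \<xi> (\<lambda>y. pbk P ?l (y, x0) ?ws) y0" by (simp only: psum)
    also have "\<dots> = dd (\<xi>, 0) (\<lambda>z. pbk P ?l z ?ws) ?z"
      by (rule dd_slice(2)[OF sform_diff[OF sform_pbk[OF Sympl.onb_E P PS l] zS]])
    finally show ?thesis by simp
  qed
  show "ext_d A (contract (X \<xi>) (\<alpha> \<xi>)) p vs = (- contract (X \<xi>) (ext_d A (\<alpha> \<xi>))) p vs"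
    using L two one by (simp add: ed_Cons fun_apply)
qed

end

section \<open>Haar mean\<close>

text \<open>The pair x codes finitely many group elements as a number and a sequence. Since the
  multiplication is a parameter, the opposite one yields averages over left translates from the same
  definition.\<close>

definition translate_mean :: "('g \<Rightarrow> 'g \<Rightarrow> 'g) \<Rightarrow> nat \<times> (nat \<Rightarrow> 'g) \<Rightarrow> ('g \<Rightarrow> real) \<Rightarrow> 'g \<Rightarrow> real" where
  "translate_mean m x f = (\<lambda>g. (\<Sum>i<fst x. f (m g (snd x i))) / real (fst x))"

abbreviation means :: "('g \<Rightarrow> 'g \<Rightarrow> 'g) \<Rightarrow> (nat \<times> (nat \<Rightarrow> 'g)) list \<Rightarrow> ('g \<Rightarrow> real) \<Rightarrow> 'g \<Rightarrow> real" where
  "means m \<equiv> foldr (translate_mean m)"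

abbreviation pos :: "(nat \<times> 'a) list \<Rightarrow> bool" where
  "pos xs \<equiv> \<forall>x\<in>set xs. fst x > 0"

definition near_const :: "real \<Rightarrow> real \<Rightarrow> ('g \<Rightarrow> real) \<Rightarrow> bool" where
  "near_const \<epsilon> c f \<longleftrightarrow> (\<forall>g. \<bar>f g - c\<bar> \<le> \<epsilon>)"

text \<open>Uniform approximability by averages of translates characterizes the Haar integral on a
  compact group, and here it replaces it.\<close>

definition mean_value :: "('g \<Rightarrow> 'g \<Rightarrow> 'g) \<Rightarrow> ('g \<Rightarrow> real) \<Rightarrow> real \<Rightarrow> bool" where
  "mean_value m f c \<longleftrightarrow> (\<forall>\<epsilon>>0. \<exists>xs. pos xs \<and> near_const \<epsilon> c (means m xs f))"

lemma translate_mean_bounds: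
  assumes "fst x > 0"
  shows "(\<And>g. a \<le> f g) \<Longrightarrow> a \<le> translate_mean m x f g" "(\<And>g. f g \<le> a) \<Longrightarrow> translate_mean m x f g \<le> a"
proof -
  assume "\<And>g. a \<le> f g"
  then have "(\<Sum>i<fst x. a) \<le> (\<Sum>i<fst x. f (m g (snd x i)))" by (intro sum_mono)
  then show "a \<le> translate_mean m x f g" using assms by (simp add: translate_mean_def field_simps)
next
  assume "\<And>g. f g \<le> a"
  then have "(\<Sum>i<fst x. f (m g (snd x i))) \<le> (\<Sum>i<fst x. a)" by (intro sum_mono)
  then show "translate_mean m x f g \<le> a" using assms by (simp add: translate_mean_def field_simps)
qed

lemma near_const_translate_mean: "fst x > 0 \<Longrightarrow> near_const \<epsilon> c f \<Longrightarrow> near_const \<epsilon> c (translate_mean m x f)"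
  using translate_mean_bounds(1)[of x "c - \<epsilon>" f m] translate_mean_bounds(2)[of x f "c + \<epsilon>" m]
  by (force simp: near_const_def abs_le_iff algebra_simps)

lemma near_const_foldr: "pos xs \<Longrightarrow> near_const \<epsilon> c f \<Longrightarrow> near_const \<epsilon> c (means m xs f)"
  by (induction xs) (auto intro: near_const_translate_mean)

lemma near_const_unique: "near_const \<epsilon> c f \<Longrightarrow> near_const \<delta> c' f \<Longrightarrow> \<bar>c - c'\<bar> \<le> \<epsilon> + \<delta>"
proof -
  assume "near_const \<epsilon> c f" "near_const \<delta> c' f"
  then have "\<bar>f undefined - c\<bar> \<le> \<epsilon>" "\<bar>f undefined - c'\<bar> \<le> \<delta>" by (simp_all add: near_const_def)
  then show ?thesis by linarith
qed

lemma translate_mean_add: "translate_mean m x (\<lambda>g. f g + h g) = (\<lambda>g. translate_mean m x f g + translate_mean m x h g)"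
  by (simp add: translate_mean_def sum.distrib add_divide_distrib)

lemma foldr_translate_mean_add:
  "means m xs (\<lambda>g. f g + h g) = (\<lambda>g. means m xs f g + means m xs h g)"
  by (induction xs) (auto simp: translate_mean_add)

lemma foldr_translate_mean_scale:
  "means m xs (\<lambda>g. c * f g) = (\<lambda>g. c * means m xs f g)"
  by (induction xs) (auto simp: translate_mean_def sum_distrib_left)

locale compact_group =
  fixes m :: "'g::t2_space \<Rightarrow> 'g \<Rightarrow> 'g" and e :: 'g and iv :: "'g \<Rightarrow> 'g"
  assumes compact: "compact (UNIV :: 'g set)"
    and assoc: "m (m x y) z = m x (m y z)" and one: "m e x = x" "m x e = x"
    and inverse: "m (iv x) x = e" "m x (iv x) = e"
    and cont: "continuous_on UNIV (\<lambda>z. m (fst z) (snd z))"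
begin

abbreviation mop :: "'g \<Rightarrow> 'g \<Rightarrow> 'g" where
  "mop x y \<equiv> m y x"

lemma opposite: "compact_group mop e iv"
proof
  have "continuous_on UNIV (\<lambda>z. m (fst (snd z, fst z)) (snd (snd z, fst z)))"
    by (rule continuous_on_compose2[OF cont]) (auto intro!: continuous_intros)
  then show "continuous_on UNIV (\<lambda>z. m (snd z) (fst z))" by simp
qed (auto simp: compact assoc one inverse)

lemma cont_right: "continuous_on UNIV (\<lambda>y. m y x)"
proof -
  have c: "continuous_on UNIV (\<lambda>y. (y, x))" by (intro continuous_intros)
  show ?thesis using continuous_on_compose2[OF cont c] by simp
qed

lemma continuous_translate_mean: "continuous_on UNIV f \<Longrightarrow> continuous_on UNIV (translate_mean m x f)"
  unfolding translate_mean_def divide_inverse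
  by (intro continuous_on_mult continuous_on_sum continuous_on_const continuous_on_compose2[of UNIV f, OF _ cont_right]) auto

lemma continuous_foldr: "continuous_on UNIV f \<Longrightarrow> continuous_on UNIV (means m xs f)"
  by (induction xs) (auto intro: continuous_translate_mean)

lemma translate_mean_shift: "translate_mean mop x (\<lambda>g. f (m g k)) = (\<lambda>g. translate_mean mop x f (m g k))"
  by (simp add: translate_mean_def assoc)

lemma foldr_shift: "means mop xs (\<lambda>g. f (m g k)) = (\<lambda>g. means mop xs f (m g k))"
  by (induction xs) (auto simp: translate_mean_shift)

lemma foldr_commute_one: "means mop xs (translate_mean m y f) =
    translate_mean m y (means mop xs f)"
proof (induction xs)
  case (Cons x xs)
  have "translate_mean mop x (translate_mean m y h) = translate_mean m y (translate_mean mop x h)" for h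
  proof
    fix g
    have "(\<Sum>i<fst x. \<Sum>j<fst y. h (m (m (snd x i) g) (snd y j))) = (\<Sum>j<fst y. \<Sum>i<fst x. h (m (m (snd x i) g) (snd y j)))"
      by (rule sum.swap)
    then show "translate_mean mop x (translate_mean m y h) g = translate_mean m y (translate_mean mop x h) g"
      by (simp add: translate_mean_def assoc mult.commute flip: sum_divide_distrib)
  qed
  then show ?case using Cons by simp
qed simp

lemma foldr_commute: "means mop xs (means m ys f) =
    means m ys (means mop xs f)"
  by (induction ys) (auto simp: foldr_commute_one)

text \<open>If \<open>G\<close> is covered by \<open>N\<close> translates of a neighbourhood \<open>U\<close> of \<open>1\<close> on which \<open>f\<close> varies by
  at most \<open>\<epsilon>\<close>, then averaging over \<open>N\<close> translates that carry a minimum of \<open>f\<close> near every point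
  replaces the oscillation \<open>s\<close> by \<open>s - (s - \<epsilon>) / N\<close>.\<close>

lemma exists_near_const:
  assumes f: "continuous_on UNIV f" and eps: "\<epsilon> > 0"
  shows "\<exists>xs c. pos xs \<and> near_const \<epsilon> c (means m xs f)"
proof -
  define \<delta> where "\<delta> = \<epsilon> / 2"
  have \<delta>: "\<delta> > 0" using eps by (simp add: \<delta>_def)
  have fm: "continuous_on (UNIV \<times> UNIV) (\<lambda>z. f (m (fst z) (snd z)))"
    using continuous_on_compose2[OF f cont] by simp
  \<comment> \<open>Compactness makes the neighbourhood U of the identity uniform in x.\<close>
  obtain U where U: "e \<in> U" "open U" "\<forall>u\<in>U \<inter> UNIV. \<forall>x\<in>UNIV. dist (f (m (fst (u, x)) (snd (u, x)))) (f (m (fst (e, x)) (snd (e, x)))) \<le> \<delta>"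
    by (rule continuous_on_prod_compactE[OF fm compact UNIV_I \<delta>])
  have Uf: "\<bar>f (m u x) - f x\<bar> \<le> \<delta>" if "u \<in> U" for u x
    using U(3) that by (simp add: one dist_real_def)
  have "open ((\<lambda>g. m g (iv h)) -` U)" for h using cont_right U(2) by (simp add: open_vimage)
  moreover have "UNIV \<subseteq> (\<Union>h\<in>UNIV. (\<lambda>g. m g (iv h)) -` U)" using U(1) by (auto simp: inverse)
  ultimately obtain C where C: "finite C" "UNIV \<subseteq> (\<Union>h\<in>C. (\<lambda>g. m g (iv h)) -` U)"
    using compactE_image[OF compact, of UNIV "\<lambda>h. (\<lambda>g. m g (iv h)) -` U"] by (metis (no_types, lifting))
  obtain N :: nat and gs where gs: "C = gs ` {i. i < N}" using C(1) finite_imp_nat_seg_image_inj_on by blast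
  have N: "N > 0" using C(2) gs by auto
  have cover: "\<exists>i<N. \<exists>u\<in>U. g = m u (gs i)" for g
  proof -
    obtain i where "i < N" "m g (iv (gs i)) \<in> U" using C(2) gs by auto
    moreover have "g = m (m g (iv (gs i))) (gs i)" by (simp add: assoc inverse one)
    ultimately show ?thesis by blast
  qed
  define r where "r = 1 - 1 / real N"
  have r: "0 \<le> r" "r < 1" using N by (auto simp: r_def field_simps)
  \<comment> \<open>The modulus on U is inherited by all averages, since translating on the right
    does not disturb the left factor u.\<close>
  have equi: "\<bar>means m xs f (m u x) - means m xs f x\<bar> \<le> \<delta>"
    if "u \<in> U" "pos xs" for u x xs
    using that(2)
  proof (induction xs arbitrary: x)
    case (Cons y xs)
    let ?F = "means m xs f"
    have "\<bar>(\<Sum>i<fst y. ?F (m (m u x) (snd y i))) - (\<Sum>i<fst y. ?F (m x (snd y i)))\<bar> \<le> (\<Sum>i<fst y. \<delta>)"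
      unfolding sum_subtractf[symmetric] using Cons by (intro order_trans[OF sum_abs] sum_mono) (auto simp: assoc)
    then show ?case using Cons.prems
      by (simp add: translate_mean_def[of m y] diff_divide_distrib[symmetric] abs_divide) (simp add: field_simps)
  qed (use Uf[OF that(1)] in simp)
  have step: "\<exists>xs a. pos xs \<and> (\<forall>g. a \<le> means m xs f g \<and>
      means m xs f g \<le> a + \<delta> + r ^ k * s)"
    if s: "\<And>g h. f g - f h \<le> s" for k s
  proof (induction k)
    case 0
    obtain x where "\<And>g. f x \<le> f g" using continuous_attains_inf[OF compact _ f] by auto
    moreover have "f g \<le> f x + \<delta> + s" for g using s[of g x] \<delta> by simp
    ultimately show ?case by (intro exI[of _ "[]"] exI[of _ "f x"]) simp
  next
    case (Suc k)
    then obtain xs a where xs: "pos xs" and a: "\<And>g. a \<le> means m xs f g"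
      "\<And>g. means m xs f g \<le> a + \<delta> + r ^ k * s" by blast
    let ?F = "means m xs f"
    obtain x0 where x0: "\<And>g. ?F x0 \<le> ?F g" using continuous_attains_inf[OF compact _ continuous_foldr[OF f]] by auto
    \<comment> \<open>For g = m u (gs i) the i-th translate is evaluated at m u x0, where it is at
      most \<delta> above the minimum; the other N - 1 terms obey the old upper bound. This is the
      origin of the factor r.\<close>
    define y where "y = (N, \<lambda>i. m (iv (gs i)) x0)"
    have up: "translate_mean m y ?F g \<le> ?F x0 + \<delta> + r ^ Suc k * s" for g
    proof -
      obtain i u where i: "i < N" "u \<in> U" "g = m u (gs i)" using cover by blast
      have "m g (m (iv (gs i)) x0) = m u x0" using i(3) by (metis assoc inverse(2) one(1))
      then have 1: "?F (m g (m (iv (gs i)) x0)) \<le> ?F x0 + \<delta>" using equi[OF i(2) xs, of x0] by simp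
      have "(\<Sum>j<N. ?F (m g (m (iv (gs j)) x0))) = ?F (m g (m (iv (gs i)) x0)) + (\<Sum>j\<in>{..<N} - {i}. ?F (m g (m (iv (gs j)) x0)))"
        using i(1) by (simp add: sum.remove)
      also have "\<dots> \<le> (?F x0 + \<delta>) + (\<Sum>j\<in>{..<N} - {i}. ?F x0 + \<delta> + r ^ k * s)"
        using order_trans[OF a(2) add_right_mono[OF add_right_mono[OF a(1)[of x0]]]]
        by (intro add_mono 1 sum_mono) auto
      also have "\<dots> = real N * (?F x0 + \<delta>) + (real N - 1) * (r ^ k * s)"
        using i(1) N by (simp add: algebra_simps of_nat_diff)
      finally show ?thesis using N by (simp add: translate_mean_def y_def r_def field_simps)
    qed
    have "fst y > 0" using N by (simp add: y_def)
    then show ?case using up xs translate_mean_bounds(1)[of y "?F x0" ?F m] x0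
      by (intro exI[of _ "y # xs"] exI[of _ "?F x0"]) auto
  qed
  obtain x1 x2 where x: "\<And>g. f x1 \<le> f g" "\<And>g. f g \<le> f x2"
    using continuous_attains_inf[OF compact _ f] continuous_attains_sup[OF compact _ f] by auto
  define s where "s = f x2 - f x1"
  have s: "f g - f h \<le> s" for g h using x[of g] x[of h] by (simp add: s_def)
  have "(\<lambda>k. r ^ k * s) \<longlonglongrightarrow> 0 * s" by (intro tendsto_mult LIMSEQ_realpow_zero r tendsto_const)
  then have "\<forall>\<^sub>F k in sequentially. r ^ k * s < \<delta>" using \<delta> by (intro order_tendstoD) auto
  then obtain k where k: "r ^ k * s < \<delta>" by (auto simp: eventually_sequentially)
  obtain xs a where "pos xs" "\<And>g. a \<le> means m xs f g \<and>
      means m xs f g \<le> a + \<delta> + r ^ k * s" using step[OF s, of k] by blast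
  moreover have "near_const \<epsilon> a (means m xs f)"
    unfolding near_const_def
  proof
    fix g
    have "a \<le> means m xs f g" "means m xs f g \<le> a + \<delta> + r ^ k * s" using calculation(2) by auto
    then show "\<bar>means m xs f g - a\<bar> \<le> \<epsilon>" using k by (simp add: \<delta>_def)
  qed
  ultimately show ?thesis by blast
qed

text \<open>Left averages of a right average that is close to c stay close to c, and conversely for
  c'; as the two kinds of averages commute, one function is close to both constants.\<close>

lemma near_const_both:
  assumes "pos xs" "near_const \<epsilon> c (means m xs f)"
    and "pos ys" "near_const \<delta> c' (means mop ys f)"
  shows "\<bar>c - c'\<bar> \<le> \<epsilon> + \<delta>"
  using near_const_unique[OF near_const_foldr[OF assms(3,2), of mop, unfolded foldr_commute] near_const_foldr[OF assms(1,4)]] .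

text \<open>Averages over right translates commute with averages over left translates; hence they approach
  the same constants.\<close>

lemma exists_mean_value:
  assumes f: "continuous_on UNIV f" shows "\<exists>c. mean_value m f c \<and> mean_value mop f c"
proof -
  interpret opp: compact_group mop e iv by (rule opposite)
  define \<epsilon> where "\<epsilon> k = inverse (real (Suc k))" for k
  have \<epsilon>: "\<epsilon> k > 0" for k by (simp add: \<epsilon>_def)
  have "\<forall>k. \<exists>xs c. pos xs \<and> near_const (\<epsilon> k) c (means m xs f)"
    using exists_near_const[OF f \<epsilon>] by blast
  then obtain xs c where c: "\<And>k. pos (xs k) \<and> near_const (\<epsilon> k) (c k) (means m (xs k) f)"
    by metis
  have "\<forall>k. \<exists>xs c. pos xs \<and> near_const (\<epsilon> k) c (means mop xs f)"
    using opp.exists_near_const[OF f \<epsilon>] by blast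
  then obtain ys d where d: "\<And>k. pos (ys k) \<and> near_const (\<epsilon> k) (d k) (means mop (ys k) f)"
    by metis
  have cd: "\<bar>c i - d j\<bar> \<le> \<epsilon> i + \<epsilon> j" for i j using near_const_both c d by blast
  have \<epsilon>0: "\<epsilon> \<longlonglongrightarrow> 0" unfolding \<epsilon>_def by (rule LIMSEQ_inverse_real_of_nat)
  have cc: "\<bar>c i - c j\<bar> \<le> \<epsilon> i + \<epsilon> j" for i j
  proof -
    have "(\<lambda>k. \<epsilon> i + \<epsilon> j + (\<epsilon> k + \<epsilon> k)) \<longlonglongrightarrow> \<epsilon> i + \<epsilon> j + (0 + 0)" by (intro tendsto_add tendsto_const \<epsilon>0)
    moreover have "\<bar>c i - c j\<bar> \<le> \<epsilon> i + \<epsilon> j + (\<epsilon> k + \<epsilon> k)" for k using cd[of i k] cd[of j k] by simp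
    ultimately show ?thesis using LIMSEQ_le_const[of _ "\<epsilon> i + \<epsilon> j + (0 + 0)" "\<bar>c i - c j\<bar>"] by auto
  qed
  have "Cauchy c"
  proof (rule metric_CauchyI)
    fix \<eta> :: real assume "\<eta> > 0"
    then have "\<forall>\<^sub>F k in sequentially. \<epsilon> k < \<eta> / 2" using \<epsilon>0 by (intro order_tendstoD) auto
    then obtain K where K: "\<And>k. k \<ge> K \<Longrightarrow> \<epsilon> k < \<eta> / 2" by (auto simp: eventually_sequentially)
    have "dist (c i) (c j) < \<eta>" if "i \<ge> K" "j \<ge> K" for i j
      using cc[of i j] K[OF that(1)] K[OF that(2)] by (simp add: dist_real_def)
    then show "\<exists>K. \<forall>i\<ge>K. \<forall>j\<ge>K. dist (c i) (c j) < \<eta>" by (intro exI[of _ K]) simp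
  qed
  then obtain b where b: "c \<longlonglongrightarrow> b" using Cauchy_convergent[of c] unfolding convergent_def by blast
  have cb: "\<bar>c i - b\<bar> \<le> \<epsilon> i" for i
  proof -
    have l: "(\<lambda>k. \<epsilon> i + \<epsilon> k) \<longlonglongrightarrow> \<epsilon> i + 0" "(\<lambda>k. \<bar>c i - c k\<bar>) \<longlonglongrightarrow> \<bar>c i - b\<bar>"
      by (intro tendsto_add tendsto_const \<epsilon>0 tendsto_rabs tendsto_diff b)+
    have "\<bar>c i - b\<bar> \<le> \<epsilon> i + 0" by (rule LIMSEQ_le[OF l(2,1)]) (use cc in auto)
    then show ?thesis by simp
  qed
  \<comment> \<open>Here 3 = 2 + 1: d i is within 2 \<open>\<epsilon> i\<close> of c i, which is
    within \<open>\<epsilon> i\<close> of the limit b. The factor 4 below adds the error in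
    \<open>near_const\<close>.\<close>
  have db: "\<bar>d i - b\<bar> \<le> 3 * \<epsilon> i" for i using cd[of i i] cb[of i] by simp
  have small: "\<exists>k. 4 * \<epsilon> k \<le> \<eta>" if "\<eta> > 0" for \<eta>
  proof -
    have "\<forall>\<^sub>F k in sequentially. \<epsilon> k < \<eta> / 4" using \<epsilon>0 that by (intro order_tendstoD) auto
    then obtain k where "\<epsilon> k < \<eta> / 4" by (auto simp: eventually_sequentially)
    then show ?thesis by (intro exI[of _ k]) simp
  qed
  have nc: "near_const \<eta> b h" if "near_const (\<epsilon> k) b' h" "\<bar>b' - b\<bar> \<le> 3 * \<epsilon> k" "4 * \<epsilon> k \<le> \<eta>" for b' k \<eta> h
    unfolding near_const_def
  proof
    fix g have "\<bar>h g - b'\<bar> \<le> \<epsilon> k" using that(1) by (simp add: near_const_def)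
    then show "\<bar>h g - b\<bar> \<le> \<eta>" using that(2,3) by linarith
  qed
  have "mean_value m f b \<and> mean_value mop f b"
    unfolding mean_value_def
  proof (intro conjI allI impI)
    fix \<eta> :: real assume "\<eta> > 0"
    then obtain k where k: "4 * \<epsilon> k \<le> \<eta>" using small by blast
    have "\<bar>c k - b\<bar> \<le> 3 * \<epsilon> k" using cb[of k] \<epsilon>[of k] by simp
    then show "\<exists>xs. pos xs \<and> near_const \<eta> b (means m xs f)"
      "\<exists>xs. pos xs \<and> near_const \<eta> b (means mop xs f)"
      using c[of k] d[of k] db[of k] nc k by blast+
  qed
  then show ?thesis by blast
qed

lemma mean_value_unique: "mean_value m f c \<Longrightarrow> mean_value mop f c' \<Longrightarrow> c = c'"
proof (rule ccontr)
  assume "mean_value m f c" "mean_value mop f c'" "c \<noteq> c'"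
  moreover define \<epsilon> where "\<epsilon> = \<bar>c - c'\<bar> / 3"
  ultimately have "\<epsilon> > 0" "\<exists>xs. pos xs \<and> near_const \<epsilon> c (means m xs f)"
    "\<exists>xs. pos xs \<and> near_const \<epsilon> c' (means mop xs f)"
    by (auto simp: mean_value_def)
  then have "\<bar>c - c'\<bar> \<le> \<epsilon> + \<epsilon>" using near_const_both by blast
  then show False using \<open>c \<noteq> c'\<close> by (simp add: \<epsilon>_def)
qed

section \<open>The mean as an invariant linear functional\<close>

definition mean :: "('g \<Rightarrow> real) \<Rightarrow> real" where
  "mean f = (SOME c. mean_value m f c \<and> mean_value mop f c)"

lemma mean: "continuous_on UNIV f \<Longrightarrow> mean_value m f (mean f)" "continuous_on UNIV f \<Longrightarrow> mean_value mop f (mean f)"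
  unfolding mean_def using someI_ex[OF exists_mean_value[of f]] by auto

lemma mean_eqI:
  assumes "continuous_on UNIV f" "mean_value m f c \<or> mean_value mop f c" shows "mean f = c"
  using mean[OF assms(1)] mean_value_unique assms(2) by blast

lemma mean_const [simp]: "mean (\<lambda>g. c) = c"
proof (rule mean_eqI)
  show "mean_value m (\<lambda>g. c) c \<or> mean_value mop (\<lambda>g. c) c"
    unfolding mean_value_def by (intro disjI1 allI impI exI[of _ "[]"]) (simp add: near_const_def)
qed simp

text \<open>The shift acts on the right, so it commutes with averages over left translates; the mean
  is therefore tested with \<open>mop\<close>.\<close>

lemma mean_shift: "continuous_on UNIV f \<Longrightarrow> mean (\<lambda>g. f (m g k)) = mean f"
proof (rule mean_eqI)
  assume f: "continuous_on UNIV f"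
  show "continuous_on UNIV (\<lambda>g. f (m g k))" by (rule continuous_on_compose2[OF f cont_right]) simp
  have "mean_value mop (\<lambda>g. f (m g k)) (mean f)"
    unfolding mean_value_def
  proof (intro allI impI)
    fix \<epsilon> :: real assume "\<epsilon> > 0"
    then obtain xs where "pos xs" "near_const \<epsilon> (mean f) (means mop xs f)"
      using mean(2)[OF f] unfolding mean_value_def by blast
    then show "\<exists>xs. pos xs \<and> near_const \<epsilon> (mean f) (means mop xs (\<lambda>g. f (m g k)))"
      by (intro exI[of _ xs]) (simp add: foldr_shift near_const_def)
  qed
  then show "mean_value m (\<lambda>g. f (m g k)) (mean f) \<or> mean_value mop (\<lambda>g. f (m g k)) (mean f)" ..
qed

lemma mean_scale: "continuous_on UNIV f \<Longrightarrow> mean (\<lambda>g. c * f g) = c * mean f"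
proof (rule mean_eqI)
  assume f: "continuous_on UNIV f"
  have "mean_value m (\<lambda>g. c * f g) (c * mean f)"
    unfolding mean_value_def foldr_translate_mean_scale
  proof (intro allI impI)
    fix \<epsilon> :: real assume e: "\<epsilon> > 0"
    have "\<epsilon> / (\<bar>c\<bar> + 1) > 0" using e by (intro divide_pos_pos) auto
    then obtain xs where xs: "pos xs" "near_const (\<epsilon> / (\<bar>c\<bar> + 1)) (mean f) (means m xs f)"
      using mean(1)[OF f] unfolding mean_value_def by blast
    have "\<bar>c * means m xs f g - c * mean f\<bar> \<le> \<epsilon>" for g
    proof -
      have "\<bar>c * means m xs f g - c * mean f\<bar> = \<bar>c\<bar> * \<bar>means m xs f g - mean f\<bar>"
        by (simp add: abs_mult[symmetric] algebra_simps)
      also have "\<dots> \<le> \<bar>c\<bar> * (\<epsilon> / (\<bar>c\<bar> + 1))" using xs(2) by (intro mult_left_mono) (auto simp: near_const_def)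
      also have "\<dots> = \<epsilon> * (\<bar>c\<bar> / (\<bar>c\<bar> + 1))" by simp
      also have "\<dots> \<le> \<epsilon> * 1" using e by (intro mult_left_mono) (auto simp: field_simps)
      also have "\<dots> = \<epsilon>" by simp
      finally show ?thesis .
    qed
    then show "\<exists>xs. pos xs \<and> near_const \<epsilon> (c * mean f) (\<lambda>g. c * means m xs f g)"
      using xs(1) by (auto simp: near_const_def)
  qed
  then show "mean_value m (\<lambda>g. c * f g) (c * mean f) \<or> mean_value mop (\<lambda>g. c * f g) (c * mean f)" ..
qed (intro continuous_on_mult continuous_on_const)

text \<open>After averaging f by xs to near a constant, the averaged h still has the mean of h, as
  seen by left translates, which commute with xs. Averaging further by ys brings it near that mean
  and does not spoil f.\<close>

lemma mean_add: "continuous_on UNIV f \<Longrightarrow> continuous_on UNIV h \<Longrightarrow> mean (\<lambda>g. f g + h g) = mean f + mean h"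
proof (rule mean_eqI)
  assume f: "continuous_on UNIV f" and h: "continuous_on UNIV h"
  have "mean_value m (\<lambda>g. f g + h g) (mean f + mean h)"
    unfolding mean_value_def
  proof (intro allI impI)
    fix \<epsilon> :: real assume "\<epsilon> > 0"
    then have e: "\<epsilon> / 2 > 0" by simp
    obtain xs where xs: "pos xs" "near_const (\<epsilon> / 2) (mean f) (means m xs f)"
      using mean(1)[OF f] e unfolding mean_value_def by blast
    let ?h = "means m xs h"
    have ch: "continuous_on UNIV ?h" by (rule continuous_foldr[OF h])
    have "mean_value mop ?h (mean h)"
      using mean(2)[OF h] near_const_foldr[OF xs(1)] unfolding mean_value_def foldr_commute by blast
    then have "mean ?h = mean h" using mean_eqI[OF ch] by blast
    then have "mean_value m ?h (mean h)" using mean(1)[OF ch] by simp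
    then obtain ys where ys: "pos ys" "near_const (\<epsilon> / 2) (mean h) (means m ys ?h)"
      using e unfolding mean_value_def by blast
    have fy: "near_const (\<epsilon> / 2) (mean f) (means m ys (means m xs f))"
      by (rule near_const_foldr[OF ys(1) xs(2)])
    have "near_const \<epsilon> (mean f + mean h) (means m (ys @ xs) (\<lambda>g. f g + h g))"
      unfolding near_const_def
    proof
      fix g
      have "\<bar>means m ys (means m xs f) g - mean f\<bar> \<le> \<epsilon> / 2"
        "\<bar>means m ys ?h g - mean h\<bar> \<le> \<epsilon> / 2" using fy ys(2) by (auto simp: near_const_def)
      then show "\<bar>means m (ys @ xs) (\<lambda>g. f g + h g) g - (mean f + mean h)\<bar> \<le> \<epsilon>"
        unfolding foldr_append foldr_translate_mean_add by linarith
    qed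
    moreover have "pos (ys @ xs)" using xs ys by auto
    ultimately show "\<exists>xs. pos xs \<and> near_const \<epsilon> (mean f + mean h) (means m xs (\<lambda>g. f g + h g))"
      by blast
  qed
  then show "mean_value m (\<lambda>g. f g + h g) (mean f + mean h) \<or> mean_value mop (\<lambda>g. f g + h g) (mean f + mean h)" ..
qed (intro continuous_on_add)

lemma mean_sum: "(\<And>i. i \<in> I \<Longrightarrow> continuous_on UNIV (f i)) \<Longrightarrow> mean (\<lambda>g. \<Sum>i\<in>I. f i g) = (\<Sum>i\<in>I. mean (f i))"
  by (induction I rule: infinite_finite_induct) (auto simp: mean_add continuous_on_sum)

lemma mean_bound:
  assumes f: "continuous_on UNIV f" and b: "\<And>g. \<bar>f g\<bar> \<le> b" shows "\<bar>mean f\<bar> \<le> b"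
proof (rule field_le_epsilon)
  fix \<epsilon> :: real assume "\<epsilon> > 0"
  then obtain xs where xs: "pos xs" "near_const \<epsilon> (mean f) (means m xs f)"
    using mean(1)[OF f] unfolding mean_value_def by blast
  have "near_const b 0 f" using b by (simp add: near_const_def)
  from near_const_unique[OF xs(2) near_const_foldr[OF xs(1) this]] show "\<bar>mean f\<bar> \<le> b + \<epsilon>" by simp
qed

end

section \<open>Means of smooth functions and of polynomials\<close>

text \<open>Derivatives are taken in x only, but continuity is joint in x and the group variable,
  which by compactness makes the estimates for means uniform.\<close>

primrec joint_Ck :: "nat \<Rightarrow> 'a::real_normed_vector set \<Rightarrow> ('g::topological_space \<Rightarrow> 'a \<Rightarrow> real) \<Rightarrow> bool" where
  "joint_Ck 0 S K \<longleftrightarrow> continuous_on (S \<times> UNIV) (\<lambda>z. K (snd z) (fst z))"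
| "joint_Ck (Suc k) S K \<longleftrightarrow> continuous_on (S \<times> UNIV) (\<lambda>z. K (snd z) (fst z)) \<and>
    (\<forall>g. \<forall>x\<in>S. K g differentiable at x) \<and> (\<forall>v. joint_Ck k S (\<lambda>g. dd v (K g)))"

lemma joint_Ck_continuous: "joint_Ck k S K \<Longrightarrow> continuous_on (S \<times> UNIV) (\<lambda>z. K (snd z) (fst z))"
  by (cases k) auto

lemma joint_Ck_slice: "joint_Ck k S K \<Longrightarrow> x \<in> S \<Longrightarrow> continuous_on UNIV (\<lambda>g. K g x)"
proof -
  assume K: "joint_Ck k S K" and x: "x \<in> S"
  have "continuous_on UNIV (\<lambda>g. (x, g))" by (intro continuous_intros)
  from continuous_on_compose2[OF joint_Ck_continuous[OF K] this] show ?thesis using x by auto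
qed

lemma joint_Ck_cong:
  assumes S: "open S" and "\<And>g x. x \<in> S \<Longrightarrow> K g x = K' g x" "joint_Ck k S K"
  shows "joint_Ck k S K'"
  using assms(2,3)
proof (induction k arbitrary: K K')
  case 0
  have "continuous_on (S \<times> UNIV) (\<lambda>z. K' (snd z) (fst z))"
    by (rule continuous_on_eq[OF joint_Ck_continuous[OF 0(2)]]) (auto simp: 0(1))
  then show ?case by simp
next
  case (Suc k)
  have d: "K g differentiable at x" if "x \<in> S" for g x using Suc.prems(2) that by simp
  have "joint_Ck k S (\<lambda>g. dd v (K' g))" for v
    by (rule Suc.IH[of "\<lambda>g. dd v (K g)"]) (use dd_cong[OF S _ Suc.prems(1) d] Suc.prems(2) in auto)
  moreover have "K' g differentiable at x" if "x \<in> S" for g x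
    by (rule differentiable_transform[OF S that Suc.prems(1) d[OF that]])
  moreover have "continuous_on (S \<times> UNIV) (\<lambda>z. K' (snd z) (fst z))"
    by (rule continuous_on_eq[OF joint_Ck_continuous[OF Suc.prems(2)]]) (auto simp: Suc.prems(1))
  ultimately show ?case by simp
qed

lemma joint_Ck_zero: "joint_Ck k (S :: 'a::real_normed_vector set) (\<lambda>g x. 0)"
proof (induction k)
  case (Suc k)
  have "dd v (\<lambda>x::'a. 0 :: real) = (\<lambda>x. 0)" for v by (simp add: fun_eq_iff)
  then show ?case using Suc by simp
qed simp

lemma joint_Ck_add:
  assumes S: "open S" shows "joint_Ck k S K \<Longrightarrow> joint_Ck k S K' \<Longrightarrow> joint_Ck k S (\<lambda>g x. K g x + K' g x)"
proof (induction k arbitrary: K K')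
  case 0
  then show ?case by (simp add: continuous_on_add)
next
  case (Suc k)
  have "joint_Ck k S (\<lambda>g. dd v (\<lambda>x. K g x + K' g x))" for v
    by (rule joint_Ck_cong[OF S _ Suc.IH[of "\<lambda>g. dd v (K g)" "\<lambda>g. dd v (K' g)"]]) (use Suc.prems in \<open>auto simp: dd_add\<close>)
  then show ?case using Suc.prems by (simp add: continuous_on_add)
qed

lemma joint_Ck_mult:
  assumes S: "open S" and r: "continuous_on UNIV r"
  shows "joint_Ck k S K \<Longrightarrow> joint_Ck k S (\<lambda>g x. r g * K g x)"
proof (induction k arbitrary: K)
  have r': "continuous_on (S \<times> UNIV) (\<lambda>z. r (snd z))"
    by (rule continuous_on_compose2[OF r]) (auto intro!: continuous_intros)
  {
    case 0
    then show ?case using r' by (simp add: continuous_on_mult)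
  next
    case (Suc k)
    have "joint_Ck k S (\<lambda>g. dd v (\<lambda>x. r g * K g x))" for v
      by (rule joint_Ck_cong[OF S _ Suc.IH[of "\<lambda>g. dd v (K g)"]]) (use Suc.prems in \<open>auto simp: dd_mult\<close>)
    then show ?case using Suc.prems r' by (simp add: continuous_on_mult)
  }
qed

lemma joint_Ck_sum: "open S \<Longrightarrow> (\<And>i. i \<in> I \<Longrightarrow> joint_Ck k S (K i)) \<Longrightarrow> joint_Ck k S (\<lambda>g x. \<Sum>i\<in>I. K i g x)"
  by (induction I rule: infinite_finite_induct) (auto intro: joint_Ck_zero joint_Ck_add)

definition chart_factor ::
  "'g::t2_space set \<Rightarrow> 'a::real_normed_vector set \<Rightarrow> ('f::real_normed_vector \<times> 'a) set \<Rightarrow> ('g \<Rightarrow> 'f) \<Rightarrow> ('f \<times> 'a \<Rightarrow> real) \<Rightarrow>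
    ('g \<Rightarrow> 'a \<Rightarrow> real) \<Rightarrow> bool" where
  "chart_factor N T U r H K \<longleftrightarrow> open N \<and> open T \<and> open U \<and> continuous_on N r \<and> smooth_on U H \<and>
     (\<forall>g\<in>N. \<forall>x\<in>T. (r g, x) \<in> U \<and> K g x = H (r g, x))"

text \<open>The coefficients depend on g through a chart r of the group and a smooth function H of
  (r g, x), so derivatives in x have the same shape. The \<open>itself\<close> argument names the
  type of the chart values, which does not occur in the type of K.\<close>

definition chart_smooth :: "('g::t2_space \<Rightarrow> 'f::real_normed_vector) itself \<Rightarrow> 'a::real_normed_vector set \<Rightarrow> ('g \<Rightarrow> 'a \<Rightarrow> real) \<Rightarrow> bool" where
  "chart_smooth _ S K \<longleftrightarrow> (\<forall>g0. \<forall>x0\<in>S. \<exists>N T U. \<exists>r::'g \<Rightarrow> 'f. \<exists>H. g0 \<in> N \<and> x0 \<in> T \<and> chart_factor N T U r H K)"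

lemma chart_factorD:
  assumes "chart_factor N T U r H K"
  shows "open N" "open T" "open U" "continuous_on N r" "smooth_on U H"
    "g \<in> N \<Longrightarrow> x \<in> T \<Longrightarrow> (r g, x) \<in> U" "g \<in> N \<Longrightarrow> x \<in> T \<Longrightarrow> K g x = H (r g, x)"
  using assms by (simp_all add: chart_factor_def)

lemma chart_factor_dd:
  assumes K: "chart_factor N T U r H K"
  shows "chart_factor N T U r (dd (0, v) H) (\<lambda>g. dd v (K g))"
    "g \<in> N \<Longrightarrow> x \<in> T \<Longrightarrow> K g differentiable at x"
proof -
  note * = chart_factorD[OF K]
  have der: "K g differentiable at x" "dd v (K g) x = dd (0, v) H (r g, x)" if "g \<in> N" "x \<in> T" for g x
  proof -
    have d: "H differentiable at (r g, x)" by (rule smooth_on_differentiable[OF *(5) *(6)[OF that]])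
    note eq = *(7)[OF that(1), symmetric]
    show "K g differentiable at x" by (rule differentiable_transform[OF *(2) that(2) eq dd_slice(3)[OF d]])
    show "dd v (K g) x = dd (0, v) H (r g, x)"
      using dd_cong[OF *(2) that(2) eq dd_slice(3)[OF d]] by (simp add: dd_slice(1)[OF d])
  qed
  show "chart_factor N T U r (dd (0, v) H) (\<lambda>g. dd v (K g))"
    using K smooth_on_dd[OF *(5)] der(2) by (simp add: chart_factor_def)
  show "g \<in> N \<Longrightarrow> x \<in> T \<Longrightarrow> K g differentiable at x" by (rule der(1))
qed

lemma chart_factor_continuous:
  assumes "chart_factor N T U r H K" shows "continuous_on (T \<times> N) (\<lambda>z. K (snd z) (fst z))"
proof -
  note * = chart_factorD[OF assms]
  have "continuous_on (T \<times> N) (\<lambda>z. (r (snd z), fst z))"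
    by (intro continuous_intros continuous_on_compose2[OF *(4)]) auto
  then have "continuous_on (T \<times> N) (\<lambda>z. H (r (snd z), fst z))"
    by (rule continuous_on_compose2[OF smooth_on_continuous[OF *(5)]]) (use *(6) in auto)
  then show ?thesis by (rule continuous_on_eq) (use *(7) in auto)
qed

lemma chart_smooth_joint_Ck:
  "chart_smooth TYPE('g::t2_space \<Rightarrow> 'f::real_normed_vector) S K \<Longrightarrow> joint_Ck k S K"
proof (induction k arbitrary: K)
  have ct: "continuous_on (S \<times> UNIV) (\<lambda>z. K (snd z) (fst z))" if K: "chart_smooth TYPE('g \<Rightarrow> 'f) S K" for K :: "'g \<Rightarrow> 'a \<Rightarrow> real"
  proof (rule continuous_at_imp_continuous_on, rule ballI)
    fix z assume z: "z \<in> S \<times> (UNIV :: 'g set)"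
    then have "fst z \<in> S" by auto
    then obtain N T U H and r :: "'g \<Rightarrow> 'f" where *: "snd z \<in> N" "fst z \<in> T" "chart_factor N T U r H K"
      using K unfolding chart_smooth_def by meson
    have "open (T \<times> N)" "z \<in> T \<times> N" using *(1,2) chart_factorD(1,2)[OF *(3)] by (auto simp: open_Times mem_Times_iff)
    then show "isCont (\<lambda>z. K (snd z) (fst z)) z"
      using chart_factor_continuous[OF *(3)] continuous_on_eq_continuous_at by blast
  qed
  {
    case 0
    then show ?case using ct by simp
  next
    case (Suc k)
    have "chart_smooth TYPE('g \<Rightarrow> 'f) S (\<lambda>g. dd v (K g))" for v
      unfolding chart_smooth_def
    proof (intro allI ballI)
      fix g0 x0 assume "x0 \<in> S"
      then obtain N T U H and r :: "'g \<Rightarrow> 'f" where f: "g0 \<in> N" "x0 \<in> T" "chart_factor N T U r H K"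
        using Suc.prems unfolding chart_smooth_def by meson
      show "\<exists>N T U. \<exists>r::'g \<Rightarrow> 'f. \<exists>H. g0 \<in> N \<and> x0 \<in> T \<and> chart_factor N T U r H (\<lambda>g. dd v (K g))"
        using f(1,2) chart_factor_dd(1)[OF f(3), of v] by blast
    qed
    moreover have "K g differentiable at x" if "x \<in> S" for g x
      using Suc.prems that chart_factor_dd(2) unfolding chart_smooth_def by meson
    ultimately show ?case using Suc.IH ct[OF Suc.prems] by simp
  }
qed

context compact_group begin

lemma mean_diff: "continuous_on UNIV f \<Longrightarrow> continuous_on UNIV h \<Longrightarrow> mean (\<lambda>g. f g - h g) = mean f - mean h"
  using mean_add[of f "\<lambda>g. (- 1) * h g"] mean_scale[of h "- 1"] by (simp add: continuous_on_minus)

text \<open>Compactness of the group makes the continuity in x uniform in g, and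
  \<open>mean_bound\<close> carries the uniform estimate over to the mean.\<close>

lemma continuous_mean:
  fixes K :: "'g \<Rightarrow> 'a::real_inner \<Rightarrow> real"
  assumes K: "continuous_on (S \<times> UNIV) (\<lambda>z. K (snd z) (fst z))" and S: "open S"
  shows "continuous_on S (\<lambda>x. mean (\<lambda>g. K g x))"
proof (rule continuous_onI)
  fix x0 and \<epsilon> :: real assume x0: "x0 \<in> S" and e: "\<epsilon> > 0"
  have sl: "continuous_on UNIV (\<lambda>g. K g x)" if "x \<in> S" for x
    using joint_Ck_slice[of 0 S K x] K that by simp
  obtain X where X: "x0 \<in> X" "open X" "\<forall>x\<in>X \<inter> S. \<forall>g\<in>UNIV. dist (K (snd (x, g)) (fst (x, g))) (K (snd (x0, g)) (fst (x0, g))) \<le> \<epsilon>"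
    by (rule continuous_on_prod_compactE[OF K compact x0 e])
  obtain d where d: "d > 0" "ball x0 d \<subseteq> X \<inter> S" using open_contains_ball[THEN iffD1, OF open_Int[OF X(2) S]] X(1) x0 by blast
  have "dist (mean (\<lambda>g. K g x)) (mean (\<lambda>g. K g x0)) \<le> \<epsilon>" if "dist x x0 < d" for x
  proof -
    have x: "x \<in> X \<inter> S" using d(2) that by (auto simp: dist_commute)
    have "\<bar>mean (\<lambda>g. K g x - K g x0)\<bar> \<le> \<epsilon>"
      by (rule mean_bound) (use X(3) x sl x0 in \<open>auto simp: dist_real_def intro: continuous_on_diff\<close>)
    then show ?thesis using x x0 sl by (simp add: mean_diff dist_real_def)
  qed
  then show "\<exists>d>0. \<forall>x\<in>S. dist x x0 < d \<longrightarrow> dist (mean (\<lambda>g. K g x)) (mean (\<lambda>g. K g x0)) \<le> \<epsilon>" using d(1) by blast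
qed

text \<open>Differentiation under the mean: by the mean value inequality the linearization errors are uniform
  in the group variable.\<close>

lemma mean_has_derivative:
  fixes K :: "'g \<Rightarrow> 'a::real_inner \<Rightarrow> real"
  assumes B: "onb (B :: 'a set)" and S: "open S" and K: "joint_Ck (Suc 0) S K" and x0: "x0 \<in> S"
  shows "((\<lambda>x. mean (\<lambda>g. K g x)) has_derivative (\<lambda>v. mean (\<lambda>g. dd v (K g) x0))) (at x0)"
  unfolding has_derivative_at_alt
proof (intro conjI allI impI)
  have sl: "continuous_on UNIV (\<lambda>g. K g x)" if "x \<in> S" for x by (rule joint_Ck_slice[OF K that])
  have Kd: "continuous_on (S \<times> UNIV) (\<lambda>z. dd v (K (snd z)) (fst z))" for v using K by simp
  have sd: "continuous_on UNIV (\<lambda>g. dd v (K g) x0)" for v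
    using joint_Ck_slice[of 0 S "\<lambda>g. dd v (K g)" x0] Kd x0 by simp
  have df: "K g differentiable at x" if "x \<in> S" for g x using K that by simp
  note lin = linear_dd[OF df[OF x0]]
  show "bounded_linear (\<lambda>v. mean (\<lambda>g. dd v (K g) x0))"
    by (rule onb_bounded_linear[OF B], rule linearI)
      (simp_all add: linear_add[OF lin] linear_scale[OF lin] mean_add[OF sd sd] mean_scale[OF sd])
  fix \<epsilon> :: real assume e: "\<epsilon> > 0"
  \<comment> \<open>Z bounds the operator norm of the difference between the derivatives at
    \<open>fst z\<close> and at x0, and it is zero at x0.\<close>
  define Z where "Z = (\<lambda>z. \<Sum>b\<in>B. \<bar>dd b (K (snd z)) (fst z) - dd b (K (snd z)) x0\<bar>)"
  have cZ: "continuous_on (S \<times> UNIV) Z"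
    unfolding Z_def by (intro continuous_on_sum continuous_on_rabs continuous_on_diff Kd continuous_on_compose2[OF sd] continuous_intros) auto
  obtain X where X: "x0 \<in> X" "open X" "\<forall>x\<in>X \<inter> S. \<forall>g\<in>UNIV. dist (Z (x, g)) (Z (x0, g)) \<le> \<epsilon>"
    by (rule continuous_on_prod_compactE[OF cZ compact x0 e])
  obtain d where d: "d > 0" "ball x0 d \<subseteq> X \<inter> S" using open_contains_ball[THEN iffD1, OF open_Int[OF X(2) S]] X(1) x0 by blast
  have lb: "norm (K g y - K g x0 - dd (y - x0) (K g) x0) \<le> norm (y - x0) * \<epsilon>" if y: "y \<in> ball x0 d" for g y
  proof (rule differentiable_bound_linearization[where S = "ball x0 d" and f = "K g" and f' = "\<lambda>x v. dd v (K g) x"])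
    show "x0 + t *\<^sub>R (y - x0) \<in> ball x0 d" if "t \<in> {0..1}" for t
    proof -
      have "norm (t *\<^sub>R (y - x0)) \<le> 1 * norm (y - x0)" unfolding norm_scaleR using that by (intro mult_right_mono) auto
      then show ?thesis using y by (simp add: dist_norm norm_minus_commute)
    qed
    show "(K g has_derivative (\<lambda>v. dd v (K g) x)) (at x within ball x0 d)" if "x \<in> ball x0 d" for x
      by (rule has_derivative_at_withinI[OF has_derivative_dd[OF df]]) (use that d(2) in auto)
    show "x0 \<in> ball x0 d" using d(1) by simp
    fix x assume x: "x \<in> ball x0 d"
    then have xS: "x \<in> X" "x \<in> S" using d(2) by auto
    show "onorm ((\<lambda>v. dd v (K g) x) - (\<lambda>v. dd v (K g) x0)) \<le> \<epsilon>"
    proof (rule onorm_bound)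
      fix v
      have "dd v (K g) x - dd v (K g) x0 = (\<Sum>b\<in>B. inner b v * (dd b (K g) x - dd b (K g) x0))"
        using onb_linear[OF B linear_dd[OF df[OF xS(2)]], of v g] onb_linear[OF B lin, of v g]
        by (simp add: sum_subtractf right_diff_distrib)
      also have "\<bar>\<dots>\<bar> \<le> (\<Sum>b\<in>B. \<bar>inner b v * (dd b (K g) x - dd b (K g) x0)\<bar>)" by (rule sum_abs)
      also have "\<dots> \<le> (\<Sum>b\<in>B. norm v * \<bar>dd b (K g) x - dd b (K g) x0\<bar>)"
      proof (rule sum_mono)
        fix b assume "b \<in> B"
        then have "norm b = 1" using onb_inner[OF B, of b b] by (simp add: norm_eq_sqrt_inner)
        then have "\<bar>inner b v\<bar> \<le> norm v" using Cauchy_Schwarz_ineq2[of b v] by simp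
        then show "\<bar>inner b v * (dd b (K g) x - dd b (K g) x0)\<bar> \<le> norm v * \<bar>dd b (K g) x - dd b (K g) x0\<bar>"
          by (simp add: abs_mult mult_right_mono)
      qed
      also have "\<dots> = Z (x, g) * norm v" by (simp add: Z_def sum_distrib_left mult.commute)
      also have "\<dots> \<le> \<epsilon> * norm v"
        using X(3) xS by (intro mult_right_mono) (auto simp: dist_real_def Z_def)
      finally show "norm (((\<lambda>v. dd v (K g) x) - (\<lambda>v. dd v (K g) x0)) v) \<le> \<epsilon> * norm v" by (simp add: minus_apply)
    qed (use e in simp)
  qed
  have "norm (mean (\<lambda>g. K g y) - mean (\<lambda>g. K g x0) - mean (\<lambda>g. dd (y - x0) (K g) x0)) \<le> \<epsilon> * norm (y - x0)" if "norm (y - x0) < d" for y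
  proof -
    have y: "y \<in> ball x0 d" "y \<in> S" using that d(2) by (auto simp: dist_norm norm_minus_commute)
    have "\<bar>mean (\<lambda>g. K g y - K g x0 - dd (y - x0) (K g) x0)\<bar> \<le> \<epsilon> * norm (y - x0)"
      by (rule mean_bound) (use lb[OF y(1)] in \<open>auto simp: mult.commute intro!: continuous_on_diff sl y x0 sd\<close>)
    then show ?thesis using sl[OF y(2)] sl[OF x0] sd by (simp add: mean_diff continuous_on_diff)
  qed
  then show "\<exists>d>0. \<forall>y. norm (y - x0) < d \<longrightarrow>
      norm (mean (\<lambda>g. K g y) - mean (\<lambda>g. K g x0) - mean (\<lambda>g. dd (y - x0) (K g) x0)) \<le> \<epsilon> * norm (y - x0)" using d(1) by blast
qed

lemma joint_Ck_1: "joint_Ck (Suc k) S K \<Longrightarrow> joint_Ck (Suc 0) S K"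
proof -
  assume K: "joint_Ck (Suc k) S K"
  have "continuous_on (S \<times> UNIV) (\<lambda>z. dd v (K (snd z)) (fst z))" for v
    by (rule joint_Ck_continuous[of k S "\<lambda>g. dd v (K g)"]) (use K in simp)
  then show ?thesis using K by simp
qed

lemma Ck_on_mean:
  fixes K :: "'g \<Rightarrow> 'a::real_inner \<Rightarrow> real"
  assumes B: "onb (B :: 'a set)" and S: "open S"
  shows "joint_Ck k S K \<Longrightarrow> Ck_on k S (\<lambda>x. mean (\<lambda>g. K g x))"
proof (induction k arbitrary: K)
  case 0
  then show ?case using continuous_mean[OF _ S] by simp
next
  case (Suc k)
  show ?case
    by (rule Ck_on_SucI[OF S mean_has_derivative[OF B S joint_Ck_1[OF Suc.prems]] Suc.IH]) (use Suc.prems in auto)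
qed

end

text \<open>Substituting a linear map keeps a polynomial in a finite-dimensional space; T will be Ad
  g, and Q has to serve for all g at once.\<close>

definition composes_into :: "('f::real_normed_vector \<Rightarrow> real) set \<Rightarrow> ('f \<Rightarrow> real) \<Rightarrow> bool" where
  "composes_into Q q \<longleftrightarrow> finite Q \<and> (\<forall>f\<in>Q. real_polynomial_function f) \<and>
    (\<forall>T :: 'f \<Rightarrow> 'f. linear T \<longrightarrow> (\<lambda>x. q (T x)) \<in> span Q)"

lemma composes_intoD:
  assumes "composes_into Q q"
  shows "finite Q" "\<And>f. f \<in> Q \<Longrightarrow> real_polynomial_function f" "\<And>T. linear T \<Longrightarrow> (\<lambda>x. q (T x)) \<in> span Q"
  using assms by (simp_all add: composes_into_def)

lemma span_compose_polynomial:
  assumes B: "onb (B :: 'f::real_inner set)" and q: "real_polynomial_function (q :: 'f \<Rightarrow> real)"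
  shows "\<exists>Q. composes_into Q q"
  using q
proof (induction q)
  case (linear f)
  note f = bounded_linear.linear[OF linear]
  have "(\<lambda>x. f (T x)) \<in> span (inner ` B)" if T: "linear T" for T :: "'f \<Rightarrow> 'f"
  proof -
    have "(\<lambda>x. f (T x)) = (\<Sum>b\<in>B. f (T b) *\<^sub>R inner b)"
    proof
      fix x show "f (T x) = (\<Sum>b\<in>B. f (T b) *\<^sub>R inner b) x"
        using onb_linear[OF B linear_compose[OF T f], of x] by (simp add: o_def sum_fun_apply scaleR_fun_apply mult.commute)
    qed
    then show ?thesis by (simp only:) (rule span_sum, rule span_scale, rule span_base, rule imageI)
  qed
  moreover have "real_polynomial_function (inner b)" for b :: 'f
    by (rule real_polynomial_function.intros(1)[OF bounded_linear_inner_right])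
  ultimately have "composes_into (inner ` B) f" using onb_finite[OF B] by (auto simp: composes_into_def)
  then show ?case ..
next
  case (const c)
  have c: "(\<lambda>x::'f. c) \<in> span {\<lambda>x. c}" by (rule span_base) simp
  have "composes_into {\<lambda>x::'f. c} (\<lambda>x. c)"
    unfolding composes_into_def by (intro conjI ballI allI impI c) (auto intro: real_polynomial_function.intros(2))
  then show ?case ..
next
  case (add f g)
  then obtain P Q where "composes_into P f" "composes_into Q g" by blast
  note PQ = composes_intoD[OF this(1)] composes_intoD[OF this(2)]
  have "(\<lambda>x. f (T x) + g (T x)) \<in> span (P \<union> Q)" if T: "linear T" for T :: "'f \<Rightarrow> 'f"
  proof -
    have "(\<lambda>x. f (T x)) \<in> span (P \<union> Q)" "(\<lambda>x. g (T x)) \<in> span (P \<union> Q)"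
      using PQ(3,6)[OF T] span_mono[of P "P \<union> Q"] span_mono[of Q "P \<union> Q"] by blast+
    moreover have "(\<lambda>x. f (T x) + g (T x)) = (\<lambda>x. f (T x)) + (\<lambda>x. g (T x))" by (simp add: fun_eq_iff plus_fun_apply)
    ultimately show ?thesis by (simp add: span_add)
  qed
  then have "composes_into (P \<union> Q) (\<lambda>x. f x + g x)"
    unfolding composes_into_def using PQ(1,2,4,5) by blast
  then show ?case ..
next
  case (mult f g)
  then obtain P Q where "composes_into P f" "composes_into Q g" by blast
  note PQ = composes_intoD[OF this(1)] composes_intoD[OF this(2)]
  let ?R = "(\<lambda>(a, b). (\<lambda>x. a x * b x :: real)) ` (P \<times> Q)"
  have 1: "(\<lambda>x. a x * b x) \<in> span ?R" if b: "b \<in> Q" and a: "a \<in> span P" for a b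
    using a
  proof (induction a rule: span_induct_alt)
    case base
    then show ?case using span_zero[of ?R] by (simp add: zero_fun_apply zero_fun_def)
  next
    case (step c u a)
    have "(\<lambda>x. u x * b x) \<in> span ?R" using step b by (intro span_base) auto
    moreover have "(\<lambda>x. (c *\<^sub>R u + a) x * b x) = c *\<^sub>R (\<lambda>x. u x * b x) + (\<lambda>x. a x * b x)"
      by (simp add: fun_eq_iff fun_apply algebra_simps)
    ultimately show ?case using step by (simp add: span_add span_scale)
  qed
  have 2: "(\<lambda>x. a x * b x) \<in> span ?R" if a: "a \<in> span P" and b: "b \<in> span Q" for a b
    using b
  proof (induction b rule: span_induct_alt)
    case base
    then show ?case using span_zero[of ?R] by (simp add: zero_fun_apply zero_fun_def)
  next
    case (step c u b)
    have "(\<lambda>x. a x * (c *\<^sub>R u + b) x) = c *\<^sub>R (\<lambda>x. a x * u x) + (\<lambda>x. a x * b x)"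
      by (simp add: fun_eq_iff fun_apply algebra_simps)
    then show ?case using step 1[OF _ a, of u] by (simp add: span_add span_scale)
  qed
  have "(\<lambda>x. f (T x) * g (T x)) \<in> span ?R" if "linear T" for T :: "'f \<Rightarrow> 'f" by (rule 2[OF PQ(3)[OF that] PQ(6)[OF that]])
  moreover have "real_polynomial_function h" if "h \<in> ?R" for h
    using that PQ(2,5) by (auto intro: real_polynomial_function.intros(4))
  ultimately have "composes_into ?R (\<lambda>x. f x * g x)" unfolding composes_into_def using PQ(1,4) by blast
  then show ?case ..
qed

definition dual_points :: "('a \<Rightarrow> real) set \<Rightarrow> nat \<Rightarrow> (nat \<Rightarrow> 'a) \<Rightarrow> (nat \<Rightarrow> 'a \<Rightarrow> real) \<Rightarrow> bool" where
  "dual_points V m pts l \<longleftrightarrow> (\<forall>j<m. l j \<in> V) \<and> (\<forall>i<m. \<forall>j<m. l i (pts j) = (if i = j then 1 else 0)) \<and>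
    (\<forall>f\<in>V. \<forall>x. f x = (\<Sum>j<m. f (pts j) * l j x))"

text \<open>A new function q is interpolated at the old points. If the remainder r is nonzero
  somewhere, that point is added and r, rescaled, becomes its dual function; otherwise the span has
  not grown.\<close>

lemma exists_dual_points: "finite Q \<Longrightarrow> \<exists>m pts l. dual_points (span Q) m pts l"
proof (induction Q rule: finite_induct)
  case empty
  show ?case by (intro exI[of _ 0]) (simp add: dual_points_def zero_fun_apply)
next
  case (insert q Q)
  then obtain m pts l where L: "dual_points (span Q) m pts l" by blast
  then have l: "\<And>j. j < m \<Longrightarrow> l j \<in> span Q" "\<And>i j. i < m \<Longrightarrow> j < m \<Longrightarrow> l i (pts j) = (if i = j then 1 else 0)"
    "\<And>f x. f \<in> span Q \<Longrightarrow> f x = (\<Sum>j<m. f (pts j) * l j x)" unfolding dual_points_def by blast+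
  define r where "r = q - (\<Sum>j<m. q (pts j) *\<^sub>R l j)"
  have sub: "span Q \<subseteq> span (insert q Q)" by (rule span_mono) auto
  have s: "(\<Sum>j<m. q (pts j) *\<^sub>R l j) \<in> span Q" using l(1) by (auto intro!: span_sum span_scale)
  have r: "r \<in> span (insert q Q)" unfolding r_def using s sub by (intro span_diff) (auto simp: span_base)
  have rx: "r x = q x - (\<Sum>j<m. q (pts j) * l j x)" for x by (simp add: r_def fun_apply)
  have r0: "r (pts i) = 0" if i: "i < m" for i
  proof -
    have "(\<Sum>j<m. q (pts j) * l j (pts i)) = (\<Sum>j<m. if j = i then q (pts j) else 0)"
      using l(2) i by (intro sum.cong) auto
    then show ?thesis using i by (simp add: rx)
  qed
  have dec: "\<exists>c f'. f' \<in> span Q \<and> f = c *\<^sub>R r + f'" if f: "f \<in> span (insert q Q)" for f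
  proof -
    obtain c where c: "f - c *\<^sub>R q \<in> span Q" using f unfolding span_insert by blast
    have "f = c *\<^sub>R r + ((f - c *\<^sub>R q) + c *\<^sub>R (\<Sum>j<m. q (pts j) *\<^sub>R l j))" by (simp add: r_def scaleR_diff_right)
    moreover have "(f - c *\<^sub>R q) + c *\<^sub>R (\<Sum>j<m. q (pts j) *\<^sub>R l j) \<in> span Q" using c s by (intro span_add span_scale)
    ultimately show ?thesis by blast
  qed
  show ?case
  proof (cases "r = 0")
    case True
    then have "f \<in> span Q" if "f \<in> span (insert q Q)" for f using dec[OF that] by auto
    then have "span (insert q Q) = span Q" using sub by blast
    then show ?thesis using L by auto
  next
    case False
    then obtain y where y: "r y \<noteq> 0" by (auto simp: fun_eq_iff zero_fun_apply)
    define r' where "r' = (1 / r y) *\<^sub>R r"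
    define l' where "l' j = (if j < m then l j - l j y *\<^sub>R r' else r')" for j
    define p' where "p' j = (if j < m then pts j else y)" for j
    have r': "r' \<in> span (insert q Q)" "r' y = 1" "\<And>i. i < m \<Longrightarrow> r' (pts i) = 0"
      using r y r0 by (auto simp: r'_def scaleR_fun_apply span_scale)
    have "l' j \<in> span (insert q Q)" for j using r'(1) l(1) sub by (auto simp: l'_def intro!: span_diff span_scale)
    moreover have "l' i (p' j) = (if i = j then 1 else 0)" if "i < Suc m" "j < Suc m" for i j
      using that l(2) r' by (auto simp: l'_def p'_def fun_apply less_Suc_eq)
    moreover have "f x = (\<Sum>j<Suc m. f (p' j) * l' j x)" if f: "f \<in> span (insert q Q)" for f x
    proof -
      obtain c f' where f': "f' \<in> span Q" "f = c *\<^sub>R r + f'" using dec[OF f] by blast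
      have "(\<Sum>j<Suc m. f (p' j) * l' j x) = (\<Sum>j<m. f (pts j) * (l j x - l j y * r' x)) + f y * r' x"
        by (simp add: p'_def l'_def fun_apply)
      also have "(\<Sum>j<m. f (pts j) * (l j x - l j y * r' x)) = (\<Sum>j<m. f' (pts j) * (l j x - l j y * r' x))"
        by (rule sum.cong) (auto simp: f'(2) fun_apply r0)
      also have "\<dots> = f' x - f' y * r' x"
        using l(3)[OF f'(1), of x] l(3)[OF f'(1), of y] by (simp add: right_diff_distrib sum_subtractf sum_distrib_right mult.assoc)
      also have "f' x - f' y * r' x + f y * r' x = f x"
        using y by (simp add: f'(2) fun_apply r'_def field_simps)
      finally show ?thesis ..
    qed
    ultimately have "dual_points (span (insert q Q)) (Suc m) p' l'" unfolding dual_points_def by blast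
    then show ?thesis by blast
  qed
qed

text \<open>The points and the polynomials l do not depend on T; this uniformity is what makes the
  average over all Ad g polynomial again.\<close>

lemma polynomial_lagrange:
  assumes B: "onb (B :: 'f::real_inner set)" and q: "\<And>i. i < N \<Longrightarrow> real_polynomial_function (q i :: 'f \<Rightarrow> real)"
  shows "\<exists>(m::nat) pts l. (\<forall>j<m. real_polynomial_function (l j)) \<and>
    (\<forall>i<(N::nat). \<forall>T :: 'f \<Rightarrow> 'f. \<forall>x. linear T \<longrightarrow> q i (T x) = (\<Sum>j<m. q i (T (pts j)) * l j x))"
proof -
  have "\<forall>i. \<exists>Q. i < N \<longrightarrow> composes_into Q (q i)" using span_compose_polynomial[OF B q] by blast
  then obtain Q where "\<And>i. i < N \<Longrightarrow> composes_into (Q i) (q i)" by metis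
  note Q = composes_intoD[OF this]
  let ?Q = "\<Union>i<N. Q i"
  have "finite ?Q" using Q(1) by auto
  from exists_dual_points[OF this] obtain m pts l where "dual_points (span ?Q) m pts l" by blast
  then have l: "\<And>j. j < m \<Longrightarrow> l j \<in> span ?Q" "\<And>f x. f \<in> span ?Q \<Longrightarrow> f x = (\<Sum>j<m. f (pts j) * l j x)"
    unfolding dual_points_def by blast+
  have "real_polynomial_function f" if "f \<in> span ?Q" for f
    using that
  proof (induction f rule: span_induct_alt)
    case base
    have "(0 :: 'f \<Rightarrow> real) = (\<lambda>x. 0)" by (simp add: fun_eq_iff zero_fun_apply)
    then show ?case using real_polynomial_function.intros(2)[of 0] by metis
  next
    case (step c f h)
    then have "real_polynomial_function (\<lambda>x. c * f x + h x)"
      using Q(2) by (intro real_polynomial_function.intros(2-4)) auto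
    moreover have "(\<lambda>x. c * f x + h x) = c *\<^sub>R f + h" by (simp add: fun_eq_iff fun_apply)
    ultimately show ?case by simp
  qed
  moreover have "q i (T x) = (\<Sum>j<m. q i (T (pts j)) * l j x)" if "i < N" "linear T" for i x and T :: "'f \<Rightarrow> 'f"
  proof -
    have "(\<lambda>x. q i (T x)) \<in> span ?Q" using Q(3)[OF that] that(1) span_mono[of "Q i" ?Q] by blast
    from l(2)[OF this] show ?thesis .
  qed
  ultimately show ?thesis using l(1) by (intro exI[of _ m] exI[of _ pts] exI[of _ l]) blast
qed

section \<open>Averages of differential forms\<close>

lemma sum_lessThan_add: "(\<Sum>i<N + (M::nat). f i) = (\<Sum>i<N. f i) + (\<Sum>i<M. f (N + i) :: 'a::comm_monoid_add)"
  by (induction M) (simp_all add: add.assoc)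

lemma polynomial_form_mapsD:
  assumes "\<beta> \<in> polynomial_form_maps A"
  shows "\<exists>(N::nat) q \<eta>. (\<forall>i<N. real_polynomial_function (q i) \<and> \<eta> i \<in> Omega A) \<and> \<beta> = (\<lambda>\<xi>. \<Sum>i<N. q i \<xi> *\<^sub>R \<eta> i)"
proof -
  obtain N q \<eta> where *: "\<forall>i<(N::nat). real_polynomial_function (q i) \<and> \<eta> i \<in> Omega A"
    "\<beta> = (\<lambda>\<xi> p vs. \<Sum>i<N. q i \<xi> * \<eta> i p vs)"
    using assms unfolding polynomial_form_maps_def by blast
  have "\<beta> = (\<lambda>\<xi>. \<Sum>i<N. q i \<xi> *\<^sub>R \<eta> i)" unfolding *(2) by (simp add: fun_eq_iff fun_apply)
  then show ?thesis using *(1) by blast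
qed

lemma polynomial_form_mapsI:
  assumes "\<And>i. i < N \<Longrightarrow> real_polynomial_function (q i)" "\<And>i. i < N \<Longrightarrow> \<eta> i \<in> Omega A"
  shows "(\<lambda>\<xi>. \<Sum>i<(N::nat). q i \<xi> *\<^sub>R \<eta> i) \<in> polynomial_form_maps A"
proof -
  have "(\<lambda>\<xi>. \<Sum>i<N. q i \<xi> *\<^sub>R \<eta> i) = (\<lambda>\<xi> p vs. \<Sum>i<N. q i \<xi> * \<eta> i p vs)" by (simp add: fun_eq_iff fun_apply)
  then show ?thesis unfolding polynomial_form_maps_def using assms by blast
qed

lemma polynomial_form_maps_add:
  assumes "\<alpha> \<in> polynomial_form_maps A" "\<beta> \<in> polynomial_form_maps A"
  shows "(\<lambda>\<xi>. \<alpha> \<xi> + \<beta> \<xi>) \<in> polynomial_form_maps A"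
proof -
  obtain N q \<eta> where a: "\<forall>i<(N::nat). real_polynomial_function (q i) \<and> \<eta> i \<in> Omega A" "\<alpha> = (\<lambda>\<xi>. \<Sum>i<N. q i \<xi> *\<^sub>R \<eta> i)"
    using polynomial_form_mapsD[OF assms(1)] by blast
  obtain M r \<theta> where b: "\<forall>i<(M::nat). real_polynomial_function (r i) \<and> \<theta> i \<in> Omega A" "\<beta> = (\<lambda>\<xi>. \<Sum>i<M. r i \<xi> *\<^sub>R \<theta> i)"
    using polynomial_form_mapsD[OF assms(2)] by blast
  have "(\<lambda>\<xi>. \<Sum>i<N + M. (if i < N then q i else r (i - N)) \<xi> *\<^sub>R (if i < N then \<eta> i else \<theta> (i - N))) \<in> polynomial_form_maps A"
    by (rule polynomial_form_mapsI) (use a(1) b(1) in auto)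
  moreover have "(\<lambda>\<xi>. \<Sum>i<N + M. (if i < N then q i else r (i - N)) \<xi> *\<^sub>R (if i < N then \<eta> i else \<theta> (i - N))) = (\<lambda>\<xi>. \<alpha> \<xi> + \<beta> \<xi>)"
    by (rule ext) (simp add: a(2) b(2) sum_lessThan_add)
  ultimately show ?thesis by simp
qed

lemma polynomial_form_maps_scale:
  assumes "real_polynomial_function r" "\<beta> \<in> polynomial_form_maps A"
  shows "(\<lambda>\<xi>. r \<xi> *\<^sub>R \<beta> \<xi>) \<in> polynomial_form_maps A"
proof -
  obtain N q \<eta> where a: "\<forall>i<(N::nat). real_polynomial_function (q i) \<and> \<eta> i \<in> Omega A" "\<beta> = (\<lambda>\<xi>. \<Sum>i<N. q i \<xi> *\<^sub>R \<eta> i)"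
    using polynomial_form_mapsD[OF assms(2)] by blast
  have "(\<lambda>\<xi>. \<Sum>i<N. (r \<xi> * q i \<xi>) *\<^sub>R \<eta> i) \<in> polynomial_form_maps A"
    by (rule polynomial_form_mapsI) (use a(1) assms(1) in \<open>auto intro: real_polynomial_function.intros\<close>)
  then show ?thesis by (simp add: a(2) scaleR_sum_right)
qed

context smooth_manifold begin

lemma polynomial_form_maps_Omega: "\<beta> \<in> polynomial_form_maps A \<Longrightarrow> \<beta> \<xi> \<in> Omega A"
proof -
  assume "\<beta> \<in> polynomial_form_maps A"
  then obtain N q \<eta> where a: "\<forall>i<(N::nat). real_polynomial_function (q i) \<and> \<eta> i \<in> Omega A" "\<beta> = (\<lambda>\<xi>. \<Sum>i<N. q i \<xi> *\<^sub>R \<eta> i)"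
    using polynomial_form_mapsD by blast
  show ?thesis unfolding a(2) by (rule subspace_sum[OF subspace_Omega], rule subspace_scale[OF subspace_Omega]) (use a(1) in auto)
qed

lemma polynomial_form_maps_map:
  assumes T: "lin_op (Omega A) T" and b: "\<beta> \<in> polynomial_form_maps A"
  shows "(\<lambda>\<xi>. T (\<beta> \<xi>)) \<in> polynomial_form_maps A"
proof -
  obtain N q \<eta> where a: "\<forall>i<(N::nat). real_polynomial_function (q i) \<and> \<eta> i \<in> Omega A" "\<beta> = (\<lambda>\<xi>. \<Sum>i<N. q i \<xi> *\<^sub>R \<eta> i)"
    using polynomial_form_mapsD[OF b] by blast
  have "T (\<Sum>i<N. q i \<xi> *\<^sub>R \<eta> i) = (\<Sum>i<N. T (q i \<xi> *\<^sub>R \<eta> i))" for \<xi>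
    by (rule lin_op_sum[OF T subspace_Omega]) (use a(1) in \<open>auto intro: subspace_scale[OF subspace_Omega]\<close>)
  also have "(\<Sum>i<N. T (q i \<xi> *\<^sub>R \<eta> i)) = (\<Sum>i<N. q i \<xi> *\<^sub>R T (\<eta> i))" for \<xi>
    using a(1) by (intro sum.cong lin_op_scale[OF T]) auto
  finally have "(\<lambda>\<xi>. T (\<beta> \<xi>)) = (\<lambda>\<xi>. \<Sum>i<N. q i \<xi> *\<^sub>R T (\<eta> i))" by (simp add: a(2))
  moreover have "(\<lambda>\<xi>. \<Sum>i<N. q i \<xi> *\<^sub>R T (\<eta> i)) \<in> polynomial_form_maps A"
    by (rule polynomial_form_mapsI) (use a(1) lin_op_mem[OF T] in auto)
  ultimately show ?thesis by simp
qed

lemma polynomial_form_maps_zero: "(\<lambda>\<xi>. 0) \<in> polynomial_form_maps A"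
  using polynomial_form_mapsI[of 0] by simp

lemma polynomial_form_maps_sum:
  "(\<And>i. i \<in> I \<Longrightarrow> \<beta> i \<in> polynomial_form_maps A) \<Longrightarrow> (\<lambda>\<xi>. \<Sum>i\<in>I. \<beta> i \<xi>) \<in> polynomial_form_maps A"
  by (induction I rule: infinite_finite_induct) (auto intro: polynomial_form_maps_zero polynomial_form_maps_add)

end

lemma polynomial_form_maps_lagrange:
  fixes \<beta> :: "'f::real_inner \<Rightarrow> ('m, 'e::real_normed_vector) form"
  assumes B: "onb (B :: 'f set)" and b: "\<beta> \<in> polynomial_form_maps A"
  shows "\<exists>(m::nat) pts l. (\<forall>j<m. real_polynomial_function (l j)) \<and>
    (\<forall>T :: 'f \<Rightarrow> 'f. \<forall>\<xi>. linear T \<longrightarrow> \<beta> (T \<xi>) = (\<Sum>j<m. l j \<xi> *\<^sub>R \<beta> (T (pts j))))"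
proof -
  obtain N q \<eta> where a: "\<forall>i<(N::nat). real_polynomial_function (q i) \<and> \<eta> i \<in> Omega A" "\<beta> = (\<lambda>\<xi>. \<Sum>i<N. q i \<xi> *\<^sub>R \<eta> i)"
    using polynomial_form_mapsD[OF b] by blast
  obtain m pts l where l: "\<forall>j<(m::nat). real_polynomial_function (l j)"
    "\<forall>i<N. \<forall>T :: 'f \<Rightarrow> 'f. \<forall>x. linear T \<longrightarrow> q i (T x) = (\<Sum>j<m. q i (T (pts j)) * l j x)"
    using polynomial_lagrange[OF B, of N q] a(1) by blast
  have "\<beta> (T \<xi>) = (\<Sum>j<m. l j \<xi> *\<^sub>R \<beta> (T (pts j)))" if T: "linear T" for T :: "'f \<Rightarrow> 'f" and \<xi>
  proof -
    have "\<beta> (T \<xi>) = (\<Sum>i<N. \<Sum>j<m. (q i (T (pts j)) * l j \<xi>) *\<^sub>R \<eta> i)"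
      unfolding a(2) using l(2) T by (intro sum.cong refl) (auto simp: scaleR_sum_left)
    also have "\<dots> = (\<Sum>j<m. \<Sum>i<N. (q i (T (pts j)) * l j \<xi>) *\<^sub>R \<eta> i)" by (rule sum.swap)
    also have "\<dots> = (\<Sum>j<m. l j \<xi> *\<^sub>R \<beta> (T (pts j)))" by (simp add: a(2) scaleR_sum_right mult.commute)
    finally show ?thesis .
  qed
  then show ?thesis using l(1) by blast
qed

text \<open>The inherited type variables are \<open>'a\<close> for the group, \<open>'b\<close> for
  its Lie algebra, \<open>'c\<close> for the manifold and \<open>'d\<close> for its model
  space.\<close>

locale lefschetz_hamiltonian_action = hamiltonian_action +
  assumes compact_G: "compact (UNIV :: 'a set)" and strong_lefschetz: "strong_lefschetz A n \<omega>"
begin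

sublocale cg: compact_group "mult G" "one G" "m_inv G"
proof
  show "continuous_on UNIV (\<lambda>z. fst z \<otimes> snd z)"
    using Lie.smooth_mult by (simp add: smooth_map_def case_prod_beta')
qed (auto simp: compact_G Lie.m_assoc)

section \<open>Smooth families of forms over the group and their means\<close>

definition smooth_family :: "('a \<Rightarrow> ('c, 'd) form) \<Rightarrow> bool" where
  "smooth_family \<kappa> \<longleftrightarrow> (\<forall>g. \<kappa> g \<in> Omega A) \<and>
     (\<forall>c\<in>A. \<forall>vs k. joint_Ck k (chart_image c) (\<lambda>g x. local_form A c (\<kappa> g) x vs))"

definition form_mean :: "('a \<Rightarrow> ('c, 'd) form) \<Rightarrow> ('c, 'd) form" where
  "form_mean \<kappa> = (\<lambda>p vs. cg.mean (\<lambda>g. \<kappa> g p vs))"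

lemma smooth_familyD:
  assumes "smooth_family \<kappa>"
  shows "\<kappa> g \<in> Omega A" "c \<in> A \<Longrightarrow> joint_Ck k (chart_image c) (\<lambda>g x. local_form A c (\<kappa> g) x vs)"
  using assms by (simp_all add: smooth_family_def)

lemma continuous_family: "smooth_family \<kappa> \<Longrightarrow> continuous_on UNIV (\<lambda>g. \<kappa> g p vs)"
proof -
  assume k: "smooth_family \<kappa>"
  show ?thesis
    using joint_Ck_slice[OF smooth_familyD(2)[OF k Sympl.chart_at(1), of 0] Sympl.base_point, of p vs]
    by (simp add: Sympl.local_form_at)
qed

lemma local_form_mean: "local_form A c (form_mean \<kappa>) x vs = cg.mean (\<lambda>g. local_form A c (\<kappa> g) x vs)"
  by (simp add: local_form_rep form_mean_def)

lemma Omega_form_mean: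
  assumes k: "smooth_family \<kappa>" shows "form_mean \<kappa> \<in> Omega A"
proof (rule Sympl.OmegaI)
  fix p
  note a = Sympl.OmegaD(1)[OF smooth_familyD(1)[OF k], of _ p] and c = continuous_family[OF k]
  have "linear (\<lambda>v. form_mean \<kappa> p (us @ v # ws))" for us ws
  proof -
    note l = alt_formD(1)[OF a, of _ us ws]
    show ?thesis unfolding form_mean_def
      by (rule linearI) (simp_all add: linear_add[OF l] linear_scale[OF l] cg.mean_add[OF c c] cg.mean_scale[OF c])
  qed
  moreover have "form_mean \<kappa> p vs = 0" if "\<not> distinct vs" for vs
    using a that by (simp add: form_mean_def alt_form_def)
  ultimately show "alt_form (form_mean \<kappa> p)" by (simp add: alt_form_def)
next
  fix c assume c: "c \<in> A"
  show "sform (chart_image c) (local_form A c (form_mean \<kappa>))"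
    unfolding sform_def smooth_on_def local_form_mean
    using Sympl.open_image[OF c] cg.Ck_on_mean[OF Sympl.onb_E Sympl.open_image[OF c] smooth_familyD(2)[OF k c]] by blast
qed

lemma ext_d_form_mean:
  assumes k: "smooth_family \<kappa>" shows "ext_d A (form_mean \<kappa>) = form_mean (\<lambda>g. ext_d A (\<kappa> g))"
proof (intro ext)
  fix p and vs :: "'d list"
  let ?c = "chart_at A p"
  let ?K = "\<lambda>us g x. local_form A ?c (\<kappa> g) x us" and ?x = "snd ?c p" and ?us = "\<lambda>i. take i vs @ drop (Suc i) vs"
  note S = Sympl.open_image[OF Sympl.chart_at(1), of p]
  note j = smooth_familyD(2)[OF k Sympl.chart_at(1)]
  have d: "dd v (\<lambda>x. cg.mean (\<lambda>g. ?K us g x)) ?x = cg.mean (\<lambda>g. dd v (?K us g) ?x)" for v us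
    by (rule dd_eq[OF cg.mean_has_derivative[OF Sympl.onb_E S j Sympl.base_point]])
  have ct: "continuous_on UNIV (\<lambda>g. dd v (?K us g) ?x)" for v us
    by (rule joint_Ck_slice[OF _ Sympl.base_point, of 0]) (use j[of "Suc 0" p us] in simp)
  have "ext_d A (form_mean \<kappa>) p vs = (\<Sum>i<length vs. (- 1) ^ i * cg.mean (\<lambda>g. dd (vs ! i) (?K (?us i) g) ?x))"
    by (simp add: Sympl.ext_d_eq ed_def local_form_mean d)
  also have "\<dots> = cg.mean (\<lambda>g. \<Sum>i<length vs. (- 1) ^ i * dd (vs ! i) (?K (?us i) g) ?x)"
    by (subst cg.mean_sum) (auto simp: cg.mean_scale[OF ct] intro: continuous_on_mult ct)
  finally show "ext_d A (form_mean \<kappa>) p vs = form_mean (\<lambda>g. ext_d A (\<kappa> g)) p vs"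
    by (simp add: form_mean_def Sympl.ext_d_eq ed_def)
qed

lemma form_mean_wedge:
  assumes k: "smooth_family \<kappa>" shows "form_mean (\<lambda>g. form_wedge \<tau> (\<kappa> g)) = form_wedge \<tau> (form_mean \<kappa>)"
    and "continuous_on UNIV (\<lambda>g. form_wedge \<tau> (\<kappa> g) p vs)"
proof -
  note c = continuous_family[OF k]
  have "cg.mean (\<lambda>g. \<Sum>I\<in>X. s I * \<kappa> g p (us I)) = (\<Sum>I\<in>X. s I * cg.mean (\<lambda>g. \<kappa> g p (us I)))"
    for X :: "nat set set" and s us p
    by (subst cg.mean_sum) (auto simp: cg.mean_scale[OF c] intro: continuous_on_mult c)
  then show "form_mean (\<lambda>g. form_wedge \<tau> (\<kappa> g)) = form_wedge \<tau> (form_mean \<kappa>)"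
    by (simp add: fun_eq_iff form_mean_def form_wedge_def wedge_def)
  show "continuous_on UNIV (\<lambda>g. form_wedge \<tau> (\<kappa> g) p vs)"
    unfolding form_wedge_def wedge_def by (intro continuous_on_sum continuous_on_mult continuous_on_const c)
qed

text \<open>In coordinates the coefficients of the pullback are those of the pullback along the
  joint action map P, evaluated on vectors (0, v); hence they factor through a chart of the
  group.\<close>

lemma smooth_family_pullback:
  assumes b: "\<beta> \<in> Omega A" shows "smooth_family (\<lambda>g. pullback A A (act g) \<beta>)"
  unfolding smooth_family_def
proof (intro conjI allI ballI)
  show "pullback A A (act g) \<beta> \<in> Omega A" for g by (rule Omega_pullback[OF Sympl.M Sympl.M smooth_act b])
  fix c and vs :: "'d list" and k assume c: "c \<in> A"
  let ?F = "\<lambda>(g, p). act g p"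
  have "chart_smooth TYPE('a \<Rightarrow> 'b) (chart_image c) (\<lambda>g x. local_form A c (pullback A A (act g) \<beta>) x vs)"
    unfolding chart_smooth_def
  proof (intro allI ballI)
    fix g0 x0 assume x0: "x0 \<in> chart_image c"
    define e where "e = chart_at A\<^sub>G g0"
    define c' where "c' = chart_at A (act g0 (chart_inv c x0))"
    have e: "e \<in> A\<^sub>G" "g0 \<in> fst e" and c': "c' \<in> A" "act g0 (chart_inv c x0) \<in> fst c'"
      by (simp_all add: e_def c'_def Lie.chart_at Sympl.chart_at)
    define P where "P = prep e c ?F c'"
    define U where "U = prep_dom e c ?F c'"
    note P = act.prep[OF e(1) c c'(1), folded P_def U_def]
    have PU: "P z \<in> chart_image c'" if "z \<in> U" for z
      unfolding P_def by (rule act.prep_image[OF c'(1) that[unfolded U_def]])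
    have "(snd e g0, x0) \<in> U"
      using x0 e c' by (simp add: U_def prep_dom_def Lie.chart_inv[OF e(1)])
    then obtain V T where VT: "open V" "open T" "(snd e g0, x0) \<in> V \<times> T" "V \<times> T \<subseteq> U"
      using open_prod_elim[OF P(1)] by blast
    define N where "N = fst e \<inter> snd e -` V"
    have ce: "continuous_on (fst e) (snd e)"
      using Lie.chart_homeomorphism[OF e(1)] by (auto simp: homeomorphism_def)
    have N: "open N" unfolding N_def by (rule continuous_open_preimage[OF ce Lie.open_domain[OF e(1)] VT(1)])
    have sH: "smooth_on U (\<lambda>z. pbk P (local_form A c' \<beta>) z (map (Pair 0) vs))"
      by (rule sformD(2)[OF sform_pbk[OF Sympl.onb_E P PU Sympl.OmegaD(2,3)[OF b c'(1)]]])
    have "chart_factor N T U (snd e) (\<lambda>z. pbk P (local_form A c' \<beta>) z (map (Pair 0) vs))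
        (\<lambda>g x. local_form A c (pullback A A (act g) \<beta>) x vs)"
      unfolding chart_factor_def
    proof (intro conjI ballI N VT(2) P(1) sH)
      show "continuous_on N (snd e)" by (rule continuous_on_subset[OF ce]) (simp add: N_def)
      fix g x assume g: "g \<in> N" and x: "x \<in> T"
      then show gU: "(snd e g, x) \<in> U" using VT(4) by (auto simp: N_def)
      have "chart_inv e (snd e g) = g" using g by (simp add: N_def Lie.chart_inv[OF e(1)])
      then show "local_form A c (pullback A A (act g) \<beta>) x vs = pbk P (local_form A c' \<beta>) (snd e g, x) (map (Pair 0) vs)"
        using local_form_act[OF e(1) c c'(1) gU[unfolded U_def], of \<beta> vs] by (simp add: P_def)
    qed
    moreover have "g0 \<in> N" "x0 \<in> T" using VT(3) e by (auto simp: N_def)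
    ultimately show "\<exists>N T U. \<exists>r::'a \<Rightarrow> 'b. \<exists>H. g0 \<in> N \<and> x0 \<in> T \<and>
        chart_factor N T U r H (\<lambda>g x. local_form A c (pullback A A (act g) \<beta>) x vs)" by blast
  qed
  then show "joint_Ck k (chart_image c) (\<lambda>g x. local_form A c (pullback A A (act g) \<beta>) x vs)"
    by (rule chart_smooth_joint_Ck)
qed

text \<open>The transform of \<beta> by g; a polynomial map is equivariant exactly when all its
  transforms equal it.\<close>

definition orbit_family :: "('b \<Rightarrow> ('c, 'd) form) \<Rightarrow> 'b \<Rightarrow> 'a \<Rightarrow> ('c, 'd) form" where
  "orbit_family \<beta> \<xi> g = pullback A A (act g) (\<beta> (Ad G A\<^sub>G g \<xi>))"

lemma smooth_orbit_family:
  assumes b: "\<beta> \<in> polynomial_form_maps A" shows "smooth_family (orbit_family \<beta> \<xi>)"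
  unfolding smooth_family_def
proof (intro conjI allI ballI)
  show "orbit_family \<beta> \<xi> g \<in> Omega A" for g
    unfolding orbit_family_def
    by (rule Omega_pullback[OF Sympl.M Sympl.M smooth_act Sympl.polynomial_form_maps_Omega[OF b]])
  fix c and vs :: "'d list" and k assume c: "c \<in> A"
  obtain N q \<eta> where a: "\<forall>i<(N::nat). real_polynomial_function (q i) \<and> \<eta> i \<in> Omega A" "\<beta> = (\<lambda>\<xi>. \<Sum>i<N. q i \<xi> *\<^sub>R \<eta> i)"
    using polynomial_form_mapsD[OF b] by blast
  have e: "local_form A c (orbit_family \<beta> \<xi> g) x vs =
      (\<Sum>i<N. q i (Ad G A\<^sub>G g \<xi>) * local_form A c (pullback A A (act g) (\<eta> i)) x vs)" for g x
    by (rule local_form_sum) (simp add: orbit_family_def pullback_def a(2) fun_apply)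
  have "continuous_on UNIV (\<lambda>g. q i (Ad G A\<^sub>G g \<xi>))" if "i < N" for i
  proof (rule continuous_on_compose2[OF _ Lie.continuous_Ad])
    show "continuous_on UNIV (q i)"
      using a(1) that continuous_real_polymonial_function by (blast intro: continuous_at_imp_continuous_on)
  qed simp
  then have "joint_Ck k (chart_image c) (\<lambda>g x. \<Sum>i<N. q i (Ad G A\<^sub>G g \<xi>) * local_form A c (pullback A A (act g) (\<eta> i)) x vs)"
    using a(1) by (intro joint_Ck_sum joint_Ck_mult Sympl.open_image[OF c] smooth_familyD(2)[OF smooth_family_pullback c]) auto
  then show "joint_Ck k (chart_image c) (\<lambda>g x. local_form A c (orbit_family \<beta> \<xi> g) x vs)" by (simp add: e)
qed

definition average :: "('b \<Rightarrow> ('c, 'd) form) \<Rightarrow> 'b \<Rightarrow> ('c, 'd) form" where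
  "average \<beta> \<xi> = form_mean (orbit_family \<beta> \<xi>)"

text \<open>Interpolation at points independent of g writes the average as a sum of polynomials
  times averages of single families, so it is polynomial in \<xi>. Equivariance is the invariance of
  the mean under right shifts.\<close>

lemma average_Omega_G:
  assumes b: "\<beta> \<in> polynomial_form_maps A" shows "average \<beta> \<in> Omega_G G A\<^sub>G A act"
proof -
  obtain m pts l where l: "\<forall>j<(m::nat). real_polynomial_function (l j)"
    "\<forall>T :: 'b \<Rightarrow> 'b. \<forall>\<xi>. linear T \<longrightarrow> \<beta> (T \<xi>) = (\<Sum>j<m. l j \<xi> *\<^sub>R \<beta> (T (pts j)))"
    using polynomial_form_maps_lagrange[OF Lie.onb_E b] by blast
  have o: "orbit_family \<beta> \<xi> g p vs = (\<Sum>j<m. l j \<xi> * orbit_family \<beta> (pts j) g p vs)" for \<xi> g p vs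
    using l(2)[rule_format, OF Lie.linear_Ad[of g], of \<xi>] by (simp add: orbit_family_def pullback_def fun_apply)
  have mean: "cg.mean (\<lambda>g. \<Sum>j<m. l j \<xi> * orbit_family \<beta> (pts j) g p vs) =
      (\<Sum>j<m. l j \<xi> * cg.mean (\<lambda>g. orbit_family \<beta> (pts j) g p vs))" for \<xi> p vs
    using continuous_family[OF smooth_orbit_family[OF b]]
    by (subst cg.mean_sum) (auto simp: cg.mean_scale intro: continuous_on_mult)
  have eq: "average \<beta> = (\<lambda>\<xi>. \<Sum>j<m. l j \<xi> *\<^sub>R average \<beta> (pts j))"
  proof (intro ext)
    fix \<xi> p vs
    have "average \<beta> \<xi> p vs = cg.mean (\<lambda>g. \<Sum>j<m. l j \<xi> * orbit_family \<beta> (pts j) g p vs)"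
      by (simp only: average_def form_mean_def o[of \<xi>])
    then show "average \<beta> \<xi> p vs = (\<Sum>j<m. l j \<xi> *\<^sub>R average \<beta> (pts j)) p vs"
      by (simp add: mean fun_apply) (simp add: average_def form_mean_def)
  qed
  have "(\<lambda>\<xi>. \<Sum>j<m. l j \<xi> *\<^sub>R average \<beta> (pts j)) \<in> polynomial_form_maps A"
    by (rule polynomial_form_mapsI) (use l(1) Omega_form_mean[OF smooth_orbit_family[OF b]] in \<open>auto simp: average_def\<close>)
  then have "average \<beta> \<in> polynomial_form_maps A" by (subst eq)
  moreover have "pullback A A (act k) (average \<beta> (Ad G A\<^sub>G k \<xi>)) = average \<beta> \<xi>" for k \<xi>
  proof (intro ext)
    fix p and vs :: "'d list"
    have "orbit_family \<beta> \<xi> (g \<otimes> k) = pullback A A (act k) (orbit_family \<beta> (Ad G A\<^sub>G k \<xi>) g)" for g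
      by (simp add: orbit_family_def Lie.Ad_mult pullback_mult)
    then have "pullback A A (act k) (average \<beta> (Ad G A\<^sub>G k \<xi>)) p vs = cg.mean (\<lambda>g. orbit_family \<beta> \<xi> (g \<otimes> k) p vs)"
      by (simp add: average_def form_mean_def pullback_def)
    also have "\<dots> = average \<beta> \<xi> p vs"
      using cg.mean_shift[OF continuous_family[OF smooth_orbit_family[OF b]]] by (simp add: average_def form_mean_def)
    finally show "pullback A A (act k) (average \<beta> (Ad G A\<^sub>G k \<xi>)) p vs = average \<beta> \<xi> p vs" .
  qed
  ultimately show ?thesis by (simp add: Omega_G_def)
qed

end

section \<open>The Cartan complex\<close>

context hamiltonian_action begin

definition lift :: "(('m, 'e) form \<Rightarrow> ('m, 'e) form) \<Rightarrow> ('f \<Rightarrow> ('m, 'e) form) \<Rightarrow> 'f \<Rightarrow> ('m, 'e) form" where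
  "lift T \<alpha> = (\<lambda>\<xi>. T (\<alpha> \<xi>))"

abbreviation "OG \<equiv> Omega_G G A\<^sub>G A act"

lemma OG_iff: "\<alpha> \<in> OG \<longleftrightarrow> \<alpha> \<in> polynomial_form_maps A \<and> (\<forall>g \<xi>. pullback A A (act g) (\<alpha> (Ad G A\<^sub>G g \<xi>)) = \<alpha> \<xi>)"
  by (simp add: Omega_G_def Lie.carrier_UNIV)

lemma OG_Omega: "\<alpha> \<in> OG \<Longrightarrow> \<alpha> \<xi> \<in> Omega A"
  by (simp add: OG_iff Sympl.polynomial_form_maps_Omega)

lemma pullback_lin:
  "pullback A A f (\<alpha> + \<beta>) = pullback A A f \<alpha> + pullback A A f \<beta>"
  "pullback A A f (r *\<^sub>R \<alpha>) = r *\<^sub>R pullback A A f \<alpha>" "pullback A A f 0 = 0"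
  by (simp_all add: pullback_def fun_eq_iff fun_apply)

lemma pullback_form_part: "pullback A A f (form_part k \<alpha>) = form_part k (pullback A A f \<alpha>)"
  by (simp add: pullback_def form_part_def ext_part_def fun_eq_iff)

lemma subspace_OG: "subspace OG"
  unfolding subspace_def
proof (intro conjI ballI allI)
  have z: "(\<lambda>\<xi>::'f. 0 :: ('m, 'e) form) = 0" by (rule ext) (simp only: zero_fun_apply[of "_ :: 'f"])
  show "0 \<in> OG"
  proof -
    have "(\<lambda>\<xi>::'f. 0 :: ('m, 'e) form) \<in> polynomial_form_maps A" by (rule Sympl.polynomial_form_maps_zero)
    then show ?thesis unfolding z by (simp add: OG_iff pullback_lin zero_fun_apply[of "_ :: 'f"])
  qed
  fix \<alpha> assume a: "\<alpha> \<in> OG"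
  show "\<alpha> + \<beta> \<in> OG" if b: "\<beta> \<in> OG" for \<beta>
  proof -
    have "(\<lambda>\<xi>. \<alpha> \<xi> + \<beta> \<xi>) \<in> polynomial_form_maps A" by (rule polynomial_form_maps_add) (use a b in \<open>simp_all add: OG_iff\<close>)
    moreover have "(\<lambda>\<xi>. \<alpha> \<xi> + \<beta> \<xi>) = \<alpha> + \<beta>" by (rule ext) (simp only: plus_fun_apply[of \<alpha>])
    ultimately show ?thesis using a b by (simp add: OG_iff pullback_lin plus_fun_apply[of \<alpha>])
  qed
  show "r *\<^sub>R \<alpha> \<in> OG" for r
  proof -
    have "(\<lambda>\<xi>. r *\<^sub>R \<alpha> \<xi>) \<in> polynomial_form_maps A"
      by (rule polynomial_form_maps_scale[OF real_polynomial_function.intros(2)]) (use a in \<open>simp add: OG_iff\<close>)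
    moreover have "(\<lambda>\<xi>. r *\<^sub>R \<alpha> \<xi>) = r *\<^sub>R \<alpha>" by (rule ext) (simp only: scaleR_fun_apply[of _ \<alpha>])
    ultimately show ?thesis using a by (simp add: OG_iff pullback_lin scaleR_fun_apply[of _ \<alpha>])
  qed
qed

lemma lift_lin_op:
  assumes T: "lin_op (Omega A) T" and c: "\<And>g \<beta>. \<beta> \<in> Omega A \<Longrightarrow> pullback A A (act g) (T \<beta>) = T (pullback A A (act g) \<beta>)"
  shows "lin_op OG (lift T)"
proof (rule lin_opI)
  fix \<alpha> \<beta> and r :: real assume a: "\<alpha> \<in> OG"
  show "lift T \<alpha> \<in> OG"
    using a Sympl.polynomial_form_maps_map[OF T, of \<alpha>] c[OF OG_Omega[OF a]] by (simp add: OG_iff lift_def)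
  show "lift T (r *\<^sub>R \<alpha>) = r *\<^sub>R lift T \<alpha>"
  proof
    fix \<xi> show "lift T (r *\<^sub>R \<alpha>) \<xi> = (r *\<^sub>R lift T \<alpha>) \<xi>"
      unfolding scaleR_fun_apply[of _ "lift T \<alpha>"] unfolding lift_def scaleR_fun_apply[of _ \<alpha>]
      by (rule lin_op_scale[OF T OG_Omega[OF a]])
  qed
  assume b: "\<beta> \<in> OG"
  show "lift T (\<alpha> + \<beta>) = lift T \<alpha> + lift T \<beta>"
  proof
    fix \<xi> show "lift T (\<alpha> + \<beta>) \<xi> = (lift T \<alpha> + lift T \<beta>) \<xi>"
      unfolding plus_fun_apply[of "lift T \<alpha>"] unfolding lift_def plus_fun_apply[of \<alpha>]
      by (rule lin_op_add[OF T OG_Omega[OF a] OG_Omega[OF b]])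
  qed
qed

lemma pow_lift: "(lift T ^^ k) \<alpha> \<xi> = (T ^^ k) (\<alpha> \<xi>)"
  by (induction k) (simp_all add: lift_def)

sublocale GC: lefschetz_complex OG n "\<lambda>k. lift (form_part k)" "lift Sympl.form_L" "lift Sympl.form_Lam" "lift (ext_d A)"
proof
  show "subspace OG" by (rule subspace_OG)
  show "lin_op OG (lift (form_part k))" for k by (rule lift_lin_op[OF Sympl.P pullback_form_part])
  show "lin_op OG (lift Sympl.form_L)" by (rule lift_lin_op[OF Sympl.L pullback_L])
  show "lin_op OG (lift Sympl.form_Lam)" by (rule lift_lin_op[OF Sympl.Lam pullback_Lam])
  show "lin_op OG (lift (ext_d A))"
    by (rule lift_lin_op[OF Sympl.d pullback_ext_d[OF Sympl.M Sympl.M smooth_act, symmetric]])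
  fix \<alpha> and j k :: nat assume "\<alpha> \<in> OG"
  note a = OG_Omega[OF this]
  show "lift (form_part j) (lift (form_part k) \<alpha>) = (if j = k then lift (form_part k) \<alpha> else 0)"
    by (rule ext) (auto simp: lift_def Sympl.P_P[OF a] zero_fun_apply[of "_ :: 'f"])
  show "(\<Sum>k\<le>2 * n. lift (form_part k) \<alpha>) = \<alpha>"
    by (rule ext) (simp add: sum_fun_apply[of "\<lambda>k. lift (form_part k) \<alpha>"] lift_def Sympl.P_sum[OF a])
  show "lift (form_part k) (lift Sympl.form_L \<alpha>) = (if k < 2 then 0 else lift Sympl.form_L (lift (form_part (k - 2)) \<alpha>))"
    by (rule ext) (auto simp: lift_def Sympl.P_L[OF a] zero_fun_apply[of "_ :: 'f"])
  show "lift (form_part k) (lift Sympl.form_Lam \<alpha>) = lift Sympl.form_Lam (lift (form_part (k + 2)) \<alpha>)"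
    by (rule ext) (simp only: lift_def Sympl.P_Lam[OF a])
  show "lift (form_part k) (lift (ext_d A) \<alpha>) = (if k = 0 then 0 else lift (ext_d A) (lift (form_part (k - 1)) \<alpha>))"
    by (rule ext) (auto simp: lift_def Sympl.P_d[OF a] zero_fun_apply[of "_ :: 'f"])
  show "lift (ext_d A) (lift (ext_d A) \<alpha>) = 0"
  proof
    fix \<xi> show "lift (ext_d A) (lift (ext_d A) \<alpha>) \<xi> = 0 \<xi>"
      unfolding zero_fun_apply[of \<xi>] lift_def by (rule Sympl.d_d[OF a])
  qed
  show "lift Sympl.form_L (lift (ext_d A) \<alpha>) = lift (ext_d A) (lift Sympl.form_L \<alpha>)"
    by (rule ext) (simp only: lift_def Sympl.L_d[OF a])
  assume h: "lift (form_part k) \<alpha> = \<alpha>"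
  show "lift Sympl.form_Lam (lift Sympl.form_L \<alpha>) =
      lift Sympl.form_L (lift Sympl.form_Lam \<alpha>) + (real n - real k) *\<^sub>R \<alpha>"
  proof
    fix \<xi>
    have "form_part k (\<alpha> \<xi>) = \<alpha> \<xi>" using fun_cong[OF h, of \<xi>] by (simp add: lift_def)
    from Sympl.Lam_L[OF a this]
    show "lift Sympl.form_Lam (lift Sympl.form_L \<alpha>) \<xi> =
        (lift Sympl.form_L (lift Sympl.form_Lam \<alpha>) + (real n - real k) *\<^sub>R \<alpha>) \<xi>"
      unfolding plus_fun_apply[of _ _ \<xi>] scaleR_fun_apply[of _ \<alpha> \<xi>] unfolding lift_def .
  qed
qed

lemma GC_W: "GC.W \<alpha> \<xi> = Sympl.W (\<alpha> \<xi>)"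
proof -
  have "trunc_exp N r (lift T) \<beta> \<xi> = trunc_exp N r T (\<beta> \<xi>)" for N r T \<beta>
    by (rule trunc_exp_at) (simp add: lift_def)
  then show ?thesis by (simp add: GC.W_def Sympl.W_def)
qed

lemma GC_hom_part: "\<alpha> \<in> GC.hom_part k \<longleftrightarrow> \<alpha> \<in> OG \<and> (\<forall>\<xi>. \<alpha> \<xi> \<in> Sympl.hom_part k)"
  by (auto simp: GC.hom_part_def Sympl.hom_part_def lift_def OG_Omega fun_eq_iff[of "\<lambda>\<xi>. form_part k (\<alpha> \<xi>)"])

lemma GC_D: "GC.D \<alpha> \<xi> = Sympl.D (\<alpha> \<xi>)"
  unfolding GC.D_def Sympl.D_def minus_apply[of _ _ \<xi>] unfolding lift_def ..

lemma GC_delta: "\<alpha> \<in> OG \<Longrightarrow> GC.D \<alpha> = cartan_delta A n \<omega> \<alpha>"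
  by (rule ext) (simp add: GC_D cartan_delta_def Sympl.sympl_delta_eq OG_Omega)

definition moment_mult :: "('f \<Rightarrow> ('m, 'e) form) \<Rightarrow> 'f \<Rightarrow> ('m, 'e) form" where
  "moment_mult \<alpha> \<xi> = (\<lambda>p. \<phi> \<xi> p *\<^sub>R \<alpha> \<xi> p)"

lemma moment_mult_lin_op: "lin_op OG moment_mult"
proof (rule lin_opI)
  fix \<alpha> \<beta> and r :: real assume a: "\<alpha> \<in> OG"
  have lin: "lin_op (Omega A) (\<lambda>\<eta> p. \<phi> b p *\<^sub>R \<eta> p)" for b
    by (rule lin_opI[OF Omega_moment]) (auto simp: fun_eq_iff fun_apply algebra_simps)
  \<comment> \<open>The moment map is linear in \<xi>; its expansion in an orthonormal basis
    exhibits the polynomial dependence.\<close>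
  have "(\<lambda>\<xi>. \<Sum>b\<in>Lie.E. inner b \<xi> *\<^sub>R (\<lambda>p. \<phi> b p *\<^sub>R \<alpha> \<xi> p)) \<in> polynomial_form_maps A"
    by (intro Sympl.polynomial_form_maps_sum polynomial_form_maps_scale real_polynomial_function.intros(1)
        bounded_linear_inner_right Sympl.polynomial_form_maps_map[OF lin]) (use a in \<open>simp add: OG_iff\<close>)
  moreover have "(\<lambda>\<xi>. \<Sum>b\<in>Lie.E. inner b \<xi> *\<^sub>R (\<lambda>p. \<phi> b p *\<^sub>R \<alpha> \<xi> p)) = moment_mult \<alpha>"
  proof (intro ext)
    fix \<xi> p vs
    show "(\<Sum>b\<in>Lie.E. inner b \<xi> *\<^sub>R (\<lambda>p. \<phi> b p *\<^sub>R \<alpha> \<xi> p)) p vs = moment_mult \<alpha> \<xi> p vs"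
      using onb_linear[OF Lie.onb_E moment_linear[of p], of \<xi>]
      by (simp add: moment_mult_def fun_apply sum_distrib_right)
  qed
  ultimately have "moment_mult \<alpha> \<in> polynomial_form_maps A" by simp
  moreover have "pullback A A (act g) (moment_mult \<alpha> (Ad G A\<^sub>G g \<xi>)) = moment_mult \<alpha> \<xi>" for g \<xi>
  proof (intro ext)
    fix p vs
    have "pullback A A (act g) (\<alpha> (Ad G A\<^sub>G g \<xi>)) p vs = \<alpha> \<xi> p vs" using a by (simp add: OG_iff)
    then show "pullback A A (act g) (moment_mult \<alpha> (Ad G A\<^sub>G g \<xi>)) p vs = moment_mult \<alpha> \<xi> p vs"
      by (simp add: pullback_def moment_mult_def moment_equivariant fun_apply)
  qed
  ultimately show "moment_mult \<alpha> \<in> OG" by (simp add: OG_iff)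
  show "moment_mult (r *\<^sub>R \<alpha>) = r *\<^sub>R moment_mult \<alpha>" "moment_mult (\<alpha> + \<beta>) = moment_mult \<alpha> + moment_mult \<beta>"
    by (simp_all add: moment_mult_def fun_eq_iff fun_apply algebra_simps)
qed

abbreviation "hor \<equiv> cartan_hor G A\<^sub>G A act"

lemma hor_at: "hor \<alpha> \<xi> p = - contr (X \<xi> p) (\<alpha> \<xi> p)"
  by (simp add: cartan_hor_def contract_def contr_def fun_eq_iff fun_apply)

text \<open>This is \<open>D_function_mult\<close> for the function \<phi> \<xi>; the minus sign of
  \<open>cartan_hor\<close> makes the constant of the abstract locale equal to 1.\<close>

lemma hor_moment:
  assumes a: "\<alpha> \<in> OG" shows "hor \<alpha> = 1 *\<^sub>R (GC.D (moment_mult \<alpha>) - moment_mult (GC.D \<alpha>))"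
proof (intro ext)
  fix \<xi> p vs
  have "contract (X \<xi>) (\<alpha> \<xi>) p vs = \<phi> \<xi> p * Sympl.D (\<alpha> \<xi>) p vs - Sympl.D (\<lambda>p. \<phi> \<xi> p *\<^sub>R \<alpha> \<xi> p) p vs"
    by (simp add: contract_field[OF OG_Omega[OF a]] fun_apply)
  moreover have "(1 *\<^sub>R (GC.D (moment_mult \<alpha>) - moment_mult (GC.D \<alpha>))) \<xi> p vs =
      GC.D (moment_mult \<alpha>) \<xi> p vs - moment_mult (GC.D \<alpha>) \<xi> p vs" by (simp add: fun_apply)
  ultimately show "hor \<alpha> \<xi> p vs = (1 *\<^sub>R (GC.D (moment_mult \<alpha>) - moment_mult (GC.D \<alpha>))) \<xi> p vs"
    by (simp add: GC_D cartan_hor_def) (simp add: moment_mult_def GC_D fun_apply)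
qed

lemma hor_lin_op: "lin_op OG hor"
proof (rule lin_opI)
  fix \<alpha> \<beta> and r :: real assume a: "\<alpha> \<in> OG"
  \<comment> \<open>Polynomiality and equivariance come from the commutator formula, not from
    properties of the induced vector fields.\<close>
  show "hor \<alpha> \<in> OG"
    unfolding hor_moment[OF a] using a lin_op_mem[OF moment_mult_lin_op] by (intro GC.Vsub(2,4)) auto
  show "hor (r *\<^sub>R \<alpha>) = r *\<^sub>R hor \<alpha>"
    by (simp add: cartan_hor_def contract_def fun_eq_iff fun_apply)
  show "hor (\<alpha> + \<beta>) = hor \<alpha> + hor \<beta>"
    by (simp add: cartan_hor_def contract_def fun_eq_iff fun_apply)
qed

end

section \<open>Averaging in the Cartan complex and its Lefschetz property\<close>

context lefschetz_hamiltonian_action begin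

lemma orbit_family_invariant: "\<alpha> \<in> OG \<Longrightarrow> orbit_family \<alpha> \<xi> g = \<alpha> \<xi>"
  by (simp add: orbit_family_def OG_iff)

lemma orbit_family_d: "\<beta> \<in> polynomial_form_maps A \<Longrightarrow> orbit_family (\<lambda>\<xi>. ext_d A (\<beta> \<xi>)) \<xi> g = ext_d A (orbit_family \<beta> \<xi> g)"
  unfolding orbit_family_def
  by (rule pullback_ext_d[OF Sympl.M Sympl.M smooth_act Sympl.polynomial_form_maps_Omega, symmetric])

lemma orbit_family_L_pow: "orbit_family (\<lambda>\<xi>. (Sympl.form_L ^^ k) (\<beta> \<xi>)) \<xi> g = (Sympl.form_L ^^ k) (orbit_family \<beta> \<xi> g)"
  unfolding orbit_family_def by (induction k) (simp_all add: pullback_L)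

lemma orbit_family_part: "orbit_family (\<lambda>\<xi>. form_part k (\<beta> \<xi>)) \<xi> g = form_part k (orbit_family \<beta> \<xi> g)"
  by (simp add: orbit_family_def pullback_form_part)

lemma orbit_family_add: "orbit_family (\<lambda>\<xi>. \<alpha> \<xi> + \<beta> \<xi>) \<xi> g = orbit_family \<alpha> \<xi> g + orbit_family \<beta> \<xi> g"
  by (simp add: orbit_family_def pullback_lin)

lemma average_invariant: "\<alpha> \<in> OG \<Longrightarrow> average \<alpha> = \<alpha>"
  by (simp add: average_def form_mean_def orbit_family_invariant fun_eq_iff)

lemma average_d:
  assumes b: "\<beta> \<in> polynomial_form_maps A" shows "average (\<lambda>\<xi>. ext_d A (\<beta> \<xi>)) \<xi> = ext_d A (average \<beta> \<xi>)"
proof -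
  have "orbit_family (\<lambda>\<xi>. ext_d A (\<beta> \<xi>)) \<xi> = (\<lambda>g. ext_d A (orbit_family \<beta> \<xi> g))" by (rule ext, rule orbit_family_d[OF b])
  then show ?thesis by (simp add: average_def ext_d_form_mean[OF smooth_orbit_family[OF b]])
qed

lemma average_L_pow:
  assumes b: "\<beta> \<in> polynomial_form_maps A"
  shows "average (\<lambda>\<xi>. (Sympl.form_L ^^ k) (\<beta> \<xi>)) \<xi> = (Sympl.form_L ^^ k) (average \<beta> \<xi>)"
proof -
  have "orbit_family (\<lambda>\<xi>. (Sympl.form_L ^^ k) (\<beta> \<xi>)) \<xi> = (\<lambda>g. form_wedge (form_power \<omega> k) (orbit_family \<beta> \<xi> g))"
    by (rule ext) (subst orbit_family_L_pow, subst Sympl.form_L_pow, rule refl)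
  then show ?thesis by (simp add: average_def form_mean_wedge(1)[OF smooth_orbit_family[OF b]] Sympl.form_L_pow)
qed

lemma average_part: "average (\<lambda>\<xi>. form_part k (\<beta> \<xi>)) \<xi> = form_part k (average \<beta> \<xi>)"
proof (intro ext)
  fix p and vs :: "'d list"
  show "average (\<lambda>\<xi>. form_part k (\<beta> \<xi>)) \<xi> p vs = form_part k (average \<beta> \<xi>) p vs"
    by (simp add: average_def form_mean_def orbit_family_part) (simp add: form_part_def ext_part_def)
qed

lemma average_add:
  assumes "\<alpha> \<in> polynomial_form_maps A" "\<beta> \<in> polynomial_form_maps A"
  shows "average (\<lambda>\<xi>. \<alpha> \<xi> + \<beta> \<xi>) \<xi> = average \<alpha> \<xi> + average \<beta> \<xi>"
  by (intro ext) (simp add: average_def form_mean_def orbit_family_add fun_apply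
    cg.mean_add[OF continuous_family[OF smooth_orbit_family[OF assms(1)]] continuous_family[OF smooth_orbit_family[OF assms(2)]]])

lemma OG_lagrange:
  assumes "\<alpha> \<in> OG"
  shows "\<exists>(m::nat) pts l. (\<forall>j<m. real_polynomial_function (l j)) \<and> (\<forall>\<xi>. \<alpha> \<xi> = (\<Sum>j<m. l j \<xi> *\<^sub>R \<alpha> (pts j)))"
proof -
  have a: "\<alpha> \<in> polynomial_form_maps A" using assms by (simp add: OG_iff)
  obtain m pts l where l: "\<forall>j<(m::nat). real_polynomial_function (l j)"
    "\<forall>T :: 'b \<Rightarrow> 'b. \<forall>\<xi>. linear T \<longrightarrow> \<alpha> (T \<xi>) = (\<Sum>j<m. l j \<xi> *\<^sub>R \<alpha> (T (pts j)))"
    using polynomial_form_maps_lagrange[OF Lie.onb_E a] by blast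
  have "\<alpha> \<xi> = (\<Sum>j<m. l j \<xi> *\<^sub>R \<alpha> (pts j))" for \<xi>
    using l(2)[rule_format, of "\<lambda>x. x" \<xi>] linear_ident by blast
  then show ?thesis using l(1) by blast
qed

text \<open>The interpolated a0 and c0 are polynomial but not equivariant. As \<open>average\<close>
  fixes b and commutes with d, with powers of L and with the projections, the equation b = L^k a0 +
  d c0, the closedness of a0 and its degree all pass to the averages.\<close>

lemma equivariant_surj:
  assumes k: "k \<le> n" and b: "b \<in> GC.hom_part (n + k)" "lift (ext_d A) b = 0"
  shows "\<exists>a\<in>GC.hom_part (n - k). lift (ext_d A) a = 0 \<and> (\<exists>c\<in>OG. b = (lift Sympl.form_L ^^ k) a + lift (ext_d A) c)"
proof -
  have bO: "b \<in> OG" and bh: "\<And>\<xi>. b \<xi> \<in> Sympl.hom_part (n + k)" using b(1) by (auto simp: GC_hom_part)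
  have bd: "ext_d A (b \<xi>) = 0" for \<xi> using fun_cong[OF b(2), of \<xi>] by (simp add: lift_def zero_fun_apply[of \<xi>])
  obtain m pts l where l: "\<forall>j<(m::nat). real_polynomial_function (l j)" "\<forall>\<xi>. b \<xi> = (\<Sum>j<m. l j \<xi> *\<^sub>R b (pts j))"
    using OG_lagrange[OF bO] by blast
  have "\<forall>j. \<exists>a c. a \<in> Sympl.hom_part (n - k) \<and> ext_d A a = 0 \<and> c \<in> Omega A \<and> b (pts j) = (Sympl.form_L ^^ k) a + ext_d A c"
    using Sympl.form_lefschetz_surj[OF strong_lefschetz k bh bd] by blast
  then obtain a c where ac: "\<And>j. a j \<in> Sympl.hom_part (n - k)" "\<And>j. ext_d A (a j) = 0" "\<And>j. c j \<in> Omega A"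
    "\<And>j. b (pts j) = (Sympl.form_L ^^ k) (a j) + ext_d A (c j)" by metis
  have aV: "a j \<in> Omega A" "form_part (n - k) (a j) = a j" for j using Sympl.hom_partD[OF ac(1)] by auto
  define a0 where "a0 = (\<lambda>\<xi>. \<Sum>j<m. l j \<xi> *\<^sub>R a j)"
  define c0 where "c0 = (\<lambda>\<xi>. \<Sum>j<m. l j \<xi> *\<^sub>R c j)"
  have P: "a0 \<in> polynomial_form_maps A" "c0 \<in> polynomial_form_maps A"
    unfolding a0_def c0_def by (rule polynomial_form_mapsI; use l(1) aV(1) ac(3) in simp)+
  have T: "T (\<Sum>j<m. l j \<xi> *\<^sub>R x j) = (\<Sum>j<m. l j \<xi> *\<^sub>R T (x j))" if "lin_op (Omega A) T" "\<And>j. x j \<in> Omega A" for T x \<xi>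
    by (subst lin_op_sum[OF that(1) Sympl.V]) (simp_all add: that(2) lin_op_scale[OF that(1)])
  have da0: "ext_d A (a0 \<xi>) = 0" for \<xi> unfolding a0_def T[OF Sympl.d aV(1)] by (simp add: ac(2))
  have pa0: "form_part (n - k) (a0 \<xi>) = a0 \<xi>" for \<xi> unfolding a0_def T[OF Sympl.P aV(1)] by (simp add: aV(2))
  have ba0: "b = (\<lambda>\<xi>. (Sympl.form_L ^^ k) (a0 \<xi>) + ext_d A (c0 \<xi>))"
  proof
    fix \<xi>
    have "b \<xi> = (\<Sum>j<m. l j \<xi> *\<^sub>R b (pts j))" using l(2) by blast
    also have "\<dots> = (\<Sum>j<m. l j \<xi> *\<^sub>R ((Sympl.form_L ^^ k) (a j) + ext_d A (c j)))" by (simp only: ac(4))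
    also have "\<dots> = (Sympl.form_L ^^ k) (a0 \<xi>) + ext_d A (c0 \<xi>)"
      unfolding a0_def c0_def T[OF lin_op_pow[OF Sympl.L] aV(1)] T[OF Sympl.d ac(3)] by (simp add: scaleR_add_right sum.distrib)
    finally show "b \<xi> = (Sympl.form_L ^^ k) (a0 \<xi>) + ext_d A (c0 \<xi>)" .
  qed
  have PP: "(\<lambda>\<xi>. (Sympl.form_L ^^ k) (a0 \<xi>)) \<in> polynomial_form_maps A" "(\<lambda>\<xi>. ext_d A (c0 \<xi>)) \<in> polynomial_form_maps A"
    by (rule Sympl.polynomial_form_maps_map[OF lin_op_pow[OF Sympl.L] P(1)], rule Sympl.polynomial_form_maps_map[OF Sympl.d P(2)])
  have eq: "b = (lift Sympl.form_L ^^ k) (average a0) + lift (ext_d A) (average c0)"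
  proof
    fix \<xi>
    have "b \<xi> = average b \<xi>" by (simp add: average_invariant[OF bO])
    also have "\<dots> = (Sympl.form_L ^^ k) (average a0 \<xi>) + ext_d A (average c0 \<xi>)"
      unfolding ba0 average_add[OF PP] average_L_pow[OF P(1)] average_d[OF P(2)] ..
    finally show "b \<xi> = ((lift Sympl.form_L ^^ k) (average a0) + lift (ext_d A) (average c0)) \<xi>"
      unfolding plus_fun_apply[of _ _ \<xi>] pow_lift unfolding lift_def .
  qed
  have z: "average (\<lambda>\<xi>. 0) \<xi> = 0" for \<xi>
    by (simp add: average_def form_mean_def orbit_family_def pullback_lin fun_eq_iff zero_fun_apply)
  have "lift (ext_d A) (average a0) = 0"
  proof
    fix \<xi> show "lift (ext_d A) (average a0) \<xi> = 0 \<xi>"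
      using average_d[OF P(1), of \<xi>] by (simp add: da0 z lift_def zero_fun_apply[of \<xi>])
  qed
  moreover have "average a0 \<in> GC.hom_part (n - k)"
    unfolding GC_hom_part Sympl.hom_part_def
  proof (intro conjI allI CollectI)
    show "average a0 \<in> OG" by (rule average_Omega_G[OF P(1)])
    show "average a0 \<xi> \<in> Omega A" for \<xi> by (rule OG_Omega[OF average_Omega_G[OF P(1)]])
    show "form_part (n - k) (average a0 \<xi>) = average a0 \<xi>" for \<xi>
      using average_part[of "n - k" a0 \<xi>] unfolding pa0 by (rule sym)
  qed
  ultimately show ?thesis using eq average_Omega_G[OF P(2)] by blast
qed

lemma equivariant_inj:
  assumes k: "k \<le> n" and a: "a \<in> GC.hom_part (n - k)" "lift (ext_d A) a = 0"
    and c: "c \<in> OG" "(lift Sympl.form_L ^^ k) a = lift (ext_d A) c"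
  shows "\<exists>e\<in>OG. a = lift (ext_d A) e"
proof -
  have aO: "a \<in> OG" and ah: "\<And>\<xi>. a \<xi> \<in> Sympl.hom_part (n - k)" using a(1) by (auto simp: GC_hom_part)
  have ad: "ext_d A (a \<xi>) = 0" for \<xi> using fun_cong[OF a(2), of \<xi>] by (simp add: lift_def zero_fun_apply[of \<xi>])
  have ac: "(Sympl.form_L ^^ k) (a \<xi>) = ext_d A (c \<xi>)" for \<xi> using fun_cong[OF c(2), of \<xi>] unfolding pow_lift unfolding lift_def .
  obtain m pts l where l: "\<forall>j<(m::nat). real_polynomial_function (l j)" "\<forall>\<xi>. a \<xi> = (\<Sum>j<m. l j \<xi> *\<^sub>R a (pts j))"
    using OG_lagrange[OF aO] by blast
  have "\<forall>j. \<exists>e. e \<in> Omega A \<and> a (pts j) = ext_d A e"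
    using Sympl.form_lefschetz_inj[OF strong_lefschetz k ah ad OG_Omega[OF c(1)] ac] by blast
  then obtain e where e: "\<And>j. e j \<in> Omega A" "\<And>j. a (pts j) = ext_d A (e j)" by metis
  define e0 where "e0 = (\<lambda>\<xi>. \<Sum>j<m. l j \<xi> *\<^sub>R e j)"
  have P: "e0 \<in> polynomial_form_maps A" unfolding e0_def by (rule polynomial_form_mapsI; use l(1) e(1) in simp)
  have ae: "a = (\<lambda>\<xi>. ext_d A (e0 \<xi>))"
  proof
    fix \<xi>
    have "a \<xi> = (\<Sum>j<m. l j \<xi> *\<^sub>R a (pts j))" using l(2) by blast
    also have "\<dots> = (\<Sum>j<m. l j \<xi> *\<^sub>R ext_d A (e j))" by (simp only: e(2))
    also have "\<dots> = ext_d A (e0 \<xi>)"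
      unfolding e0_def by (subst lin_op_sum[OF Sympl.d Sympl.V]) (simp_all add: e(1) lin_op_scale[OF Sympl.d])
    finally show "a \<xi> = ext_d A (e0 \<xi>)" .
  qed
  have "a = lift (ext_d A) (average e0)"
  proof
    fix \<xi>
    have "a \<xi> = average a \<xi>" by (simp add: average_invariant[OF aO])
    also have "\<dots> = ext_d A (average e0 \<xi>)" unfolding ae average_d[OF P] ..
    finally show "a \<xi> = lift (ext_d A) (average e0) \<xi>" unfolding lift_def .
  qed
  then show ?thesis using average_Omega_G[OF P] by blast
qed

sublocale eq: equivariant_lefschetz_hodge OG n "\<lambda>k. lift (form_part k)" "lift Sympl.form_L" "lift Sympl.form_Lam" "lift (ext_d A)"
  hor moment_mult 1
proof
  fix k :: nat and b assume "k \<le> n" "b \<in> GC.hom_part (n + k)" "lift (ext_d A) b = 0"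
  then show "\<exists>a\<in>GC.hom_part (n - k). lift (ext_d A) a = 0 \<and> (\<exists>c\<in>OG. b = (lift Sympl.form_L ^^ k) a + lift (ext_d A) c)"
    by (rule equivariant_surj)
next
  fix k :: nat and a c assume "k \<le> n" "a \<in> GC.hom_part (n - k)" "lift (ext_d A) a = 0" "c \<in> OG"
    "(lift Sympl.form_L ^^ k) a = lift (ext_d A) c"
  then show "\<exists>e\<in>OG. a = lift (ext_d A) e" by (rule equivariant_inj)
next
  fix k \<alpha> assume "\<alpha> \<in> GC.hom_part k"
  then have "\<alpha> \<xi> \<in> Sympl.hom_part k" for \<xi> by (simp add: GC_hom_part)
  from Sympl.form_W_W[OF this] show "GC.W (GC.W \<alpha>) = (- 1) ^ (n + k) *\<^sub>R \<alpha>"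
    by (intro ext[where f = "GC.W (GC.W \<alpha>)"]) (simp add: GC_W scaleR_fun_apply[of _ \<alpha>])
next
  show "lin_op OG hor" "lin_op OG moment_mult" by (rule hor_lin_op, rule moment_mult_lin_op)
  fix \<alpha> and k :: nat assume a: "\<alpha> \<in> OG"
  show "hor \<alpha> = 1 *\<^sub>R (GC.D (moment_mult \<alpha>) - moment_mult (GC.D \<alpha>))" by (rule hor_moment[OF a])
  have alt: "alt_form (\<alpha> \<xi> p)" for \<xi> p by (rule Sympl.OmegaD(1)[OF OG_Omega[OF a]])
  show "lift (form_part k) (hor \<alpha>) = hor (lift (form_part (k + 1)) \<alpha>)"
    by (auto simp: lift_def cartan_hor_def contract_def form_part_def ext_part_def fun_eq_iff)
  show "hor (hor \<alpha>) = 0"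
  proof (intro ext)
    fix \<xi> p vs
    have "\<alpha> \<xi> p (X \<xi> p # X \<xi> p # vs) = 0" using alt[of \<xi> p] by (simp add: alt_form_def)
    then show "hor (hor \<alpha>) \<xi> p vs = 0 \<xi> p vs" by (simp add: cartan_hor_def contract_def fun_apply)
  qed
  show "lift Sympl.form_Lam (hor \<alpha>) = hor (lift Sympl.form_Lam \<alpha>)"
  proof (rule ext, rule ext)
    fix \<xi> p
    interpret S: symplectic_space Sympl.E n "\<omega> p" by (rule Sympl.sp)
    have "S.Lam (- contr (X \<xi> p) (\<alpha> \<xi> p)) = - contr (X \<xi> p) (S.Lam (\<alpha> \<xi> p))"
      using lin_op_minus[OF S.Lam, of "contr (X \<xi> p) (\<alpha> \<xi> p)"] S.Lam_contr[OF alt, of "X \<xi> p" \<xi> p] alt by (simp add: alt_contr)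
    then show "lift Sympl.form_Lam (hor \<alpha>) \<xi> p = hor (lift Sympl.form_Lam \<alpha>) \<xi> p"
      by (simp add: lift_def Sympl.form_Lam_def hor_at)
  qed
  \<comment> \<open>Of the relations for \<open>hor\<close> this is the one that rests on the
    equivariance of \<alpha>, through \<open>cartan_formula\<close>.\<close>
  show "lift (ext_d A) (hor \<alpha>) = - hor (lift (ext_d A) \<alpha>)"
  proof
    fix \<xi>
    have h: "hor \<beta> \<xi> = - contract (X \<xi>) (\<beta> \<xi>)" for \<beta> by (simp add: cartan_hor_def fun_eq_iff fun_apply)
    have "ext_d A (- contract (X \<xi>) (\<alpha> \<xi>)) = - ext_d A (contract (X \<xi>) (\<alpha> \<xi>))"
      by (rule lin_op_minus[OF Sympl.d Omega_contract[OF OG_Omega[OF a]]])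
    then show "lift (ext_d A) (hor \<alpha>) \<xi> = (- hor (lift (ext_d A) \<alpha>)) \<xi>"
      unfolding uminus_apply[of "hor _"] h lift_def cartan_formula[OF a] by simp
  qed
qed

lemma eq_dG: "eq.dG = cartan_d G A\<^sub>G A act"
  by (simp add: eq.dG_def cartan_d_def cartan_vert_def lift_def fun_eq_iff fun_apply)

end

theorem theorem3p9:
  fixes G :: "'g::t2_space monoid"
    and A\<^sub>G :: "('g, 'f::{real_inner, heine_borel}) atlas"
    and A :: "('m::t2_space, 'e::{real_inner, heine_borel}) atlas"
    and n :: nat
    and \<omega> :: "('m, 'e) form"
    and act :: "'g \<Rightarrow> 'm \<Rightarrow> 'm"
    and \<phi> :: "'f \<Rightarrow> 'm \<Rightarrow> real"
    and \<alpha> :: "'f \<Rightarrow> ('m, 'e) form"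
  assumes "compact (UNIV :: 'g set)" and "connected (UNIV :: 'g set)"
    and "compact (UNIV :: 'm set)"
    and "hamiltonian_action G A\<^sub>G A n \<omega> act \<phi>"
    and "strong_lefschetz A n \<omega>"
    and "\<alpha> \<in> Omega_G G A\<^sub>G A act"
    and "cartan_d G A\<^sub>G A act \<alpha> = cartan_zero"
    and "cartan_delta A n \<omega> \<alpha> = cartan_zero"
    and "(\<exists>\<gamma>\<in>Omega_G G A\<^sub>G A act. \<alpha> = cartan_d G A\<^sub>G A act \<gamma>) \<or>
         (\<exists>\<gamma>\<in>Omega_G G A\<^sub>G A act. \<alpha> = cartan_delta A n \<omega> \<gamma>)"
  shows "\<exists>\<beta>\<in>Omega_G G A\<^sub>G A act. \<alpha> = cartan_d G A\<^sub>G A act (cartan_delta A n \<omega> \<beta>)"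
proof -
  interpret lefschetz_hamiltonian_action G A\<^sub>G A n \<omega> act \<phi>
    using assms(1,4,5) by (simp add: lefschetz_hamiltonian_action_def lefschetz_hamiltonian_action_axioms_def)
  have zero: "cartan_zero = (0 :: 'f \<Rightarrow> ('m, 'e) form)"
    by (simp add: cartan_zero_def zero_form_def fun_eq_iff fun_apply)
  have "eq.dG \<alpha> = 0" "GC.D \<alpha> = 0"
    using assms(7,8) GC_delta[OF assms(6)] by (simp_all add: eq_dG zero)
  moreover have "\<exists>\<gamma>\<in>OG. \<alpha> = eq.dG \<gamma> \<or> \<alpha> = GC.D \<gamma>"
    using assms(9) GC_delta unfolding eq_dG by metis
  ultimately obtain \<beta> where "\<beta> \<in> OG" "\<alpha> = eq.dG (GC.D \<beta>)"
    using eq.dG_D_lemma[OF assms(6)] by blast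
  then show ?thesis unfolding eq_dG using GC_delta by auto
qed

end
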